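(* Suppose that $f:I\to I$ satisfies (A1), (A2) and (A3$_p$) for some $p>1$, let $\mu$ be its ergodic absolutely continuous invariant probability measure and $\tau$ the associated return time function, and suppose that $f$ is mixing with respect to $\mu$. Suppose further that $\mu(\tau>n)=O(n^{-(\beta+1)})$ for some $\beta>0$. Then for any $v\in\mathrm{BV}$ with $\int_I v\,d\mu=0$ and any $\epsilon>0$, there exists a constant $C>0$ such that $$\mu\Bigl(\Bigl|\sum_{j=0}^{n-1}v\circ f^j\Bigr|\ge\epsilon n\Bigr)\le Cn^{-\beta}\quad\text{for all } n\ge1.$$
   Context: **Maps.** $I=[0,1]$, $m$ is Lebesgue measure, $\mathrm{BV}$ is the space of functions $v:I\to\mathbb R$ of bounded variation. $f:I\to I$ is piecewise smooth: $I$ is a union of finitely many intervals such that $f$ is $C^2$ and monotone on the interior of each interval and extends continuously to the boundary of each interval. $\mathcal C$ is the (finite) set of one-sided critical/singular points $c^+$, $c^-$; write $c$ for a generic element (values of $f$ and its iterates at a one-sided point are one-sided limits). For $\delta>0$ let $\Delta(c^+,\delta)=(c^+,c^++\delta)$, $\Delta(c^-,\delta)=(c^--\delta,c^-)$, $\Delta=\bigcup_{c\in\mathcal C}\Delta(c,\delta)$. Write $u\approx v$ if $u/v$ is bounded above and below by positive constants uniformly on the stated domain. (A1) Each $c\in\mathcal C$ has a critical order $\ell=\ell(c)>0$, $\ell(c)\ne1$, such that $|f(x)-f(c)|\approx d(x,c)^{\ell}$, $|f'(x)|\approx d(x,c)^{\ell-1}$, $|f''(x)|\approx d(x,c)^{\ell-2}$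 for all $x$ in some $\Delta(c,\delta)$. ($c$ is a critical point if $\ell(c)>1$, a singular point if $\ell(c)<1$.) (A2) There is $\kappa>0$, independent of $\delta$, such that $|(f^n)'(x)|\ge\kappa$ for every $x$ and $n\ge1$ with $d(f^jx,\mathcal C)>\delta$ for $0\le j\le n-1$ and $d(f^nx,\mathcal C)\le\delta$. Further, for every $\delta>0$ there are $c(\delta)>0$, $\lambda(\delta)>0$ with $|(f^n)'(x)|\ge c(\delta)e^{\lambda(\delta)n}$ for every $x$ and $n\ge1$ with $d(f^jx,\mathcal C)>\delta$ for $0\le j\le n-1$. For $c\in\mathcal C$ let $D_n=|(f^n)'(f c)|$, $E_n=D_{n-1}^{1/(2\ell(c)-1)}$, $d_n=d(f^nc,\mathcal C)$. For $p\ge0$: (A3$_p$) for every critical point $c$ (i.e. $\ell(c)>1$), $\sum_{n\ge1}n^p d_n^{-1}\log d_n^{-1}\,E_n^{-1}<\infty$. (A4$_p$) for every critical point $c$ (i.e. $\ell(c)>1$), $\sum_{n\ge1}n^pE_n^{-1}<\infty$. The paper uses that (A3$_p$) implies (A4$_{p'}$) for $p\ge p'$. **Return time $\tau$ and the measure $\mu$.** Araújo, Luzzatto and Viana proved that (A1), (A2), (A3$_0$), (A4$_1$) imply the existence of the following inducing construction, which is fixed. For a sufficiently small $\delta>0$ each $x\in\Delta$ has an integer binding period $b(x)\ge1$; $q_0\ge1$ is a large fixed integer; $\ell_0(x)=\min\{j\ge0:f^jx\in\Delta\}$; $\tau(x)=q_0$ if $\ell_0(x)\ge q_0$, and $\tau(x)=\ell_0(x)+b(f^{\ell_0(x)}x)$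 otherwise, in which case $x$ is said to have binding period $b(f^{\ell_0(x)}x)$. There is a finite or countable partition $\alpha$ of $I$ (mod $0$) into intervals such that binding period and $\tau$ are constant on elements, and on each $a\in\alpha$ the iterates $f^j$, $0\le j\le\tau(a)$, are continuous and monotone and $F=f^{\tau}$ is smooth, monotone and uniformly expanding. With $\alpha(b)$, $b\ge1$, the set of elements with points of binding period $b$ and $\alpha(0)$ the remaining elements, there are $C,M>0$ with $\#\alpha(b)\le M$; for $a\in\alpha(b)$, $b\ge2$, there is a critical point $c$ with $\sup_a|1/F'|\le CE_b^{-1}$ and $\operatorname{var}_a|1/F'|\le C(1+\log d_{b-1}^{-1})d_{b-1}^{-1}E_{b-1}^{-1}$; for $b\le1$ both quantities are at most $C$. $F$ has an ergodic absolutely continuous invariant probability measure $\hat\mu$ with density $h=d\hat\mu/dm\in\mathrm{BV}$, $\tau$ is Lebesgue integrable, and $\mu(A)=\big(\int\tau\,d\hat\mu\big)^{-1}\sum_{j\ge0}\hat\mu(\{\tau>j\}\cap f^{-j}A)$ is an ergodic absolutely continuous $f$-invariant probability measure. In the corollary, $\mu$ and $\tau$ denote these objects. *)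

theory Defs
  imports "HOL-Probability.Probability" "HOL-Library.Landau_Symbols"
begin

section \<open>Bounded variation\<close>

definition total_variation :: "(real \<Rightarrow> real) \<Rightarrow> real set \<Rightarrow> ennreal" where
  "total_variation g S =
     (SUP xs \<in> {xs. sorted_wrt (<) xs \<and> set xs \<subseteq> S}.
        \<Sum>i<length xs - 1. ennreal \<bar>g (xs ! Suc i) - g (xs ! i)\<bar>)"

definition BV_on :: "real set \<Rightarrow> (real \<Rightarrow> real) \<Rightarrow> bool" where
  "BV_on S g \<longleftrightarrow> total_variation g S < \<infinity>"

section \<open>Ergodic theory\<close>

definition measure_preserving_map :: "'a measure \<Rightarrow> ('a \<Rightarrow> 'a) \<Rightarrow> bool" where
  "measure_preserving_map M T \<longleftrightarrow> T \<in> measurable M M \<and> distr M M T = M"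

definition ergodic_map :: "'a measure \<Rightarrow> ('a \<Rightarrow> 'a) \<Rightarrow> bool" where
  "ergodic_map M T \<longleftrightarrow> measure_preserving_map M T \<and>
     (\<forall>A\<in>sets M. T -` A \<inter> space M = A \<longrightarrow> A \<in> null_sets M \<or> space M - A \<in> null_sets M)"

definition mixing_map :: "'a measure \<Rightarrow> ('a \<Rightarrow> 'a) \<Rightarrow> bool" where
  "mixing_map M T \<longleftrightarrow> measure_preserving_map M T \<and>
     (\<forall>A\<in>sets M. \<forall>B\<in>sets M.
        (\<lambda>n. measure M (A \<inter> ((T ^^ n) -` B \<inter> space M))) \<longlonglongrightarrow> measure M A * measure M B)"

section \<open>Piecewise smooth interval maps\<close>

text \<open>A map of the unit interval is a total function on the reals; its values outside
  \<open>{0..1}\<close> play no role.\<close>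

definition C2_on :: "real set \<Rightarrow> (real \<Rightarrow> real) \<Rightarrow> bool" where
  "C2_on U f \<longleftrightarrow> (\<exists>f' f''. (\<forall>x\<in>U. (f has_real_derivative f' x) (at x) \<and>
                                 (f' has_real_derivative f'' x) (at x)) \<and>
                         continuous_on U f'')"

definition piecewise_smooth :: "(real \<Rightarrow> real) \<Rightarrow> bool" where
  "piecewise_smooth f \<longleftrightarrow> f ` {0..1} \<subseteq> {0..1} \<and>
     (\<exists>\<K>. finite \<K> \<and> \<Union>\<K> = {0..1} \<and>
        (\<forall>K\<in>\<K>. is_interval K \<and> C2_on (interior K) f \<and>
           (mono_on (interior K) f \<or> antimono_on (interior K) f) \<and>
           (\<exists>g. continuous_on (closure K) g \<and> (\<forall>x\<in>interior K. g x = f x))))"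

text \<open>One-sided points: \<open>LeftOf c\<close> is \<open>c\<^sup>-\<close> and \<open>RightOf c\<close> is \<open>c\<^sup>+\<close>.\<close>

datatype one_sided = LeftOf real | RightOf real

primrec pt :: "one_sided \<Rightarrow> real" where
  "pt (LeftOf c) = c"
| "pt (RightOf c) = c"

primrec at_side :: "one_sided \<Rightarrow> real filter" where
  "at_side (LeftOf c) = at_left c"
| "at_side (RightOf c) = at_right c"

primrec side_nbhd :: "one_sided \<Rightarrow> real \<Rightarrow> real set" where
  "side_nbhd (LeftOf c) \<delta> = {c - \<delta><..<c}"
| "side_nbhd (RightOf c) \<delta> = {c<..<c + \<delta>}"

text \<open>A one-sided point of the interval is critical if \<open>f'\<close> tends to \<open>0\<close> there, and
  singular if \<open>f'\<close> has no finite limit there.  A jump of \<open>f\<close> at which \<open>f'\<close> has a finite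
  nonzero one-sided limit is neither.  Under the nondegeneracy condition \<open>A1\<close> below,
  critical means order greater than 1, and singular means order less than 1.\<close>

definition crit_set :: "(real \<Rightarrow> real) \<Rightarrow> one_sided set" where
  "crit_set f = {c \<in> LeftOf ` {0<..1} \<union> RightOf ` {0..<1}.
      (deriv f \<longlongrightarrow> 0) (at_side c) \<or> \<not> (\<exists>L. (deriv f \<longlongrightarrow> L) (at_side c))}"

definition crit_nbhd :: "(real \<Rightarrow> real) \<Rightarrow> real \<Rightarrow> real set" where
  "crit_nbhd f \<delta> = (\<Union>c\<in>crit_set f. side_nbhd c \<delta>)"

section \<open>The assumptions on the map\<close>

definition comparable_on :: "real set \<Rightarrow> (real \<Rightarrow> real) \<Rightarrow> (real \<Rightarrow> real) \<Rightarrow> bool" where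
  "comparable_on S u v \<longleftrightarrow> (\<exists>k>0. \<exists>K>0. \<forall>x\<in>S. k \<le> u x / v x \<and> u x / v x \<le> K)"

text \<open>The value of \<open>f\<^sup>n\<close> at a one-sided point.\<close>

definition iter_at :: "(real \<Rightarrow> real) \<Rightarrow> nat \<Rightarrow> one_sided \<Rightarrow> real" where
  "iter_at f n c = Lim (at_side c) (f ^^ n)"

definition A1 :: "(real \<Rightarrow> real) \<Rightarrow> (one_sided \<Rightarrow> real) \<Rightarrow> bool" where
  "A1 f ell \<longleftrightarrow> (\<forall>c\<in>crit_set f. ell c > 0 \<and> ell c \<noteq> 1 \<and>
     (\<exists>\<delta>>0.
        comparable_on (side_nbhd c \<delta>) (\<lambda>x. \<bar>f x - iter_at f 1 c\<bar>) (\<lambda>x. \<bar>x - pt c\<bar> powr ell c) \<and>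
        comparable_on (side_nbhd c \<delta>) (\<lambda>x. \<bar>deriv f x\<bar>) (\<lambda>x. \<bar>x - pt c\<bar> powr (ell c - 1)) \<and>
        comparable_on (side_nbhd c \<delta>) (\<lambda>x. \<bar>deriv (deriv f) x\<bar>) (\<lambda>x. \<bar>x - pt c\<bar> powr (ell c - 2))))"

text \<open>\<open>far_from_crit f \<delta> x\<close> says that the distance from \<open>x\<close> to the (finite) set of
  critical/singular points exceeds \<open>\<delta>\<close>.  It is spelled out because \<^const>\<open>infdist\<close> to the
  empty set is \<open>0\<close>, whereas here that distance is infinite.\<close>

definition far_from_crit :: "(real \<Rightarrow> real) \<Rightarrow> real \<Rightarrow> real \<Rightarrow> bool" where
  "far_from_crit f \<delta> x \<longleftrightarrow> (\<forall>c\<in>crit_set f. dist x (pt c) > \<delta>)"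

text \<open>The derivative bounds are imposed wherever \<open>f\<^sup>n\<close> has a derivative (one-sided at the
  end points of the interval); an orbit may also meet jumps of \<open>f\<close> outside the critical set.\<close>

definition A2 :: "(real \<Rightarrow> real) \<Rightarrow> bool" where
  "A2 f \<longleftrightarrow>
     (\<exists>\<kappa>>0. \<forall>\<delta>>0. \<forall>x\<in>{0..1}. \<forall>n\<ge>1. \<forall>D.
        ((f ^^ n) has_real_derivative D) (at x within {0..1}) \<longrightarrow>
        (\<forall>j<n. far_from_crit f \<delta> ((f ^^ j) x)) \<longrightarrow> \<not> far_from_crit f \<delta> ((f ^^ n) x) \<longrightarrow>
        \<bar>D\<bar> \<ge> \<kappa>) \<and>
     (\<forall>\<delta>>0. \<exists>k>0. \<exists>\<theta>>0. \<forall>x\<in>{0..1}. \<forall>n\<ge>1. \<forall>D.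
        ((f ^^ n) has_real_derivative D) (at x within {0..1}) \<longrightarrow>
        (\<forall>j<n. far_from_crit f \<delta> ((f ^^ j) x)) \<longrightarrow>
        \<bar>D\<bar> \<ge> k * exp (\<theta> * real n))"

text \<open>\<open>D\<^sub>n = |(f\<^sup>n)'(f c)|\<close>, as a one-sided limit at \<open>c\<close>.\<close>

definition crit_deriv :: "(real \<Rightarrow> real) \<Rightarrow> nat \<Rightarrow> one_sided \<Rightarrow> real" where
  "crit_deriv f n c = Lim (at_side c) (\<lambda>x. \<bar>deriv (f ^^ n) (f x)\<bar>)"

text \<open>\<open>E\<^sub>n\<close>, used for \<open>n \<ge> 1\<close> only.\<close>

definition crit_E :: "(real \<Rightarrow> real) \<Rightarrow> (one_sided \<Rightarrow> real) \<Rightarrow> nat \<Rightarrow> one_sided \<Rightarrow> real" where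
  "crit_E f ell n c = crit_deriv f (n - 1) c powr (1 / (2 * ell c - 1))"

text \<open>\<open>d\<^sub>n\<close>, used only for \<open>c \<in> crit_set f\<close>, so that the set is nonempty.\<close>

definition crit_dist :: "(real \<Rightarrow> real) \<Rightarrow> nat \<Rightarrow> one_sided \<Rightarrow> real" where
  "crit_dist f n c = infdist (iter_at f n c) (pt ` crit_set f)"

text \<open>Finiteness of the series includes \<open>d\<^sub>n > 0\<close>, which has to be stated because
  \<open>1 / 0 = 0\<close> here.  The orbit of \<open>f c\<close> then avoids the critical set, so \<open>D\<^sub>n\<close> is positive.\<close>

definition A3 :: "(real \<Rightarrow> real) \<Rightarrow> (one_sided \<Rightarrow> real) \<Rightarrow> real \<Rightarrow> bool" where
  "A3 f ell p \<longleftrightarrow> (\<forall>c\<in>crit_set f. ell c > 1 \<longrightarrow>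
     (\<forall>n\<ge>1. crit_dist f n c > 0) \<and>
     summable (\<lambda>m. let n = Suc m; d = crit_dist f n c in
                 real n powr p * inverse d * ln (inverse d) * inverse (crit_E f ell n c)))"

section \<open>The inducing construction\<close>

text \<open>\<open>b\<close> is the binding period on \<open>crit_nbhd f \<delta>\<close>.\<close>

definition first_entry :: "(real \<Rightarrow> real) \<Rightarrow> real \<Rightarrow> real \<Rightarrow> nat" where
  "first_entry f \<delta> x = (LEAST j. (f ^^ j) x \<in> crit_nbhd f \<delta>)"

definition return_time ::
    "(real \<Rightarrow> real) \<Rightarrow> real \<Rightarrow> nat \<Rightarrow> (real \<Rightarrow> nat) \<Rightarrow> real \<Rightarrow> nat" where
  "return_time f \<delta> q\<^sub>0 b x =
     (if \<exists>j<q\<^sub>0. (f ^^ j) x \<in> crit_nbhd f \<delta>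
      then first_entry f \<delta> x + b ((f ^^ first_entry f \<delta> x) x) else q\<^sub>0)"

text \<open>The value \<open>0\<close> means that \<open>x\<close> has no binding period.\<close>

definition binding_period ::
    "(real \<Rightarrow> real) \<Rightarrow> real \<Rightarrow> nat \<Rightarrow> (real \<Rightarrow> nat) \<Rightarrow> real \<Rightarrow> nat" where
  "binding_period f \<delta> q\<^sub>0 b x =
     (if \<exists>j<q\<^sub>0. (f ^^ j) x \<in> crit_nbhd f \<delta> then b ((f ^^ first_entry f \<delta> x) x) else 0)"

definition induced_map ::
    "(real \<Rightarrow> real) \<Rightarrow> real \<Rightarrow> nat \<Rightarrow> (real \<Rightarrow> nat) \<Rightarrow> real \<Rightarrow> real" where
  "induced_map f \<delta> q\<^sub>0 b x = (f ^^ return_time f \<delta> q\<^sub>0 b x) x"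

text \<open>Elements of the partition \<open>\<alpha>\<close> may or may not contain their end points, so derivatives
  are taken on their interiors.  Measures live on the Lebesgue measurable subsets of \<open>{0..1}\<close>.
  \<open>\<mu>\<^sub>F\<close> is the invariant measure of the induced map, with density \<open>h\<close>.\<close>

locale inducing_construction =
  fixes f :: "real \<Rightarrow> real" and ell :: "one_sided \<Rightarrow> real"
    and \<delta> :: real and q\<^sub>0 :: nat and b :: "real \<Rightarrow> nat" and \<alpha> :: "real set set"
    and \<mu>\<^sub>F :: "real measure" and h :: "real \<Rightarrow> real" and \<mu> :: "real measure"
    and \<tau> bp :: "real \<Rightarrow> nat" and F :: "real \<Rightarrow> real"
  defines "\<tau> \<equiv> return_time f \<delta> q\<^sub>0 b"
    and "bp \<equiv> binding_period f \<delta> q\<^sub>0 b"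
    and "F \<equiv> induced_map f \<delta> q\<^sub>0 b"
  assumes \<delta>_pos: "\<delta> > 0"
    and q0_pos: "q\<^sub>0 \<ge> 1"
    and b_pos: "x \<in> crit_nbhd f \<delta> \<inter> {0..1} \<Longrightarrow> b x \<ge> 1"
    and \<alpha>_countable: "countable \<alpha>"
    and \<alpha>_interval: "a \<in> \<alpha> \<Longrightarrow> is_interval a \<and> interior a \<noteq> {} \<and> a \<subseteq> {0..1}"
    and \<alpha>_disjoint: "disjoint \<alpha>"
    and \<alpha>_cover: "{0..1} - \<Union>\<alpha> \<in> null_sets lebesgue"
    and constant_on_elements: "a \<in> \<alpha> \<Longrightarrow> bp constant_on a \<and> \<tau> constant_on a"
    and iterates_on_elements: "a \<in> \<alpha> \<Longrightarrow> x \<in> a \<Longrightarrow> j \<le> \<tau> x \<Longrightarrow>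
          continuous_on a (f ^^ j) \<and> (mono_on a (f ^^ j) \<or> antimono_on a (f ^^ j))"
    and F_smooth: "a \<in> \<alpha> \<Longrightarrow> C2_on (interior a) F"
    and F_expanding: "\<exists>\<sigma>>1. \<forall>a\<in>\<alpha>. \<forall>x\<in>interior a. \<bar>deriv F x\<bar> \<ge> \<sigma>"
    and F_bounds: "\<exists>C>0. \<exists>M>0.
          (\<forall>k. let \<alpha>k = {a \<in> \<alpha>. \<exists>x\<in>a. bp x = k} in finite \<alpha>k \<and> card \<alpha>k \<le> M) \<and>
          (\<forall>a\<in>\<alpha>. \<forall>k. (\<exists>x\<in>a. bp x = k) \<longrightarrow>
             (k \<le> 1 \<longrightarrow>
                (\<forall>x\<in>interior a. \<bar>1 / deriv F x\<bar> \<le> C) \<and>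
                total_variation (\<lambda>x. \<bar>1 / deriv F x\<bar>) (interior a) \<le> ennreal C) \<and>
             (k \<ge> 2 \<longrightarrow> (\<exists>c\<in>crit_set f. ell c > 1 \<and>
                (\<forall>x\<in>interior a. \<bar>1 / deriv F x\<bar> \<le> C * inverse (crit_E f ell k c)) \<and>
                total_variation (\<lambda>x. \<bar>1 / deriv F x\<bar>) (interior a) \<le>
                  ennreal (C * (1 + ln (inverse (crit_dist f (k - 1) c))) *
                    inverse (crit_dist f (k - 1) c) * inverse (crit_E f ell (k - 1) c)))))"
    and h_BV: "BV_on {0..1} h"
    and h_nonneg: "x \<in> {0..1} \<Longrightarrow> h x \<ge> 0"
    and muF_density: "\<mu>\<^sub>F = density (lebesgue_on {0..1}) (\<lambda>x. ennreal (h x))"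
    and muF_prob: "prob_space \<mu>\<^sub>F"
    and muF_ergodic: "ergodic_map \<mu>\<^sub>F F"
    and \<tau>_integrable: "integrable (lebesgue_on {0..1}) (\<lambda>x. real (\<tau> x))"
    and mu_sets: "sets \<mu> = sets (lebesgue_on {0..1})"
    and mu_eq: "A \<in> sets \<mu> \<Longrightarrow> measure \<mu> A =
          inverse (\<integral>x. real (\<tau> x) \<partial>\<mu>\<^sub>F) *
          (\<Sum>j. measure \<mu>\<^sub>F {x \<in> {0..1}. \<tau> x > j \<and> (f ^^ j) x \<in> A})"
    and mu_prob: "prob_space \<mu>"
    and mu_abs_cont: "absolutely_continuous (lebesgue_on {0..1}) \<mu>"
    and mu_ergodic: "ergodic_map \<mu> f"

end

theory Submission
  imports Defs "HOL-Real_Asymp.Real_Asymp"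
begin

text \<open>The proof follows the pattern of the Fuk--Nagaev inequality: a sum of \<open>n\<close> centred variables with
  tails \<open>n\<^sup>-\<^sup>(\<^sup>\<beta>\<^sup>+\<^sup>1\<^sup>)\<close> deviates linearly either because one of them has size of order \<open>n\<close>, which costs
  \<open>n \<cdot> n\<^sup>-\<^sup>(\<^sup>\<beta>\<^sup>+\<^sup>1\<^sup>)\<close>, or in spite of all of them being at most \<open>\<eta> n\<close>, and the second event has a probability that
  decays faster than any prescribed power once \<open>\<eta>\<close> is small.  The variables here are the sums of \<open>v\<close> over the
  successive excursions of the induced map \<open>F = f\<^sup>\<tau>\<close>.

  An orbit segment of length \<open>n\<close> started at \<open>f\<^sup>j x\<close> with \<open>j < \<tau> x\<close> is, up to two incomplete excursions, a
  concatenation of at most \<open>2 n\<close> excursions (\<open>deviation_dichotomy\<close>).  Long excursions are counted directly with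
  \<open>\<mu>\<close>: either \<open>\<tau> x > \<eta> n\<close>, whose weight in the tower over \<open>F\<close> is a tail sum of \<open>j\<^sup>-\<^sup>(\<^sup>\<beta>\<^sup>+\<^sup>1\<^sup>)\<close>, or
  one of the points \<open>f\<^sup>l y\<close>, \<open>1 \<le> l \<le> n\<close>, lies in \<open>{\<tau> > \<eta> n}\<close>, and invariance of \<open>\<mu>\<close> gives
  \<open>n \<mu>(\<tau> > \<eta> n)\<close> (\<open>deviation_split\<close>).

  If all excursions are shorter than \<open>k = \<eta> n\<close>, the exponential moment method applies with \<open>t = A (log n) / n\<close>.
  The moment of the sum of \<open>V\<close> along \<open>K\<close> steps of \<open>F\<close> is the mass of \<open>L\<^sup>K h\<close>, where \<open>L\<close> is the transfer
  operator of \<open>F\<close> on the finitely many branches with return time at most \<open>k\<close>, weighted by \<open>e\<^sup>t\<^sup>V\<close>.  Since \<open>p > 1\<close>,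
  the branches satisfy a summability condition with weight \<open>\<tau>\<^sup>1\<^sup>+\<^sup>s\<close>, \<open>s > 0\<close>, so \<open>L\<close> is a small perturbation of the
  unweighted operator as soon as \<open>t\<^sup>s e\<^sup>t\<^sup>M\<^sup>k\<close> is small (\<open>M\<close> a bound for \<open>\<bar>V\<bar> / \<tau>\<close>), which a small \<open>\<eta>\<close> guarantees for every \<open>A\<close>.  A
  Lasota--Yorke inequality that is uniform in \<open>t\<close> and \<open>k\<close> (\<open>uniform_lasota_yorke\<close>) bounds the variation of the densities
  by their mass.  To first order in \<open>t\<close> the mass grows by \<open>t\<close> times the integral of \<open>V\<close> against the accumulated
  density; this density is nearly \<open>F\<close>-invariant, hence by compactness and ergodicity nearly a multiple of \<open>h\<close>
  (\<open>almost_invariant_integral\<close>), and \<open>V\<close> has mean zero against \<open>h\<close>.  So the mass grows at most like \<open>e\<^sup>\<epsilon>\<^sup>t\<^sup>K\<close> for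
  every \<open>\<epsilon> > 0\<close> (\<open>exponential_moment\<close>).

  The summability over branches comes from the bounds of the inducing construction and the series \<open>A3\<close>.  Where \<open>d\<^sub>n\<close> is close
  to \<open>1\<close> the logarithm in \<open>A3\<close> degenerates; there the expansion away from the critical set is used
  (\<open>critical_series_summable\<close>).\<close>

section \<open>Functions of bounded variation\<close>

text \<open>Variation at most \<open>B\<close> is witnessed by a function \<open>q\<close> of oscillation at most \<open>B\<close> whose increments dominate
  those of \<open>g\<close>; the variation function is one.  In this form sums, products and monotone changes of variable
  become pointwise inequalities between increments.\<close>

definition varbound :: "(real \<Rightarrow> real) \<Rightarrow> real set \<Rightarrow> real \<Rightarrow> bool" where
  "varbound g S B \<longleftrightarrow> 0 \<le> B \<and> (\<exists>q. \<forall>x\<in>S. \<forall>y\<in>S. x \<le> y \<longrightarrow> \<bar>g y - g x\<bar> \<le> q y - q x \<and> q y - q x \<le> B)"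

lemma varboundI:
  assumes "0 \<le> B"
    and "\<And>x y. x \<in> S \<Longrightarrow> y \<in> S \<Longrightarrow> x \<le> y \<Longrightarrow> \<bar>g y - g x\<bar> \<le> q y - q x"
    and "\<And>x y. x \<in> S \<Longrightarrow> y \<in> S \<Longrightarrow> x \<le> y \<Longrightarrow> q y - q x \<le> B"
  shows "varbound g S B"
  using assms unfolding varbound_def by blast

lemma varboundE:
  assumes "varbound g S B"
  obtains q where "0 \<le> B"
    and "\<And>x y. x \<in> S \<Longrightarrow> y \<in> S \<Longrightarrow> x \<le> y \<Longrightarrow> \<bar>g y - g x\<bar> \<le> q y - q x"
    and "\<And>x y. x \<in> S \<Longrightarrow> y \<in> S \<Longrightarrow> x \<le> y \<Longrightarrow> q y - q x \<le> B"
  using assms unfolding varbound_def by blast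

lemma varbound_nonneg: "varbound g S B \<Longrightarrow> 0 \<le> B"
  by (simp add: varbound_def)

lemma varbound_subset: "varbound g S B \<Longrightarrow> S' \<subseteq> S \<Longrightarrow> varbound g S' B"
  unfolding varbound_def by (meson subsetD)

lemma varbound_mono: "varbound g S B \<Longrightarrow> B \<le> B' \<Longrightarrow> varbound g S B'"
  unfolding varbound_def by (meson order_trans)

lemma varbound_cong: "varbound g S B \<Longrightarrow> (\<And>x. x \<in> S \<Longrightarrow> g x = g' x) \<Longrightarrow> varbound g' S B"
  unfolding varbound_def by auto

lemma varbound_dist:
  assumes "varbound g S B" "x \<in> S" "y \<in> S"
  shows "\<bar>g y - g x\<bar> \<le> B"
proof -
  obtain q where "\<And>x y. x \<in> S \<Longrightarrow> y \<in> S \<Longrightarrow> x \<le> y \<Longrightarrow> \<bar>g y - g x\<bar> \<le> q y - q x"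
    "\<And>x y. x \<in> S \<Longrightarrow> y \<in> S \<Longrightarrow> x \<le> y \<Longrightarrow> q y - q x \<le> B"
    by (rule varboundE[OF assms(1)]) blast
  then show ?thesis using assms(2,3)
    by (metis abs_minus_commute linorder_le_cases order_trans)
qed

lemma varbound_const: "varbound (\<lambda>x. c) S 0"
  by (rule varboundI[where q="\<lambda>_. 0"]) auto

lemma varbound_add:
  assumes "varbound g S B" "varbound h S C"
  shows "varbound (\<lambda>x. g x + h x) S (B + C)"
proof -
  obtain q where q: "0 \<le> B" "\<And>x y. x \<in> S \<Longrightarrow> y \<in> S \<Longrightarrow> x \<le> y \<Longrightarrow> \<bar>g y - g x\<bar> \<le> q y - q x"
    "\<And>x y. x \<in> S \<Longrightarrow> y \<in> S \<Longrightarrow> x \<le> y \<Longrightarrow> q y - q x \<le> B"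
    by (rule varboundE[OF assms(1)]) blast
  obtain r where r: "0 \<le> C" "\<And>x y. x \<in> S \<Longrightarrow> y \<in> S \<Longrightarrow> x \<le> y \<Longrightarrow> \<bar>h y - h x\<bar> \<le> r y - r x"
    "\<And>x y. x \<in> S \<Longrightarrow> y \<in> S \<Longrightarrow> x \<le> y \<Longrightarrow> r y - r x \<le> C"
    by (rule varboundE[OF assms(2)]) blast
  show ?thesis
  proof (rule varboundI[where q="\<lambda>x. q x + r x"])
    fix x y assume xy: "x \<in> S" "y \<in> S" "x \<le> y"
    show "\<bar>g y + h y - (g x + h x)\<bar> \<le> q y + r y - (q x + r x)"
      using q(2)[OF xy] r(2)[OF xy] by linarith
    show "q y + r y - (q x + r x) \<le> B + C"
      using q(3)[OF xy] r(3)[OF xy] by linarith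
  qed (use q r in auto)
qed

lemma varbound_sum:
  assumes "\<And>i. i \<in> I \<Longrightarrow> varbound (g i) S (B i)"
  shows "varbound (\<lambda>x. \<Sum>i\<in>I. g i x) S (\<Sum>i\<in>I. B i)"
  using assms
proof (induction I rule: infinite_finite_induct)
  case (insert i I)
  then show ?case using varbound_add[of "g i" S "B i"] by simp
qed (auto simp: varbound_const)

lemma varbound_cmult:
  assumes "varbound g S B"
  shows "varbound (\<lambda>x. c * g x) S (\<bar>c\<bar> * B)"
proof -
  obtain q where q: "0 \<le> B" "\<And>x y. x \<in> S \<Longrightarrow> y \<in> S \<Longrightarrow> x \<le> y \<Longrightarrow> \<bar>g y - g x\<bar> \<le> q y - q x"
    "\<And>x y. x \<in> S \<Longrightarrow> y \<in> S \<Longrightarrow> x \<le> y \<Longrightarrow> q y - q x \<le> B"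
    by (rule varboundE[OF assms(1)]) blast
  show ?thesis
  proof (rule varboundI[where q="\<lambda>x. \<bar>c\<bar> * q x"])
    fix x y assume xy: "x \<in> S" "y \<in> S" "x \<le> y"
    have "\<bar>c * g y - c * g x\<bar> = \<bar>c\<bar> * \<bar>g y - g x\<bar>"
      by (metis abs_mult right_diff_distrib)
    then show "\<bar>c * g y - c * g x\<bar> \<le> \<bar>c\<bar> * q y - \<bar>c\<bar> * q x"
      using q(2)[OF xy] by (metis abs_ge_zero mult_left_mono right_diff_distrib)
    show "\<bar>c\<bar> * q y - \<bar>c\<bar> * q x \<le> \<bar>c\<bar> * B"
      using q(3)[OF xy] by (metis abs_ge_zero mult_left_mono right_diff_distrib)
  qed (use q in auto)
qed

lemma varbound_diff:
  assumes "varbound g S B" "varbound h S C"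
  shows "varbound (\<lambda>x. g x - h x) S (B + C)"
  using varbound_add[OF assms(1) varbound_cmult[OF assms(2), of "-1"]] by simp

lemma varbound_mult:
  assumes g: "varbound g S B" "\<And>x. x \<in> S \<Longrightarrow> \<bar>g x\<bar> \<le> M"
    and h: "varbound h S C" "\<And>x. x \<in> S \<Longrightarrow> \<bar>h x\<bar> \<le> s" and "0 \<le> M" "0 \<le> s"
  shows "varbound (\<lambda>x. g x * h x) S (s * B + M * C)"
proof -
  obtain q where q: "0 \<le> B" "\<And>x y. x \<in> S \<Longrightarrow> y \<in> S \<Longrightarrow> x \<le> y \<Longrightarrow> \<bar>g y - g x\<bar> \<le> q y - q x"
    "\<And>x y. x \<in> S \<Longrightarrow> y \<in> S \<Longrightarrow> x \<le> y \<Longrightarrow> q y - q x \<le> B"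
    by (rule varboundE[OF g(1)]) blast
  obtain r where r: "0 \<le> C" "\<And>x y. x \<in> S \<Longrightarrow> y \<in> S \<Longrightarrow> x \<le> y \<Longrightarrow> \<bar>h y - h x\<bar> \<le> r y - r x"
    "\<And>x y. x \<in> S \<Longrightarrow> y \<in> S \<Longrightarrow> x \<le> y \<Longrightarrow> r y - r x \<le> C"
    by (rule varboundE[OF h(1)]) blast
  show ?thesis
  proof (rule varboundI[where q="\<lambda>x. s * q x + M * r x"])
    fix x y assume xy: "x \<in> S" "y \<in> S" "x \<le> y"
    have "g y * h y - g x * h x = (g y - g x) * h y + g x * (h y - h x)"
      by (simp add: algebra_simps)
    then have "\<bar>g y * h y - g x * h x\<bar> \<le> \<bar>g y - g x\<bar> * \<bar>h y\<bar> + \<bar>g x\<bar> * \<bar>h y - h x\<bar>"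
      by (metis abs_mult abs_triangle_ineq)
    also have "\<dots> \<le> (q y - q x) * s + M * (r y - r x)"
      using q(2)[OF xy] r(2)[OF xy] g(2)[OF xy(1)] h(2)[OF xy(2)] assms(5,6)
      by (intro add_mono mult_mono) auto
    finally show "\<bar>g y * h y - g x * h x\<bar> \<le> s * q y + M * r y - (s * q x + M * r x)"
      by (simp add: algebra_simps)
    have "s * (q y - q x) + M * (r y - r x) \<le> s * B + M * C"
      using q(3)[OF xy] r(3)[OF xy] assms(5,6) by (intro add_mono mult_left_mono) auto
    then show "s * q y + M * r y - (s * q x + M * r x) \<le> s * B + M * C"
      by (simp add: algebra_simps)
  qed (use q r assms in auto)
qed

lemma varbound_lipschitz_comp:
  assumes u: "varbound u S B" and L: "0 \<le> L"
    and "\<And>x y. x \<in> S \<Longrightarrow> y \<in> S \<Longrightarrow> \<bar>\<phi> (u y) - \<phi> (u x)\<bar> \<le> L * \<bar>u y - u x\<bar>"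
  shows "varbound (\<lambda>x. \<phi> (u x)) S (L * B)"
proof -
  obtain q where q: "0 \<le> B" "\<And>x y. x \<in> S \<Longrightarrow> y \<in> S \<Longrightarrow> x \<le> y \<Longrightarrow> \<bar>u y - u x\<bar> \<le> q y - q x"
    "\<And>x y. x \<in> S \<Longrightarrow> y \<in> S \<Longrightarrow> x \<le> y \<Longrightarrow> q y - q x \<le> B"
    by (rule varboundE[OF u]) blast
  show ?thesis
  proof (rule varboundI[where q="\<lambda>x. L * q x"])
    fix x y assume xy: "x \<in> S" "y \<in> S" "x \<le> y"
    show "\<bar>\<phi> (u y) - \<phi> (u x)\<bar> \<le> L * q y - L * q x"
      using assms(3)[OF xy(1,2)] mult_left_mono[OF q(2)[OF xy] L] by (simp add: algebra_simps)
    show "L * q y - L * q x \<le> L * B"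
      using mult_left_mono[OF q(3)[OF xy] L] by (simp add: algebra_simps)
  qed (use q L in auto)
qed

text \<open>If \<open>q\<close> is a witness for \<open>g\<close>, then \<open>q\<close> after \<open>\<psi>\<close>, with a minus sign in the decreasing case, is one for the composition.\<close>

lemma varbound_comp_mono:
  assumes g: "varbound g S' B" and "\<psi> ` S \<subseteq> S'" and "mono_on S \<psi> \<or> antimono_on S \<psi>"
  shows "varbound (\<lambda>x. g (\<psi> x)) S B"
proof -
  obtain q where q: "0 \<le> B" "\<And>x y. x \<in> S' \<Longrightarrow> y \<in> S' \<Longrightarrow> x \<le> y \<Longrightarrow> \<bar>g y - g x\<bar> \<le> q y - q x"
    "\<And>x y. x \<in> S' \<Longrightarrow> y \<in> S' \<Longrightarrow> x \<le> y \<Longrightarrow> q y - q x \<le> B"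
    by (rule varboundE[OF g]) blast
  from assms(3) show ?thesis
  proof
    assume "mono_on S \<psi>"
    then have *: "x \<in> S \<Longrightarrow> y \<in> S \<Longrightarrow> x \<le> y \<Longrightarrow> \<psi> x \<le> \<psi> y" for x y
      by (auto simp: monotone_on_def)
    show ?thesis
      by (rule varboundI[where q="\<lambda>x. q (\<psi> x)"]) (use q * assms(2) in \<open>auto simp: image_subset_iff\<close>)
  next
    assume "antimono_on S \<psi>"
    then have *: "x \<in> S \<Longrightarrow> y \<in> S \<Longrightarrow> x \<le> y \<Longrightarrow> \<psi> y \<le> \<psi> x" for x y
      by (auto simp: monotone_on_def)
    show ?thesis
    proof (rule varboundI[where q="\<lambda>x. - q (\<psi> x)"])
      fix x y assume xy: "x \<in> S" "y \<in> S" "x \<le> y"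
      then have "\<psi> y \<le> \<psi> x" "\<psi> x \<in> S'" "\<psi> y \<in> S'" using * assms(2) by auto
      then show "\<bar>g (\<psi> y) - g (\<psi> x)\<bar> \<le> - q (\<psi> y) - - q (\<psi> x)" "- q (\<psi> y) - - q (\<psi> x) \<le> B"
        using q(2)[of "\<psi> y" "\<psi> x"] q(3)[of "\<psi> y" "\<psi> x"] by auto
    qed (use q in auto)
  qed
qed

text \<open>The extension by zero adds at most one jump of height \<open>M\<close> at each end of the interval.\<close>

lemma varbound_indicator:
  assumes g: "varbound g S B" and S: "is_interval S" and M: "\<And>x. x \<in> S \<Longrightarrow> \<bar>g x\<bar> \<le> M" and "0 \<le> M"
  shows "varbound (\<lambda>x. if x \<in> S then g x else 0) UNIV (B + 2 * M)"
proof (cases "S = {}")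
  case True
  then show ?thesis using varbound_nonneg[OF g] \<open>0 \<le> M\<close>
    by (intro varbound_mono[OF varbound_cong[OF varbound_const[of 0]]]) auto
next
  case False
  then obtain z where z: "z \<in> S" by auto
  obtain q where q: "0 \<le> B" "\<And>x y. x \<in> S \<Longrightarrow> y \<in> S \<Longrightarrow> x \<le> y \<Longrightarrow> \<bar>g y - g x\<bar> \<le> q y - q x"
    "\<And>x y. x \<in> S \<Longrightarrow> y \<in> S \<Longrightarrow> x \<le> y \<Longrightarrow> q y - q x \<le> B"
    by (rule varboundE[OF g]) blast
  have mono: "x \<in> S \<Longrightarrow> y \<in> S \<Longrightarrow> x \<le> y \<Longrightarrow> q x \<le> q y" for x y
    using q(2)[of x y] by linarith
  define i where "i = Inf (q ` S)"
  have osc: "q x \<ge> q z - B" if "x \<in> S" for x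
    using q(3)[of x z] mono[of z x] z that q(1) by (cases "x \<le> z") auto
  have bdd: "bdd_below (q ` S)" using osc by (intro bdd_belowI2) auto
  have i_le: "i \<le> q x" if "x \<in> S" for x
    unfolding i_def using that bdd by (simp add: cINF_lower)
  have le_i: "q x \<le> i + B" if "x \<in> S" for x
  proof -
    have "q x - B \<le> i" unfolding i_def
    proof (rule cINF_greatest)
      fix y assume "y \<in> S" then show "q x - B \<le> q y"
        using q(3)[of y x] mono[of x y] that q(1) by (cases "y \<le> x") auto
    qed (use False in auto)
    then show ?thesis by linarith
  qed
  define r where "r x = (if x \<in> S then q x - i + M else if x < z then 0 else B + 2 * M)" for x
  have out: "x \<notin> S \<Longrightarrow> y \<in> S \<Longrightarrow> x < z \<Longrightarrow> x < y" "x \<notin> S \<Longrightarrow> y \<in> S \<Longrightarrow> \<not> x < z \<Longrightarrow> y < x" for x y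
    using S z unfolding is_interval_1 by (meson linorder_not_less order_less_imp_le order.trans)+
  show ?thesis
  proof (rule varboundI[where q=r])
    fix x y :: real assume xy: "x \<le> y"
    show "\<bar>(if y \<in> S then g y else 0) - (if x \<in> S then g x else 0)\<bar> \<le> r y - r x"
    proof (cases "x \<in> S"; cases "y \<in> S")
      assume "x \<in> S" "y \<in> S" then show ?thesis using q(2)[of x y] xy by (simp add: r_def)
    next
      assume a: "x \<in> S" "y \<notin> S"
      then have "\<not> y < z" using out(1)[OF a(2,1)] xy by auto
      then show ?thesis using a le_i[OF a(1)] M[OF a(1)] by (simp add: r_def)
    next
      assume a: "x \<notin> S" "y \<in> S"
      then have "x < z" using out(2)[OF a(1,2)] xy by auto
      then show ?thesis using a i_le[OF a(2)] M[OF a(2)] by (simp add: r_def)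
    next
      assume a: "x \<notin> S" "y \<notin> S"
      then show ?thesis using xy q(1) \<open>0 \<le> M\<close> by (auto simp: r_def)
    qed
    have "0 \<le> r x" "r y \<le> B + 2 * M"
      using i_le le_i[of y] \<open>0 \<le> M\<close> q(1) by (auto simp: r_def)
    then show "r y - r x \<le> B + 2 * M" by linarith
  qed (use q \<open>0 \<le> M\<close> in auto)
qed

text \<open>The witness is the total variation over \<open>S \<inter> {..x}\<close>, as a function of \<open>x\<close>.\<close>

lemma varbound_total_variation:
  assumes "total_variation g S \<le> ennreal C" "0 \<le> C"
  shows "varbound g S C"
proof -
  define tv where "tv xs = (\<Sum>i<length xs - 1. ennreal \<bar>g (xs ! Suc i) - g (xs ! i)\<bar>)" for xs
  define A where "A T = {xs. sorted_wrt (<) xs \<and> set xs \<subseteq> T}" for T :: "real set"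
  have tvA: "total_variation g T = (SUP xs\<in>A T. tv xs)" for T
    by (simp add: total_variation_def A_def tv_def)
  have tvsnoc: "tv (xs @ [x, y]) = tv (xs @ [x]) + ennreal \<bar>g y - g x\<bar>" for xs x y
  proof -
    have "tv (xs @ [x, y]) = (\<Sum>i<Suc (length xs). ennreal \<bar>g ((xs @ [x, y]) ! Suc i) - g ((xs @ [x, y]) ! i)\<bar>)"
      by (simp add: tv_def)
    also have "\<dots> = (\<Sum>i<length xs. ennreal \<bar>g ((xs @ [x, y]) ! Suc i) - g ((xs @ [x, y]) ! i)\<bar>) + ennreal \<bar>g y - g x\<bar>"
      by (simp add: nth_append)
    also have "(\<Sum>i<length xs. ennreal \<bar>g ((xs @ [x, y]) ! Suc i) - g ((xs @ [x, y]) ! i)\<bar>)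
             = (\<Sum>i<length xs. ennreal \<bar>g ((xs @ [x]) ! Suc i) - g ((xs @ [x]) ! i)\<bar>)"
      by (intro sum.cong refl) (auto simp: nth_append nth_Cons split: nat.splits)
    finally show ?thesis by (simp add: tv_def)
  qed
  have le_snoc: "tv xs \<le> tv (xs @ [x])" for xs x
  proof (cases xs rule: rev_cases)
    case (snoc ys y)
    then show ?thesis using tvsnoc[of ys y x] by simp
  qed (simp add: tv_def)
  have step: "total_variation g (S \<inter> {..x}) + ennreal \<bar>g y - g x\<bar> \<le> total_variation g (S \<inter> {..y})"
    if xy: "x \<in> S" "y \<in> S" "x < y" for x y
  proof -
    have "tv xs + ennreal \<bar>g y - g x\<bar> \<le> total_variation g (S \<inter> {..y})" if xs: "xs \<in> A (S \<inter> {..x})" for xs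
    proof -
      have "\<exists>ys. ys @ [x] \<in> A (S \<inter> {..x}) \<and> tv xs \<le> tv (ys @ [x])"
      proof (cases "xs \<noteq> [] \<and> last xs = x")
        case True then show ?thesis using xs by (metis append_butlast_last_id order_refl)
      next
        case False
        have "z < x" if "z \<in> set xs" for z
        proof -
          from that xs have "xs \<noteq> []" by auto
          then obtain zs w where zw: "xs = zs @ [w]" by (metis append_butlast_last_id)
          have "w < x" using False xs zw by (auto simp: A_def)
          then show ?thesis using that xs by (auto simp: A_def zw sorted_wrt_append)
        qed
        then have "xs @ [x] \<in> A (S \<inter> {..x})" using xs xy by (auto simp: A_def sorted_wrt_append)
        then show ?thesis using le_snoc by blast
      qed
      then obtain ys where ys: "ys @ [x] \<in> A (S \<inter> {..x})" "tv xs \<le> tv (ys @ [x])" by blast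
      then have "ys @ [x, y] \<in> A (S \<inter> {..y})" using xy by (force simp: A_def sorted_wrt_append)
      then have "tv (ys @ [x, y]) \<le> total_variation g (S \<inter> {..y})" unfolding tvA by (rule SUP_upper)
      then show ?thesis using ys(2) unfolding tvsnoc by (metis add_right_mono order_trans)
    qed
    moreover have "A (S \<inter> {..x}) \<noteq> {}" by (auto simp: A_def intro!: exI[of _ "[]"])
    ultimately show ?thesis
      unfolding tvA[of "S \<inter> {..x}"] by (subst ennreal_SUP_add_left[symmetric]) (auto intro: SUP_least)
  qed
  have fin: "total_variation g (S \<inter> {..x}) \<le> ennreal C" for x
  proof -
    have "total_variation g (S \<inter> {..x}) \<le> total_variation g S"
      unfolding tvA by (rule SUP_subset_mono) (auto simp: A_def)
    then show ?thesis using assms by auto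
  qed
  define q where "q x = enn2real (total_variation g (S \<inter> {..x}))" for x
  have qe: "ennreal (q x) = total_variation g (S \<inter> {..x})" for x
    unfolding q_def using fin[of x] by (intro ennreal_enn2real) (auto simp: top_unique less_top[symmetric])
  have q0: "0 \<le> q x" for x by (simp add: q_def)
  show ?thesis
  proof (rule varboundI[where q=q])
    fix x y assume xy: "x \<in> S" "y \<in> S" "x \<le> y"
    show "\<bar>g y - g x\<bar> \<le> q y - q x"
    proof (cases "x = y")
      case False
      then have "ennreal (q x) + ennreal \<bar>g y - g x\<bar> \<le> ennreal (q y)" using step xy unfolding qe by auto
      then have "q x + \<bar>g y - g x\<bar> \<le> q y" using q0 by (simp flip: ennreal_plus)
      then show ?thesis by simp
    qed auto
    have "ennreal (q y) \<le> ennreal C" using fin[of y] by (simp add: qe)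
    then have "q y \<le> C" using assms(2) by (simp add: ennreal_le_iff)
    then show "q y - q x \<le> C" using q0[of x] by linarith
  qed fact
qed

lemma BV_on_varbound:
  assumes "BV_on S g" obtains B where "varbound g S B"
proof -
  from assms have "total_variation g S \<le> ennreal (enn2real (total_variation g S))"
    unfolding BV_on_def by (simp add: less_top)
  then show ?thesis using that varbound_total_variation by (metis enn2real_nonneg)
qed

text \<open>Jordan decomposition: \<open>g = q - (q - g)\<close> is a difference of monotone functions.\<close>

lemma varbound_UNIV_measurable:
  assumes "varbound g UNIV B" shows "g \<in> borel_measurable borel"
proof -
  obtain q where q: "\<And>x y. x \<le> y \<Longrightarrow> \<bar>g y - g x\<bar> \<le> q y - q x"
    by (rule varboundE[OF assms]) blast
  have "mono q" using q by (intro monoI) (smt (verit))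
  moreover have "mono (\<lambda>x. q x - g x)" using q by (intro monoI) (smt (verit))
  ultimately have "(\<lambda>x. q x - (q x - g x)) \<in> borel_measurable borel"
    by (intro borel_measurable_diff borel_measurable_mono)
  then show ?thesis by simp
qed


text \<open>On each piece take the oscillation of a common witness \<open>q\<close>.  As \<open>q\<close> is monotone, the ranges of \<open>q\<close> on disjoint intervals
  are non-overlapping subintervals of an interval of length \<open>B\<close>, so their lengths add up to at most \<open>B\<close>.\<close>

lemma varbound_disjoint_sum:
  assumes g: "varbound g UNIV B" and fin: "finite \<U>" and disj: "disjoint \<U>"
    and int: "\<And>U. U \<in> \<U> \<Longrightarrow> is_interval U \<and> U \<noteq> {}"
  shows "\<exists>\<beta>. (\<forall>U\<in>\<U>. varbound g U (\<beta> U)) \<and> (\<Sum>U\<in>\<U>. \<beta> U) \<le> B"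
proof -
  obtain q where q: "0 \<le> B" "\<And>x y. x \<le> y \<Longrightarrow> \<bar>g y - g x\<bar> \<le> q y - q x" "\<And>x y. x \<le> y \<Longrightarrow> q y - q x \<le> B"
    by (rule varboundE[OF g]) blast
  have mono: "x \<le> y \<Longrightarrow> q x \<le> q y" for x y
    using q(2)[of x y] by linarith
  have osc: "q x \<le> q y + B" for x y
    using q(1) q(3)[of y x] mono[of x y] by (cases "y \<le> x") auto
  \<comment> \<open>The range of the witness on a piece is contained in \<open>{i U..s U}\<close>.\<close>
  define i where "i U = Inf (q ` U)" for U
  define s where "s U = Sup (q ` U)" for U
  have bb: "bdd_below (q ` U)" for U using osc[of 0] by (intro bdd_belowI2[of _ "q 0 - B"]) (simp add: algebra_simps)
  have ba: "bdd_above (q ` U)" for U using osc[of _ 0] by (intro bdd_aboveI2[of _ _ "q 0 + B"]) (simp add: algebra_simps)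
  have iq: "x \<in> U \<Longrightarrow> i U \<le> q x" and qs: "x \<in> U \<Longrightarrow> q x \<le> s U" for x U
    unfolding i_def s_def by (auto intro: cINF_lower[OF bb] cSUP_upper[OF _ ba])
  have is_le: "U \<noteq> {} \<Longrightarrow> i U \<le> s U" for U
    using iq qs by (meson all_not_in_conv order_trans)
  have sep: "s U \<le> i V" if U: "U \<in> \<U>" and V: "V \<in> \<U>" and "\<And>x y. x \<in> U \<Longrightarrow> y \<in> V \<Longrightarrow> x \<le> y" for U V
    unfolding i_def s_def using int[OF U] int[OF V] that(3) mono
    by (intro cSUP_least cINF_greatest) auto
  have ord: "(\<forall>x\<in>U. \<forall>y\<in>V. x \<le> y) \<or> (\<forall>x\<in>V. \<forall>y\<in>U. x \<le> y)"
    if UV: "U \<in> \<U>" "V \<in> \<U>" "U \<noteq> V" for U V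
  proof (rule ccontr)
    assume "\<not> ?thesis"
    then obtain x y x' y' where h: "x \<in> U" "y \<in> V" "y < x" "x' \<in> V" "y' \<in> U" "y' < x'" by (auto simp: not_le)
    have d: "U \<inter> V = {}" using disj UV by (auto simp: disjoint_def)
    have iU: "is_interval U" and iV: "is_interval V" using int UV by auto
    show False
    proof (cases "y' \<le> y")
      case True
      then have "y \<in> U" using iU[unfolded is_interval_1, rule_format, of y' x y] h by simp
      then show False using d h by auto
    next
      case False
      then have "y' \<in> V" using iV[unfolded is_interval_1, rule_format, of y x' y'] h by simp
      then show False using d h by auto
    qed
  qed
  have "(\<Sum>U\<in>\<U>. measure lborel {i U<..<s U}) = measure lborel (\<Union>U\<in>\<U>. {i U<..<s U})"
  proof (rule measure_finite_Union[symmetric, OF fin])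
    show "disjoint_family_on (\<lambda>U. {i U<..<s U}) \<U>"
    proof (unfold disjoint_family_on_def, intro ballI impI)
      fix U V assume UV: "U \<in> \<U>" "V \<in> \<U>" "U \<noteq> V"
      from ord[OF UV] sep[OF UV(1,2)] sep[OF UV(2,1)] have "s U \<le> i V \<or> s V \<le> i U" by blast
      then show "{i U<..<s U} \<inter> {i V<..<s V} = {}" by auto
    qed
  qed (use int is_le in \<open>auto simp: emeasure_lborel_Ioo\<close>)
  also have "\<dots> \<le> measure lborel {i UNIV..i UNIV + B}"
  proof (rule measure_mono_fmeasurable)
    have "s U \<le> i UNIV + B" if "U \<in> \<U>" for U
    proof -
      have "s U \<le> q y + B" for y unfolding s_def using int[OF that] osc by (intro cSUP_least) auto
      then have "s U - B \<le> i UNIV" unfolding i_def by (intro cINF_greatest) (auto simp: algebra_simps)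
      then show ?thesis by simp
    qed
    moreover have "i UNIV \<le> i U" if "U \<in> \<U>" for U
      unfolding i_def using int[OF that] by (intro cINF_superset_mono[OF _ bb]) auto
    ultimately show "(\<Union>U\<in>\<U>. {i U<..<s U}) \<subseteq> {i UNIV..i UNIV + B}" by fastforce
    show "(\<Union>U\<in>\<U>. {i U<..<s U}) \<in> sets lborel" by (simp, intro borel_open) auto
    show "{i UNIV..i UNIV + B} \<in> fmeasurable lborel" using q(1) by (intro fmeasurableI) auto
  qed
  finally have sum: "(\<Sum>U\<in>\<U>. s U - i U) \<le> B"
    using int is_le q(1) by simp
  show ?thesis
  proof (intro exI[of _ "\<lambda>U. s U - i U"] conjI ballI sum)
    fix U assume U: "U \<in> \<U>"
    show "varbound g U (s U - i U)"
    proof (rule varboundI[where q=q])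
      show "0 \<le> s U - i U" using is_le[of U] int[OF U] by simp
      show "q y - q x \<le> s U - i U" if "x \<in> U" "y \<in> U" "x \<le> y" for x y
        using iq[OF that(1)] qs[OF that(2)] by linarith
    qed (rule q(2))
  qed
qed

text \<open>Cut at the points where a witness \<open>q\<close> has increased by \<open>\<epsilon>\<close>.  The function \<open>q\<close> may jump at such a point, but \<open>G\<close> does not, so
  the point can be attached to the piece on its left.\<close>

lemma small_variation_partition:
  fixes G :: "real \<Rightarrow> real"
  assumes "continuous_on {l<..<r} G" "varbound G {l<..<r} B" "0 < \<epsilon>" "l < r"
  shows "\<exists>\<P>. finite \<P> \<and> disjoint \<P> \<and> \<Union>\<P> = {l<..<r} \<and>
           (\<forall>U\<in>\<P>. is_interval U \<and> interior U \<noteq> {} \<and> varbound G U \<epsilon>)"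
proof -
  obtain q where q: "0 \<le> B" "\<And>x y. x \<in> {l<..<r} \<Longrightarrow> y \<in> {l<..<r} \<Longrightarrow> x \<le> y \<Longrightarrow> \<bar>G y - G x\<bar> \<le> q y - q x"
    "\<And>x y. x \<in> {l<..<r} \<Longrightarrow> y \<in> {l<..<r} \<Longrightarrow> x \<le> y \<Longrightarrow> q y - q x \<le> B"
    by (rule varboundE[OF assms(2)]) blast
  obtain k where k: "B \<le> real k * \<epsilon>" using reals_Archimedean3[OF assms(3)] less_imp_le by blast
  have gen: "\<exists>\<P>. finite \<P> \<and> disjoint \<P> \<and> \<Union>\<P> = {a<..<r} \<and>
           (\<forall>U\<in>\<P>. is_interval U \<and> interior U \<noteq> {} \<and> varbound G U \<epsilon>)"
    if "l \<le> a" "a < r" "\<And>x y. x \<in> {a<..<r} \<Longrightarrow> y \<in> {a<..<r} \<Longrightarrow> x \<le> y \<Longrightarrow> q y - q x \<le> real k * \<epsilon>" for a k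
    using that
  proof (induction k arbitrary: a)
    case 0
    then have "varbound G {a<..<r} \<epsilon>"
    proof (intro varboundI[where q=q])
      fix x y assume xy: "x \<in> {a<..<r}" "y \<in> {a<..<r}" "x \<le> y"
      show "\<bar>G y - G x\<bar> \<le> q y - q x" using xy 0(1) by (intro q(2)) auto
      show "q y - q x \<le> \<epsilon>" using 0(3)[OF xy] assms(3) by simp
    qed (use assms(3) in simp)
    with 0 show ?case by (intro exI[of _ "{{a<..<r}}"]) (auto simp: disjoint_def)
  next
    case (Suc k)
    let ?I = "{a<..<r}"
    have mono: "q x \<le> q y" if "x \<in> ?I" "y \<in> ?I" "x \<le> y" for x y
      using q(2)[of x y] Suc.prems(1) that by auto
    define i where "i = Inf (q ` ?I)"
    have ne: "?I \<noteq> {}" using Suc.prems by simp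
    have up: "q y \<le> q x + real (Suc k) * \<epsilon>" if "x \<in> ?I" "y \<in> ?I" for x y
    proof (cases "x \<le> y")
      case True then show ?thesis using Suc.prems(3)[of x y] that by linarith
    next
      case False
      have "0 \<le> real (Suc k) * \<epsilon>" using assms(3) by simp
      then show ?thesis using mono[of y x] that False by linarith
    qed
    obtain z where z: "z \<in> ?I" using ne by blast
    have bb: "bdd_below (q ` ?I)" using up[OF _ z] by (intro bdd_belowI2[of _ "q z - real (Suc k) * \<epsilon>"]) (simp add: algebra_simps)
    have iq: "x \<in> ?I \<Longrightarrow> i \<le> q x" for x unfolding i_def by (rule cINF_lower[OF bb])
    have qi: "q y \<le> i + real (Suc k) * \<epsilon>" if "y \<in> ?I" for y
    proof -
      have "q y - real (Suc k) * \<epsilon> \<le> i" unfolding i_def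
        using up[OF _ that] ne by (intro cINF_greatest) (auto simp: algebra_simps)
      then show ?thesis by linarith
    qed
    define S where "S = {x \<in> ?I. q x \<le> i + \<epsilon>}"
    have "\<exists>x\<in>?I. q x < i + \<epsilon>"
      using cINF_less_iff[OF ne bb, of "i + \<epsilon>"] assms(3) by (simp add: i_def)
    then obtain x0 where x0: "x0 \<in> S" unfolding S_def using that less_imp_le by blast
    define c where "c = Sup S"
    have ba: "bdd_above S" by (intro bdd_aboveI[of _ r]) (auto simp: S_def)
    have ac: "a < c" "c \<le> r" using x0 cSup_upper[OF x0 ba] cSup_least[of S r] by (auto simp: c_def S_def)
    have low: "q x \<le> i + \<epsilon>" if xc: "x \<in> ?I" "x < c" for x
    proof -
      obtain y where "y \<in> S" "x < y" using less_cSupD[of S x] xc(2) x0 unfolding c_def by blast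
      then show ?thesis using mono[of x y] xc by (auto simp: S_def)
    qed
    have high: "i + \<epsilon> \<le> q x" if "x \<in> ?I" "c < x" for x
      using cSup_upper[OF _ ba, of x] that by (force simp: c_def S_def)
    show ?case
    proof (cases "c = r")
      case True
      have "varbound G ?I \<epsilon>"
      proof (rule varboundI[where q=q])
        fix x y assume "x \<in> ?I" "y \<in> ?I" "x \<le> y"
        then show "\<bar>G y - G x\<bar> \<le> q y - q x" "q y - q x \<le> \<epsilon>"
          using q(2)[of x y] Suc.prems(1) low[of y] iq[of x] True by auto
      qed (use assms in auto)
      with Suc.prems show ?thesis by (intro exI[of _ "{?I}"]) (auto simp: disjoint_def)
    next
      case False
      with ac have cr: "c < r" by simp
      have "q y - q x \<le> real k * \<epsilon>" if "x \<in> {c<..<r}" "y \<in> {c<..<r}" for x y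
        using qi[of y] high[of x] that ac by (auto simp: algebra_simps)
      then obtain \<P> where \<P>: "finite \<P>" "disjoint \<P>" "\<Union>\<P> = {c<..<r}"
        "\<forall>U\<in>\<P>. is_interval U \<and> interior U \<noteq> {} \<and> varbound G U \<epsilon>"
        using Suc.IH[of c] cr ac Suc.prems(1) by auto
      have vc: "varbound G {a<..c} \<epsilon>"
      proof (rule varboundI[where q="\<lambda>x. if x < c then q x else i + \<epsilon>"])
        fix x y assume xy: "x \<in> {a<..c}" "y \<in> {a<..c}" "x \<le> y"
        show "(if y < c then q y else i + \<epsilon>) - (if x < c then q x else i + \<epsilon>) \<le> \<epsilon>"
          using xy cr low[of y] iq[of x] assms(3) by auto
        show "\<bar>G y - G x\<bar> \<le> (if y < c then q y else i + \<epsilon>) - (if x < c then q x else i + \<epsilon>)"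
        proof (cases "y < c")
          case True then show ?thesis using xy q(2)[of x y] Suc.prems(1) cr by auto
        next
          case False
          then have y: "y = c" using xy by simp
          show ?thesis
          proof (cases "x < c")
            case True
            have "isCont G c" using assms(1) ac cr Suc.prems(1)
              by (simp add: continuous_on_eq_continuous_at)
            then have lim: "((\<lambda>t. \<bar>G t - G x\<bar>) \<longlongrightarrow> \<bar>G c - G x\<bar>) (at_left c)"
              by (intro tendsto_intros) (simp add: continuous_at filterlim_at_split)
            have "\<forall>\<^sub>F t in at_left c. \<bar>G t - G x\<bar> \<le> i + \<epsilon> - q x"
              using eventually_at_left_real[OF True]
            proof eventually_elim
              case (elim t)
              then show ?case using q(2)[of x t] low[of t] xy Suc.prems(1) cr by simp
            qed
            from tendsto_upperbound[OF lim this] show ?thesis using y True by simp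
          qed (use y xy in auto)
        qed
      qed (use assms in auto)
      have "disjoint (insert {a<..c} \<P>)"
        proof -
        have "{a<..c} \<inter> U = {}" if "U \<in> \<P>" for U
        proof -
          have "U \<subseteq> {c<..<r}" using \<P>(3) that by blast
          then show ?thesis by fastforce
        qed
        then show ?thesis using \<P>(2) by (auto simp: disjoint_def Int_commute)
      qed
      moreover have "\<Union>(insert {a<..c} \<P>) = ?I" unfolding Union_insert \<P>(3) using ac cr by auto
      moreover have "is_interval {a<..c} \<and> interior {a<..c} \<noteq> {} \<and> varbound G {a<..c} \<epsilon>"
        using vc ac by (simp add: is_interval_1)
      ultimately show ?thesis using \<P>(1,4)
        by (intro exI[of _ "insert {a<..c} \<P>"]) simp
    qed
  qed
  show ?thesis
  proof (rule gen[of l k, OF order.refl assms(4)])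
    fix x y assume "x \<in> {l<..<r}" "y \<in> {l<..<r}" "x \<le> y"
    then show "q y - q x \<le> real k * \<epsilon>" using q(3)[of x y] k by linarith
  qed
qed

abbreviation leb :: "real measure" where "leb \<equiv> lebesgue_on {0..1}"

text \<open>A function that vanishes outside the unit interval is bounded by its variation over the line, so the variation alone
  serves as the norm.\<close>

definition bv0 :: "(real \<Rightarrow> real) \<Rightarrow> real \<Rightarrow> bool" where
  "bv0 g B \<longleftrightarrow> varbound g UNIV B \<and> (\<forall>x. x \<notin> {0..1} \<longrightarrow> g x = 0)"

lemma bv0_zero: "bv0 g B \<Longrightarrow> x \<notin> {0..1} \<Longrightarrow> g x = 0"
  by (auto simp: bv0_def)

lemma bv0_varbound: "bv0 g B \<Longrightarrow> varbound g S B"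
  by (auto simp: bv0_def intro: varbound_subset)

lemma bv0_nonneg: "bv0 g B \<Longrightarrow> 0 \<le> B"
  by (auto simp: bv0_def varbound_nonneg)

lemma bv0_mono: "bv0 g B \<Longrightarrow> B \<le> B' \<Longrightarrow> bv0 g B'"
  by (auto simp: bv0_def intro: varbound_mono)

lemma bv0_bound: assumes "bv0 g B" shows "\<bar>g x\<bar> \<le> B"
  using varbound_dist[of g UNIV B 2 x] bv0_zero[OF assms, of 2] assms by (simp add: bv0_def)

lemma bv0_add: "bv0 g B \<Longrightarrow> bv0 h C \<Longrightarrow> bv0 (\<lambda>x. g x + h x) (B + C)"
  by (auto simp: bv0_def varbound_add)

lemma bv0_diff: "bv0 g B \<Longrightarrow> bv0 h C \<Longrightarrow> bv0 (\<lambda>x. g x - h x) (B + C)"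
  by (auto simp: bv0_def varbound_diff)

lemma bv0_cmult: "bv0 g B \<Longrightarrow> bv0 (\<lambda>x. c * g x) (\<bar>c\<bar> * B)"
  by (auto simp: bv0_def varbound_cmult)

lemma bv0_sum: "(\<And>i. i \<in> I \<Longrightarrow> bv0 (g i) (B i)) \<Longrightarrow> bv0 (\<lambda>x. \<Sum>i\<in>I. g i x) (\<Sum>i\<in>I. B i)"
  by (auto simp: bv0_def intro: varbound_sum)

lemma bv0_measurable: "bv0 g B \<Longrightarrow> g \<in> borel_measurable borel"
  by (auto simp: bv0_def intro: varbound_UNIV_measurable)

lemma borel_measurable_leb: "g \<in> borel_measurable borel \<Longrightarrow> g \<in> borel_measurable leb"
  by (simp add: borel_measurable_if_I measurable_completion measurable_restrict_space1)

lemma leb_bounded_integrable: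
  fixes g :: "real \<Rightarrow> real"
  assumes "g \<in> borel_measurable leb" "\<And>x. x \<in> {0..1} \<Longrightarrow> \<bar>g x\<bar> \<le> B"
  shows "integrable leb g"
proof -
  interpret finite_measure leb by (rule finite_measure_lebesgue_on) auto
  show ?thesis using assms by (intro integrable_const_bound[where B=B]) (auto simp: AE_restrict_space_iff)
qed

lemma bv0_leb: "bv0 g B \<Longrightarrow> g \<in> borel_measurable leb"
  by (simp add: bv0_measurable borel_measurable_leb)

lemma bv0_integrable: "bv0 g B \<Longrightarrow> integrable leb g"
  by (rule leb_bounded_integrable[where B=B]) (auto simp: bv0_leb bv0_bound)

lemma leb_integral_lborel:
  fixes g :: "real \<Rightarrow> real"
  assumes "g \<in> borel_measurable borel" "\<And>x. x \<notin> {0..1} \<Longrightarrow> g x = 0"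
  shows "integral\<^sup>L leb g = integral\<^sup>L lborel g"
proof -
  have "integral\<^sup>L leb g = (LINT x|lebesgue. indicator {0..1} x *\<^sub>R g x)"
    by (subst integral_restrict_space) auto
  also have "(\<lambda>x. indicator {0..1} x *\<^sub>R g x) = g" by (rule ext, case_tac "x \<in> {0..1}") (use assms(2) in simp_all)
  also have "integral\<^sup>L lebesgue g = integral\<^sup>L lborel g" by (rule integral_completion) (use assms in simp)
  finally show ?thesis .
qed

text \<open>On each cell of a grid of width \<open>1 / K\<close> the function differs from its value at the left end by at most the increment of a witness;
  the increments telescope.\<close>

lemma bv0_L1_sampling:
  assumes g: "bv0 g B" and K: "0 < K"
  shows "(\<integral>x. \<bar>g x\<bar> \<partial>leb) \<le> (B + (\<Sum>j<K. \<bar>g (real j / real K)\<bar>)) / real K"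
proof -
  have "varbound g UNIV B" using g by (simp add: bv0_def)
  then obtain q where q: "0 \<le> B" "\<And>x y. x \<le> y \<Longrightarrow> \<bar>g y - g x\<bar> \<le> q y - q x" "\<And>x y. x \<le> y \<Longrightarrow> q y - q x \<le> B"
    by (rule varboundE) blast
  define z where "z j = real j / real K" for j
  define c where "c j = \<bar>g (z j)\<bar> + (q (z (Suc j)) - q (z j))" for j
  let ?J = "\<lambda>j. {z j..<z (Suc j)}"
  have zle: "z j \<le> z (Suc j)" for j using K by (simp add: z_def divide_right_mono)
  have mon: "x \<le> y \<Longrightarrow> q x \<le> q y" for x y using q(2)[of x y] by linarith
  have c0: "0 \<le> c j" for j using mon[OF zle[of j]] by (simp add: c_def)
  have "(\<integral>x. \<bar>g x\<bar> \<partial>leb) = (\<integral>x. \<bar>g x\<bar> \<partial>lborel)"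
    using bv0_measurable[OF g] bv0_zero[OF g] by (intro leb_integral_lborel) auto
  also have "\<dots> \<le> (\<integral>x. (\<Sum>j<K. c j * indicator (?J j) x) \<partial>lborel)"
  proof (rule integral_mono_AE')
    show "integrable lborel (\<lambda>x. (\<Sum>j<K. c j * indicator (?J j) x))"
      by (intro Bochner_Integration.integrable_sum integrable_mult_right integrable_real_indicator) (auto simp: emeasure_lborel_Ico zle)
    have "AE x in lborel. x \<noteq> (1::real)" by (rule AE_lborel_singleton)
    then show "AE x in lborel. \<bar>g x\<bar> \<le> (\<Sum>j<K. c j * indicator (?J j) x)"
    proof eventually_elim
      case (elim x)
      show ?case
      proof (cases "x \<in> {0..1}")
        case True
        define j where "j = nat \<lfloor>x * K\<rfloor>"
        have x: "0 \<le> x" "x < 1" using True elim by auto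
        have j: "real j \<le> x * K" "x * K < real j + 1" using x K by (auto simp: j_def)
        have "x * real K < real K" using x K by simp
        then have jK: "j < K" using j by linarith
        have xJ: "x \<in> ?J j" using j K by (simp add: z_def field_simps)
        have "\<bar>g x\<bar> \<le> c j" using q(2)[of "z j" x] mon[of x "z (Suc j)"] xJ by (auto simp: c_def)
        also have "\<dots> = c j * indicator (?J j) x" using xJ by simp
        also have "\<dots> \<le> (\<Sum>j<K. c j * indicator (?J j) x)"
          using jK c0 by (intro member_le_sum) auto
        finally show ?thesis .
      qed (use bv0_zero[OF g] c0 in \<open>auto intro!: sum_nonneg\<close>)
    qed
  qed (use c0 in \<open>auto intro!: sum_nonneg\<close>)
  also have "\<dots> = (\<Sum>j<K. c j * (z (Suc j) - z j))"
    using zle by (subst Bochner_Integration.integral_sum) (auto intro!: integrable_mult_right integrable_real_indicator simp: emeasure_lborel_Ico)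
  also have "\<dots> = (\<Sum>j<K. c j) / K" using K by (simp add: z_def sum_divide_distrib field_simps)
  also have "(\<Sum>j<K. c j) = (\<Sum>j<K. \<bar>g (z j)\<bar>) + (q (z K) - q (z 0))"
    using sum_lessThan_telescope[of "\<lambda>j. q (z j)" K] by (simp add: c_def sum.distrib)
  also have "\<dots> / K \<le> (B + (\<Sum>j<K. \<bar>g (z j)\<bar>)) / K"
    using q(3)[of "z 0" "z K"] K by (intro divide_right_mono) (auto simp: z_def)
  finally show ?thesis by (simp add: z_def)
qed


section \<open>Transfer operators and the Lasota--Yorke inequality\<close>

text \<open>The sum runs over the preimages of \<open>y\<close> in \<open>D\<close>.  With \<open>\<Phi> = 1 / \<bar>T'\<bar>\<close> this is the Perron--Frobenius operator of \<open>T\<close>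
  restricted to \<open>D\<close>; this form makes composition of such operators immediate.\<close>

definition transfer :: "(real \<Rightarrow> real) \<Rightarrow> real set \<Rightarrow> (real \<Rightarrow> real) \<Rightarrow> (real \<Rightarrow> real) \<Rightarrow> real \<Rightarrow> real" where
  "transfer T D \<Phi> g y = (\<Sum>x | x \<in> D \<and> T x = y. g x * \<Phi> x)"

lemma transfer_diff: "transfer T D \<Phi> (\<lambda>x. g x - h x) = (\<lambda>y. transfer T D \<Phi> g y - transfer T D \<Phi> h y)"
  by (simp add: transfer_def fun_eq_iff left_diff_distrib sum_subtractf)

lemma transfer_weight_diff: "transfer T D (\<lambda>x. \<Phi> x - \<Psi> x) g = (\<lambda>y. transfer T D \<Phi> g y - transfer T D \<Psi> g y)"
  by (simp add: transfer_def fun_eq_iff right_diff_distrib sum_subtractf)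

lemma transfer_nonneg: "(\<And>x. x \<in> D \<Longrightarrow> 0 \<le> g x * \<Phi> x) \<Longrightarrow> 0 \<le> transfer T D \<Phi> g y"
  by (auto simp: transfer_def intro: sum_nonneg)

lemma transfer_union:
  assumes "D \<inter> E = {}" "\<And>y. finite {x. x \<in> D \<and> T x = y}" "\<And>y. finite {x. x \<in> E \<and> T x = y}"
  shows "transfer T (D \<union> E) \<Phi> g = (\<lambda>y. transfer T D \<Phi> g y + transfer T E \<Phi> g y)"
proof
  fix y
  have "{x. x \<in> D \<union> E \<and> T x = y} = {x. x \<in> D \<and> T x = y} \<union> {x. x \<in> E \<and> T x = y}" by auto
  then show "transfer T (D \<union> E) \<Phi> g y = transfer T D \<Phi> g y + transfer T E \<Phi> g y"
    unfolding transfer_def using assms by (simp) (subst sum.union_disjoint, auto)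
qed

lemma transfer_Union:
  assumes "finite \<P>" "disjoint \<P>" "\<And>U. U \<in> \<P> \<Longrightarrow> inj_on T U"
  shows "transfer T (\<Union>\<P>) \<Phi> g y = (\<Sum>U\<in>\<P>. transfer T U \<Phi> g y)"
    and "finite {x. x \<in> \<Union>\<P> \<and> T x = y}"
proof -
  have eq: "{x. x \<in> \<Union>\<P> \<and> T x = y} = (\<Union>U\<in>\<P>. {x. x \<in> U \<and> T x = y})" by auto
  have fin: "finite {x. x \<in> U \<and> T x = y}" if "U \<in> \<P>" for U
  proof -
    have "inj_on T {x. x \<in> U \<and> T x = y}" using assms(3)[OF that] by (rule inj_on_subset) auto
    moreover have "T ` {x. x \<in> U \<and> T x = y} \<subseteq> {y}" by auto
    ultimately show ?thesis by (meson finite.emptyI finite.insertI inj_on_finite)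
  qed
  show "finite {x. x \<in> \<Union>\<P> \<and> T x = y}" unfolding eq using assms(1) fin by auto
  show "transfer T (\<Union>\<P>) \<Phi> g y = (\<Sum>U\<in>\<P>. transfer T U \<Phi> g y)"
    unfolding transfer_def eq
    by (rule sum.UNION_disjoint) (use assms(1,2) fin in \<open>auto simp: disjoint_def\<close>)
qed

lemma transfer_comp:
  assumes fT: "\<And>y. finite {x. x \<in> D \<and> T x = y}" and fS: "\<And>y. finite {x. x \<in> E \<and> S x = y}"
  shows "transfer T D \<Phi> (transfer S E \<Psi> g) = transfer (\<lambda>x. T (S x)) {x \<in> E. S x \<in> D} (\<lambda>x. \<Psi> x * \<Phi> (S x)) g"
    and "finite {x. x \<in> {x \<in> E. S x \<in> D} \<and> T (S x) = y}"
proof -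
  have eq: "{x. x \<in> {x \<in> E. S x \<in> D} \<and> T (S x) = y} = (\<Union>z\<in>{z. z \<in> D \<and> T z = y}. {x. x \<in> E \<and> S x = z})" for y
    by auto
  show "finite {x. x \<in> {x \<in> E. S x \<in> D} \<and> T (S x) = y}"
    unfolding eq using fT fS by auto
  show "transfer T D \<Phi> (transfer S E \<Psi> g) = transfer (\<lambda>x. T (S x)) {x \<in> E. S x \<in> D} (\<lambda>x. \<Psi> x * \<Phi> (S x)) g"
  proof
    fix y
    have "transfer T D \<Phi> (transfer S E \<Psi> g) y =
        (\<Sum>z | z \<in> D \<and> T z = y. \<Sum>x | x \<in> E \<and> S x = z. g x * (\<Psi> x * \<Phi> (S x)))"
      unfolding transfer_def sum_distrib_right by (intro sum.cong refl) (auto simp: mult.assoc)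
    also have "\<dots> = transfer (\<lambda>x. T (S x)) {x \<in> E. S x \<in> D} (\<lambda>x. \<Psi> x * \<Phi> (S x)) g y"
      unfolding transfer_def eq using fT fS by (subst sum.UNION_disjoint) auto
    finally show "transfer T D \<Phi> (transfer S E \<Psi> g) y = transfer (\<lambda>x. T (S x)) {x \<in> E. S x \<in> D} (\<lambda>x. \<Psi> x * \<Phi> (S x)) g y" .
  qed
qed

text \<open>The image of a function under one monotone branch is the function, cut off outside \<open>U\<close>, composed with a monotone
  extension of the inverse branch to the line that sends the complement of \<open>T ` U\<close> outside \<open>U\<close>.\<close>

lemma transfer_branch_bv0:
  assumes U: "is_interval U" "U \<subseteq> {0..1}" and T: "continuous_on U T" "inj_on T U" "T ` U \<subseteq> {0..1}"
    and B: "varbound (\<lambda>x. if x \<in> U then g x * \<Phi> x else 0) UNIV B"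
  shows "bv0 (transfer T U \<Phi> g) B"
proof -
  let ?J = "T ` U" and ?u = "\<lambda>x. if x \<in> U then g x * \<Phi> x else 0"
  have J: "is_interval ?J" using U(1) T(1) by (simp add: connected_continuous_image is_interval_connected_1)
  have fib: "{x. x \<in> U \<and> T x = y} = (if y \<in> ?J then {inv_into U T y} else {})" for y
  proof (cases "y \<in> ?J")
    case True
    then obtain x where x: "x \<in> U" "y = T x" by blast
    then have "x' = x" if "x' \<in> U" "T x' = y" for x' using that inj_onD[OF T(2), of x' x] by simp
    then have "{x. x \<in> U \<and> T x = y} = {x}" using x by blast
    then show ?thesis using x T(2) by simp
  qed auto
  \<comment> \<open>The sign \<open>e\<close> is the direction of the branch: points below the image go to \<open>-1\<close> and points above it to \<open>2\<close>, or conversely.\<close>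
  define \<Psi> where "\<Psi> e y = (if y \<in> ?J then inv_into U T y else if \<forall>z\<in>?J. y < z then (1 - 3 * e) / 2 else (1 + 3 * e) / (2::real))" for e y
  have above: "z < y" if ab: "y \<notin> ?J" "\<not> (\<forall>z\<in>?J. y < z)" "z \<in> ?J" for y z
  proof (rule ccontr)
    assume "\<not> z < y"
    moreover obtain w where "w \<in> ?J" "w \<le> y" using ab(2) by (auto simp: not_less)
    ultimately have "y \<in> ?J" using J ab(3) unfolding is_interval_1 by (metis linorder_not_less)
    with ab(1) show False ..
  qed
  have cmp: "x \<in> ?J \<Longrightarrow> \<not> (\<forall>z\<in>?J. y < z)" "x \<notin> ?J \<Longrightarrow> y \<in> ?J \<Longrightarrow> \<forall>z\<in>?J. x < z"
    "\<forall>z\<in>?J. y < z \<Longrightarrow> \<forall>z\<in>?J. x < z" if "x \<le> y" for x y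
    using that above[of x y] by (force, force, force)
  have inU: "inv_into U T y \<in> {0..1}" if "y \<in> ?J" for y using U(2) inv_into_into[OF that] by auto
  have eq: "transfer T U \<Phi> g y = ?u (\<Psi> e y)" if "e = 1 \<or> e = -1" for y e
  proof -
    have "(1 - 3 * e) / 2 \<notin> U" "(1 + 3 * e) / 2 \<notin> U" using that U(2) by force+
    then show ?thesis unfolding transfer_def fib by (auto simp: \<Psi>_def inv_into_into)
  qed
  have "strict_mono_on U T \<or> strict_antimono_on U T"
    using injective_eq_monotone_map[OF U(1) T(1)] T(2) by simp
  then have "\<exists>e. (e = 1 \<or> e = -1) \<and> (mono_on UNIV (\<Psi> e) \<or> antimono_on UNIV (\<Psi> e))"
  proof
    assume T': "strict_mono_on U T"
    have inv: "inv_into U T x \<le> inv_into U T y" if "x \<in> ?J" "y \<in> ?J" "x \<le> y" for x y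
    proof (rule ccontr)
      assume "\<not> ?thesis"
      then have "T (inv_into U T y) < T (inv_into U T x)"
        using T' that(1,2) by (auto simp: monotone_on_def inv_into_into)
      then show False using that by (simp add: f_inv_into_f)
    qed
    have "mono_on UNIV (\<Psi> 1)"
    proof (rule monotone_onI)
      fix x y :: real assume "x \<le> y"
      then show "\<Psi> 1 x \<le> \<Psi> 1 y"
        using cmp[of x y] inv[of x y] inU[of x] inU[of y]
        by (cases "x \<in> ?J"; cases "y \<in> ?J"; cases "\<forall>z\<in>?J. x < z"; cases "\<forall>z\<in>?J. y < z") (simp_all only: \<Psi>_def if_True if_False, simp_all)
    qed
    then show ?thesis by blast
  next
    assume T': "strict_antimono_on U T"
    have inv: "inv_into U T y \<le> inv_into U T x" if "x \<in> ?J" "y \<in> ?J" "x \<le> y" for x y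
    proof (rule ccontr)
      assume "\<not> ?thesis"
      then have "T (inv_into U T y) < T (inv_into U T x)"
        using T' that(1,2) by (auto simp: monotone_on_def inv_into_into)
      then show False using that by (simp add: f_inv_into_f)
    qed
    have "antimono_on UNIV (\<Psi> (-1))"
    proof (rule monotone_onI)
      fix x y :: real assume "x \<le> y"
      then show "\<Psi> (-1) x \<ge> \<Psi> (-1) y"
        using cmp[of x y] inv[of x y] inU[of x] inU[of y]
        by (cases "x \<in> ?J"; cases "y \<in> ?J"; cases "\<forall>z\<in>?J. x < z"; cases "\<forall>z\<in>?J. y < z") (simp_all only: \<Psi>_def if_True if_False, simp_all)
    qed
    then show ?thesis by blast
  qed
  then obtain e where e: "e = 1 \<or> e = -1" "mono_on UNIV (\<Psi> e) \<or> antimono_on UNIV (\<Psi> e)" by blast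
  have "varbound (\<lambda>y. ?u (\<Psi> e y)) UNIV B" by (rule varbound_comp_mono[OF B _ e(2)]) simp
  then have "varbound (transfer T U \<Phi> g) UNIV B" unfolding eq[OF e(1), symmetric] .
  moreover have "transfer T U \<Phi> g y = 0" if "y \<notin> {0..1}" for y
    unfolding transfer_def fib using that T(3) by auto
  ultimately show ?thesis by (simp add: bv0_def)
qed

lemma transfer_pieces_bv0:
  assumes \<P>: "finite \<P>" "disjoint \<P>"
    and "\<And>U. U \<in> \<P> \<Longrightarrow> is_interval U \<and> U \<subseteq> {0..1} \<and> continuous_on U T \<and> inj_on T U \<and> T ` U \<subseteq> {0..1}"
    and "\<And>U. U \<in> \<P> \<Longrightarrow> varbound (\<lambda>x. if x \<in> U then g x * \<Phi> x else 0) UNIV (B U)"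
  shows "bv0 (transfer T (\<Union>\<P>) \<Phi> g) (\<Sum>U\<in>\<P>. B U)"
proof -
  have "transfer T (\<Union>\<P>) \<Phi> g = (\<lambda>y. \<Sum>U\<in>\<P>. transfer T U \<Phi> g y)"
    using transfer_Union(1)[OF \<P>] assms(3) by blast
  then show ?thesis using assms(3,4) by (auto intro!: bv0_sum transfer_branch_bv0)
qed

lemma transfer_bv0_crude:
  assumes \<P>: "finite \<P>" "disjoint \<P>"
    and U: "\<And>U. U \<in> \<P> \<Longrightarrow> is_interval U \<and> U \<subseteq> {0..1} \<and> continuous_on U T \<and> inj_on T U \<and> T ` U \<subseteq> {0..1}"
    and c: "\<And>U. U \<in> \<P> \<Longrightarrow> varbound \<Phi> U (c U)" "\<And>U x. U \<in> \<P> \<Longrightarrow> x \<in> U \<Longrightarrow> \<bar>\<Phi> x\<bar> \<le> c U"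
    and g: "bv0 g B"
  shows "bv0 (transfer T (\<Union>\<P>) \<Phi> g) (4 * (\<Sum>U\<in>\<P>. c U) * B)"
proof -
  have "bv0 (transfer T (\<Union>\<P>) \<Phi> g) (\<Sum>U\<in>\<P>. 4 * c U * B)"
  proof (rule transfer_pieces_bv0[OF \<P> U])
    fix V assume V: "V \<in> \<P>"
    have c0: "0 \<le> c V" using c(1)[OF V] by (rule varbound_nonneg)
    have B0: "0 \<le> B" using g by (rule bv0_nonneg)
    have "varbound (\<lambda>x. g x * \<Phi> x) V (c V * B + B * c V)"
      using bv0_varbound[OF g] bv0_bound[OF g] c V c0 B0 by (intro varbound_mult) auto
    then have "varbound (\<lambda>x. if x \<in> V then g x * \<Phi> x else 0) UNIV (c V * B + B * c V + 2 * (B * c V))"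
      using U[OF V] c0 B0 bv0_bound[OF g] c(2)[OF V]
      by (intro varbound_indicator) (auto simp: abs_mult intro!: mult_mono)
    then show "varbound (\<lambda>x. if x \<in> V then g x * \<Phi> x else 0) UNIV (4 * c V * B)"
      by (rule varbound_mono) simp
  qed
  then show ?thesis by (simp add: sum_distrib_left sum_distrib_right)
qed

lemma interval_measure_pos:
  assumes "interior U \<noteq> {}" "is_interval U" "U \<subseteq> {0..1::real}"
  shows "0 < measure leb U" "U \<in> sets leb"
proof -
  have U: "U \<in> sets lebesgue" using measurable_convex[of U] assms(2,3) by (meson bounded_cbox bounded_closed_interval bounded_subset fmeasurableD is_interval_convex)
  then show "U \<in> sets leb" using assms(3) by (simp add: sets_restrict_space_iff)
  obtain z where "z \<in> interior U" using assms(1) by blast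
  then obtain e where e: "0 < e" "cball z e \<subseteq> U" by (meson interior_subset mem_interior_cball)
  have "2 * e = measure lebesgue {z - e..z + e}" using e by simp
  also have "\<dots> \<le> measure lebesgue U"
    using e U assms(3) by (intro measure_mono_fmeasurable fmeasurableI2[OF _ assms(3)]) (auto simp: cball_eq_atLeastAtMost)
  also have "\<dots> = measure leb U" using assms(3) by (simp add: measure_restrict_space)
  finally show "0 < measure leb U" using e by simp
qed

lemma bv0_bound_on_piece:
  assumes g: "bv0 g B" and U: "interior U \<noteq> {}" "is_interval U" "U \<subseteq> {0..1}" and \<beta>: "varbound g U \<beta>"
    and x: "x \<in> U"
  shows "\<bar>g x\<bar> \<le> \<beta> + (\<integral>y. \<bar>g y\<bar> \<partial>leb) / measure leb U"
proof -
  interpret finite_measure leb by (rule finite_measure_lebesgue_on) auto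
  have "(\<bar>g x\<bar> - \<beta>) * measure leb U = (\<integral>y. (\<bar>g x\<bar> - \<beta>) * indicator U y \<partial>leb)"
    using U(3) by (simp add: Int_absorb2)
  also have "\<dots> \<le> (\<integral>y. \<bar>g y\<bar> \<partial>leb)"
  proof (rule integral_mono)
    show "integrable leb (\<lambda>y. (\<bar>g x\<bar> - \<beta>) * indicator U y)"
      using interval_measure_pos[OF U] by (intro integrable_mult_right integrable_real_indicator) (auto simp: emeasure_eq_measure)
    show "integrable leb (\<lambda>y. \<bar>g y\<bar>)" using bv0_integrable[OF g] by simp
    show "(\<bar>g x\<bar> - \<beta>) * indicator U y \<le> \<bar>g y\<bar>" for y
      using varbound_dist[OF \<beta> x, of y] by (auto simp: indicator_def)
  qed
  finally show ?thesis using interval_measure_pos[OF U] by (simp add: field_simps)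
qed

text \<open>Subdivide each branch into pieces on which \<open>H\<close> varies by at most \<open>s\<close>.  On a piece, \<open>\<bar>g\<bar>\<close> is at most its variation there plus
  its mean over the piece; the variations of \<open>g\<close> over the pieces add up to at most \<open>B\<close>, and the means are absorbed into the
  integral term.  The factor \<open>4\<close> collects the variation of \<open>g\<close>, that of \<open>H\<close>, and the two jumps at the ends of a piece.\<close>

lemma lasota_yorke_branches:
  assumes \<U>: "finite \<U>" "disjoint \<U>"
    and U: "\<And>U. U \<in> \<U> \<Longrightarrow> is_interval U \<and> open U \<and> U \<noteq> {} \<and> U \<subseteq> {0..1} \<and> continuous_on U T \<and> inj_on T U \<and> T ` U \<subseteq> {0..1}"
    and H: "\<And>U. U \<in> \<U> \<Longrightarrow> continuous_on U H \<and> (\<exists>B. varbound H U B)" "\<And>U x. U \<in> \<U> \<Longrightarrow> x \<in> U \<Longrightarrow> \<bar>H x\<bar> \<le> s"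
    and s: "0 < s"
  shows "\<exists>C\<ge>0. \<forall>g B. bv0 g B \<longrightarrow> bv0 (transfer T (\<Union>\<U>) H g) (4 * s * B + C * (\<integral>x. \<bar>g x\<bar> \<partial>leb))"
proof -
  have "\<exists>\<P>. finite \<P> \<and> disjoint \<P> \<and> \<Union>\<P> = V \<and> (\<forall>W\<in>\<P>. is_interval W \<and> interior W \<noteq> {} \<and> varbound H W s)"
    if V: "V \<in> \<U>" for V
  proof -
    have "V = {Inf V<..<Sup V}" "Inf V < Sup V"
    proof -
      have c: "connected V" "open V" "V \<noteq> {}" "bdd_below V" "bdd_above V"
        using U[OF V] by (auto simp: is_interval_connected_1 intro: bdd_below_mono bdd_above_mono)
      have "Inf V < x \<and> x < Sup V" if x: "x \<in> V" for x
      proof -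
        obtain e where e: "0 < e" "ball x e \<subseteq> V" using c(2) x by (meson openE)
        then have "x - e/2 \<in> V" "x + e/2 \<in> V" by (auto simp: subset_iff dist_real_def)
        then show ?thesis using e(1) cInf_lower[OF _ c(4), of "x - e/2"] cSup_upper[OF _ c(5), of "x + e/2"] by linarith
      qed
      moreover have "x \<in> V" if xx: "Inf V < x" "x < Sup V" for x
      proof -
        obtain a b where "a \<in> V" "a < x" "b \<in> V" "x < b"
          using xx cInf_less_iff[OF c(3,4)] less_cSup_iff[OF c(3,5)] by blast
        then show ?thesis using U[OF V] unfolding is_interval_1 by (meson less_imp_le)
      qed
      ultimately show "V = {Inf V<..<Sup V}" "Inf V < Sup V" using c(3) by force+
    qed
    then show ?thesis using small_variation_partition[of "Inf V" "Sup V" H _ s] H(1)[OF V] s by metis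
  qed
  then obtain P where P: "\<And>V. V \<in> \<U> \<Longrightarrow> finite (P V) \<and> disjoint (P V) \<and> \<Union>(P V) = V \<and> (\<forall>W\<in>P V. is_interval W \<and> interior W \<noteq> {} \<and> varbound H W s)"
    by metis
  define \<P> where "\<P> = (\<Union>V\<in>\<U>. P V)"
  have un: "\<Union>\<P> = \<Union>\<U>" proof -
    have "\<Union>\<P> = (\<Union>V\<in>\<U>. \<Union>(P V))" by (auto simp: \<P>_def)
    also have "\<dots> = \<Union>\<U>" using P by simp
    finally show ?thesis .
  qed
  have fin: "finite \<P>" using P \<U> by (auto simp: \<P>_def)
  have piece: "\<exists>V\<in>\<U>. W \<subseteq> V \<and> W \<in> P V" if "W \<in> \<P>" for W using that P by (fastforce simp: \<P>_def)
  have disj: "disjoint \<P>"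
    unfolding disjoint_def
  proof (intro ballI impI)
    fix W W' assume W: "W \<in> \<P>" "W' \<in> \<P>" "W \<noteq> W'"
    obtain V V' where "V \<in> \<U>" "W \<subseteq> V" "W \<in> P V" "V' \<in> \<U>" "W' \<subseteq> V'" "W' \<in> P V'" using piece W by meson
    note V = this
    show "W \<inter> W' = {}"
    proof (cases "V = V'")
      case True
      have "disjoint (P V)" using P V(1) by blast
      then show ?thesis using V True W(3) unfolding disjoint_def by simp
    next
      case False
      then have "V \<inter> V' = {}" using \<U>(2) V unfolding disjoint_def by simp
      then show ?thesis using V(2,5) by auto
    qed
  qed
  have good: "is_interval W \<and> W \<subseteq> {0..1} \<and> continuous_on W T \<and> inj_on T W \<and> T ` W \<subseteq> {0..1}" 
     "interior W \<noteq> {}" "varbound H W s" "x \<in> W \<Longrightarrow> \<bar>H x\<bar> \<le> s" if W: "W \<in> \<P>" for W x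
  proof -
    obtain V where V: "V \<in> \<U>" "W \<subseteq> V" "W \<in> P V" using piece W by meson
    show "is_interval W \<and> W \<subseteq> {0..1} \<and> continuous_on W T \<and> inj_on T W \<and> T ` W \<subseteq> {0..1}"
    proof (intro conjI)
      have "T ` W \<subseteq> T ` V" using V(2) by (rule image_mono)
      then show "T ` W \<subseteq> {0..1}" using U[OF V(1)] by blast
    qed (use P[OF V(1)] U[OF V(1)] V(2,3) in \<open>auto intro: continuous_on_subset inj_on_subset\<close>)
    show "interior W \<noteq> {}" "varbound H W s" using P[OF V(1)] V(3) by auto
    show "x \<in> W \<Longrightarrow> \<bar>H x\<bar> \<le> s" using H(2)[OF V(1)] V(2) by auto
  qed
  define C where "C = (\<Sum>W\<in>\<P>. 3 * s / measure leb W)"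
  have "bv0 (transfer T (\<Union>\<U>) H g) (4 * s * B + C * (\<integral>x. \<bar>g x\<bar> \<partial>leb))" if g: "bv0 g B" for g B
  proof -
    define I where "I = (\<integral>x. \<bar>g x\<bar> \<partial>leb)"
    have I0: "0 \<le> I" by (simp add: I_def)
    obtain \<beta> where \<beta>: "\<forall>W\<in>\<P>. varbound g W (\<beta> W)" "(\<Sum>W\<in>\<P>. \<beta> W) \<le> B"
      using varbound_disjoint_sum[OF bv0_varbound[OF g] fin disj] good by (metis interior_empty)
    have "bv0 (transfer T (\<Union>\<P>) H g) (\<Sum>W\<in>\<P>. 4 * s * \<beta> W + 3 * s / measure leb W * I)"
    proof (rule transfer_pieces_bv0[OF fin disj good(1)])
      fix W assume W: "W \<in> \<P>"
      define M where "M = \<beta> W + I / measure leb W"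
      have b: "varbound g W (\<beta> W)" using \<beta> W by auto
      have b0: "0 \<le> \<beta> W" using b by (rule varbound_nonneg)
      have M0: "0 \<le> M" using b0 I0 by (simp add: M_def)
      have gM: "\<bar>g x\<bar> \<le> M" if "x \<in> W" for x
        unfolding M_def I_def using bv0_bound_on_piece[OF g good(2)[OF W] _ _ b that] good(1)[OF W] by blast
      have "varbound (\<lambda>x. g x * H x) W (s * \<beta> W + M * s)"
        using b gM good(3,4)[OF W] M0 s by (intro varbound_mult) auto
      then have "varbound (\<lambda>x. if x \<in> W then g x * H x else 0) UNIV (s * \<beta> W + M * s + 2 * (M * s))"
        using good(1)[OF W] M0 s gM good(4)[OF W]
        by (intro varbound_indicator) (auto simp: abs_mult intro!: mult_mono)
      then show "varbound (\<lambda>x. if x \<in> W then g x * H x else 0) UNIV (4 * s * \<beta> W + 3 * s / measure leb W * I)"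
        by (rule varbound_mono) (simp add: M_def algebra_simps)
    qed auto
    then have "bv0 (transfer T (\<Union>\<U>) H g) (\<Sum>W\<in>\<P>. 4 * s * \<beta> W + 3 * s / measure leb W * I)" by (simp add: un)
    moreover have "(\<Sum>W\<in>\<P>. 4 * s * \<beta> W + 3 * s / measure leb W * I) \<le> 4 * s * B + C * I"
      unfolding C_def sum.distrib sum_distrib_right[symmetric] sum_distrib_left[symmetric]
      using mult_left_mono[OF \<beta>(2), of "4 * s"] s by simp
    ultimately show ?thesis unfolding I_def by (rule bv0_mono)
  qed
  moreover have "0 \<le> C" using s by (auto simp: C_def intro!: sum_nonneg)
  ultimately show ?thesis by blast
qed


text \<open>Telescoping \<open>L\<^sup>k - P\<^sup>k = \<Sum> P\<^sup>i (L - P) L\<^sup>k\<^sup>-\<^sup>1\<^sup>-\<^sup>i\<close>.\<close>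

lemma operator_power_perturbation:
  fixes L P :: "(real \<Rightarrow> real) \<Rightarrow> real \<Rightarrow> real"
  assumes L: "\<And>g B. bv0 g B \<Longrightarrow> bv0 (L g) (K * B)" and P: "\<And>g B. bv0 g B \<Longrightarrow> bv0 (P g) (K * B)"
    and diff: "\<And>g B. bv0 g B \<Longrightarrow> bv0 (\<lambda>y. L g y - P g y) (e * B)"
    and lin: "\<And>g h. P (\<lambda>x. g x - h x) = (\<lambda>y. P g y - P h y)"
    and K: "1 \<le> K" "0 \<le> e" and g: "bv0 g B"
  shows "bv0 (\<lambda>y. (L ^^ k) g y - (P ^^ k) g y) (real k * K ^ k * e * B)"
proof -
  have B0: "0 \<le> B" using g by (rule bv0_nonneg)
  have Lk: "bv0 ((L ^^ k) g) (K ^ k * B)" for k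
  proof (induction k)
    case (Suc k) then show ?case using L[OF Suc] by (simp add: mult.assoc)
  qed (use g in simp)
  show ?thesis
  proof (induction k)
    case 0 show ?case using varbound_const[of 0 UNIV] by (simp add: bv0_def)
  next
    case (Suc k)
    have eq: "(\<lambda>y. (L ^^ Suc k) g y - (P ^^ Suc k) g y) =
       (\<lambda>y. (L ((L ^^ k) g) y - P ((L ^^ k) g) y) + P (\<lambda>y. (L ^^ k) g y - (P ^^ k) g y) y)"
      by (simp add: lin fun_eq_iff)
    have "bv0 (\<lambda>y. (L ((L ^^ k) g) y - P ((L ^^ k) g) y) + P (\<lambda>y. (L ^^ k) g y - (P ^^ k) g y) y) (e * (K ^ k * B) + K * (real k * K ^ k * e * B))"
      by (rule bv0_add[OF diff[OF Lk] P[OF Suc]])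
    moreover have "e * (K ^ k * B) + K * (real k * K ^ k * e * B) \<le> real (Suc k) * K ^ Suc k * e * B"
    proof -
      have "e * (K ^ k * B) \<le> K * (e * (K ^ k * B))"
        using K B0 mult_right_mono[of 1 K "e * (K ^ k * B)"] by simp
      then show ?thesis by (simp add: algebra_simps)
    qed
    ultimately show ?case unfolding eq by (rule bv0_mono)
  qed
qed

lemma interval_Icc: "is_interval a \<Longrightarrow> x \<in> a \<Longrightarrow> y \<in> a \<Longrightarrow> {x..y::real} \<subseteq> a"
  unfolding is_interval_1 by (meson atLeastAtMost_iff subsetI)

text \<open>The number \<open>\<kappa> a\<close> bounds supremum and variation of \<open>1 / \<bar>F'\<bar>\<close> on the branch \<open>a\<close>; its summability is Rychlik's condition.\<close>

locale expanding_branches =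
  fixes F F' :: "real \<Rightarrow> real" and \<A> :: "real set set" and \<kappa> :: "real set \<Rightarrow> real" and \<sigma> :: real
  assumes branch: "a \<in> \<A> \<Longrightarrow> is_interval a \<and> open a \<and> a \<noteq> {} \<and> a \<subseteq> {0..1}"
    and disj: "disjoint \<A>"
    and F_into: "x \<in> {0..1} \<Longrightarrow> F x \<in> {0..1}"
    and F_deriv: "a \<in> \<A> \<Longrightarrow> x \<in> a \<Longrightarrow> (F has_real_derivative F' x) (at x)"
    and F'_cont: "a \<in> \<A> \<Longrightarrow> continuous_on a F'"
    and expanding: "1 < \<sigma>" "a \<in> \<A> \<Longrightarrow> x \<in> a \<Longrightarrow> \<sigma> \<le> \<bar>F' x\<bar>"
    and \<kappa>_bound: "a \<in> \<A> \<Longrightarrow> x \<in> a \<Longrightarrow> \<bar>1 / F' x\<bar> \<le> \<kappa> a"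
    and \<kappa>_var: "a \<in> \<A> \<Longrightarrow> varbound (\<lambda>x. \<bar>1 / F' x\<bar>) a (\<kappa> a)"
    and \<kappa>_summable: "\<kappa> summable_on \<A>"
begin

definition G :: "real \<Rightarrow> real" where "G x = \<bar>1 / F' x\<bar>"

lemma \<kappa>_nonneg: "a \<in> \<A> \<Longrightarrow> 0 \<le> \<kappa> a"
  using \<kappa>_var varbound_nonneg by blast

lemma F'_nz: "a \<in> \<A> \<Longrightarrow> x \<in> a \<Longrightarrow> F' x \<noteq> 0"
  using expanding by force

lemma F_cont: "a \<in> \<A> \<Longrightarrow> continuous_on a F"
  using F_deriv by (meson DERIV_isCont continuous_at_imp_continuous_on)

lemma F_inj: assumes a: "a \<in> \<A>" shows "inj_on F a"
proof (rule inj_onI)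
  have *: False if xy: "x \<in> a" "y \<in> a" "F x = F y" "x < y" for x y
  proof -
    have sub: "{x..y} \<subseteq> a" using branch[OF a] xy interval_Icc by blast
    have "(F has_real_derivative F' t) (at t)" if "x \<le> t" "t \<le> y" for t
      using F_deriv[OF a, of t] sub that by auto
    from MVT2[OF xy(4) this] obtain t where t: "x < t" "t < y" "F y - F x = (y - x) * F' t" by blast
    then have "F' t = 0" using xy by simp
    moreover have "t \<in> a" using sub t by auto
    ultimately show False using F'_nz[OF a, of t] by simp
  qed
  fix x y assume xy: "x \<in> a" "y \<in> a" "F x = F y"
  show "x = y"
  proof (rule linorder_cases[of x y])
    show "x < y \<Longrightarrow> x = y" using *[OF xy] by blast
    show "y < x \<Longrightarrow> x = y" using *[OF xy(2,1) xy(3)[symmetric]] by blast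
  qed
qed

lemma branchT: "a \<in> \<A> \<Longrightarrow> is_interval a \<and> a \<subseteq> {0..1} \<and> continuous_on a F \<and> inj_on F a \<and> F ` a \<subseteq> {0..1}"
  using branch[of a] F_cont[of a] F_inj[of a] F_into by blast

lemma fibres: "finite A \<Longrightarrow> A \<subseteq> \<A> \<Longrightarrow> finite {x. x \<in> \<Union>A \<and> F x = y}"
  using disj F_inj by (intro transfer_Union(2)) (auto simp: disjoint_def)

lemma G_cont: "a \<in> \<A> \<Longrightarrow> continuous_on a G"
  unfolding G_def using F'_cont F'_nz by (intro continuous_intros) auto

lemma G_le: "a \<in> \<A> \<Longrightarrow> x \<in> a \<Longrightarrow> \<bar>G x\<bar> \<le> 1 / \<sigma>"
  using expanding(1) expanding(2)[of a x] by (simp add: G_def frac_le)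

definition iter_dom :: "real set set \<Rightarrow> nat \<Rightarrow> real set" where
  "iter_dom A N = {x. \<forall>i<N. (F ^^ i) x \<in> \<Union>A}"

definition iter_weight :: "(real \<Rightarrow> real) \<Rightarrow> nat \<Rightarrow> real \<Rightarrow> real" where
  "iter_weight \<Phi> N x = (\<Prod>i<N. \<Phi> ((F ^^ i) x))"

lemma iter_dom_Suc: "iter_dom A (Suc N) = {x \<in> iter_dom A N. (F ^^ N) x \<in> \<Union>A}"
  by (auto simp: iter_dom_def less_Suc_eq)

lemma transfer_power:
  assumes A: "finite A" "A \<subseteq> \<A>"
  shows "(transfer F (\<Union>A) \<Phi> ^^ N) g = transfer (F ^^ N) (iter_dom A N) (iter_weight \<Phi> N) g
     \<and> (\<forall>y. finite {x. x \<in> iter_dom A N \<and> (F ^^ N) x = y})"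
proof (induction N)
  case 0
  have "{x. x = y} = {y}" for y :: real by auto
  then show ?case by (auto simp: iter_dom_def iter_weight_def transfer_def)
next
  case (Suc N)
  have "(transfer F (\<Union>A) \<Phi> ^^ Suc N) g = transfer F (\<Union>A) \<Phi> (transfer (F ^^ N) (iter_dom A N) (iter_weight \<Phi> N) g)"
    using Suc by simp
  also have "\<dots> = transfer (\<lambda>x. F ((F ^^ N) x)) {x \<in> iter_dom A N. (F ^^ N) x \<in> \<Union>A}
      (\<lambda>x. iter_weight \<Phi> N x * \<Phi> ((F ^^ N) x)) g"
    using Suc fibres[OF A] by (intro transfer_comp(1)) auto
  also have "\<dots> = transfer (F ^^ Suc N) (iter_dom A (Suc N)) (iter_weight \<Phi> (Suc N)) g"
    by (simp add: iter_dom_Suc iter_weight_def[abs_def] comp_def)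
  finally have 1: "(transfer F (\<Union>A) \<Phi> ^^ Suc N) g = transfer (F ^^ Suc N) (iter_dom A (Suc N)) (iter_weight \<Phi> (Suc N)) g" .
  have "finite {x. x \<in> {x \<in> iter_dom A N. (F ^^ N) x \<in> \<Union>A} \<and> F ((F ^^ N) x) = y}" for y
    by (rule transfer_comp(2)) (use Suc fibres[OF A] in auto)
  then have "finite {x. x \<in> iter_dom A (Suc N) \<and> (F ^^ Suc N) x = y}" for y
    by (simp add: iter_dom_Suc)
  with 1 show ?case by (simp add: comp_def)
qed

definition iter_branch :: "nat \<Rightarrow> real set \<Rightarrow> bool" where
  "iter_branch N U \<longleftrightarrow> is_interval U \<and> open U \<and> U \<noteq> {} \<and> U \<subseteq> {0..1} \<and>
     continuous_on U (F ^^ N) \<and> inj_on (F ^^ N) U \<and> (F ^^ N) ` U \<subseteq> {0..1} \<and>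
     continuous_on U (iter_weight G N) \<and> (\<exists>B. varbound (iter_weight G N) U B) \<and>
     (\<forall>x\<in>U. \<bar>iter_weight G N x\<bar> \<le> (1 / \<sigma>) ^ N)"

lemma iter_branch_step:
  assumes U: "iter_branch N U" and a: "a \<in> \<A>" and ne: "U \<inter> (F ^^ N) -` a \<noteq> {}"
  shows "iter_branch (Suc N) (U \<inter> (F ^^ N) -` a)"
proof -
  let ?W = "U \<inter> (F ^^ N) -` a"
  have Uc: "is_interval U" "open U" "U \<subseteq> {0..1}" "continuous_on U (F ^^ N)" "inj_on (F ^^ N) U"
      "continuous_on U (iter_weight G N)" "\<And>x. x \<in> U \<Longrightarrow> \<bar>iter_weight G N x\<bar> \<le> (1 / \<sigma>) ^ N"
    using U by (auto simp: iter_branch_def)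
  have WU: "?W \<subseteq> U" and im: "(F ^^ N) ` ?W \<subseteq> a" by auto
  have smono: "strict_mono_on U (F ^^ N) \<or> strict_antimono_on U (F ^^ N)"
    using injective_eq_monotone_map[OF Uc(1,4)] Uc(5) by simp
  then have mono: "mono_on U (F ^^ N) \<or> antimono_on U (F ^^ N)"
    by (auto simp: monotone_on_def le_less)
  have int: "is_interval ?W"
    unfolding is_interval_1
  proof (intro allI impI ballI)
    fix x y z assume h: "x \<in> ?W" "y \<in> ?W" "x \<le> z \<and> z \<le> y"
    then have z: "z \<in> U" using Uc(1) unfolding is_interval_1 by blast
    have "(F ^^ N) x \<le> (F ^^ N) z \<and> (F ^^ N) z \<le> (F ^^ N) y \<or> (F ^^ N) y \<le> (F ^^ N) z \<and> (F ^^ N) z \<le> (F ^^ N) x"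
      using mono h z by (auto simp: monotone_on_def)
    then have "(F ^^ N) z \<in> a" using branch[OF a] h unfolding is_interval_1 by blast
    with z show "z \<in> ?W" by simp
  qed
  have op: "open ?W" using continuous_open_preimage[OF Uc(4,2)] branch[OF a] by blast
  have cW: "continuous_on ?W (F ^^ N)" using Uc(4) WU by (rule continuous_on_subset)
  have comp: "F ^^ Suc N = F \<circ> (F ^^ N)" by simp
  have c1: "continuous_on ?W (F ^^ Suc N)"
    unfolding comp using cW continuous_on_subset[OF F_cont[OF a] im] by (rule continuous_on_compose)
  have i1: "inj_on (F ^^ Suc N) ?W"
    unfolding comp using inj_on_subset[OF Uc(5) WU] inj_on_subset[OF F_inj[OF a] im] by (rule comp_inj_on)
  have r1: "(F ^^ Suc N) ` ?W \<subseteq> {0..1}" using branchT[OF a] by auto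
  have we: "iter_weight G (Suc N) = (\<lambda>x. iter_weight G N x * G ((F ^^ N) x))"
    by (simp add: iter_weight_def fun_eq_iff)
  have c2: "continuous_on ?W (iter_weight G (Suc N))"
    unfolding we
  proof (rule continuous_on_mult)
    show "continuous_on ?W (iter_weight G N)" using Uc(6) WU by (rule continuous_on_subset)
    show "continuous_on ?W (\<lambda>x. G ((F ^^ N) x))"
      using continuous_on_compose[OF cW continuous_on_subset[OF G_cont[OF a] im]] by (simp add: comp_def)
  qed
  obtain B where B: "varbound (iter_weight G N) U B" using U by (auto simp: iter_branch_def)
  have v2: "varbound (\<lambda>x. G ((F ^^ N) x)) ?W (\<kappa> a)"
  proof (rule varbound_comp_mono[where S'=a and g=G and \<psi>="F ^^ N"])
    show "varbound G a (\<kappa> a)" using \<kappa>_var[OF a] by (simp add: G_def[abs_def])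
    show "mono_on ?W (F ^^ N) \<or> antimono_on ?W (F ^^ N)"
      using mono WU by (meson monotone_on_subset)
  qed (rule im)
  have "varbound (iter_weight G (Suc N)) ?W (1 / \<sigma> * B + (1 / \<sigma>) ^ N * \<kappa> a)"
    unfolding we using varbound_subset[OF B WU] v2 Uc(7) G_le[OF a] expanding(1)
    by (intro varbound_mult) auto
  moreover have "\<bar>iter_weight G (Suc N) x\<bar> \<le> (1 / \<sigma>) ^ Suc N" if "x \<in> ?W" for x
  proof -
    have "\<bar>iter_weight G N x\<bar> * \<bar>G ((F ^^ N) x)\<bar> \<le> (1 / \<sigma>) ^ N * (1 / \<sigma>)"
      using Uc(7)[of x] G_le[OF a, of "(F ^^ N) x"] that expanding(1) by (intro mult_mono) auto
    then show ?thesis by (simp add: we abs_mult mult.commute)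
  qed
  ultimately show ?thesis
    unfolding iter_branch_def using int op ne Uc(3) WU c1 i1 r1 c2 by blast
qed

text \<open>Pull the branches back along \<open>F\<^sup>N\<close>; since \<open>F\<^sup>N\<close> is monotone on each domain of iterate \<open>N\<close>, the pullbacks are intervals.\<close>

lemma iter_partition:
  assumes A: "finite A" "A \<subseteq> \<A>"
  shows "\<exists>\<U>. finite \<U> \<and> disjoint \<U> \<and> \<Union>\<U> = iter_dom A (Suc N) \<and> (\<forall>U\<in>\<U>. iter_branch (Suc N) U)"
proof (induction N)
  case 0
  have "iter_branch (Suc 0) a" if a: "a \<in> \<A>" for a
  proof -
    have "iter_weight G (Suc 0) = G" by (simp add: iter_weight_def fun_eq_iff)
    moreover have "varbound G a (\<kappa> a)" using \<kappa>_var[OF a] by (simp add: G_def[abs_def])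
    ultimately show ?thesis using branch[OF a] branchT[OF a] G_cont[OF a] G_le[OF a]
      by (auto simp: iter_branch_def)
  qed
  moreover have "disjoint A" using disj A(2) by (auto simp: disjoint_def)
  moreover have "\<Union>A = iter_dom A (Suc 0)" by (auto simp: iter_dom_def)
  ultimately show ?case using A by blast
next
  case (Suc N)
  then obtain \<U> where \<U>: "finite \<U>" "disjoint \<U>" "\<Union>\<U> = iter_dom A (Suc N)" "\<And>U. U \<in> \<U> \<Longrightarrow> iter_branch (Suc N) U"
    by blast
  define \<V> where "\<V> = (\<lambda>(U, a). U \<inter> (F ^^ Suc N) -` a) ` (\<U> \<times> A) - {{}}"
  have "finite \<V>" using \<U>(1) A(1) by (simp add: \<V>_def)
  moreover have "disjoint \<V>"
    unfolding disjoint_def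
  proof (intro ballI impI)
    fix X Y assume "X \<in> \<V>" "Y \<in> \<V>" and ne: "X \<noteq> Y"
    then obtain U a V c where h: "U \<in> \<U>" "a \<in> A" "X = U \<inter> (F ^^ Suc N) -` a" "V \<in> \<U>" "c \<in> A" "Y = V \<inter> (F ^^ Suc N) -` c"
      by (auto simp: \<V>_def)
    then have "U \<noteq> V \<or> a \<noteq> c" using ne by auto
    moreover have "U \<inter> V = {}" if "U \<noteq> V" using \<U>(2) h that by (simp add: disjoint_def)
    moreover have "a \<inter> c = {}" if "a \<noteq> c" using disj A(2) h that by (auto simp: disjoint_def)
    ultimately show "X \<inter> Y = {}" using h by blast
  qed
  moreover have "\<Union>\<V> = iter_dom A (Suc (Suc N))"
    unfolding iter_dom_Suc[of A "Suc N"] \<U>(3)[symmetric] \<V>_def by (auto simp del: funpow.simps)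
  moreover have "iter_branch (Suc (Suc N)) X" if "X \<in> \<V>" for X
  proof -
    from that have "X \<noteq> {}" by (simp add: \<V>_def)
    moreover from that obtain U a where "U \<in> \<U>" "a \<in> A" "X = U \<inter> (F ^^ Suc N) -` a" by (auto simp: \<V>_def)
    ultimately show ?thesis using iter_branch_step[OF \<U>(4), of U a] A(2) by blast
  qed
  ultimately show ?case by blast
qed

text \<open>The expansion need not beat the factor \<open>4\<close> in one step; after enough iterates \<open>4 / \<sigma>\<^sup>N\<close> is small.\<close>

lemma lasota_yorke_power:
  assumes A: "finite A" "A \<subseteq> \<A>"
  shows "\<exists>C\<ge>0. \<forall>g B. bv0 g B \<longrightarrow>
    bv0 ((transfer F (\<Union>A) G ^^ Suc N) g) (4 * (1 / \<sigma>) ^ Suc N * B + C * (\<integral>x. \<bar>g x\<bar> \<partial>leb))"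
proof -
  obtain \<U> where \<U>: "finite \<U>" "disjoint \<U>" "\<Union>\<U> = iter_dom A (Suc N)" "\<And>U. U \<in> \<U> \<Longrightarrow> iter_branch (Suc N) U"
    using iter_partition[OF A, of N] by blast
  have "\<exists>C\<ge>0. \<forall>g B. bv0 g B \<longrightarrow> bv0 (transfer (F ^^ Suc N) (\<Union>\<U>) (iter_weight G (Suc N)) g)
     (4 * (1 / \<sigma>) ^ Suc N * B + C * (\<integral>x. \<bar>g x\<bar> \<partial>leb))"
  proof (rule lasota_yorke_branches[OF \<U>(1,2)])
    fix U assume "U \<in> \<U>"
    note U = \<U>(4)[OF this, unfolded iter_branch_def]
    show "is_interval U \<and> open U \<and> U \<noteq> {} \<and> U \<subseteq> {0..1} \<and> continuous_on U (F ^^ Suc N) \<and> inj_on (F ^^ Suc N) U \<and>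
      (F ^^ Suc N) ` U \<subseteq> {0..1}" using U by blast
    show "continuous_on U (iter_weight G (Suc N)) \<and> (\<exists>B. varbound (iter_weight G (Suc N)) U B)" using U by blast
    show "\<bar>iter_weight G (Suc N) x\<bar> \<le> (1 / \<sigma>) ^ Suc N" if "x \<in> U" for x using U that by blast
  qed (use expanding(1) in simp)
  moreover have "(transfer F (\<Union>A) G ^^ Suc N) g = transfer (F ^^ Suc N) (\<Union>\<U>) (iter_weight G (Suc N)) g" for g
    unfolding \<U>(3) using transfer_power[OF A, where \<Phi>=G and N="Suc N" and g=g] by blast
  ultimately show ?thesis by (simp del: funpow.simps power_Suc)
qed

text \<open>The transfer operator of \<open>F\<close> on the branches in \<open>A\<close>, tilted by the factor \<open>W\<close>.\<close>

definition weighted :: "real set set \<Rightarrow> (real \<Rightarrow> real) \<Rightarrow> (real \<Rightarrow> real) \<Rightarrow> real \<Rightarrow> real" where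
  "weighted A W = transfer F (\<Union>A) (\<lambda>x. W x * G x)"

lemma \<kappa>_sum_le: "finite A \<Longrightarrow> A \<subseteq> \<A> \<Longrightarrow> (\<Sum>a\<in>A. \<kappa> a) \<le> infsum \<kappa> \<A>"
  by (rule finite_sum_le_infsum[OF \<kappa>_summable]) (auto intro: \<kappa>_nonneg)

lemma \<kappa>_tail:
  assumes "0 < e"
  shows "\<exists>A0. finite A0 \<and> A0 \<subseteq> \<A> \<and> (\<forall>A. finite A \<and> A0 \<subseteq> A \<and> A \<subseteq> \<A> \<longrightarrow> (\<Sum>a\<in>A - A0. \<kappa> a) \<le> e)"
proof -
  have "(sum \<kappa> \<longlongrightarrow> infsum \<kappa> \<A>) (finite_subsets_at_top \<A>)"
    using \<kappa>_summable by (simp add: has_sum_def[symmetric])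
  then have "\<forall>\<^sub>F A in finite_subsets_at_top \<A>. infsum \<kappa> \<A> - e < sum \<kappa> A"
    by (rule order_tendstoD) (use assms in simp)
  then obtain A0 where A0: "finite A0" "A0 \<subseteq> \<A>" "infsum \<kappa> \<A> - e < sum \<kappa> A0"
    unfolding eventually_finite_subsets_at_top by blast
  have "(\<Sum>a\<in>A - A0. \<kappa> a) \<le> e" if A: "finite A" "A0 \<subseteq> A" "A \<subseteq> \<A>" for A
    using \<kappa>_sum_le[OF A(1,3)] A0(3) sum_diff[OF A(1,2), of \<kappa>] by linarith
  with A0 show ?thesis by blast
qed

lemma weight_bounds:
  assumes a: "a \<in> \<A>" and W: "varbound (\<lambda>x. W x - 1) a w" "\<And>x. x \<in> a \<Longrightarrow> \<bar>W x - 1\<bar> \<le> w"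
  shows "varbound (\<lambda>x. W x * G x - G x) a (2 * (\<kappa> a * w))" "x \<in> a \<Longrightarrow> \<bar>W x * G x - G x\<bar> \<le> 2 * (\<kappa> a * w)"
    "varbound (\<lambda>x. W x * G x) a (\<kappa> a + 2 * (\<kappa> a * w))" "x \<in> a \<Longrightarrow> \<bar>W x * G x\<bar> \<le> \<kappa> a + 2 * (\<kappa> a * w)"
proof -
  have w0: "0 \<le> w" using W(1) by (rule varbound_nonneg)
  have G: "varbound G a (\<kappa> a)" "\<And>x. x \<in> a \<Longrightarrow> \<bar>G x\<bar> \<le> \<kappa> a"
    using \<kappa>_var[OF a] \<kappa>_bound[OF a] by (simp_all add: G_def[abs_def])
  have "varbound (\<lambda>x. (W x - 1) * G x) a (\<kappa> a * w + w * \<kappa> a)"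
    using W G w0 \<kappa>_nonneg[OF a] by (intro varbound_mult) auto
  then have 1: "varbound (\<lambda>x. W x * G x - G x) a (2 * (\<kappa> a * w))"
    by (simp add: algebra_simps)
  have 2: "\<bar>W x * G x - G x\<bar> \<le> 2 * (\<kappa> a * w)" if "x \<in> a" for x
  proof -
    have "\<bar>(W x - 1) * G x\<bar> \<le> w * \<kappa> a"
      unfolding abs_mult using W(2)[OF that] G(2)[OF that] w0 by (intro mult_mono) auto
    moreover have "0 \<le> w * \<kappa> a" using w0 \<kappa>_nonneg[OF a] by simp
    ultimately show ?thesis by (simp add: algebra_simps)
  qed
  show "varbound (\<lambda>x. W x * G x - G x) a (2 * (\<kappa> a * w))" "x \<in> a \<Longrightarrow> \<bar>W x * G x - G x\<bar> \<le> 2 * (\<kappa> a * w)"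
    using 1 2 by auto
  show "varbound (\<lambda>x. W x * G x) a (\<kappa> a + 2 * (\<kappa> a * w))"
    using varbound_add[OF G(1) 1] by simp
  show "x \<in> a \<Longrightarrow> \<bar>W x * G x\<bar> \<le> \<kappa> a + 2 * (\<kappa> a * w)"
    using 2[of x] G(2)[of x] by linarith
qed

text \<open>Compare with the unweighted operator on a fixed finite set \<open>A0\<close> of branches, for which the previous estimate holds with constants
  independent of \<open>A\<close> and \<open>W\<close>.  The difference has small norm: the branches outside \<open>A0\<close> contribute a tail of \<open>\<Sum> \<kappa>\<close>, the tilting
  contributes \<open>\<Sum> \<kappa> a * w a\<close>.\<close>

lemma uniform_lasota_yorke:
  "\<exists>N C K \<omega> A0. 0 < N \<and> 0 \<le> C \<and> 1 \<le> K \<and> 0 < \<omega> \<and> finite A0 \<and> A0 \<subseteq> \<A> \<and>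
    (\<forall>A W w. finite A \<and> A0 \<subseteq> A \<and> A \<subseteq> \<A> \<and> (\<forall>a\<in>A. varbound (\<lambda>x. W x - 1) a (w a) \<and> (\<forall>x\<in>a. \<bar>W x - 1\<bar> \<le> w a)) \<and>
        (\<Sum>a\<in>A. \<kappa> a * w a) \<le> \<omega> \<longrightarrow>
      (\<forall>g B. bv0 g B \<longrightarrow> bv0 (weighted A W g) (K * B) \<and>
          bv0 ((weighted A W ^^ N) g) (B / 2 + C * (\<integral>x. \<bar>g x\<bar> \<partial>leb))))"
proof -
  define S where "S = infsum \<kappa> \<A>"
  define K where "K = 4 * S + 9"
  have S0: "0 \<le> S" unfolding S_def by (rule infsum_nonneg) (rule \<kappa>_nonneg)
  have K1: "1 \<le> K" using S0 by (simp add: K_def)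
  have "(\<lambda>n. (1 / \<sigma>) ^ n) \<longlonglongrightarrow> 0" using expanding(1) by (intro LIMSEQ_realpow_zero) auto
  then have "\<forall>\<^sub>F n in sequentially. (1 / \<sigma>) ^ n < 1 / 16" by (rule order_tendstoD) simp
  then obtain M where M: "(1 / \<sigma>) ^ Suc M < 1 / 16"
    unfolding eventually_sequentially by (meson le_Suc_eq order_refl)
  define N where "N = Suc M"
  \<comment> \<open>Norm \<open>12 * \<omega>\<close> of the perturbation makes that of the \<open>N\<close>-th power at most \<open>1 / 4\<close>.\<close>
  define \<omega> where "\<omega> = 1 / (48 * real N * K ^ N)"
  have NK: "1 \<le> real N * K ^ N"
    using mult_mono[of 1 "real N" 1 "K ^ N"] one_le_power[OF K1, of N] by (simp add: N_def)
  have \<omega>: "0 < \<omega>" "\<omega> \<le> 1" "real N * K ^ N * (12 * \<omega>) \<le> 1 / 4" using NK by (auto simp: \<omega>_def field_simps)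
  obtain A0 where "finite A0 \<and> A0 \<subseteq> \<A> \<and> (\<forall>A. finite A \<and> A0 \<subseteq> A \<and> A \<subseteq> \<A> \<longrightarrow> (\<Sum>a\<in>A - A0. \<kappa> a) \<le> \<omega>)"
    using \<kappa>_tail[OF \<omega>(1)] ..
  then have A0: "finite A0" "A0 \<subseteq> \<A>" "finite A \<Longrightarrow> A0 \<subseteq> A \<Longrightarrow> A \<subseteq> \<A> \<Longrightarrow> (\<Sum>a\<in>A - A0. \<kappa> a) \<le> \<omega>" for A
    by simp_all
  obtain C where "0 \<le> C \<and> (\<forall>g B. bv0 g B \<longrightarrow>
    bv0 ((transfer F (\<Union>A0) G ^^ N) g) (4 * (1 / \<sigma>) ^ N * B + C * (\<integral>x. \<bar>g x\<bar> \<partial>leb)))"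
    using lasota_yorke_power[OF A0(1,2), of M] unfolding N_def ..
  then have C: "0 \<le> C" "bv0 g B \<Longrightarrow>
    bv0 ((transfer F (\<Union>A0) G ^^ N) g) (4 * (1 / \<sigma>) ^ N * B + C * (\<integral>x. \<bar>g x\<bar> \<partial>leb))" for g B
    by simp_all
  have main: "bv0 (weighted A W g) (K * B) \<and> bv0 ((weighted A W ^^ N) g) (B / 2 + C * (\<integral>x. \<bar>g x\<bar> \<partial>leb))"
    if A: "finite A" "A0 \<subseteq> A" "A \<subseteq> \<A>" and W: "\<And>a. a \<in> A \<Longrightarrow> varbound (\<lambda>x. W x - 1) a (w a)" "\<And>a x. a \<in> A \<Longrightarrow> x \<in> a \<Longrightarrow> \<bar>W x - 1\<bar> \<le> w a"
      and s: "(\<Sum>a\<in>A. \<kappa> a * w a) \<le> \<omega>" and g: "bv0 g B" for A W w g B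
  proof -
    let ?P = "transfer F (\<Union>A0) G" and ?L = "weighted A W"
    have dj: "disjoint A'" if "A' \<subseteq> A" for A' using disj A(3) that by (auto simp: disjoint_def)
    have kw0: "0 \<le> \<kappa> a * w a" if "a \<in> A" for a
      using \<kappa>_nonneg[of a] varbound_nonneg[OF W(1)[OF that]] A(3) that by auto
    have sub: "(\<Sum>a\<in>A'. \<kappa> a * w a) \<le> \<omega>" if "A' \<subseteq> A" for A'
      using sum_mono2[OF A(1) that, of "\<lambda>a. \<kappa> a * w a"] kw0 s by force
    have op: "bv0 (transfer F (\<Union>A') (\<lambda>x. W x * G x) g) (4 * (\<Sum>a\<in>A'. \<kappa> a + 2 * (\<kappa> a * w a)) * B)" 
      if "A' \<subseteq> A" "bv0 g B" for A' g B
      using that A W branchT weight_bounds(3,4) finite_subset[OF that(1) A(1)] dj[OF that(1)]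
      by (intro transfer_bv0_crude) (auto simp: subset_iff)
    have opL: "bv0 (?L g) (K * B)" if g: "bv0 g B" for g B
    proof -
      have "(\<Sum>a\<in>A. \<kappa> a + 2 * (\<kappa> a * w a)) \<le> S + 2 * \<omega>"
        using \<kappa>_sum_le[OF A(1,3)] s by (simp add: sum.distrib sum_distrib_left[symmetric] S_def)
      then have "4 * (\<Sum>a\<in>A. \<kappa> a + 2 * (\<kappa> a * w a)) * B \<le> K * B"
        using \<omega>(2) bv0_nonneg[OF g] by (intro mult_right_mono) (auto simp: K_def)
      then show ?thesis unfolding weighted_def using bv0_mono[OF op[OF order_refl g]] by blast
    qed
    have opP: "bv0 (?P g) (K * B)" if g: "bv0 g B" for g B
    proof -
      have "bv0 (?P g) (4 * (\<Sum>a\<in>A0. \<kappa> a) * B)"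
        using A0 branchT \<kappa>_var \<kappa>_bound disj g
        by (intro transfer_bv0_crude) (auto simp: subset_iff G_def[abs_def] disjoint_def)
      moreover have "4 * (\<Sum>a\<in>A0. \<kappa> a) * B \<le> K * B"
        using \<kappa>_sum_le[OF A0(1,2)] bv0_nonneg[OF g] by (intro mult_right_mono) (auto simp: K_def S_def)
      ultimately show ?thesis by (rule bv0_mono)
    qed
    have opQ: "bv0 (\<lambda>y. ?L g y - ?P g y) (12 * \<omega> * B)" if g: "bv0 g B" for g B
    proof -
      have e1: "?L g = (\<lambda>y. transfer F (\<Union>(A - A0)) (\<lambda>x. W x * G x) g y + transfer F (\<Union>A0) (\<lambda>x. W x * G x) g y)"
      proof -
        have "\<Union>(A - A0) \<inter> \<Union>A0 = {}" using disj A(3) A0(2) by (fastforce simp: disjoint_def)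
        moreover have "finite {x. x \<in> \<Union>(A - A0) \<and> F x = y}" "finite {x. x \<in> \<Union>A0 \<and> F x = y}" for y
          using fibres[of "A - A0"] fibres[of A0] A A0(1,2) by blast+
        moreover have eq: "\<Union>A = \<Union>(A - A0) \<union> \<Union>A0" using A(2) by auto
        ultimately show ?thesis unfolding weighted_def eq by (intro transfer_union)
      qed
      have q2: "bv0 (transfer F (\<Union>A0) (\<lambda>x. W x * G x - G x) g) (4 * (\<Sum>a\<in>A0. 2 * (\<kappa> a * w a)) * B)"
        using A A0(1,2) W branchT weight_bounds(1,2) dj[OF A(2)] g
        by (intro transfer_bv0_crude) (auto simp: subset_iff)
      have q1: "bv0 (transfer F (\<Union>(A - A0)) (\<lambda>x. W x * G x) g) (4 * (\<Sum>a\<in>A - A0. \<kappa> a + 2 * (\<kappa> a * w a)) * B)"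
        by (rule op[OF _ g]) auto
      have "(\<Sum>a\<in>A - A0. \<kappa> a + 2 * (\<kappa> a * w a)) = (\<Sum>a\<in>A - A0. \<kappa> a) + 2 * (\<Sum>a\<in>A - A0. \<kappa> a * w a)"
        by (simp add: sum.distrib sum_distrib_left)
      moreover have "(\<Sum>a\<in>A. \<kappa> a * w a) = (\<Sum>a\<in>A - A0. \<kappa> a * w a) + (\<Sum>a\<in>A0. \<kappa> a * w a)"
        by (rule sum.subset_diff[OF A(2,1)])
      ultimately have tot: "4 * (\<Sum>a\<in>A - A0. \<kappa> a + 2 * (\<kappa> a * w a)) + 4 * (\<Sum>a\<in>A0. 2 * (\<kappa> a * w a)) \<le> 12 * \<omega>"
        using A0(3)[OF A] s by (simp add: sum_distrib_left[symmetric])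
      have "bv0 (\<lambda>y. transfer F (\<Union>(A - A0)) (\<lambda>x. W x * G x) g y + (transfer F (\<Union>A0) (\<lambda>x. W x * G x) g y - ?P g y))
         (4 * (\<Sum>a\<in>A - A0. \<kappa> a + 2 * (\<kappa> a * w a)) * B + 4 * (\<Sum>a\<in>A0. 2 * (\<kappa> a * w a)) * B)"
        using q1 q2 unfolding transfer_weight_diff by (rule bv0_add)
      moreover have "4 * (\<Sum>a\<in>A - A0. \<kappa> a + 2 * (\<kappa> a * w a)) * B + 4 * (\<Sum>a\<in>A0. 2 * (\<kappa> a * w a)) * B \<le> 12 * \<omega> * B"
        using mult_right_mono[OF tot bv0_nonneg[OF g]] by (simp add: distrib_right)
      ultimately show ?thesis unfolding e1 add_diff_eq by (rule bv0_mono)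
    qed
    have "bv0 (\<lambda>y. (?L ^^ N) g y - (?P ^^ N) g y) (real N * K ^ N * (12 * \<omega>) * B)"
      using opL opP opQ transfer_diff K1 \<omega>(1) g by (intro operator_power_perturbation) auto
    then have "bv0 (\<lambda>y. (?L ^^ N) g y - (?P ^^ N) g y + (?P ^^ N) g y)
        (real N * K ^ N * (12 * \<omega>) * B + (4 * (1 / \<sigma>) ^ N * B + C * (\<integral>x. \<bar>g x\<bar> \<partial>leb)))"
      by (rule bv0_add[OF _ C(2)[OF g]])
    moreover have "real N * K ^ N * (12 * \<omega>) * B + (4 * (1 / \<sigma>) ^ N * B + C * (\<integral>x. \<bar>g x\<bar> \<partial>leb)) \<le> B / 2 + C * (\<integral>x. \<bar>g x\<bar> \<partial>leb)"
    proof -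
      have "4 * (1 / \<sigma>) ^ N * B \<le> 1 / 4 * B"
      proof (rule mult_right_mono)
        show "4 * (1 / \<sigma>) ^ N \<le> 1 / 4" using M unfolding N_def by linarith
      qed (rule bv0_nonneg[OF g])
      moreover have "real N * K ^ N * (12 * \<omega>) * B \<le> 1 / 4 * B"
        by (rule mult_right_mono[OF \<omega>(3) bv0_nonneg[OF g]])
      ultimately show ?thesis by linarith
    qed
    ultimately have "bv0 ((?L ^^ N) g) (B / 2 + C * (\<integral>x. \<bar>g x\<bar> \<partial>leb))" using bv0_mono by force
    with opL[OF g] show ?thesis by blast
  qed
  have "0 < N" by (simp add: N_def)
  moreover have "\<forall>A W w. finite A \<and> A0 \<subseteq> A \<and> A \<subseteq> \<A> \<and> (\<forall>a\<in>A. varbound (\<lambda>x. W x - 1) a (w a) \<and> (\<forall>x\<in>a. \<bar>W x - 1\<bar> \<le> w a)) \<and>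
        (\<Sum>a\<in>A. \<kappa> a * w a) \<le> \<omega> \<longrightarrow>
      (\<forall>g B. bv0 g B \<longrightarrow> bv0 (weighted A W g) (K * B) \<and>
          bv0 ((weighted A W ^^ N) g) (B / 2 + C * (\<integral>x. \<bar>g x\<bar> \<partial>leb)))"
    by (intro allI impI, rule main) blast+
  ultimately show ?thesis using C(1) K1 \<omega>(1) A0(1,2) by blast
qed

end


lemma interval_sets_leb:
  assumes "is_interval U" "U \<subseteq> {0..1::real}"
  shows "U \<in> sets lebesgue" "U \<in> sets leb"
proof -
  show U: "U \<in> sets lebesgue"
    using measurable_convex[of U] assms by (meson bounded_closed_interval bounded_subset fmeasurableD is_interval_convex)
  then show "U \<in> sets leb" using assms(2) by (simp add: sets_restrict_space_iff)
qed

section \<open>Duality between the transfer operator and composition\<close>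

lemma leb_set_integral:
  fixes g :: "real \<Rightarrow> real"
  assumes "a \<subseteq> {0..1}"
  shows "g absolutely_integrable_on a \<longleftrightarrow> integrable leb (\<lambda>x. indicator a x * g x)"
    and "g absolutely_integrable_on a \<Longrightarrow> integral a g = (\<integral>x. indicator a x * g x \<partial>leb)"
proof -
  have e: "(\<lambda>x. indicator {0..1} x *\<^sub>R (indicator a x * g x)) = (\<lambda>x. indicator a x *\<^sub>R g x)"
    using assms by (auto simp: fun_eq_iff indicator_def)
  show "g absolutely_integrable_on a \<longleftrightarrow> integrable leb (\<lambda>x. indicator a x * g x)"
    unfolding set_integrable_def by (subst integrable_restrict_space) (simp_all only: e, auto)
  assume "g absolutely_integrable_on a"
  then have "integral a g = (LINT x:a | lebesgue. g x)" by (simp add: set_lebesgue_integral_eq_integral)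
  also have "\<dots> = (\<integral>x. indicator a x * g x \<partial>leb)"
    unfolding set_lebesgue_integral_def by (subst integral_restrict_space) (simp_all only: e, auto)
  finally show "integral a g = (\<integral>x. indicator a x * g x \<partial>leb)" .
qed

context expanding_branches
begin

text \<open>Change of variables on a single branch.\<close>

lemma transfer_branch_integral:
  assumes F: "F \<in> measurable leb leb" and a: "a \<in> \<A>"
    and u: "u \<in> borel_measurable leb" "\<And>x. x \<in> {0..1} \<Longrightarrow> \<bar>u x\<bar> \<le> B"
    and W: "W \<in> borel_measurable leb" "\<And>x. x \<in> a \<Longrightarrow> \<bar>W x\<bar> \<le> B'"
    and \<phi>: "\<phi> \<in> borel_measurable leb" "\<And>x. x \<in> {0..1} \<Longrightarrow> \<bar>\<phi> x\<bar> \<le> B''"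
  shows "integrable leb (\<lambda>x. indicator a x * (W x * u x * \<phi> (F x)))"
    and "integrable leb (\<lambda>y. transfer F a (\<lambda>x. W x * G x) u y * \<phi> y)"
    and "(\<integral>y. transfer F a (\<lambda>x. W x * G x) u y * \<phi> y \<partial>leb) = (\<integral>x. indicator a x * (W x * u x * \<phi> (F x)) \<partial>leb)"
proof -
  define f where "f y = transfer F a (\<lambda>x. W x * G x) u y * \<phi> y" for y
  have aI: "is_interval a" "a \<subseteq> {0..1}" "F ` a \<subseteq> {0..1}" "inj_on F a" "continuous_on a F" using branchT[OF a] by auto
  note as = interval_sets_leb[OF aI(1,2)]
  have FaI: "is_interval (F ` a)"
    using aI(1,5) by (simp add: connected_continuous_image is_interval_connected_1)
  have fib: "{x'. x' \<in> a \<and> F x' = F x} = {x}" if "x \<in> a" for x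
    using inj_onD[OF aI(4)] that by blast
  have fF: "\<bar>F' x\<bar> * f (F x) = W x * u x * \<phi> (F x)" if "x \<in> a" for x
    using F'_nz[OF a that] by (simp add: f_def transfer_def fib[OF that] G_def)
  have f0: "indicator (F ` a) y * f y = f y" for y
  proof (cases "y \<in> F ` a")
    case False
    then have e: "{x. x \<in> a \<and> F x = y} = {}" by auto
    show ?thesis unfolding f_def transfer_def e by simp
  qed simp
  have B0: "0 \<le> B" "0 \<le> B''" using u(2)[of 0] \<phi>(2)[of 0] by auto
  have \<phi>F: "(\<lambda>x. \<phi> (F x)) \<in> borel_measurable leb" using measurable_compose[OF F \<phi>(1)] .
  show int1: "integrable leb (\<lambda>x. indicator a x * (W x * u x * \<phi> (F x)))"
  proof (rule leb_bounded_integrable[where B="\<bar>B'\<bar> * B * B''"])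
    show "(\<lambda>x. indicator a x * (W x * u x * \<phi> (F x))) \<in> borel_measurable leb"
      using as(2) W(1) u(1) \<phi>F by (intro borel_measurable_times borel_measurable_indicator) auto
    fix x :: real assume x: "x \<in> {0..1}"
    show "\<bar>indicator a x * (W x * u x * \<phi> (F x))\<bar> \<le> \<bar>B'\<bar> * B * B''"
    proof (cases "x \<in> a")
      case True
      have "\<bar>W x\<bar> * \<bar>u x\<bar> * \<bar>\<phi> (F x)\<bar> \<le> \<bar>B'\<bar> * B * B''"
        using W(2)[OF True] u(2)[OF x] \<phi>(2)[OF F_into[OF x]] B0 by (intro mult_mono) auto
      then show ?thesis using True by (simp add: abs_mult)
    qed (use B0 in simp)
  qed
  have e: "(\<lambda>x. indicator a x * (\<bar>F' x\<bar> * f (F x))) = (\<lambda>x. indicator a x * (W x * u x * \<phi> (F x)))"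
    using fF by (auto simp: fun_eq_iff indicator_def)
  have ab: "(\<lambda>x. \<bar>F' x\<bar> * f (F x)) absolutely_integrable_on a"
    unfolding leb_set_integral(1)[OF aI(2)] e by (rule int1)
  have der: "(F has_field_derivative F' x) (at x within a)" if "x \<in> a" for x
    using F_deriv[OF a that] by (rule has_field_derivative_at_within)
  have "f absolutely_integrable_on F ` a \<and> integral (F ` a) f = integral a (\<lambda>x. \<bar>F' x\<bar> * f (F x))"
    using has_absolute_integral_change_of_variables_1'[OF as(1) der aI(4), where f=f and b="integral a (\<lambda>x. \<bar>F' x\<bar> * f (F x))"] ab by simp
  then have r: "f absolutely_integrable_on F ` a" "integral (F ` a) f = integral a (\<lambda>x. \<bar>F' x\<bar> * f (F x))" by auto
  show "integrable leb (\<lambda>y. transfer F a (\<lambda>x. W x * G x) u y * \<phi> y)"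
    using r(1) unfolding leb_set_integral(1)[OF aI(3)] f0 unfolding f_def .
  have "integral (F ` a) f = (\<integral>y. f y \<partial>leb)"
    using leb_set_integral(2)[OF aI(3) r(1)] by (simp only: f0)
  moreover have "integral a (\<lambda>x. \<bar>F' x\<bar> * f (F x)) = (\<integral>x. indicator a x * (W x * u x * \<phi> (F x)) \<partial>leb)"
    using leb_set_integral(2)[OF aI(2) ab] by (simp only: e)
  ultimately show "(\<integral>y. transfer F a (\<lambda>x. W x * G x) u y * \<phi> y \<partial>leb) = (\<integral>x. indicator a x * (W x * u x * \<phi> (F x)) \<partial>leb)"
    using r(2) by (simp add: f_def)
qed

text \<open>Weighting and composing with \<open>F\<close> are dual, also for truncated and tilted weights; only the branches in \<open>A\<close> are seen.\<close>

lemma weighted_integral: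
  assumes F: "F \<in> measurable leb leb" and A: "finite A" "A \<subseteq> \<A>"
    and u: "u \<in> borel_measurable leb" "\<And>x. x \<in> {0..1} \<Longrightarrow> \<bar>u x\<bar> \<le> B"
    and W: "W \<in> borel_measurable leb" "\<And>x. x \<in> \<Union>A \<Longrightarrow> \<bar>W x\<bar> \<le> B'"
    and \<phi>: "\<phi> \<in> borel_measurable leb" "\<And>x. x \<in> {0..1} \<Longrightarrow> \<bar>\<phi> x\<bar> \<le> B''"
  shows "integrable leb (\<lambda>x. indicator (\<Union>A) x * (W x * u x * \<phi> (F x)))"
    and "integrable leb (\<lambda>y. weighted A W u y * \<phi> y)"
    and "(\<integral>y. weighted A W u y * \<phi> y \<partial>leb) = (\<integral>x. indicator (\<Union>A) x * (W x * u x * \<phi> (F x)) \<partial>leb)"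
proof -
  note 1 = transfer_branch_integral[OF F _ u W(1) _ \<phi>, of _ B']
  have dA: "disjoint A" using disj A(2) by (auto simp: disjoint_def)
  have "indicator (\<Union>A) x = (\<Sum>a\<in>A. indicator a x :: real)" for x
    proof -
    have "disjoint_family_on id A" using dA by (auto simp: disjoint_family_on_def disjoint_def)
    from indicator_UN_disjoint[OF A(1) this, of x] show ?thesis by simp
  qed
  then have e1: "(\<lambda>x. indicator (\<Union>A) x * (W x * u x * \<phi> (F x))) = (\<lambda>x. \<Sum>a\<in>A. indicator a x * (W x * u x * \<phi> (F x)))"
    by (simp add: sum_distrib_right fun_eq_iff)
  have e2: "(\<lambda>y. weighted A W u y * \<phi> y) = (\<lambda>y. \<Sum>a\<in>A. transfer F a (\<lambda>x. W x * G x) u y * \<phi> y)"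
  proof -
    have "inj_on F U" if "U \<in> A" for U using F_inj A(2) that by blast
    from transfer_Union(1)[OF A(1) dA this] show ?thesis
      unfolding weighted_def by (simp add: sum_distrib_right fun_eq_iff)
  qed
  have W': "\<bar>W x\<bar> \<le> B'" if "a \<in> A" "x \<in> a" for a x using W(2) that by auto
  show "integrable leb (\<lambda>x. indicator (\<Union>A) x * (W x * u x * \<phi> (F x)))"
    unfolding e1 using A(2) W' by (intro Bochner_Integration.integrable_sum 1(1)) auto
  show "integrable leb (\<lambda>y. weighted A W u y * \<phi> y)"
    unfolding e2 using A(2) W' by (intro Bochner_Integration.integrable_sum 1(2)) auto
  have "(\<integral>y. weighted A W u y * \<phi> y \<partial>leb) = (\<Sum>a\<in>A. \<integral>y. transfer F a (\<lambda>x. W x * G x) u y * \<phi> y \<partial>leb)"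
    unfolding e2 using A(2) W' by (intro Bochner_Integration.integral_sum 1(2)) auto
  also have "\<dots> = (\<Sum>a\<in>A. \<integral>x. indicator a x * (W x * u x * \<phi> (F x)) \<partial>leb)"
    using A(2) W' by (intro sum.cong refl 1(3)) auto
  also have "\<dots> = (\<integral>x. indicator (\<Union>A) x * (W x * u x * \<phi> (F x)) \<partial>leb)"
    unfolding e1 using A(2) W' by (intro Bochner_Integration.integral_sum[symmetric] 1(1)) auto
  finally show "(\<integral>y. weighted A W u y * \<phi> y \<partial>leb) = (\<integral>x. indicator (\<Union>A) x * (W x * u x * \<phi> (F x)) \<partial>leb)" .
qed

end

section \<open>Compactness and uniqueness of the invariant density\<close>

text \<open>A diagonal argument gives convergence at every rational point.  Sampling on a fine rational grid controls the integral
  of the difference of two members of the sequence, so the subsequence is Cauchy in the mean.\<close>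

lemma bv0_compact:
  fixes g :: "nat \<Rightarrow> real \<Rightarrow> real"
  assumes g: "\<And>i. bv0 (g i) 1"
  obtains r where "strict_mono (r :: nat \<Rightarrow> nat)" "AE x in leb. Cauchy (\<lambda>i. g (r i) x)"
proof -
  obtain m :: "real \<Rightarrow> nat" where "bij_betw m \<rat> UNIV"
    using countable_rat Rats_infinite by (erule countableE_infinite)
  then obtain e :: "nat \<Rightarrow> real" where e: "bij_betw e UNIV \<rat>"
    using bij_betw_inv by blast
  let ?P = "\<lambda>n s. convergent (\<lambda>k. g (s k) (e n))"
  interpret nat: subseqs ?P
  proof (unfold convergent_def, unfold subseqs_def, auto)
    fix n :: nat and s :: "nat \<Rightarrow> nat" assume s: "strict_mono s"
    have "\<And>k. g (s k) (e n) \<in> {-1..1}"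
      using bv0_bound[OF g] by (simp add: abs_le_iff minus_le_iff)
    then have "\<exists>l s'. strict_mono s' \<and> ((\<lambda>k. g (s k) (e n)) \<circ> s') \<longlonglongrightarrow> l"
      using compact_Icc compact_imp_seq_compact seq_compactE by metis
    then show "\<exists>s'. strict_mono (s'::nat\<Rightarrow>nat) \<and> (\<exists>l. (\<lambda>k. g (s (s' k)) (e n)) \<longlonglongrightarrow> l)"
      by (auto simp: comp_def)
  qed
  define d where "d = nat.diagseq"
  have d: "strict_mono d" unfolding d_def by (rule nat.subseq_diagseq)
  have conv: "?P n d" for n
  proof -
    have Pn: "?P n (nat.seqseq (Suc n))" by (rule nat.seqseq_holds)
    have 1: "(\<lambda>k. g ((nat.seqseq (Suc n) \<circ> (\<lambda>k. nat.fold_reduce (Suc n) k (Suc n + k))) k) (e n)) =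
       (\<lambda>k. g (nat.seqseq (Suc n) k) (e n)) \<circ> (\<lambda>k. nat.fold_reduce (Suc n) k (Suc n + k))"
      by auto
    have "?P n (d \<circ> ((+) (Suc n)))"
      unfolding d_def nat.diagseq_seqseq 1
      by (intro convergent_subseq_convergent Pn nat.subseq_diagonal_rest)
    then obtain L where "(\<lambda>na. g (d (na + Suc n)) (e n)) \<longlonglongrightarrow> L"
      by (auto simp: add.commute dest: convergentD)
    then have "(\<lambda>k. g (d k) (e n)) \<longlonglongrightarrow> L" by (rule LIMSEQ_offset)
    then show ?thesis by (auto simp: convergent_def)
  qed
  have rat: "convergent (\<lambda>k. g (d k) q)" if "q \<in> \<rat>" for q
    using conv e that unfolding bij_betw_def by (metis imageE)
  have L1: "\<exists>N. \<forall>i\<ge>N. \<forall>j\<ge>N. (\<integral>x. norm (g (d i) x - g (d j) x) \<partial>leb) < \<epsilon>" if \<epsilon>: "0 < \<epsilon>" for \<epsilon>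
  proof -
    obtain K :: nat where K: "3 / \<epsilon> < real K" using reals_Archimedean2 by blast
    have K0: "0 < K" using K \<epsilon> by (metis divide_pos_pos gr0I of_nat_0 order_less_asym zero_less_numeral)
    have "\<exists>N. \<forall>i\<ge>N. \<forall>j\<ge>N. \<bar>g (d i) (real l / real K) - g (d j) (real l / real K)\<bar> < 1 / real K" for l
    proof -
      have "Cauchy (\<lambda>k. g (d k) (real l / real K))" using rat by (intro convergent_Cauchy) auto
      then show ?thesis unfolding Cauchy_def dist_real_def using K0 by simp
    qed
    then obtain N where N: "\<And>l i j. N l \<le> i \<Longrightarrow> N l \<le> j \<Longrightarrow> \<bar>g (d i) (real l / real K) - g (d j) (real l / real K)\<bar> < 1 / real K"
      by metis
    show ?thesis
    proof (intro exI[of _ "\<Sum>l<K. N l"] allI impI)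
      fix i j assume ij: "(\<Sum>l<K. N l) \<le> i" "(\<Sum>l<K. N l) \<le> j"
      have Nl: "N l \<le> (\<Sum>l<K. N l)" if "l < K" for l
        using that by (intro member_le_sum) auto
      have "bv0 (\<lambda>x. g (d i) x - g (d j) x) 2" using bv0_diff[OF g g, of "d i" "d j"] by simp
      from bv0_L1_sampling[OF this K0]
      have "(\<integral>x. norm (g (d i) x - g (d j) x) \<partial>leb) \<le> (2 + (\<Sum>l<K. \<bar>g (d i) (real l / real K) - g (d j) (real l / real K)\<bar>)) / real K"
        by simp
      also have "(\<Sum>l<K. \<bar>g (d i) (real l / real K) - g (d j) (real l / real K)\<bar>) \<le> (\<Sum>l<K. 1 / real K)"
        using N Nl ij by (intro sum_mono less_imp_le) (meson lessThan_iff order_trans)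
      also have "(\<Sum>l<K. 1 / real K) = 1" using K0 by simp
      also have "(2 + 1) / real K < \<epsilon>" using K K0 \<epsilon> by (simp add: field_simps)
      finally show "(\<integral>x. norm (g (d i) x - g (d j) x) \<partial>leb) < \<epsilon>" using K0 by (simp add: divide_right_mono)
    qed
  qed
  have "\<And>n. integrable leb (g (d n))" by (rule bv0_integrable[OF g])
  then obtain r where r: "strict_mono r" "AE x in leb. Cauchy (\<lambda>i. g (d (r i)) x)"
    using cauchy_L1_AE_cauchy_subseq[where M=leb and s="\<lambda>n. g (d n)"] L1 by blast
  show ?thesis
    by (rule that[of "d \<circ> r"]) (use r d in \<open>auto simp: strict_mono_o\<close>)
qed

text \<open>Ergodicity speaks of strictly invariant sets.  The set of points that visit \<open>A\<close> infinitely often is strictly invariant, and it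
  agrees with \<open>A\<close> almost everywhere.\<close>

lemma ergodic_map_almost_invariant:
  assumes T: "ergodic_map M T" and A: "A \<in> sets M" and inv: "AE x in M. x \<in> A \<longleftrightarrow> T x \<in> A"
  shows "(AE x in M. x \<in> A) \<or> (AE x in M. x \<notin> A)"
proof -
  have meas: "T \<in> measurable M M" and d: "distr M M T = M" using T by (auto simp: ergodic_map_def measure_preserving_map_def)
  have measn: "(T ^^ n) \<in> measurable M M" for n
    by (induction n) (use meas in \<open>auto intro: measurable_comp\<close>)
  have AET: "AE x in M. P (T x)" if "AE x in M. P x" for P
  proof -
    have "AE x in distr M M T. P x" unfolding d by (rule that)
    then show ?thesis by (rule AE_distrD[OF meas])
  qed
  have AEn: "AE x in M. (T ^^ n) x \<in> A \<longleftrightarrow> (T ^^ Suc n) x \<in> A" for n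
  proof (induction n)
    case (Suc n)
    from AET[OF Suc] show ?case by (simp add: funpow_swap1)
  qed (use inv in simp)
  define A' where "A' = {x \<in> space M. \<forall>m. \<exists>n\<ge>m. (T ^^ n) x \<in> A}"
  have A': "A' \<in> sets M"
  proof -
    have eqA: "A' = (\<Inter>m. \<Union>n\<in>{m..}. (T ^^ n) -` A \<inter> space M)"
    proof (rule set_eqI)
      fix x show "x \<in> A' \<longleftrightarrow> x \<in> (\<Inter>m. \<Union>n\<in>{m..}. (T ^^ n) -` A \<inter> space M)"
        unfolding A'_def by (simp add: Bex_def) blast
    qed
    have m: "(T ^^ n) -` A \<inter> space M \<in> sets M" for n using measurable_sets[OF measn A] .
    show ?thesis unfolding eqA
      by (intro sets.countable_INT image_subsetI sets.countable_UN m) auto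
  qed
  have "T -` A' \<inter> space M = A'"
  proof -
    have "(\<forall>m. \<exists>n\<ge>m. (T ^^ n) (T x) \<in> A) \<longleftrightarrow> (\<forall>m. \<exists>n\<ge>m. (T ^^ n) x \<in> A)" for x
    proof safe
      fix m assume "\<forall>m. \<exists>n\<ge>m. (T ^^ n) (T x) \<in> A"
      then obtain n where "n \<ge> m" "(T ^^ Suc n) x \<in> A" by (auto simp: funpow_swap1)
      then show "\<exists>n\<ge>m. (T ^^ n) x \<in> A" by (metis le_SucI)
    next
      fix m assume "\<forall>m. \<exists>n\<ge>m. (T ^^ n) x \<in> A"
      then obtain n where n: "n \<ge> Suc m" "(T ^^ n) x \<in> A" by blast
      then obtain k where "n = Suc k" by (cases n) auto
      then show "\<exists>n\<ge>m. (T ^^ n) (T x) \<in> A" using n by (intro exI[of _ k]) (simp add: funpow_swap1)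
    qed
    then show ?thesis using measurable_space[OF meas] by (auto simp: A'_def)
  qed
  then have "A' \<in> null_sets M \<or> space M - A' \<in> null_sets M" using T A' by (auto simp: ergodic_map_def)
  moreover have "AE x in M. \<forall>n. (T ^^ n) x \<in> A \<longleftrightarrow> (T ^^ Suc n) x \<in> A" using AEn by (simp add: AE_all_countable)
  then have eq: "AE x in M. x \<in> A \<longleftrightarrow> x \<in> A'"
    using AE_space
  proof eventually_elim
    case (elim x)
    have "(T ^^ n) x \<in> A \<longleftrightarrow> x \<in> A" for n
    proof (induction n)
      case (Suc n) then show ?case using elim(1) by blast
    qed simp
    then show ?case using elim(2) by (auto simp: A'_def)
  qed
  ultimately show ?thesis
  proof (elim disjE)
    assume "A' \<in> null_sets M"
    then have "AE x in M. x \<notin> A'" by (rule AE_not_in)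
    with eq have "AE x in M. x \<notin> A" by eventually_elim simp
    then show ?thesis by blast
  next
    assume "space M - A' \<in> null_sets M"
    then have "AE x in M. x \<notin> space M - A'" by (rule AE_not_in)
    with eq AE_space have "AE x in M. x \<in> A" by eventually_elim simp
    then show ?thesis by blast
  qed
qed

locale ergodic_branches = expanding_branches +
  fixes h :: "real \<Rightarrow> real" and H :: real
  assumes h_bv: "bv0 h H" and h_nonneg: "0 \<le> h x" and h_int: "(\<integral>x. h x \<partial>leb) = 1"
    and erg: "ergodic_map (density leb (\<lambda>x. ennreal (h x))) F"
begin

lemma h_meas [measurable]: "h \<in> borel_measurable leb" using h_bv by (rule bv0_leb)

lemma F_meas [measurable]: "F \<in> measurable leb leb"
  using erg by (simp add: ergodic_map_def measure_preserving_map_def)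

lemma h_integrable: "integrable leb h" using h_bv by (rule bv0_integrable)

lemma h_le: "h x \<le> H" using bv0_bound[OF h_bv, of x] by simp

lemma h_invariant:
  assumes [measurable]: "\<phi> \<in> borel_measurable leb"
  shows "(\<integral>x. h x * \<phi> (F x) \<partial>leb) = (\<integral>x. h x * \<phi> x \<partial>leb)"
proof -
  let ?M = "density leb (\<lambda>x. ennreal (h x))"
  have d: "distr ?M ?M F = ?M" using erg by (simp add: ergodic_map_def measure_preserving_map_def)
  have "(\<integral>x. h x * \<phi> (F x) \<partial>leb) = (\<integral>x. \<phi> (F x) \<partial>?M)"
    using h_nonneg by (subst integral_density) auto
  also have "\<dots> = (\<integral>x. \<phi> x \<partial>distr ?M ?M F)" by (subst integral_distr) auto
  also have "\<dots> = (\<integral>x. h x * \<phi> x \<partial>leb)"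
    unfolding d using h_nonneg by (subst integral_density) auto
  finally show ?thesis .
qed

text \<open>Let \<open>w = u - c h\<close> with \<open>c\<close> chosen so that \<open>w\<close> has integral zero, and let \<open>A\<close> be the set where \<open>w\<close> is positive.  Invariance gives
  \<open>A\<close> and its preimage equal integrals of \<open>w\<close>, and \<open>A\<close> maximizes this integral, so \<open>A\<close> is invariant up to null sets and
  hence null or full for \<open>h\<close>.  In either case \<open>w\<close> has constant sign, hence vanishes.\<close>

lemma invariant_density_unique:
  assumes u[measurable]: "u \<in> borel_measurable leb" and ub: "\<And>x. x \<in> {0..1} \<Longrightarrow> \<bar>u x\<bar> \<le> B"
    and inv: "\<And>A. A \<in> sets leb \<Longrightarrow> (\<integral>x. u x * indicator A (F x) \<partial>leb) = (\<integral>x. u x * indicator A x \<partial>leb)"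
    and ac: "AE x in leb. h x = 0 \<longrightarrow> u x = 0"
  shows "AE x in leb. u x = (\<integral>x. u x \<partial>leb) * h x"
proof -
  define c where "c = (\<integral>x. u x \<partial>leb)"
  define w where "w x = u x - c * h x" for x
  have wm[measurable]: "w \<in> borel_measurable leb" unfolding w_def by measurable
  have ui: "integrable leb u" using u ub by (rule leb_bounded_integrable)
  have wi: "integrable leb w" unfolding w_def using ui h_integrable by auto
  have w0: "(\<integral>x. w x \<partial>leb) = 0"
    unfolding w_def using ui h_integrable h_int by (simp add: c_def)
  define A where "A = {x \<in> space leb. 0 < w x}"
  have A[measurable]: "A \<in> sets leb" unfolding A_def by measurable
  have mi: "integrable leb (\<lambda>x. k x * indicator A (F x))" "integrable leb (\<lambda>x. k x * indicator A x)" if k: "integrable leb k" for k :: "real \<Rightarrow> real"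
  proof -
    have [measurable]: "k \<in> borel_measurable leb" using k by auto
    show "integrable leb (\<lambda>x. k x * indicator A (F x))" "integrable leb (\<lambda>x. k x * indicator A x)"
      using k by (auto intro!: Bochner_Integration.integrable_bound[OF k] simp: indicator_def)
  qed
  have hA: "(\<integral>x. h x * indicator A (F x) \<partial>leb) = (\<integral>x. h x * indicator A x \<partial>leb)"
    by (rule h_invariant) measurable
  have wA: "(\<integral>x. w x * indicator A (F x) \<partial>leb) = (\<integral>x. w x * indicator A x \<partial>leb)"
  proof -
    have "(\<integral>x. w x * indicator A (F x) \<partial>leb) = (\<integral>x. u x * indicator A (F x) - c * (h x * indicator A (F x)) \<partial>leb)"
      by (simp add: w_def left_diff_distrib mult.assoc)
    also have "\<dots> = (\<integral>x. u x * indicator A x \<partial>leb) - c * (\<integral>x. h x * indicator A x \<partial>leb)"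
      using mi[OF ui] mi[OF h_integrable] inv[OF A] hA by simp
    also have "\<dots> = (\<integral>x. u x * indicator A x - c * (h x * indicator A x) \<partial>leb)"
      using mi[OF ui] mi[OF h_integrable] by simp
    also have "\<dots> = (\<integral>x. w x * indicator A x \<partial>leb)" by (simp add: w_def left_diff_distrib mult.assoc)
    finally show ?thesis .
  qed
  have "AE x in leb. w x * indicator A x - w x * indicator A (F x) = 0"
  proof (subst integral_nonneg_eq_0_iff_AE[symmetric])
    show "integrable leb (\<lambda>x. w x * indicator A x - w x * indicator A (F x))"
      using mi[OF wi] by (intro Bochner_Integration.integrable_diff)
    show "AE x in leb. 0 \<le> w x * indicator A x - w x * indicator A (F x)"
      using AE_space by eventually_elim (auto simp: A_def indicator_def)
    show "(\<integral>x. w x * indicator A x - w x * indicator A (F x) \<partial>leb) = 0"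
      using mi[OF wi] wA by simp
  qed
  then have AF: "AE x in leb. x \<in> A \<longrightarrow> F x \<in> A"
    by eventually_elim (auto simp: A_def indicator_def split: if_splits)
  have "AE x in leb. h x * indicator A (F x) - h x * indicator A x = 0"
  proof (subst integral_nonneg_eq_0_iff_AE[symmetric])
    show "integrable leb (\<lambda>x. h x * indicator A (F x) - h x * indicator A x)"
      using mi[OF h_integrable] by (intro Bochner_Integration.integrable_diff)
    show "AE x in leb. 0 \<le> h x * indicator A (F x) - h x * indicator A x"
      using AF by eventually_elim (use h_nonneg in \<open>auto simp: indicator_def\<close>)
    show "(\<integral>x. h x * indicator A (F x) - h x * indicator A x \<partial>leb) = 0"
      using mi[OF h_integrable] hA by simp
  qed
  then have "AE x in density leb (\<lambda>x. ennreal (h x)). x \<in> A \<longleftrightarrow> F x \<in> A"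
    by (subst AE_density) (auto elim!: eventually_mono simp: indicator_def split: if_splits)
  from ergodic_map_almost_invariant[OF erg _ this]
  have cases: "(AE x in leb. 0 < h x \<longrightarrow> x \<in> A) \<or> (AE x in leb. 0 < h x \<longrightarrow> x \<notin> A)"
    by (simp add: AE_density)
  have hz: "AE x in leb. h x = 0 \<longrightarrow> w x = 0"
    using ac by eventually_elim (simp add: w_def)
  have "AE x in leb. w x = 0"
    using cases
  proof
    assume "AE x in leb. 0 < h x \<longrightarrow> x \<in> A"
    with hz have "AE x in leb. 0 \<le> w x"
    proof eventually_elim
      case (elim x)
      then show ?case using h_nonneg[of x] by (cases "h x = 0") (auto simp: A_def)
    qed
    then show ?thesis using integral_nonneg_eq_0_iff_AE[OF wi] w0 by blast
  next
    assume "AE x in leb. 0 < h x \<longrightarrow> x \<notin> A"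
    with hz AE_space have "AE x in leb. 0 \<le> - w x"
    proof eventually_elim
      case (elim x)
      then show ?case using h_nonneg[of x] by (cases "h x = 0") (auto simp: A_def)
    qed
    then show ?thesis using integral_nonneg_eq_0_iff_AE[of leb "\<lambda>x. - w x"] wi w0 by simp
  qed
  then show ?thesis by eventually_elim (simp add: w_def c_def)
qed

text \<open>If this failed, normalized counterexamples for \<open>C = 1, 2, \<dots>\<close> would have defects of invariance tending to zero.  A limit along a
  subsequence is an invariant density, hence a multiple of \<open>h\<close>, and \<open>V\<close> integrates to zero against it; but the integrals
  against the counterexamples stay above \<open>\<epsilon>\<close>.\<close>

lemma almost_invariant_integral:
  assumes V: "integrable leb V" and V0: "(\<integral>x. V x * h x \<partial>leb) = 0" and \<epsilon>: "0 < \<epsilon>"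
  shows "\<exists>C\<ge>0. \<forall>g B d. bv0 g B \<and> (AE x in leb. h x = 0 \<longrightarrow> g x = 0) \<and>
      (\<forall>A\<in>sets leb. \<bar>(\<integral>x. g x * indicator A (F x) \<partial>leb) - (\<integral>x. g x * indicator A x \<partial>leb)\<bar> \<le> d) \<longrightarrow>
      \<bar>\<integral>x. V x * g x \<partial>leb\<bar> \<le> \<epsilon> * B + C * d"
proof (rule ccontr)
  assume neg: "\<not> ?thesis"
  have Vm[measurable]: "V \<in> borel_measurable leb" using V by auto
  define Q where "Q g d \<longleftrightarrow> (AE x in leb. h x = 0 \<longrightarrow> g x = 0) \<and>
      (\<forall>A\<in>sets leb. \<bar>(\<integral>x. g x * indicator A (F x) \<partial>leb) - (\<integral>x. g x * indicator A x \<partial>leb)\<bar> \<le> d)" for g :: "real \<Rightarrow> real" and d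
  have "\<exists>g d. bv0 g 1 \<and> Q g d \<and> \<epsilon> + real n * d < \<bar>\<integral>x. V x * g x \<partial>leb\<bar>" for n
  proof -
    have "\<exists>g B d. bv0 g B \<and> Q g d \<and> \<epsilon> * B + real n * d < \<bar>\<integral>x. V x * g x \<partial>leb\<bar>"
    proof (rule ccontr)
      assume "\<not> ?thesis"
      then have "\<forall>g B d. bv0 g B \<and> Q g d \<longrightarrow> \<bar>\<integral>x. V x * g x \<partial>leb\<bar> \<le> \<epsilon> * B + real n * d"
        by (meson not_le)
      then show False using neg of_nat_0_le_iff[of n] unfolding Q_def by blast
    qed
    then obtain g B d where g: "bv0 g B" "Q g d" "\<epsilon> * B + real n * d < \<bar>\<integral>x. V x * g x \<partial>leb\<bar>" by blast
    have d0: "0 \<le> d" using g(2)[unfolded Q_def, THEN conjunct2, THEN bspec, of "{}"] by simp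
    have B0: "0 < B"
    proof (rule ccontr)
      assume "\<not> 0 < B"
      then have "B = 0" using bv0_nonneg[OF g(1)] by simp
      then have "g x = 0" for x using bv0_bound[OF g(1), of x] by simp
      then have "(\<integral>x. V x * g x \<partial>leb) = 0" by simp
      then show False using g(3) \<open>B = 0\<close> mult_nonneg_nonneg[OF of_nat_0_le_iff[of n] d0] by simp
    qed
    have "bv0 (\<lambda>x. 1 / B * g x) 1" using bv0_cmult[OF g(1), of "1 / B"] B0 by simp
    moreover have "Q (\<lambda>x. 1 / B * g x) (d / B)"
      using g(2) B0 unfolding Q_def
      by (auto simp: mult.assoc abs_mult diff_divide_distrib[symmetric] abs_divide divide_right_mono)
    moreover have "\<epsilon> + real n * (d / B) < \<bar>\<integral>x. V x * (1 / B * g x) \<partial>leb\<bar>"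
    proof -
      have "(\<integral>x. V x * (1 / B * g x) \<partial>leb) = (\<integral>x. V x * g x \<partial>leb) / B" by simp
      then have "\<bar>\<integral>x. V x * (1 / B * g x) \<partial>leb\<bar> = \<bar>\<integral>x. V x * g x \<partial>leb\<bar> / B" using B0 by (simp add: abs_divide)
      moreover have "(\<epsilon> * B + real n * d) / B < \<bar>\<integral>x. V x * g x \<partial>leb\<bar> / B" using g(3) B0 by (rule divide_strict_right_mono)
      moreover have "(\<epsilon> * B + real n * d) / B = \<epsilon> + real n * (d / B)" using B0 by (simp add: add_divide_distrib)
      ultimately show ?thesis by (simp only:)
    qed
    ultimately show ?thesis by blast
  qed
  then obtain g d where g: "\<And>n. bv0 (g n) 1" "\<And>n. Q (g n) (d n)" "\<And>n. \<epsilon> + real n * d n < \<bar>\<integral>x. V x * g n x \<partial>leb\<bar>"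
    by metis
  obtain r where r: "strict_mono (r :: nat \<Rightarrow> nat)" "AE x in leb. Cauchy (\<lambda>i. g (r i) x)"
    by (rule bv0_compact[of g, OF g(1)])
  define u where "u x = lim (\<lambda>i. g (r i) x)" for x
  have gm[measurable]: "g n \<in> borel_measurable leb" for n using g(1) by (rule bv0_leb)
  have um[measurable]: "u \<in> borel_measurable leb" unfolding u_def by (rule borel_measurable_lim_metric) measurable
  have lim: "AE x in leb. (\<lambda>i. g (r i) x) \<longlonglongrightarrow> u x"
    using r(2) by eventually_elim (auto simp: u_def Cauchy_convergent_iff convergent_LIMSEQ_iff)
  have gb: "\<bar>g n x\<bar> \<le> 1" for n x using bv0_bound[OF g(1)] .
  have dom: "(\<lambda>i. \<integral>x. k x * g (r i) x \<partial>leb) \<longlonglongrightarrow> (\<integral>x. k x * u x \<partial>leb)"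
    if k: "integrable leb k" for k
  proof (rule integral_dominated_convergence[where w="\<lambda>x. \<bar>k x\<bar>"])
    have [measurable]: "k \<in> borel_measurable leb" using k by auto
    show "(\<lambda>x. k x * u x) \<in> borel_measurable leb" "(\<lambda>x. k x * g (r i) x) \<in> borel_measurable leb" for i by measurable
    show "integrable leb (\<lambda>x. \<bar>k x\<bar>)" using k by simp
    show "AE x in leb. (\<lambda>i. k x * g (r i) x) \<longlonglongrightarrow> k x * u x"
      using lim by eventually_elim (intro tendsto_intros)
    show "AE x in leb. norm (k x * g (r i) x) \<le> \<bar>k x\<bar>" for i
      using gb[of "r i"] by (simp add: abs_mult mult_left_le)
  qed
  define K where "K = (\<integral>x. \<bar>V x\<bar> \<partial>leb)"
  have Vg: "\<bar>\<integral>x. V x * g n x \<partial>leb\<bar> \<le> K" for n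
  proof -
    have "\<bar>\<integral>x. V x * g n x \<partial>leb\<bar> \<le> (\<integral>x. \<bar>V x * g n x\<bar> \<partial>leb)" by (rule integral_abs_bound)
    also have "\<dots> \<le> K" unfolding K_def
      using V gb[of n] by (intro integral_mono_AE') (auto simp: abs_mult mult_left_le)
    finally show ?thesis .
  qed
  have d0: "0 \<le> d n" for n using g(2)[of n, unfolded Q_def, THEN conjunct2, THEN bspec, of "{}"] by simp
  have "d (r n) \<le> K / real n" if "0 < n" for n
  proof -
    have "real n * d (r n) \<le> real (r n) * d (r n)"
      using seq_suble[OF r(1), of n] d0 by (intro mult_right_mono) auto
    also have "\<dots> \<le> K" using g(3)[of "r n"] Vg[of "r n"] \<epsilon> by linarith
    finally show ?thesis using that by (simp add: field_simps)
  qed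
  then have "\<forall>\<^sub>F n in sequentially. norm (d (r n)) \<le> K / real n"
    using d0 by (intro eventually_sequentiallyI[of 1]) auto
  then have dlim: "(\<lambda>n. d (r n)) \<longlonglongrightarrow> 0"
    by (rule Lim_null_comparison) (rule lim_const_over_n)
  have inv: "(\<integral>x. u x * indicator A (F x) \<partial>leb) = (\<integral>x. u x * indicator A x \<partial>leb)" if A: "A \<in> sets leb" for A
  proof -
    note [measurable] = A
    have i1: "integrable leb (\<lambda>x. indicator A (F x) :: real)" and i2: "integrable leb (\<lambda>x. indicator A x :: real)"
      by (rule leb_bounded_integrable[where B=1]; auto simp: indicator_def)+
    have "(\<lambda>i. \<bar>(\<integral>x. indicator A (F x) * g (r i) x \<partial>leb) - (\<integral>x. indicator A x * g (r i) x \<partial>leb)\<bar>)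
       \<longlonglongrightarrow> \<bar>(\<integral>x. indicator A (F x) * u x \<partial>leb) - (\<integral>x. indicator A x * u x \<partial>leb)\<bar>"
      by (intro tendsto_intros dom i1 i2)
    then have "\<bar>(\<integral>x. indicator A (F x) * u x \<partial>leb) - (\<integral>x. indicator A x * u x \<partial>leb)\<bar> \<le> 0"
      using dlim
    proof (rule LIMSEQ_le)
      show "\<exists>N. \<forall>n\<ge>N. \<bar>(\<integral>x. indicator A (F x) * g (r n) x \<partial>leb) - (\<integral>x. indicator A x * g (r n) x \<partial>leb)\<bar> \<le> d (r n)"
      proof (intro exI allI impI)
        fix n
        have "\<bar>(\<integral>x. g (r n) x * indicator A (F x) \<partial>leb) - (\<integral>x. g (r n) x * indicator A x \<partial>leb)\<bar> \<le> d (r n)"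
          using g(2)[of "r n"] A unfolding Q_def by blast
        then show "\<bar>(\<integral>x. indicator A (F x) * g (r n) x \<partial>leb) - (\<integral>x. indicator A x * g (r n) x \<partial>leb)\<bar> \<le> d (r n)"
          by (simp only: mult.commute)
      qed
    qed
    then show ?thesis by (simp add: mult.commute)
  qed
  have "\<forall>n. AE x in leb. h x = 0 \<longrightarrow> g n x = 0" using g(2) unfolding Q_def by blast
  then have "AE x in leb. \<forall>n. h x = 0 \<longrightarrow> g n x = 0" unfolding AE_all_countable .
  with lim have ac: "AE x in leb. h x = 0 \<longrightarrow> u x = 0"
  proof eventually_elim
    case (elim x) then show ?case using LIMSEQ_unique[of "\<lambda>i. g (r i) x" "u x" 0] by auto
  qed
  \<comment> \<open>The limit \<open>u\<close> is bounded only almost everywhere.\<close>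
  define u' where "u' x = max (-1) (min 1 (u x))" for x
  have uu: "AE x in leb. u x = u' x"
    using lim
  proof eventually_elim
    case (elim x)
    have "(\<lambda>i. \<bar>g (r i) x\<bar>) \<longlonglongrightarrow> \<bar>u x\<bar>" using elim by (intro tendsto_intros)
    then have "\<bar>u x\<bar> \<le> 1" by (rule LIMSEQ_le_const2) (use gb in auto)
    then show ?case by (simp add: u'_def abs_le_iff)
  qed
  have u'm[measurable]: "u' \<in> borel_measurable leb" unfolding u'_def by measurable
  have "AE x in leb. u' x = (\<integral>x. u' x \<partial>leb) * h x"
  proof (rule invariant_density_unique[where B=1])
    show "(\<integral>x. u' x * indicator A (F x) \<partial>leb) = (\<integral>x. u' x * indicator A x \<partial>leb)" if A: "A \<in> sets leb" for A
    proof -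
      note [measurable] = A
      have "(\<integral>x. u' x * indicator A (F x) \<partial>leb) = (\<integral>x. u x * indicator A (F x) \<partial>leb)"
        by (rule integral_cong_AE) (use uu in \<open>auto elim!: eventually_mono\<close>)
      also have "\<dots> = (\<integral>x. u x * indicator A x \<partial>leb)" by (rule inv[OF A])
      also have "\<dots> = (\<integral>x. u' x * indicator A x \<partial>leb)"
        by (rule integral_cong_AE) (use uu in \<open>auto elim!: eventually_mono\<close>)
      finally show ?thesis .
    qed
    show "AE x in leb. h x = 0 \<longrightarrow> u' x = 0" using ac uu by eventually_elim simp
  qed (auto simp: u'_def)
  then have "AE x in leb. V x * u x = (\<integral>x. u' x \<partial>leb) * (V x * h x)"
    using uu by eventually_elim simp
  then have "(\<integral>x. V x * u x \<partial>leb) = (\<integral>x. (\<integral>x. u' x \<partial>leb) * (V x * h x) \<partial>leb)"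
    by (intro integral_cong_AE) auto
  also have "\<dots> = 0" using V0 by simp
  finally have "(\<lambda>i. \<integral>x. V x * g (r i) x \<partial>leb) \<longlonglongrightarrow> 0" using dom[OF V] by simp
  then have "\<forall>\<^sub>F i in sequentially. \<bar>\<integral>x. V x * g (r i) x \<partial>leb\<bar> < \<epsilon>"
    using \<epsilon> by (auto simp: tendsto_iff dist_real_def)
  then obtain i where "\<bar>\<integral>x. V x * g (r i) x \<partial>leb\<bar> < \<epsilon>" by (auto simp: eventually_sequentially)
  moreover have "0 \<le> real (r i) * d (r i)" using d0 by simp
  ultimately show False using g(3)[of "r i"] by linarith
qed

end


section \<open>Exponential moments along the induced map\<close>

text \<open>The bounds produced by iterating an inequality \<open>b (k + N) \<le> b k / 2 + C * a k\<close> from the initial value \<open>b0\<close>.\<close>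

function ly_bound :: "nat \<Rightarrow> real \<Rightarrow> real \<Rightarrow> (nat \<Rightarrow> real) \<Rightarrow> nat \<Rightarrow> real" where
  "ly_bound N b0 C a k = (if N = 0 \<or> k < N then b0 else ly_bound N b0 C a (k - N) / 2 + C * a (k - N))"
  by auto
termination by (relation "Wellfounded.measure (\<lambda>(N, b0, C, a, k). k)") auto

declare ly_bound.simps [simp del]

lemma sum_lessThan_split: "sum (f :: nat \<Rightarrow> real) {..<N + M} = sum f {..<N} + (\<Sum>k<M. f (N + k))"
  by (induction M) auto

lemma ly_bound_nonneg:
  assumes "0 \<le> b0" "0 \<le> C" "\<And>k. 0 \<le> a k" shows "0 \<le> ly_bound N b0 C a k"
proof (induction k rule: less_induct)
  case (less k)
  show ?case
  proof (cases "N = 0 \<or> k < N")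
    case False
    then have "0 \<le> ly_bound N b0 C a (k - N)" using less by simp
    then show ?thesis using assms by (subst ly_bound.simps) auto
  qed (use assms in \<open>subst ly_bound.simps, auto\<close>)
qed

lemma ly_bound_sum:
  assumes N: "0 < N" and "0 \<le> b0" "0 \<le> C" and a: "\<And>k. 0 \<le> a k"
  shows "(\<Sum>k<K. ly_bound N b0 C a k) \<le> 2 * (real N * b0 + C * (\<Sum>k<K. a k))"
proof -
  let ?b = "ly_bound N b0 C a"
  note b0 = ly_bound_nonneg[OF assms(2-4), where N=N]
  have first: "(\<Sum>k<M. ?b k) \<le> real N * b0" if "M \<le> N" for M
  proof -
    have "(\<Sum>k<M. ?b k) = (\<Sum>k<M. b0)" using that by (intro sum.cong refl) (subst ly_bound.simps, auto)
    also have "\<dots> \<le> real N * b0" using that assms by (auto intro: mult_right_mono)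
    finally show ?thesis .
  qed
  have sa: "0 \<le> C * (\<Sum>k<M. a k)" for M using assms by (auto intro!: mult_nonneg_nonneg sum_nonneg)
  show ?thesis
  proof (cases "K \<le> N")
    case True
    have "0 \<le> real N * b0" using assms by simp
    then show ?thesis unfolding distrib_left using first[OF True] sa[of K] by linarith
  next
    case False
    then obtain M where M: "K = N + M" by (metis le_iff_add nat_le_linear)
    have "(\<Sum>k<K. ?b k) = (\<Sum>k<N. ?b k) + (\<Sum>k<M. ?b (N + k))" unfolding M by (rule sum_lessThan_split)
    also have "(\<Sum>k<M. ?b (N + k)) = (\<Sum>k<M. ?b k / 2 + C * a k)"
      using N by (intro sum.cong refl) (subst ly_bound.simps, simp)
    also have "\<dots> = (\<Sum>k<M. ?b k) / 2 + C * (\<Sum>k<M. a k)"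
      by (simp add: sum.distrib sum_divide_distrib sum_distrib_left)
    also have "(\<Sum>k<M. ?b k) \<le> (\<Sum>k<K. ?b k)" using b0 M by (intro sum_mono2) auto
    also have "(\<Sum>k<M. a k) \<le> (\<Sum>k<K. a k)" using a M by (intro sum_mono2) auto
    finally have "(\<Sum>k<K. ?b k) \<le> (\<Sum>k<N. ?b k) + ((\<Sum>k<K. ?b k) / 2 + C * (\<Sum>k<K. a k))"
      using assms(3) by (simp add: mult_left_mono)
    then show ?thesis unfolding distrib_left using first[of N] by linarith
  qed
qed

lemma discrete_gronwall:
  fixes a :: "nat \<Rightarrow> real"
  assumes x: "0 < x" and c: "0 \<le> c" and a: "\<And>K. a K \<le> c + x * (\<Sum>k<K. a k)"
  shows "a K \<le> c * (1 + x) ^ K"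
proof (induction K rule: less_induct)
  case (less K)
  have "(\<Sum>k<K. a k) \<le> (\<Sum>k<K. c * (1 + x) ^ k)" using less by (intro sum_mono) auto
  also have "\<dots> = c * (((1 + x) ^ K - 1) / x)"
    using geometric_sum[of "1 + x" K] x by (simp add: sum_distrib_left[symmetric])
  finally have "x * (\<Sum>k<K. a k) \<le> x * (c * (((1 + x) ^ K - 1) / x))" using x by (intro mult_left_mono) auto
  also have "\<dots> = c * ((1 + x) ^ K - 1)" using x by simp
  finally have "x * (\<Sum>k<K. a k) \<le> c * ((1 + x) ^ K - 1)" .
  then show ?case using a[of K] by (simp add: algebra_simps)
qed

lemma exp_lipschitz: "\<bar>exp x - exp y\<bar> \<le> exp M * \<bar>x - y\<bar>" if "x \<le> M" "y \<le> M" for x y M :: real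
proof -
  have *: "exp x - exp y \<le> exp M * (x - y)" if "y \<le> x" "x \<le> M" for x y
  proof -
    have "1 + (y - x) \<le> exp (y - x)" by (rule exp_ge_add_one_self)
    then have "1 - exp (y - x) \<le> x - y" by linarith
    then have "exp x * (1 - exp (y - x)) \<le> exp x * (x - y)" by (intro mult_left_mono) auto
    also have "\<dots> \<le> exp M * (x - y)" using that by (intro mult_right_mono) auto
    finally show ?thesis by (simp add: algebra_simps exp_diff)
  qed
  show ?thesis
  proof (cases "y \<le> x")
    case True
    then have "exp y \<le> exp x" by simp
    with True show ?thesis using *[OF True \<open>x \<le> M\<close>] by simp
  next
    case False
    then have "exp x \<le> exp y" by simp
    with False show ?thesis using *[of x y] \<open>y \<le> M\<close> by simp
  qed
qed

text \<open>The interpolation between the bounds of order one and two of the remainder: only a moment of order \<open>1 + s\<close> is available.\<close>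

lemma exp_remainder:
  fixes x :: real
  assumes "0 < s" "s \<le> 1" "\<bar>x\<bar> \<le> z" "z \<le> M"
  shows "\<bar>exp x - 1 - x\<bar> \<le> 2 * z powr (1 + s) * exp M"
proof -
  have z0: "0 \<le> z" using assms by simp
  have M1: "1 \<le> exp M" using assms z0 by simp
  have lip: "\<bar>exp x - 1\<bar> \<le> exp M * \<bar>x\<bar>" using exp_lipschitz[of x M 0] assms z0 by simp
  show ?thesis
  proof (cases "z \<le> 1")
    case True
    have "\<bar>exp x - 1 - x\<bar> \<le> exp \<bar>x\<bar> * \<bar>x\<bar>\<^sup>2"
    proof -
      have d: "((\<lambda>y. exp y - 1 - y) has_real_derivative exp y - 1) (at y)" for y :: real
        by (auto intro!: derivative_eq_intros)
      show ?thesis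
      proof (cases "x = 0")
        case False
        have "\<exists>y. \<bar>y\<bar> \<le> \<bar>x\<bar> \<and> exp x - 1 - x = x * (exp y - 1)"
        proof (cases "0 < x")
          case True
          from MVT2[OF True d] obtain y where "0 < y" "y < x" "exp x - 1 - x = x * (exp y - 1)" by auto
          then show ?thesis by (intro exI[of _ y]) auto
        next
          case f: False
          then have "x < 0" using False by simp
          from MVT2[OF this d] obtain y where "x < y" "y < 0" "- (exp x - 1 - x) = - x * (exp y - 1)" by auto
          then show ?thesis by (intro exI[of _ y]) auto
        qed
        then obtain y where y: "\<bar>y\<bar> \<le> \<bar>x\<bar>" "exp x - 1 - x = x * (exp y - 1)" by blast
        have "\<bar>exp y - 1\<bar> \<le> exp \<bar>x\<bar> * \<bar>y\<bar>" using exp_lipschitz[of y "\<bar>x\<bar>" 0] y(1) by simp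
        also have "\<dots> \<le> exp \<bar>x\<bar> * \<bar>x\<bar>" using y(1) by simp
        finally have "\<bar>x\<bar> * \<bar>exp y - 1\<bar> \<le> \<bar>x\<bar> * (exp \<bar>x\<bar> * \<bar>x\<bar>)" by (rule mult_left_mono) simp
        then show ?thesis unfolding y(2) abs_mult by (simp only: power2_eq_square ac_simps)
      qed simp
    qed
    also have "\<dots> \<le> exp M * z powr (1 + s)"
    proof (intro mult_mono)
      have "\<bar>x\<bar>\<^sup>2 \<le> z\<^sup>2" using assms by (intro power_mono) auto
      also have "\<dots> \<le> z powr (1 + s)"
      proof (cases "z = 0")
        case False
        then have "z\<^sup>2 = z powr 2" using z0 by (simp add: powr_numeral)
        also have "\<dots> \<le> z powr (1 + s)" using True z0 assms by (intro powr_mono') auto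
        finally show ?thesis .
      qed simp
      finally show "\<bar>x\<bar>\<^sup>2 \<le> z powr (1 + s)" .
    qed (use assms in auto)
    also have "\<dots> \<le> 2 * z powr (1 + s) * exp M" by simp
    finally show ?thesis .
  next
    case False
    have "\<bar>exp x - 1 - x\<bar> \<le> exp M * \<bar>x\<bar> + \<bar>x\<bar>" using lip by linarith
    also have "\<dots> \<le> exp M * \<bar>x\<bar> + exp M * \<bar>x\<bar>" using mult_right_mono[OF M1, of "\<bar>x\<bar>"] by linarith
    also have "\<dots> \<le> 2 * (exp M * z)" using assms by simp
    also have "z \<le> z powr (1 + s)"
      using False assms powr_mono[of 1 "1 + s" z] by simp
    finally show ?thesis by (simp add: mult_ac)
  qed
qed

text \<open>The return time is represented by its constant value \<open>\<tau> a\<close> on each branch, and \<open>V\<close> stands for the sum of an observable over one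
  excursion, so its size and variation on a branch are of order \<open>\<tau> a\<close>.\<close>

locale observable_branches = ergodic_branches +
  fixes \<tau> :: "real set \<Rightarrow> nat" and V :: "real \<Rightarrow> real" and v0 s :: real
  assumes \<tau>_pos: "a \<in> \<A> \<Longrightarrow> 1 \<le> \<tau> a"
    and \<tau>_fin: "finite {a \<in> \<A>. \<tau> a \<le> k}"
    and s: "0 < s" "s \<le> 1"
    and \<tau>_sum: "(\<lambda>a. real (\<tau> a) powr (1 + s) * \<kappa> a) summable_on \<A>"
    and cover: "AE x in leb. x \<in> \<Union>\<A>"
    and V_meas [measurable]: "V \<in> borel_measurable leb"
    and v0: "0 < v0"
    and V_bound: "a \<in> \<A> \<Longrightarrow> x \<in> a \<Longrightarrow> \<bar>V x\<bar> \<le> v0 * real (\<tau> a)"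
    and V_var: "a \<in> \<A> \<Longrightarrow> varbound V a (v0 * real (\<tau> a))"
    and V_int: "integrable leb V"
    and V_mean: "(\<integral>x. V x * h x \<partial>leb) = 0"
begin

definition lev :: "nat \<Rightarrow> real set set" where "lev k = {a \<in> \<A>. \<tau> a \<le> k}"

definition region :: "nat \<Rightarrow> real set" where "region k = \<Union>(lev k)"

definition tilted :: "real \<Rightarrow> nat \<Rightarrow> (real \<Rightarrow> real) \<Rightarrow> real \<Rightarrow> real" where
  "tilted t k = weighted (lev k) (\<lambda>x. exp (t * V x))"

definition dens :: "real \<Rightarrow> nat \<Rightarrow> nat \<Rightarrow> real \<Rightarrow> real" where
  "dens t k n = (tilted t k ^^ n) h"

definition S1 :: real where "S1 = infsum (\<lambda>a. real (\<tau> a) powr (1 + s) * \<kappa> a) \<A>"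

lemma lev_finite: "finite (lev k)" and lev_sub: "lev k \<subseteq> \<A>"
  using \<tau>_fin by (auto simp: lev_def)

lemma lev_le: "a \<in> lev k \<Longrightarrow> \<tau> a \<le> k"
  by (simp add: lev_def)

lemma region_sets [measurable]: "region k \<in> sets leb"
proof -
  have "a \<in> sets leb" if "a \<in> lev k" for a
    using that branch[of a] lev_sub[of k] interval_sets_leb by blast
  then show ?thesis unfolding region_def using lev_finite by (intro sets.finite_Union) auto
qed

lemma S1_nonneg: "0 \<le> S1"
  unfolding S1_def using \<kappa>_nonneg by (intro infsum_nonneg) auto

lemma lev_sum_le: "(\<Sum>a\<in>lev k. real (\<tau> a) powr (1 + s) * \<kappa> a) \<le> S1"
  unfolding S1_def using \<kappa>_nonneg lev_finite[of k] lev_sub[of k] by (intro finite_sum_le_infsum[OF \<tau>_sum]) auto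

lemma lev_sum1_le: "(\<Sum>a\<in>lev k. real (\<tau> a) * \<kappa> a) \<le> S1"
proof -
  have "real (\<tau> a) * \<kappa> a \<le> real (\<tau> a) powr (1 + s) * \<kappa> a" if "a \<in> lev k" for a
  proof -
    have a: "a \<in> \<A>" using that lev_sub by blast
    have "real (\<tau> a) powr 1 \<le> real (\<tau> a) powr (1 + s)" using \<tau>_pos[OF a] s by (intro powr_mono) auto
    then show ?thesis using \<kappa>_nonneg[OF a] by (intro mult_right_mono) auto
  qed
  then have "(\<Sum>a\<in>lev k. real (\<tau> a) * \<kappa> a) \<le> (\<Sum>a\<in>lev k. real (\<tau> a) powr (1 + s) * \<kappa> a)" by (rule sum_mono)
  then show ?thesis using lev_sum_le[of k] by linarith
qed

text \<open>The branch is mapped into the unit interval with derivative at least \<open>1 / \<kappa> a\<close>.\<close>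

lemma branch_length: assumes a: "a \<in> \<A>" shows "measure leb a \<le> \<kappa> a"
proof -
  interpret finite_measure leb by (rule finite_measure_lebesgue_on) auto
  have *: "integrable leb (\<lambda>y. transfer F a (\<lambda>x. 1 * G x) (\<lambda>_. 1) y * 1)"
    "(\<integral>y. transfer F a (\<lambda>x. 1 * G x) (\<lambda>_. 1) y * 1 \<partial>leb) = (\<integral>x. indicator a x * (1 * 1 * 1) \<partial>leb)"
    using transfer_branch_integral[OF F_meas a, of "\<lambda>_. 1" 1 "\<lambda>_. 1" 1 "\<lambda>_. 1" 1] by auto
  have aI: "a \<in> sets leb" "a \<subseteq> {0..1}" using branch[OF a] interval_sets_leb by auto
  have "measure leb a = (\<integral>x. indicator a x * (1 * 1 * 1) \<partial>leb)" using aI by (simp add: Int_absorb2)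
  also have "\<dots> = (\<integral>y. transfer F a (\<lambda>x. 1 * G x) (\<lambda>_. 1) y * 1 \<partial>leb)" using *(2) by simp
  also have "\<dots> \<le> (\<integral>y. \<kappa> a \<partial>leb)"
  proof (rule integral_mono[OF *(1)])
    fix y
    show "transfer F a (\<lambda>x. 1 * G x) (\<lambda>_. 1) y * 1 \<le> \<kappa> a"
    proof (cases "\<exists>x\<in>a. F x = y")
      case True
      then obtain x where x: "x \<in> a" "F x = y" by blast
      then have e: "{x. x \<in> a \<and> F x = y} = {x}" using F_inj[OF a] by (auto dest: inj_onD)
      show ?thesis unfolding transfer_def e using \<kappa>_bound[OF a x(1)] by (simp add: G_def)
    next
      case False
      then have e: "{x. x \<in> a \<and> F x = y} = {}" by auto
      show ?thesis unfolding transfer_def e using \<kappa>_nonneg[OF a] by simp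
    qed
  qed auto
  also have "\<dots> = \<kappa> a" by (simp add: measure_restrict_space)
  finally show ?thesis .
qed

text \<open>A branch \<open>a\<close> has length at most \<open>\<kappa> a\<close>.\<close>

lemma level_integral:
  assumes [measurable]: "\<psi> \<in> borel_measurable leb" and c: "\<And>a x. a \<in> lev k \<Longrightarrow> x \<in> a \<Longrightarrow> \<bar>\<psi> x\<bar> \<le> c a"
  shows "integrable leb (\<lambda>x. indicator (region k) x * \<psi> x)"
    and "(\<integral>x. indicator (region k) x * \<bar>\<psi> x\<bar> \<partial>leb) \<le> (\<Sum>a\<in>lev k. c a * \<kappa> a)"
proof -
  interpret finite_measure leb by (rule finite_measure_lebesgue_on) auto
  have c0: "0 \<le> c a" if "a \<in> lev k" for a
  proof -
    have "a \<noteq> {}" using that lev_sub branch by blast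
    then obtain x where "x \<in> a" by blast
    then show ?thesis using c[OF that, of x] by simp
  qed
  have le: "indicator (region k) x * \<bar>\<psi> x\<bar> \<le> (\<Sum>a\<in>lev k. c a * indicator a x)" for x
  proof (cases "x \<in> region k")
    case True
    then obtain a where a: "a \<in> lev k" "x \<in> a" by (auto simp: region_def)
    have "\<bar>\<psi> x\<bar> \<le> c a * indicator a x" using c[OF a] a by simp
    also have "\<dots> \<le> (\<Sum>a\<in>lev k. c a * indicator a x)" using a lev_finite c0 by (intro member_le_sum) auto
    finally show ?thesis using True by simp
  qed (use c0 in \<open>auto intro!: sum_nonneg\<close>)
  have as: "a \<in> sets leb" "a \<subseteq> {0..1}" if "a \<in> lev k" for a
    using that branch[of a] lev_sub[of k] interval_sets_leb by blast+
  have i: "integrable leb (\<lambda>x. \<Sum>a\<in>lev k. c a * indicator a x)"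
    using as by (intro Bochner_Integration.integrable_sum integrable_mult_right integrable_real_indicator) (auto simp: emeasure_eq_measure)
  show int: "integrable leb (\<lambda>x. indicator (region k) x * \<psi> x)"
    by (rule Bochner_Integration.integrable_bound[OF i]) (use le in \<open>auto simp: abs_mult intro!: AE_I2 order_trans[OF le abs_ge_self]\<close>)
  have "(\<integral>x. indicator (region k) x * \<bar>\<psi> x\<bar> \<partial>leb) \<le> (\<integral>x. (\<Sum>a\<in>lev k. c a * indicator a x) \<partial>leb)"
    using i le c0 by (intro integral_mono_AE') (auto intro!: AE_I2 sum_nonneg)
  also have "\<dots> = (\<Sum>a\<in>lev k. c a * measure leb a)"
    using as by (subst Bochner_Integration.integral_sum) (auto intro!: sum.cong integrable_mult_right integrable_real_indicator simp: emeasure_eq_measure Int_absorb2)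
  also have "\<dots> \<le> (\<Sum>a\<in>lev k. c a * \<kappa> a)"
    using branch_length c0 lev_sub by (intro sum_mono mult_left_mono) auto
  finally show "(\<integral>x. indicator (region k) x * \<bar>\<psi> x\<bar> \<partial>leb) \<le> (\<Sum>a\<in>lev k. c a * \<kappa> a)" .
qed

lemma tV_bound:
  assumes "0 < t" "a \<in> lev k" "x \<in> a"
  shows "\<bar>t * V x\<bar> \<le> t * v0 * real (\<tau> a)" "t * v0 * real (\<tau> a) \<le> t * v0 * real k" "t * V x \<le> t * v0 * real k"
proof -
  have a: "a \<in> \<A>" using assms(2) lev_sub by blast
  have "\<bar>t * V x\<bar> = t * \<bar>V x\<bar>" using assms(1) by (simp add: abs_mult)
  also have "\<dots> \<le> t * (v0 * real (\<tau> a))" using V_bound[OF a assms(3)] assms(1) by (intro mult_left_mono) auto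
  finally show 1: "\<bar>t * V x\<bar> \<le> t * v0 * real (\<tau> a)" by (simp add: mult.assoc)
  show 2: "t * v0 * real (\<tau> a) \<le> t * v0 * real k" using lev_le[OF assms(2)] assms(1) v0 by (intro mult_left_mono) auto
  show "t * V x \<le> t * v0 * real k" using 1 2 by linarith
qed

definition tw :: "real \<Rightarrow> nat \<Rightarrow> real set \<Rightarrow> real" where
  "tw t k a = exp (t * v0 * real k) * (t * v0 * real (\<tau> a))"

lemma tilt_weight:
  assumes t: "0 < t" and a: "a \<in> lev k"
  shows "varbound (\<lambda>x. exp (t * V x) - 1) a (tw t k a)" "x \<in> a \<Longrightarrow> \<bar>exp (t * V x) - 1\<bar> \<le> tw t k a"
proof -
  have aA: "a \<in> \<A>" using a lev_sub by blast
  let ?M = "t * v0 * real k"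
  have "varbound (\<lambda>x. t * V x) a (t * v0 * real (\<tau> a))"
    using varbound_cmult[OF V_var[OF aA], of t] t by (simp add: mult.assoc)
  then have "varbound (\<lambda>x. (\<lambda>u. exp u - 1) (t * V x)) a (exp ?M * (t * v0 * real (\<tau> a)))"
  proof (rule varbound_lipschitz_comp)
    fix x y assume "x \<in> a" "y \<in> a"
    then show "\<bar>(exp (t * V y) - 1) - (exp (t * V x) - 1)\<bar> \<le> exp ?M * \<bar>t * V y - t * V x\<bar>"
      using exp_lipschitz[of "t * V y" ?M "t * V x"] tV_bound(3)[OF t a] by simp
  qed simp
  then show "varbound (\<lambda>x. exp (t * V x) - 1) a (tw t k a)" by (simp add: tw_def)
  assume x: "x \<in> a"
  have "0 \<le> ?M" using t v0 by simp
  then have "\<bar>exp (t * V x) - 1\<bar> \<le> exp ?M * \<bar>t * V x\<bar>"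
    using exp_lipschitz[of "t * V x" ?M 0] tV_bound(3)[OF t a x] by simp
  also have "\<dots> \<le> tw t k a" unfolding tw_def using tV_bound(1)[OF t a x] by (intro mult_left_mono) auto
  finally show "\<bar>exp (t * V x) - 1\<bar> \<le> tw t k a" .
qed

lemma tw_sum: assumes "0 < t" shows "(\<Sum>a\<in>lev k. \<kappa> a * tw t k a) \<le> exp (t * v0 * real k) * t * v0 * S1"
proof -
  have "(\<Sum>a\<in>lev k. \<kappa> a * tw t k a) = exp (t * v0 * real k) * t * v0 * (\<Sum>a\<in>lev k. real (\<tau> a) * \<kappa> a)"
    by (simp add: tw_def sum_distrib_left mult_ac)
  also have "\<dots> \<le> exp (t * v0 * real k) * t * v0 * S1"
    using lev_sum1_le assms v0 by (intro mult_left_mono) auto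
  finally show ?thesis .
qed

lemma remainder_integral:
  assumes t: "0 < t"
  shows "integrable leb (\<lambda>x. indicator (region k) x * (exp (t * V x) - 1 - t * V x))"
    and "(\<integral>x. indicator (region k) x * \<bar>exp (t * V x) - 1 - t * V x\<bar> \<partial>leb)
          \<le> t * (2 * v0 powr (1 + s) * S1 * (t powr s * exp (t * v0 * real k)))"
proof -
  have *: "\<bar>exp (t * V x) - 1 - t * V x\<bar> \<le> 2 * (t * v0 * real (\<tau> a)) powr (1 + s) * exp (t * v0 * real k)"
    if "a \<in> lev k" "x \<in> a" for a x
    using exp_remainder[OF s tV_bound(1,2)[OF t that]] .
  show "integrable leb (\<lambda>x. indicator (region k) x * (exp (t * V x) - 1 - t * V x))"
    by (rule level_integral(1)[OF _ *]) measurable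
  have "(\<integral>x. indicator (region k) x * \<bar>exp (t * V x) - 1 - t * V x\<bar> \<partial>leb)
     \<le> (\<Sum>a\<in>lev k. 2 * (t * v0 * real (\<tau> a)) powr (1 + s) * exp (t * v0 * real k) * \<kappa> a)"
    by (rule level_integral(2)[OF _ *]) measurable
  also have "\<dots> = 2 * (t * v0) powr (1 + s) * exp (t * v0 * real k) * (\<Sum>a\<in>lev k. real (\<tau> a) powr (1 + s) * \<kappa> a)"
    using t v0 by (simp add: powr_mult sum_distrib_left mult_ac)
  also have "\<dots> \<le> 2 * (t * v0) powr (1 + s) * exp (t * v0 * real k) * S1"
    using lev_sum_le by (intro mult_left_mono) auto
  also have "\<dots> = t * (2 * v0 powr (1 + s) * S1 * (t powr s * exp (t * v0 * real k)))"
    using t v0 by (simp add: powr_mult powr_add mult_ac)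
  finally show "(\<integral>x. indicator (region k) x * \<bar>exp (t * V x) - 1 - t * V x\<bar> \<partial>leb)
          \<le> t * (2 * v0 powr (1 + s) * S1 * (t powr s * exp (t * v0 * real k)))" .
qed

lemma exp_minus_one_integral:
  assumes t: "0 < t"
  shows "integrable leb (\<lambda>x. indicator (region k) x * (exp (t * V x) - 1))"
    and "(\<integral>x. indicator (region k) x * \<bar>exp (t * V x) - 1\<bar> \<partial>leb) \<le> exp (t * v0 * real k) * t * v0 * S1"
proof -
  show "integrable leb (\<lambda>x. indicator (region k) x * (exp (t * V x) - 1))"
    by (rule level_integral(1)[OF _ tilt_weight(2)[OF t]]) measurable
  have "(\<integral>x. indicator (region k) x * \<bar>exp (t * V x) - 1\<bar> \<partial>leb) \<le> (\<Sum>a\<in>lev k. tw t k a * \<kappa> a)"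
    by (rule level_integral(2)[OF _ tilt_weight(2)[OF t]]) measurable
  then show "(\<integral>x. indicator (region k) x * \<bar>exp (t * V x) - 1\<bar> \<partial>leb) \<le> exp (t * v0 * real k) * t * v0 * S1"
    using tw_sum[OF t, of k] by (simp add: mult.commute)
qed

text \<open>The branches cover almost everything and \<open>V\<close> is integrable, so dominated convergence applies.\<close>

lemma tail_levels:
  assumes "0 < \<omega>"
  shows "\<exists>k0. \<forall>k\<ge>k0. (\<integral>x. indicator (- region k) x * \<bar>V x\<bar> \<partial>leb) \<le> \<omega> \<and> (\<integral>x. indicator (- region k) x \<partial>leb) \<le> \<omega>"
proof -
  have m[measurable]: "indicator (- region k) \<in> borel_measurable leb" for k
  proof -
    have "indicator (- region k) = (\<lambda>x. 1 - indicator (region k) x :: real)" by (auto simp: indicator_def)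
    then show ?thesis by simp
  qed
  have lim: "(\<lambda>k. \<integral>x. indicator (- region k) x * g x \<partial>leb) \<longlonglongrightarrow> (\<integral>x. 0 \<partial>leb)" if g: "integrable leb g" for g :: "real \<Rightarrow> real"
  proof (rule integral_dominated_convergence[where w="\<lambda>x. \<bar>g x\<bar>"])
    have [measurable]: "g \<in> borel_measurable leb" using g by auto
    show "(\<lambda>x. indicator (- region k) x * g x) \<in> borel_measurable leb" for k by measurable
    show "integrable leb (\<lambda>x. \<bar>g x\<bar>)" using g by simp
    show "AE x in leb. norm (indicator (- region k) x * g x) \<le> \<bar>g x\<bar>" for k by (auto simp: indicator_def)
    show "AE x in leb. (\<lambda>k. indicator (- region k) x * g x) \<longlonglongrightarrow> 0"
      using cover
    proof eventually_elim
      case (elim x)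
      then obtain a where a: "a \<in> \<A>" "x \<in> a" by blast
      have "x \<in> region k" if "\<tau> a \<le> k" for k using a that by (auto simp: region_def lev_def)
      then have "\<forall>\<^sub>F k in sequentially. indicator (- region k) x * g x = 0"
        by (intro eventually_sequentiallyI[of "\<tau> a"]) auto
      then show ?case by (rule tendsto_eventually)
    qed
  qed simp
  have i1: "integrable leb (\<lambda>x. 1 :: real)" by (rule leb_bounded_integrable[where B=1]) auto
  have "\<forall>\<^sub>F k in sequentially. (\<integral>x. indicator (- region k) x * \<bar>V x\<bar> \<partial>leb) < \<omega>"
    using lim[OF integrable_abs[OF V_int]] assms by (intro order_tendstoD) auto
  moreover have "\<forall>\<^sub>F k in sequentially. (\<integral>x. indicator (- region k) x * 1 \<partial>leb) < \<omega>"
    using lim[OF i1] assms by (intro order_tendstoD) auto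
  ultimately have "\<forall>\<^sub>F k in sequentially. (\<integral>x. indicator (- region k) x * \<bar>V x\<bar> \<partial>leb) \<le> \<omega> \<and> (\<integral>x. indicator (- region k) x \<partial>leb) \<le> \<omega>"
    by eventually_elim auto
  then show ?thesis by (simp add: eventually_sequentially)
qed

lemma exp_tV_bound: "0 < t \<Longrightarrow> x \<in> \<Union>(lev k) \<Longrightarrow> \<bar>exp (t * V x)\<bar> \<le> exp (t * v0 * real k)"
  using tV_bound(3)[of t _ k x] by auto

lemma exp_tV_meas: "(\<lambda>x. exp (t * V x)) \<in> borel_measurable leb" by measurable

lemma tilted_integral:
  assumes t: "0 < t" and u: "bv0 u B"
    and \<phi>: "\<phi> \<in> borel_measurable leb" "\<And>x. x \<in> {0..1} \<Longrightarrow> \<bar>\<phi> x\<bar> \<le> B''"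
  shows "integrable leb (\<lambda>x. indicator (region k) x * (exp (t * V x) * u x * \<phi> (F x)))"
    and "integrable leb (\<lambda>y. tilted t k u y * \<phi> y)"
    and "(\<integral>y. tilted t k u y * \<phi> y \<partial>leb) = (\<integral>x. indicator (region k) x * (exp (t * V x) * u x * \<phi> (F x)) \<partial>leb)"
  using weighted_integral[OF F_meas lev_finite lev_sub bv0_leb[OF u] bv0_bound[OF u] exp_tV_meas exp_tV_bound[OF t] \<phi>, of k]
  by (auto simp: tilted_def region_def)

lemma dens_nonneg: "0 \<le> dens t k n x"
proof (induction n arbitrary: x)
  case (Suc n)
  have "dens t k (Suc n) x = transfer F (\<Union>(lev k)) (\<lambda>x. exp (t * V x) * G x) (dens t k n) x"
    by (simp add: dens_def tilted_def weighted_def)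
  moreover have "0 \<le> \<dots>" using Suc by (intro transfer_nonneg) (simp add: G_def)
  ultimately show ?case by simp
qed (simp add: dens_def h_nonneg)

lemma dens_Suc: "dens t k (Suc n) = tilted t k (dens t k n)"
  by (simp add: dens_def)

text \<open>Almost no mass of \<open>h\<close> is mapped into \<open>{h = 0}\<close>, because \<open>h\<close> is an invariant density; the property passes to densities
  dominated by \<open>h\<close> in the sense of null sets.\<close>

lemma dens_abs_cont:
  assumes t: "0 < t" and b: "\<And>n. bv0 (dens t k n) (b n)"
  shows "AE x in leb. h x = 0 \<longrightarrow> dens t k n x = 0"
proof (induction n)
  case (Suc n)
  define Z where "Z x = (if h x = 0 then 1 else 0 :: real)" for x
  have Zm[measurable]: "Z \<in> borel_measurable leb" unfolding Z_def by measurable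
  have "(\<integral>x. h x * Z (F x) \<partial>leb) = (\<integral>x. h x * Z x \<partial>leb)" by (rule h_invariant) measurable
  also have "(\<lambda>x. h x * Z x) = (\<lambda>x. 0)" by (auto simp: Z_def)
  finally have "(\<integral>x. h x * Z (F x) \<partial>leb) = 0" by simp
  moreover have "integrable leb (\<lambda>x. h x * Z (F x))"
    by (rule leb_bounded_integrable[where B=H]) (use h_le h_nonneg in \<open>auto simp: Z_def intro: order_trans[OF h_nonneg h_le]\<close>)
  ultimately have "AE x in leb. h x * Z (F x) = 0"
    using h_nonneg by (subst integral_nonneg_eq_0_iff_AE[symmetric]) (auto simp: Z_def)
  then have z: "AE x in leb. indicator (region k) x * (exp (t * V x) * dens t k n x * Z (F x)) = 0"
    using Suc by eventually_elim auto
  note ti = tilted_integral[OF t b[of n] Zm, where k=k and B''=1]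
  have "(\<integral>y. tilted t k (dens t k n) y * Z y \<partial>leb) = (\<integral>x. indicator (region k) x * (exp (t * V x) * dens t k n x * Z (F x)) \<partial>leb)"
    by (rule ti(3)) (auto simp: Z_def)
  also have "\<dots> = (\<integral>x. 0 \<partial>leb)"
    by (rule integral_cong_AE) (use z bv0_leb[OF b] in \<open>auto\<close>)
  finally have "(\<integral>y. dens t k (Suc n) y * Z y \<partial>leb) = 0" by (simp add: dens_Suc)
  moreover have "integrable leb (\<lambda>y. dens t k (Suc n) y * Z y)"
    unfolding dens_Suc by (rule ti(2)) (auto simp: Z_def)
  ultimately have "AE y in leb. dens t k (Suc n) y * Z y = 0"
    using dens_nonneg[of t k "Suc n"] by (subst integral_nonneg_eq_0_iff_AE[symmetric]) (auto simp: Z_def)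
  then show ?case by eventually_elim (auto simp: Z_def split: if_splits)
qed (simp add: dens_def)

text \<open>Expand \<open>exp (t V)\<close> to first order on the branches that are kept; on the rest of the interval the mass is lost, and the linear term
  that has been added there is bounded with \<open>\<bar>V\<bar>\<close>.\<close>

lemma mass_increment:
  assumes t: "0 < t" and u: "bv0 u B" "\<And>x. 0 \<le> u x"
    and eR: "t powr s * exp (t * v0 * real k) \<le> \<omega>" and eV: "(\<integral>x. indicator (- region k) x * \<bar>V x\<bar> \<partial>leb) \<le> \<omega>"
  shows "(\<integral>x. tilted t k u x \<partial>leb) \<le> (\<integral>x. u x \<partial>leb) + t * (\<integral>x. V x * u x \<partial>leb) + t * ((2 * v0 powr (1 + s) * S1 + 1) * \<omega> * B)"
proof -
  have um[measurable]: "u \<in> borel_measurable leb" using u(1) by (rule bv0_leb)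
  have ub: "\<bar>u x\<bar> \<le> B" for x using bv0_bound[OF u(1)] .
  have B0: "0 \<le> B" using u(1) by (rule bv0_nonneg)
  have m[measurable]: "(\<lambda>x. indicator (- region k) x :: real) \<in> borel_measurable leb"
  proof -
    have "indicator (- region k) = (\<lambda>x. 1 - indicator (region k) x :: real)" by (auto simp: indicator_def)
    then show ?thesis by simp
  qed
  define R where "R x = indicator (region k) x * (exp (t * V x) - 1 - t * V x)" for x
  define Q where "Q x = indicator (- region k) x * \<bar>V x\<bar>" for x
  have iR: "integrable leb (\<lambda>x. \<bar>R x\<bar>)" unfolding R_def using remainder_integral(1)[OF t] by (rule integrable_abs)
  have iQ: "integrable leb Q" unfolding Q_def
    by (rule Bochner_Integration.integrable_bound[OF V_int]) (auto simp: indicator_def)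
  have iV: "integrable leb (\<lambda>x. V x * u x)"
    by (rule Bochner_Integration.integrable_bound[OF integrable_mult_left[OF integrable_abs[OF V_int], of B]])
      (use ub B0 in \<open>auto simp: abs_mult intro!: AE_I2 mult_left_mono\<close>)
  note ti = tilted_integral[OF t u(1), of "\<lambda>_. 1" 1 k, simplified]
  have "(\<integral>x. tilted t k u x \<partial>leb) = (\<integral>x. indicator (region k) x * (exp (t * V x) * u x) \<partial>leb)" by (rule ti(3))
  also have "\<dots> \<le> (\<integral>x. u x + t * (V x * u x) + B * \<bar>R x\<bar> + t * B * Q x \<partial>leb)"
  proof (rule integral_mono)
    show "integrable leb (\<lambda>x. indicator (region k) x * (exp (t * V x) * u x))" by (rule ti(1))
    show "integrable leb (\<lambda>x. u x + t * (V x * u x) + B * \<bar>R x\<bar> + t * B * Q x)"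
      using bv0_integrable[OF u(1)] iR iQ iV by auto
    fix x
    show "indicator (region k) x * (exp (t * V x) * u x) \<le> u x + t * (V x * u x) + B * \<bar>R x\<bar> + t * B * Q x"
    proof (cases "x \<in> region k")
      case True
      have "exp (t * V x) * u x - u x - t * (V x * u x) = R x * u x" using True by (simp add: R_def algebra_simps)
      also have "\<dots> \<le> \<bar>R x\<bar> * \<bar>u x\<bar>" unfolding abs_mult[symmetric] by (rule abs_ge_self)
      also have "\<dots> \<le> \<bar>R x\<bar> * B" using ub[of x] by (intro mult_left_mono) auto
      finally show ?thesis using True by (simp add: Q_def mult.commute)
    next
      case False
      have "- (V x * u x) \<le> \<bar>V x\<bar> * u x" using u(2)[of x] by (metis abs_ge_minus_self minus_mult_left mult_right_mono)
      also have "\<dots> \<le> \<bar>V x\<bar> * B" using ub[of x] by (intro mult_left_mono) auto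
      finally have "0 \<le> t * (V x * u x + \<bar>V x\<bar> * B)" using t by simp
      then show ?thesis using False u(2)[of x] by (simp add: R_def Q_def algebra_simps)
    qed
  qed
  also have "\<dots> = (\<integral>x. u x \<partial>leb) + t * (\<integral>x. V x * u x \<partial>leb) + B * (\<integral>x. \<bar>R x\<bar> \<partial>leb) + t * B * (\<integral>x. Q x \<partial>leb)"
    using bv0_integrable[OF u(1)] iR iQ iV by simp
  also have "\<dots> \<le> (\<integral>x. u x \<partial>leb) + t * (\<integral>x. V x * u x \<partial>leb) + t * ((2 * v0 powr (1 + s) * S1 + 1) * \<omega> * B)"
  proof -
    have "(\<integral>x. \<bar>R x\<bar> \<partial>leb) \<le> t * (2 * v0 powr (1 + s) * S1 * (t powr s * exp (t * v0 * real k)))"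
      using remainder_integral(2)[OF t, of k] by (simp add: R_def abs_mult)
    also have "\<dots> \<le> t * (2 * v0 powr (1 + s) * S1 * \<omega>)"
      using eR t S1_nonneg by (intro mult_left_mono) auto
    finally have "B * (\<integral>x. \<bar>R x\<bar> \<partial>leb) \<le> B * (t * (2 * v0 powr (1 + s) * S1 * \<omega>))" using B0 by (rule mult_left_mono)
    moreover have "t * B * (\<integral>x. Q x \<partial>leb) \<le> t * B * \<omega>" unfolding Q_def using eV t B0 by (intro mult_left_mono) auto
    ultimately show ?thesis by (simp add: algebra_simps)
  qed
  finally show ?thesis .
qed

text \<open>By duality the second integral is that of \<open>exp (t V) * u\<close> over the part of the preimage of \<open>A\<close> in the branches that are kept.
  So the defect has two sources: the mass outside these branches and the factor \<open>exp (t V) - 1\<close>.\<close>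

lemma invariance_defect:
  assumes t: "0 < t" "t \<le> 1" and u: "bv0 u B" and A: "A \<in> sets leb"
    and eR: "t powr s * exp (t * v0 * real k) \<le> \<omega>" and eD: "(\<integral>x. indicator (- region k) x \<partial>leb) \<le> \<omega>"
  shows "\<bar>(\<integral>x. u x * indicator A (F x) \<partial>leb) - (\<integral>x. tilted t k u x * indicator A x \<partial>leb)\<bar> \<le> (v0 * S1 + 1) * \<omega> * B"
proof -
  note [measurable] = A
  have um[measurable]: "u \<in> borel_measurable leb" using u by (rule bv0_leb)
  have ub: "\<bar>u x\<bar> \<le> B" for x using bv0_bound[OF u] .
  have B0: "0 \<le> B" using u by (rule bv0_nonneg)
  have m[measurable]: "(\<lambda>x. indicator (- region k) x :: real) \<in> borel_measurable leb"
  proof -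
    have "indicator (- region k) = (\<lambda>x. 1 - indicator (region k) x :: real)" by (auto simp: indicator_def)
    then show ?thesis by simp
  qed
  note ti = tilted_integral[OF t(1) u, of "indicator A" 1 k]
  have i1: "integrable leb (\<lambda>x. u x * indicator A (F x))"
    by (rule leb_bounded_integrable[where B=B]) (use ub B0 in \<open>auto simp: indicator_def\<close>)
  have ti3: "(\<integral>x. tilted t k u x * indicator A x \<partial>leb) = (\<integral>x. indicator (region k) x * (exp (t * V x) * u x * indicator A (F x)) \<partial>leb)"
    and ti1: "integrable leb (\<lambda>x. indicator (region k) x * (exp (t * V x) * u x * indicator A (F x)))"
    by (rule ti; auto simp: indicator_def)+
  define R where "R x = indicator (region k) x * (exp (t * V x) - 1)" for x
  have iR: "integrable leb (\<lambda>x. \<bar>R x\<bar>)" unfolding R_def using exp_minus_one_integral(1)[OF t(1)] by (rule integrable_abs)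
  have iQ: "integrable leb (\<lambda>x. indicator (- region k) x :: real)"
    by (rule leb_bounded_integrable[where B=1]) (auto simp: indicator_def)
  have eq: "(\<integral>x. u x * indicator A (F x) \<partial>leb) - (\<integral>x. tilted t k u x * indicator A x \<partial>leb)
     = (\<integral>x. u x * indicator A (F x) - indicator (region k) x * (exp (t * V x) * u x * indicator A (F x)) \<partial>leb)"
    unfolding ti3 using i1 ti1 by simp
  have "\<bar>(\<integral>x. u x * indicator A (F x) \<partial>leb) - (\<integral>x. tilted t k u x * indicator A x \<partial>leb)\<bar> \<le> (\<integral>x. \<bar>u x * indicator A (F x) - indicator (region k) x * (exp (t * V x) * u x * indicator A (F x))\<bar> \<partial>leb)"
    unfolding eq by (rule integral_abs_bound)
  also have "\<dots> \<le> (\<integral>x. B * \<bar>R x\<bar> + B * indicator (- region k) x \<partial>leb)"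
  proof (rule integral_mono)
    show "integrable leb (\<lambda>x. \<bar>u x * indicator A (F x) - indicator (region k) x * (exp (t * V x) * u x * indicator A (F x))\<bar>)"
      using i1 ti1 by (intro integrable_abs Bochner_Integration.integrable_diff)
    show "integrable leb (\<lambda>x. B * \<bar>R x\<bar> + B * indicator (- region k) x)" using iR iQ by auto
    fix x
    show "\<bar>u x * indicator A (F x) - indicator (region k) x * (exp (t * V x) * u x * indicator A (F x))\<bar> \<le> B * \<bar>R x\<bar> + B * indicator (- region k) x"
    proof (cases "x \<in> region k")
      case True
      have "\<bar>u x * indicator A (F x) - exp (t * V x) * u x * indicator A (F x)\<bar> = \<bar>exp (t * V x) - 1\<bar> * \<bar>u x\<bar> * indicator A (F x)"
        by (auto simp: indicator_def abs_mult[symmetric] left_diff_distrib abs_minus_commute)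
      also have "\<dots> \<le> \<bar>exp (t * V x) - 1\<bar> * B"
        using ub[of x] B0 by (auto simp: indicator_def intro: mult_left_mono)
      finally show ?thesis using True by (simp add: R_def mult.commute)
    next
      case False
      then show ?thesis using ub[of x] B0 by (auto simp: R_def indicator_def)
    qed
  qed
  also have "\<dots> = B * (\<integral>x. \<bar>R x\<bar> \<partial>leb) + B * (\<integral>x. indicator (- region k) x \<partial>leb)" using iR iQ by simp
  also have "\<dots> \<le> B * (v0 * S1 * \<omega>) + B * \<omega>"
  proof (intro add_mono mult_left_mono B0 eD)
    have "(\<integral>x. \<bar>R x\<bar> \<partial>leb) \<le> exp (t * v0 * real k) * t * v0 * S1"
      using exp_minus_one_integral(2)[OF t(1), of k] by (simp add: R_def abs_mult)
    also have "\<dots> = v0 * S1 * (t powr 1 * exp (t * v0 * real k))" using t by simp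
    also have "\<dots> \<le> v0 * S1 * (t powr s * exp (t * v0 * real k))"
      using t s v0 S1_nonneg by (intro mult_left_mono mult_right_mono powr_mono') auto
    also have "\<dots> \<le> v0 * S1 * \<omega>" using eR v0 S1_nonneg by (intro mult_left_mono) auto
    finally show "(\<integral>x. \<bar>R x\<bar> \<partial>leb) \<le> v0 * S1 * \<omega>" .
  qed
  finally show ?thesis by (simp add: algebra_simps)
qed

text \<open>The mass of the \<open>n\<close>-th density is the exponential moment of the Birkhoff sum of \<open>V\<close>, restricted to orbits that stay in the
  branches that are kept.\<close>

lemma koopman_iterate:
  assumes t: "0 < t" and b: "\<And>n. bv0 (dens t k n) (b n)"
    and \<phi>: "\<phi> \<in> borel_measurable leb" "\<And>x. x \<in> {0..1} \<Longrightarrow> \<bar>\<phi> x\<bar> \<le> B"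
  shows "(\<integral>x. dens t k n x * \<phi> x \<partial>leb) = (\<integral>x. h x * (iter_weight (\<lambda>x. indicator (region k) x * exp (t * V x)) n x * \<phi> ((F ^^ n) x)) \<partial>leb)"
  using \<phi>
proof (induction n arbitrary: \<phi> B)
  case 0 show ?case by (simp add: dens_def iter_weight_def)
next
  case (Suc n)
  let ?\<psi> = "\<lambda>x. indicator (region k) x * exp (t * V x) * \<phi> (F x)"
  note [measurable] = Suc.prems(1)
  have m: "?\<psi> \<in> borel_measurable leb" by measurable
  have bd: "\<bar>?\<psi> x\<bar> \<le> exp (t * v0 * real k) * \<bar>B\<bar>" if x: "x \<in> {0..1}" for x
  proof (cases "x \<in> region k")
    case True
    then show ?thesis using exp_tV_bound[OF t, of x k] Suc.prems(2)[OF F_into[OF x]]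
      by (auto simp: abs_mult region_def intro!: mult_mono)
  qed simp
  have "(\<integral>x. dens t k (Suc n) x * \<phi> x \<partial>leb) = (\<integral>x. indicator (region k) x * (exp (t * V x) * dens t k n x * \<phi> (F x)) \<partial>leb)"
    unfolding dens_Suc by (rule tilted_integral(3)[OF t b Suc.prems])
  also have "\<dots> = (\<integral>x. dens t k n x * ?\<psi> x \<partial>leb)" by (simp only: ac_simps)
  also have "\<dots> = (\<integral>x. h x * (iter_weight (\<lambda>x. indicator (region k) x * exp (t * V x)) n x * ?\<psi> ((F ^^ n) x)) \<partial>leb)"
    by (rule Suc.IH[OF m bd])
  also have "\<dots> = (\<integral>x. h x * (iter_weight (\<lambda>x. indicator (region k) x * exp (t * V x)) (Suc n) x * \<phi> ((F ^^ Suc n) x)) \<partial>leb)"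
    by (simp add: iter_weight_def mult_ac)
  finally show ?case .
qed


text \<open>With \<open>a n\<close> the mass of the \<open>n\<close>-th density and \<open>S K\<close> the sum of the first \<open>K\<close> densities, summing the increments of mass gives
  \<open>a K \<le> 1 + t \<integral> V S K\<close> up to small errors.  The defect of invariance of \<open>S K\<close> is at most about \<open>a K + 1\<close> by telescoping, and the
  variation of \<open>S K\<close> is at most a constant times \<open>1 + \<Sum> a n\<close>.  Hence \<open>a K \<le> 4 + \<epsilon> t \<Sum> a n\<close>, and Gronwall's inequality finishes.\<close>

lemma exponential_moment:
  assumes \<epsilon>: "0 < \<epsilon>"
  shows "\<exists>\<omega> k0. 0 < \<omega> \<and> (\<forall>t k. 0 < t \<and> t \<le> \<omega> \<and> k0 \<le> k \<and> t powr s * exp (t * v0 * real k) \<le> \<omega> \<longrightarrow>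
     (\<forall>n. \<exists>B. bv0 (dens t k n) B) \<and> (\<forall>n. (\<integral>x. dens t k n x \<partial>leb) \<le> 4 * exp (\<epsilon> * t * real n)))"
proof -
  obtain N C KK \<omega>1 A0 where "0 < N \<and> 0 \<le> C \<and> 1 \<le> KK \<and> 0 < \<omega>1 \<and> finite A0 \<and> A0 \<subseteq> \<A> \<and>
    (\<forall>A W w. finite A \<and> A0 \<subseteq> A \<and> A \<subseteq> \<A> \<and> (\<forall>a\<in>A. varbound (\<lambda>x. W x - 1) a (w a) \<and> (\<forall>x\<in>a. \<bar>W x - 1\<bar> \<le> w a)) \<and>
        (\<Sum>a\<in>A. \<kappa> a * w a) \<le> \<omega>1 \<longrightarrow>
      (\<forall>g B. bv0 g B \<longrightarrow> bv0 (weighted A W g) (KK * B) \<and>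
          bv0 ((weighted A W ^^ N) g) (B / 2 + C * (\<integral>x. \<bar>g x\<bar> \<partial>leb))))"
    using uniform_lasota_yorke by (elim exE)
  note U = this
  have N: "0 < N" and C: "0 \<le> C" and KK: "1 \<le> KK" and \<omega>1: "0 < \<omega>1" and A0: "finite A0" "A0 \<subseteq> \<A>"
    using U by - (elim conjE, assumption)+
  have ly: "bv0 (weighted A W g) (KK * B) \<and> bv0 ((weighted A W ^^ N) g) (B / 2 + C * (\<integral>x. \<bar>g x\<bar> \<partial>leb))"
    if "finite A" "A0 \<subseteq> A" "A \<subseteq> \<A>" "\<forall>a\<in>A. varbound (\<lambda>x. W x - 1) a (w a) \<and> (\<forall>x\<in>a. \<bar>W x - 1\<bar> \<le> w a)"
      "(\<Sum>a\<in>A. \<kappa> a * w a) \<le> \<omega>1" "bv0 g B" for A W w g B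
    by (rule U[THEN conjunct2, THEN conjunct2, THEN conjunct2, THEN conjunct2, THEN conjunct2, THEN conjunct2,
          THEN spec, THEN spec, THEN spec, THEN mp, THEN spec, THEN spec, THEN mp], intro conjI) (fact that)+
  have H0: "0 \<le> H" using h_bv by (rule bv0_nonneg)
  define b0 where "b0 = KK ^ N * H"
  have b00: "0 \<le> b0" using KK H0 by (simp add: b0_def)
  define C1 where "C1 = 2 * (real N * b0 + C) + 1"
  have C1: "0 < C1" using b00 C by (simp add: C1_def add_nonneg_pos)
  define \<epsilon>1 where "\<epsilon>1 = \<epsilon> / (4 * C1)"
  have \<epsilon>1: "0 < \<epsilon>1" "4 * \<epsilon>1 * C1 = \<epsilon>" using \<epsilon> C1 by (simp_all add: \<epsilon>1_def)
  obtain C2 where "0 \<le> C2 \<and> (\<forall>g B d. bv0 g B \<and> (AE x in leb. h x = 0 \<longrightarrow> g x = 0) \<and>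
      (\<forall>A\<in>sets leb. \<bar>(\<integral>x. g x * indicator A (F x) \<partial>leb) - (\<integral>x. g x * indicator A x \<partial>leb)\<bar> \<le> d) \<longrightarrow>
      \<bar>\<integral>x. V x * g x \<partial>leb\<bar> \<le> \<epsilon>1 * B + C2 * d)"
    using almost_invariant_integral[OF V_int V_mean \<epsilon>1(1)] by (elim exE)
  then have C2: "0 \<le> C2" and inv: "\<And>g B d. bv0 g B \<Longrightarrow> (AE x in leb. h x = 0 \<longrightarrow> g x = 0) \<Longrightarrow>
      (\<And>A. A \<in> sets leb \<Longrightarrow> \<bar>(\<integral>x. g x * indicator A (F x) \<partial>leb) - (\<integral>x. g x * indicator A x \<partial>leb)\<bar> \<le> d) \<Longrightarrow>
      \<bar>\<integral>x. V x * g x \<partial>leb\<bar> \<le> \<epsilon>1 * B + C2 * d"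
    by simp_all
  define P where "P = 2 * v0 powr (1 + s) * S1 + 1"
  define Q where "Q = v0 * S1 + 1"
  have PQ: "1 \<le> P" "1 \<le> Q" using S1_nonneg v0 by (simp_all add: P_def Q_def)
  \<comment> \<open>The first quotient controls the errors proportional to the variation, the second one the Lasota--Yorke perturbation.\<close>
  define \<omega> where "\<omega> = min 1 (min (\<epsilon>1 / (C2 * Q + P)) (min (\<omega>1 / Q) (min (1 / (2 * C2 + 1)) (1 / \<epsilon>))))"
  have den: "0 < C2 * Q + P" "0 < Q" "0 < 2 * C2 + 1"
    using PQ C2 mult_nonneg_nonneg[of C2 Q] by linarith+
  have \<omega>0: "0 < \<omega>" using den \<epsilon>1(1) \<omega>1 \<epsilon> by (simp add: \<omega>_def)
  have \<omega>: "\<omega> \<le> 1" "\<omega> * (C2 * Q + P) \<le> \<epsilon>1" "\<omega> * Q \<le> \<omega>1" "\<omega> * (2 * C2 + 1) \<le> 1" "\<omega> * \<epsilon> \<le> 1"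
    unfolding pos_le_divide_eq[OF den(1), symmetric] pos_le_divide_eq[OF den(2), symmetric]
      pos_le_divide_eq[OF den(3), symmetric] pos_le_divide_eq[OF \<epsilon>, symmetric]
    by (simp_all add: \<omega>_def)
  obtain k2 where k2': "\<forall>k\<ge>k2. (\<integral>x. indicator (- region k) x * \<bar>V x\<bar> \<partial>leb) \<le> \<omega> \<and> (\<integral>x. indicator (- region k) x \<partial>leb) \<le> \<omega>"
    using tail_levels[OF \<omega>0] by (elim exE)
  note k2 = k2'[rule_format]
  define k0 where "k0 = max k2 (\<Sum>a\<in>A0. \<tau> a)"
  have main: "(\<forall>n. \<exists>B. bv0 (dens t k n) B) \<and> (\<forall>n. (\<integral>x. dens t k n x \<partial>leb) \<le> 4 * exp (\<epsilon> * t * real n))"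
    if t: "0 < t" "t \<le> \<omega>" and k: "k0 \<le> k" and E: "t powr s * exp (t * v0 * real k) \<le> \<omega>" for t k
  proof -
    have t1: "t \<le> 1" using t \<omega>(1) by linarith
    have tail: "(\<integral>x. indicator (- region k) x * \<bar>V x\<bar> \<partial>leb) \<le> \<omega>" "(\<integral>x. indicator (- region k) x \<partial>leb) \<le> \<omega>"
      using k2[of k] k by (simp_all add: k0_def)
    have A0k: "A0 \<subseteq> lev k"
    proof
      fix a assume a: "a \<in> A0"
      have "\<tau> a \<le> (\<Sum>a\<in>A0. \<tau> a)" using a A0(1) by (intro member_le_sum) auto
      then show "a \<in> lev k" using a A0(2) k by (auto simp: lev_def k0_def)
    qed
    have w: "(\<Sum>a\<in>lev k. \<kappa> a * tw t k a) \<le> \<omega>1"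
    proof -
      have "exp (t * v0 * real k) * t * v0 * S1 = v0 * S1 * (t powr 1 * exp (t * v0 * real k))" using t by simp
      also have "\<dots> \<le> v0 * S1 * (t powr s * exp (t * v0 * real k))"
        using t t1 s v0 S1_nonneg by (intro mult_left_mono mult_right_mono powr_mono') auto
      also have "\<dots> \<le> v0 * S1 * \<omega>" using E v0 S1_nonneg by (intro mult_left_mono) auto
      also have "\<dots> \<le> \<omega> * Q" using \<omega>0 by (simp add: Q_def algebra_simps)
      finally show ?thesis using tw_sum[OF t(1), of k] \<omega>(3) by linarith
    qed
    have ly': "bv0 (tilted t k g) (KK * B)" "bv0 ((tilted t k ^^ N) g) (B / 2 + C * (\<integral>x. \<bar>g x\<bar> \<partial>leb))" if "bv0 g B" for g B
      using ly[OF lev_finite A0k lev_sub _ w that, of "\<lambda>x. exp (t * V x)"] tilt_weight[OF t(1)]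
      unfolding tilted_def by blast+
    define a where "a n = (\<integral>x. dens t k n x \<partial>leb)" for n
    have a0: "0 \<le> a n" for n unfolding a_def by (intro Bochner_Integration.integral_nonneg dens_nonneg)
    define b where "b = ly_bound N b0 C a"
    have bv: "bv0 (dens t k n) (b n)" for n
    proof (induction n rule: less_induct)
      case (less n)
      show ?case
      proof (cases "n < N")
        case True
        have "bv0 (dens t k j) (KK ^ j * H)" for j
        proof (induction j)
          case (Suc j) then show ?case using ly'(1)[OF Suc] by (simp add: dens_Suc mult.assoc)
        qed (simp add: dens_def h_bv)
        moreover have "KK ^ n * H \<le> b0" unfolding b0_def using True KK H0 by (intro mult_right_mono power_increasing) auto
        ultimately have "bv0 (dens t k n) b0" using bv0_mono by blast
        then show ?thesis unfolding b_def using True by (subst ly_bound.simps) simp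
      next
        case False
        have "dens t k n = (tilted t k ^^ (N + (n - N))) h" using False by (simp add: dens_def)
        then have e: "dens t k n = (tilted t k ^^ N) (dens t k (n - N))" by (simp add: funpow_add dens_def)
        have "bv0 (dens t k n) (b (n - N) / 2 + C * (\<integral>x. \<bar>dens t k (n - N) x\<bar> \<partial>leb))"
          unfolding e by (rule ly'(2)) (use less False N in simp)
        then have "bv0 (dens t k n) (b (n - N) / 2 + C * a (n - N))" using dens_nonneg by (simp add: a_def)
        then show ?thesis unfolding b_def using False N by (subst ly_bound.simps) simp
      qed
    qed
    define S where "S K x = (\<Sum>n<K. dens t k n x)" for K x
    define X where "X K = (\<Sum>n<K. b n)" for K
    have SX: "bv0 (S K) (X K)" for K unfolding S_def[abs_def] X_def using bv by (intro bv0_sum)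
    have X0: "0 \<le> X K" for K using SX by (rule bv0_nonneg)
    have X_le: "X K \<le> C1 * (1 + (\<Sum>n<K. a n))" for K
    proof -
      have sn: "0 \<le> (\<Sum>n<K. a n)" using a0 by (intro sum_nonneg) auto
      have "X K \<le> 2 * (real N * b0 + C * (\<Sum>n<K. a n))"
        unfolding X_def b_def by (rule ly_bound_sum[OF N b00 C a0])
      also have "\<dots> \<le> C1 * (1 + (\<Sum>n<K. a n))"
      proof -
        have "0 \<le> real N * b0 * (\<Sum>n<K. a n)" using b00 sn by simp
        then show ?thesis using C sn by (simp add: C1_def algebra_simps)
      qed
      finally show ?thesis .
    qed
    have iVd: "integrable leb (\<lambda>x. V x * u x)" if u: "bv0 u B" for u B
    proof (rule Bochner_Integration.integrable_bound[OF integrable_mult_left[OF integrable_abs[OF V_int], of B]])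
      show "(\<lambda>x. V x * u x) \<in> borel_measurable leb" using bv0_leb[OF u] by measurable
      show "AE x in leb. norm (V x * u x) \<le> norm (\<bar>V x\<bar> * B)"
        using bv0_bound[OF u] bv0_nonneg[OF u] by (auto simp: abs_mult intro!: AE_I2 mult_left_mono)
    qed
    have mass: "a K \<le> 1 + t * (\<integral>x. V x * S K x \<partial>leb) + t * (P * \<omega> * X K)" for K
    proof (induction K)
      case 0 show ?case using h_int by (simp add: a_def S_def X_def dens_def)
    next
      case (Suc K)
      have "a (Suc K) \<le> a K + t * (\<integral>x. V x * dens t k K x \<partial>leb) + t * (P * \<omega> * b K)"
        unfolding a_def dens_Suc P_def by (rule mass_increment[OF t(1) bv dens_nonneg E tail(1)])
      moreover have "(\<integral>x. V x * S (Suc K) x \<partial>leb) = (\<integral>x. V x * S K x \<partial>leb) + (\<integral>x. V x * dens t k K x \<partial>leb)"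
        unfolding S_def sum.lessThan_Suc distrib_left using iVd[OF SX[unfolded S_def[abs_def]], of K] iVd[OF bv[of K]]
        by (rule Bochner_Integration.integral_add)
      moreover have "P * \<omega> * X (Suc K) = P * \<omega> * X K + P * \<omega> * b K" by (simp add: X_def distrib_left)
      ultimately show ?case using Suc by (simp only: distrib_left)
    qed
    have iA: "integrable leb (\<lambda>x. u x * indicator A (F x))" "integrable leb (\<lambda>x. u x * indicator A x)"
      if u: "bv0 u B" and A: "A \<in> sets leb" for u B A
    proof -
      note [measurable] = A bv0_leb[OF u]
      show "integrable leb (\<lambda>x. u x * indicator A (F x))" "integrable leb (\<lambda>x. u x * indicator A x)"
        by (rule leb_bounded_integrable[where B=B]; use bv0_bound[OF u] bv0_nonneg[OF u] in \<open>auto simp: indicator_def\<close>)+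
    qed
    \<comment> \<open>The differences between consecutive densities telescope; only the first and the last one remain.\<close>
    have defect: "\<bar>(\<integral>x. S K x * indicator A (F x) \<partial>leb) - (\<integral>x. S K x * indicator A x \<partial>leb)\<bar> \<le> Q * \<omega> * X K + (a K + 1)"
      if A: "A \<in> sets leb" for A K
    proof -
      let ?I = "\<lambda>u. \<integral>x. u x * indicator A x \<partial>leb" and ?J = "\<lambda>u. \<integral>x. u x * indicator A (F x) \<partial>leb"
      have "\<bar>?J (S K) - ?I (S K) - (?I (dens t k K) - ?I h)\<bar> \<le> Q * \<omega> * X K"
      proof (induction K)
        case 0 show ?case by (simp add: S_def X_def dens_def)
      next
        case (Suc K)
        have J: "?J (S (Suc K)) = ?J (S K) + ?J (dens t k K)"
          unfolding S_def sum.lessThan_Suc distrib_right using iA(1)[OF SX[unfolded S_def[abs_def]] A, of K] iA(1)[OF bv[of K] A]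
          by (rule Bochner_Integration.integral_add)
        have I: "?I (S (Suc K)) = ?I (S K) + ?I (dens t k K)"
          unfolding S_def sum.lessThan_Suc distrib_right using iA(2)[OF SX[unfolded S_def[abs_def]] A, of K] iA(2)[OF bv[of K] A]
          by (rule Bochner_Integration.integral_add)
        have "\<bar>?J (dens t k K) - ?I (dens t k (Suc K))\<bar> \<le> Q * \<omega> * b K"
          unfolding dens_Suc Q_def by (rule invariance_defect[OF t(1) t1 bv A E tail(2)])
        moreover have "Q * \<omega> * X (Suc K) = Q * \<omega> * X K + Q * \<omega> * b K" by (simp add: X_def distrib_left)
        ultimately show ?case using Suc unfolding I J by linarith
      qed
      moreover have I_le: "0 \<le> ?I u" "?I u \<le> (\<integral>x. u x \<partial>leb)" if u: "bv0 u B" "\<And>x. 0 \<le> u x" for u B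
      proof -
        show "0 \<le> ?I u" using u(2) by (intro Bochner_Integration.integral_nonneg) auto
        show "?I u \<le> (\<integral>x. u x \<partial>leb)"
          using iA(2)[OF u(1) A] bv0_integrable[OF u(1)] u(2) by (intro integral_mono) (auto simp: indicator_def)
      qed
      moreover have "0 \<le> ?I (dens t k K)" "?I (dens t k K) \<le> a K" "0 \<le> ?I h" "?I h \<le> 1"
        using I_le[OF bv dens_nonneg, of K] I_le[OF h_bv h_nonneg] h_int by (simp_all add: a_def)
      ultimately show ?thesis using a0[of K] by linarith
    qed
    have ac: "AE x in leb. h x = 0 \<longrightarrow> S K x = 0" for K
    proof -
      have "\<forall>n. AE x in leb. h x = 0 \<longrightarrow> dens t k n x = 0" using dens_abs_cont[OF t(1) bv] by blast
      then have "AE x in leb. \<forall>n. h x = 0 \<longrightarrow> dens t k n x = 0" unfolding AE_all_countable .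
      then show ?thesis by eventually_elim (simp add: S_def)
    qed
    have rec: "a K \<le> 4 + \<epsilon> * t * (\<Sum>n<K. a n)" for K
    proof -
      let ?s = "\<Sum>n<K. a n"
      have "\<bar>\<integral>x. V x * S K x \<partial>leb\<bar> \<le> \<epsilon>1 * X K + C2 * (Q * \<omega> * X K + (a K + 1))"
        by (rule inv[OF SX ac defect])
      then have "t * (\<integral>x. V x * S K x \<partial>leb) \<le> t * (\<epsilon>1 * X K + C2 * (Q * \<omega> * X K + (a K + 1)))"
        using t by (intro mult_left_mono) auto
      then have "a K \<le> 1 + t * (\<epsilon>1 * X K + C2 * (Q * \<omega> * X K + (a K + 1))) + t * (P * \<omega> * X K)"
        using mass[of K] by linarith
      also have "\<dots> = 1 + t * (\<epsilon>1 * X K + \<omega> * (C2 * Q + P) * X K) + t * C2 * (a K + 1)" by (simp add: algebra_simps)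
      also have "\<dots> \<le> 1 + t * (\<epsilon>1 * X K + \<epsilon>1 * X K) + 1 / 2 * (a K + 1)"
      proof (intro add_mono mult_left_mono mult_right_mono order_refl \<omega>(2) X0)
        have "t * C2 \<le> \<omega> * C2" using t C2 by (intro mult_right_mono) auto
        then show "t * C2 \<le> 1 / 2" using \<omega>(4) \<omega>0 by (simp add: algebra_simps)
      qed (use t a0[of K] \<epsilon>1(1) in auto)
      also have "t * (\<epsilon>1 * X K + \<epsilon>1 * X K) \<le> t * (2 * \<epsilon>1 * (C1 * (1 + ?s)))"
        using X_le[of K] t \<epsilon>1(1) by (intro mult_left_mono) auto
      also have "t * (2 * \<epsilon>1 * (C1 * (1 + ?s))) = t * \<epsilon> / 2 * (1 + ?s)"
        unfolding \<epsilon>1(2)[symmetric] by simp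
      also have "\<dots> = t * \<epsilon> / 2 + t * \<epsilon> / 2 * ?s" by (simp add: distrib_left)
      finally have "a K \<le> 1 + (t * \<epsilon> / 2 + t * \<epsilon> / 2 * ?s) + 1 / 2 * (a K + 1)" by simp
      moreover have "t * \<epsilon> \<le> 1" using mult_right_mono[OF t(2), of \<epsilon>] \<omega>(5) \<epsilon> by linarith
      moreover have "A \<le> 4 + 2 * z" if "A \<le> 1 + (u / 2 + z) + 1 / 2 * (A + 1)" "u \<le> 1" for A u z :: real
        using that by (simp add: field_simps)
      ultimately have "a K \<le> 4 + 2 * (t * \<epsilon> / 2 * ?s)" by blast
      then show ?thesis by (simp add: mult.commute mult.left_commute)
    qed
    have "a n \<le> 4 * exp (\<epsilon> * t * real n)" for n
    proof -
      have "a n \<le> 4 * (1 + \<epsilon> * t) ^ n" by (rule discrete_gronwall[OF _ _ rec]) (use t \<epsilon> in auto)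
      also have "(1 + \<epsilon> * t) ^ n \<le> exp (\<epsilon> * t) ^ n"
        using t \<epsilon> by (intro power_mono exp_ge_add_one_self) auto
      also have "exp (\<epsilon> * t) ^ n = exp (\<epsilon> * t * real n)" by (simp add: exp_of_nat_mult[symmetric] mult.commute)
      finally show ?thesis by simp
    qed
    then show ?thesis using bv unfolding a_def by blast
  qed
  show ?thesis using \<omega>0 main by blast
qed

text \<open>Markov's inequality for the exponential moment.\<close>

lemma upper_deviation:
  assumes \<epsilon>: "0 < \<epsilon>"
  shows "\<exists>\<omega> k0. 0 < \<omega> \<and> (\<forall>t k K y. 0 < t \<and> t \<le> \<omega> \<and> k0 \<le> k \<and> t powr s * exp (t * v0 * real k) \<le> \<omega> \<longrightarrow>
     measure (density leb (\<lambda>x. ennreal (h x))) {x \<in> {0..1}. (\<forall>i<K. (F ^^ i) x \<in> region k) \<and> y \<le> (\<Sum>i<K. V ((F ^^ i) x))}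
       \<le> 4 * exp (\<epsilon> * t * real K - t * y))"
proof -
  obtain \<omega> k0 where U: "0 < \<omega> \<and> (\<forall>t k. 0 < t \<and> t \<le> \<omega> \<and> k0 \<le> k \<and> t powr s * exp (t * v0 * real k) \<le> \<omega> \<longrightarrow>
     (\<forall>n. \<exists>B. bv0 (dens t k n) B) \<and> (\<forall>n. (\<integral>x. dens t k n x \<partial>leb) \<le> 4 * exp (\<epsilon> * t * real n)))"
    using exponential_moment[OF \<epsilon>] by (elim exE)
  have \<omega>0: "0 < \<omega>" using U by (rule conjunct1)
  note m = U[THEN conjunct2, THEN spec, THEN spec, THEN mp]
  have "measure (density leb (\<lambda>x. ennreal (h x))) {x \<in> {0..1}. (\<forall>i<K. (F ^^ i) x \<in> region k) \<and> y \<le> (\<Sum>i<K. V ((F ^^ i) x))}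
       \<le> 4 * exp (\<epsilon> * t * real K - t * y)"
    if t: "0 < t \<and> t \<le> \<omega> \<and> k0 \<le> k \<and> t powr s * exp (t * v0 * real k) \<le> \<omega>" for t k K y
  proof -
    define Y where "Y = {x \<in> {0..1}. (\<forall>i<K. (F ^^ i) x \<in> region k) \<and> y \<le> (\<Sum>i<K. V ((F ^^ i) x))}"
    have Fn[measurable]: "(F ^^ n) \<in> measurable leb leb" for n
      by (induction n) (auto intro: measurable_comp)
    have Ym[measurable]: "Y \<in> sets leb"
    proof -
      have "Y = {x \<in> space leb. (\<forall>i\<in>{..<K}. (F ^^ i) x \<in> region k) \<and> y \<le> (\<Sum>i<K. V ((F ^^ i) x))}"
        by (auto simp: Y_def)
      also have "\<dots> \<in> sets leb" by measurable
      finally show ?thesis .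
    qed
    obtain b where b: "\<And>n. bv0 (dens t k n) (b n)" using m[OF t] by metis
    let ?w = "\<lambda>x. iter_weight (\<lambda>x. indicator (region k) x * exp (t * V x)) K x"
    have wm[measurable]: "?w \<in> borel_measurable leb" unfolding iter_weight_def by measurable
    have w0: "0 \<le> ?w x" for x unfolding iter_weight_def by (intro prod_nonneg) auto
    have wY: "exp (t * y) \<le> ?w x" if "x \<in> Y" for x
    proof -
      have "?w x = (\<Prod>i<K. exp (t * V ((F ^^ i) x)))"
        unfolding iter_weight_def using that by (intro prod.cong) (auto simp: Y_def)
      also have "\<dots> = exp (t * (\<Sum>i<K. V ((F ^^ i) x)))" by (simp add: exp_sum sum_distrib_left)
      also have "exp (t * y) \<le> \<dots>" using that t by (auto simp: Y_def intro!: mult_left_mono)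
      finally show ?thesis .
    qed
    have kw: "(\<integral>x. h x * (?w x * 1) \<partial>leb) = (\<integral>x. dens t k K x * 1 \<partial>leb)"
      using koopman_iterate[OF _ b, of "\<lambda>_. 1" 1 K] t by simp
    have wb: "\<bar>h x * ?w x\<bar> \<le> H * exp (t * v0 * real k) ^ K" if "x \<in> {0..1}" for x
    proof -
      have f: "0 \<le> indicator (region k) z * exp (t * V z) \<and> indicator (region k) z * exp (t * V z) \<le> exp (t * v0 * real k)" for z
        using exp_tV_bound[of t z k] t by (auto simp: indicator_def region_def)
      have "?w x \<le> (\<Prod>i<K. exp (t * v0 * real k))"
        unfolding iter_weight_def using f by (intro prod_mono) auto
      then show ?thesis using h_nonneg[of x] h_le[of x] w0[of x] by (simp add: abs_mult mult_mono)
    qed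
    have iw: "integrable leb (\<lambda>x. h x * ?w x)" using wb by (intro leb_bounded_integrable) auto
    have "exp (t * y) * measure (density leb (\<lambda>x. ennreal (h x))) Y = exp (t * y) * (\<integral>x. indicator Y x \<partial>density leb (\<lambda>x. ennreal (h x)))"
    proof -
      have "Y \<inter> {0..1} = Y" by (auto simp: Y_def)
      then show ?thesis by simp
    qed
    also have "\<dots> = exp (t * y) * (\<integral>x. h x * indicator Y x \<partial>leb)"
      using h_nonneg by (subst integral_density) auto
    also have "\<dots> = (\<integral>x. exp (t * y) * (h x * indicator Y x) \<partial>leb)" by simp
    also have "\<dots> \<le> (\<integral>x. h x * ?w x \<partial>leb)"
    proof (rule integral_mono_AE'[OF iw])
      show "AE x in leb. exp (t * y) * (h x * indicator Y x) \<le> h x * ?w x"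
        using wY w0 h_nonneg by (auto simp: indicator_def mult.commute[of "exp (t * y)"] intro!: AE_I2 mult_left_mono)
      show "AE x in leb. 0 \<le> h x * ?w x" using h_nonneg w0 by (auto intro!: AE_I2)
    qed
    also have "\<dots> \<le> 4 * exp (\<epsilon> * t * real K)" using kw m[OF t] by simp
    finally have "exp (t * y) * measure (density leb (\<lambda>x. ennreal (h x))) Y \<le> 4 * exp (\<epsilon> * t * real K)" .
    then show ?thesis unfolding Y_def[symmetric] by (simp add: exp_diff field_simps)
  qed
  with \<omega>0 show ?thesis by blast
qed

end


section \<open>Growth of derivatives along critical orbits\<close>

definition one_sided_points :: "one_sided set" where
  "one_sided_points = LeftOf ` {0<..1} \<union> RightOf ` {0..<1}"

lemma crit_set_sub: "crit_set f \<subseteq> one_sided_points"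
  by (auto simp: crit_set_def one_sided_points_def)

lemma pt_range: "g \<in> one_sided_points \<Longrightarrow> pt g \<in> {0..1}"
  by (auto simp: one_sided_points_def)

lemma eventually_at_side: "eventually P (at_side g) \<longleftrightarrow> (\<exists>\<eta>>0. \<forall>x\<in>side_nbhd g \<eta>. P x)"
proof (cases g)
  case (LeftOf c)
  have "eventually P (at_left c) \<longleftrightarrow> (\<exists>b<c. \<forall>y>b. y < c \<longrightarrow> P y)"
    by (rule eventually_at_left[of "c - 1"]) simp
  also have "\<dots> \<longleftrightarrow> (\<exists>\<eta>>0. \<forall>x\<in>{c - \<eta><..<c}. P x)"
  proof
    assume "\<exists>b<c. \<forall>y>b. y < c \<longrightarrow> P y"
    then obtain b where "b < c" "\<forall>y>b. y < c \<longrightarrow> P y" by blast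
    then show "\<exists>\<eta>>0. \<forall>x\<in>{c - \<eta><..<c}. P x" by (intro exI[of _ "c - b"]) auto
  next
    assume "\<exists>\<eta>>0. \<forall>x\<in>{c - \<eta><..<c}. P x"
    then obtain \<eta> where "\<eta> > 0" "\<forall>x\<in>{c - \<eta><..<c}. P x" by blast
    then show "\<exists>b<c. \<forall>y>b. y < c \<longrightarrow> P y" by (intro exI[of _ "c - \<eta>"]) auto
  qed
  finally show ?thesis using LeftOf by simp
next
  case (RightOf c)
  have "eventually P (at_right c) \<longleftrightarrow> (\<exists>b>c. \<forall>y>c. y < b \<longrightarrow> P y)"
    by (rule eventually_at_right[of _ "c + 1"]) simp
  also have "\<dots> \<longleftrightarrow> (\<exists>\<eta>>0. \<forall>x\<in>{c<..<c + \<eta>}. P x)"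
  proof
    assume "\<exists>b>c. \<forall>y>c. y < b \<longrightarrow> P y"
    then obtain b where "b > c" "\<forall>y>c. y < b \<longrightarrow> P y" by blast
    then show "\<exists>\<eta>>0. \<forall>x\<in>{c<..<c + \<eta>}. P x" by (intro exI[of _ "b - c"]) auto
  next
    assume "\<exists>\<eta>>0. \<forall>x\<in>{c<..<c + \<eta>}. P x"
    then obtain \<eta> where "\<eta> > 0" "\<forall>x\<in>{c<..<c + \<eta>}. P x" by blast
    then show "\<exists>b>c. \<forall>y>c. y < b \<longrightarrow> P y" by (intro exI[of _ "c + \<eta>"]) auto
  qed
  finally show ?thesis using RightOf by simp
qed

lemma at_side_le: "at_side g \<le> at (pt g)"
  by (cases g) (auto intro: at_le)

lemma at_side_neq_bot: "at_side g \<noteq> bot"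
  by (cases g) (auto simp: trivial_limit_at_left_real trivial_limit_at_right_real)

lemma side_nbhd_facts: "open (side_nbhd g \<eta>)" "is_interval (side_nbhd g \<eta>)"
  by (cases g; auto simp: is_interval_1)+

lemma eventually_side_nbhd: "0 < \<eta> \<Longrightarrow> eventually (\<lambda>x. x \<in> side_nbhd g \<eta>) (at_side g)"
  by (auto simp: eventually_at_side)

lemma filterlim_at_side_tendsto: "filterlim f (at_side g) F \<Longrightarrow> (f \<longlongrightarrow> pt g) F"
  using filterlim_mono[of f "at_side g" F "nhds (pt g)" F] at_side_le[of g] by (auto simp: at_within_def intro: order_trans inf_le1)

lemma eventually_at_side_in_unit:
  assumes "g \<in> one_sided_points" shows "eventually (\<lambda>x. x \<in> {0..1}) (at_side g)"
proof -
  from assms consider c where "g = LeftOf c" "0 < c" "c \<le> 1" | c where "g = RightOf c" "0 \<le> c" "c < 1"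
    by (auto simp: one_sided_points_def)
  then show ?thesis
  proof cases
    case 1 then show ?thesis unfolding eventually_at_side by (intro exI[of _ c]) auto
  next
    case 2 then show ?thesis unfolding eventually_at_side by (intro exI[of _ "1 - c"]) auto
  qed
qed

lemma frequently_at_side_interval:
  assumes "frequently (\<lambda>x. x \<in> K) (at_side g)" "is_interval K"
  shows "\<exists>\<eta>>0. side_nbhd g \<eta> \<subseteq> K"
proof -
  have fr: "\<exists>x\<in>side_nbhd g \<eta>. x \<in> K" if "0 < \<eta>" for \<eta>
    using assms(1) that unfolding frequently_def eventually_at_side by blast
  obtain x1 where x1: "x1 \<in> side_nbhd g 1" "x1 \<in> K" using fr[of 1] by auto
  show ?thesis
  proof (cases g)
    case (LeftOf c)
    show ?thesis
    proof (intro exI conjI subsetI)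
      show "0 < c - x1" using x1 LeftOf by simp
      fix z assume "z \<in> side_nbhd g (c - x1)"
      then have z: "x1 < z" "z < c" using LeftOf by auto
      obtain x2 where "x2 \<in> side_nbhd g (c - z)" "x2 \<in> K" using fr[of "c - z"] z by auto
      then have "z \<in> {x1..x2}" "{x1..x2} \<subseteq> K" using z LeftOf x1 interval_Icc[OF assms(2), of x1 x2] by auto
      then show "z \<in> K" by blast
    qed
  next
    case (RightOf c)
    show ?thesis
    proof (intro exI conjI subsetI)
      show "0 < x1 - c" using x1 RightOf by simp
      fix z assume "z \<in> side_nbhd g (x1 - c)"
      then have z: "c < z" "z < x1" using RightOf by auto
      obtain x2 where "x2 \<in> side_nbhd g (z - c)" "x2 \<in> K" using fr[of "z - c"] z by auto
      then have "z \<in> {x2..x1}" "{x2..x1} \<subseteq> K" using z RightOf x1 interval_Icc[OF assms(2), of x2 x1] by auto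
      then show "z \<in> K" by blast
    qed
  qed
qed

lemma pt_in_closure_side: "0 < \<eta> \<Longrightarrow> pt g \<in> closure (side_nbhd g \<eta>)"
  by (cases g) auto

text \<open>One of the finitely many intervals contains points arbitrarily close to \<open>g\<close> on its side, hence a whole one-sided neighbourhood.\<close>

lemma one_sided_limit:
  assumes f: "piecewise_smooth f" and g: "g \<in> one_sided_points"
  shows "\<exists>\<eta>>0. C2_on (side_nbhd g \<eta>) f \<and> (\<exists>l\<in>{0..1}. (f \<longlongrightarrow> l) (at_side g))"
proof -
  obtain \<K> where K: "finite \<K>" "\<Union>\<K> = {0..1}" "\<And>K. K \<in> \<K> \<Longrightarrow> is_interval K \<and> C2_on (interior K) f \<and>
           (\<exists>g. continuous_on (closure K) g \<and> (\<forall>x\<in>interior K. g x = f x))" and im: "f ` {0..1} \<subseteq> {0..1}"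
    using f unfolding piecewise_smooth_def by blast
  have "\<exists>K\<in>\<K>. frequently (\<lambda>x. x \<in> K) (at_side g)"
  proof (rule ccontr)
    assume "\<not> ?thesis"
    then have "\<forall>K\<in>\<K>. eventually (\<lambda>x. x \<notin> K) (at_side g)" by (simp add: frequently_def)
    then have "eventually (\<lambda>x. \<forall>K\<in>\<K>. x \<notin> K) (at_side g)" using K(1) by (simp add: eventually_ball_finite)
    then have "eventually (\<lambda>x. False) (at_side g)" using eventually_at_side_in_unit[OF g]
    proof eventually_elim
      case (elim x)
      then have "x \<in> \<Union>\<K>" using K(2) by simp
      with elim(1) show ?case by blast
    qed
    then show False using at_side_neq_bot[of g] by (simp add: trivial_limit_def)
  qed
  then obtain K0 where K0: "K0 \<in> \<K>" "frequently (\<lambda>x. x \<in> K0) (at_side g)" by blast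
  then obtain \<eta> where \<eta>: "0 < \<eta>" "side_nbhd g \<eta> \<subseteq> K0" using frequently_at_side_interval K(3) by blast
  have int: "side_nbhd g \<eta> \<subseteq> interior K0" using \<eta>(2) side_nbhd_facts(1) by (rule interior_maximal)
  obtain k where k: "continuous_on (closure K0) k" "\<forall>x\<in>interior K0. k x = f x" using K(3)[OF K0(1)] by blast
  have cl: "pt g \<in> closure K0" using pt_in_closure_side[OF \<eta>(1), of g] \<eta>(2) closure_mono by blast
  have C2: "C2_on (side_nbhd g \<eta>) f"
  proof -
    have "C2_on (interior K0) f" using K(3)[OF K0(1)] by blast
    then show ?thesis unfolding C2_on_def using int by (meson continuous_on_subset subsetD)
  qed
  have "(k \<longlongrightarrow> k (pt g)) (at (pt g) within closure K0)" using k(1) cl by (simp add: continuous_on)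
  moreover have "at_side g \<le> at (pt g) within closure K0"
  proof (rule filter_leI)
    fix P assume "eventually P (at (pt g) within closure K0)"
    then have "eventually (\<lambda>x. x \<in> closure K0 \<longrightarrow> P x) (at (pt g))" by (simp add: eventually_at_filter eventually_mono)
    then have "eventually (\<lambda>x. x \<in> closure K0 \<longrightarrow> P x) (at_side g)" using at_side_le by (rule filter_leD[rotated])
    then show "eventually P (at_side g)" using eventually_side_nbhd[OF \<eta>(1), of g]
      by eventually_elim (use \<eta>(2) closure_subset in blast)
  qed
  ultimately have "(k \<longlongrightarrow> k (pt g)) (at_side g)" by (rule tendsto_mono[rotated])
  moreover have "eventually (\<lambda>x. k x = f x) (at_side g)"
    using eventually_side_nbhd[OF \<eta>(1), of g] by eventually_elim (use k(2) int in blast)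
  ultimately have lim: "(f \<longlongrightarrow> k (pt g)) (at_side g)" by (rule Lim_transform_eventually)
  have "eventually (\<lambda>x. f x \<in> {0..1}) (at_side g)"
    using eventually_at_side_in_unit[OF g] by eventually_elim (use im in blast)
  then have "k (pt g) \<in> {0..1}"
    by (rule Lim_in_closed_set[OF closed_atLeastAtMost _ at_side_neq_bot lim])
  with \<eta>(1) C2 lim show ?thesis by blast
qed

lemma C2_on_deriv:
  assumes "C2_on U f" "x \<in> U" shows "(f has_real_derivative deriv f x) (at x)"
  using assms unfolding C2_on_def by (metis DERIV_imp_deriv)

lemma inj_of_deriv_nonzero:
  fixes f :: "real \<Rightarrow> real"
  assumes U: "is_interval U" and d: "\<And>x. x \<in> U \<Longrightarrow> (f has_real_derivative f' x) (at x)" "\<And>x. x \<in> U \<Longrightarrow> f' x \<noteq> 0"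
  shows "inj_on f U"
proof (rule inj_onI)
  have *: False if xy: "x \<in> U" "y \<in> U" "f x = f y" "x < y" for x y
  proof -
    have sub: "{x..y} \<subseteq> U" using interval_Icc[OF U] xy by blast
    have "(f has_real_derivative f' t) (at t)" if "x \<le> t" "t \<le> y" for t
      using d(1)[of t] sub that by auto
    from MVT2[OF xy(4) this] obtain t where t: "x < t" "t < y" "f y - f x = (y - x) * f' t" by blast
    moreover have "t \<in> U" using sub t by auto
    ultimately show False using d(2)[of t] xy by simp
  qed
  fix x y assume xy: "x \<in> U" "y \<in> U" "f x = f y"
  show "x = y"
  proof (rule linorder_cases[of x y])
    show "x < y \<Longrightarrow> x = y" using *[OF xy] by blast
    show "y < x \<Longrightarrow> x = y" using *[OF xy(2,1) xy(3)[symmetric]] by blast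
  qed
qed

text \<open>Where \<open>f'\<close> does not vanish \<open>f\<close> is injective, so it takes its one-sided limit \<open>l\<close> at most once near \<open>g\<close>; on a smaller
  neighbourhood the image is an interval that misses \<open>l\<close> and so lies on one side of it.\<close>

lemma one_sided_image:
  assumes f: "piecewise_smooth f" and g: "g \<in> one_sided_points" and nz: "eventually (\<lambda>x. deriv f x \<noteq> 0) (at_side g)"
  shows "\<exists>g'\<in>one_sided_points. filterlim f (at_side g') (at_side g)"
proof -
  obtain \<eta>1 l where 1: "0 < \<eta>1" "C2_on (side_nbhd g \<eta>1) f" "l \<in> {0..1}" "(f \<longlongrightarrow> l) (at_side g)"
    using one_sided_limit[OF f g] by blast
  have im: "f ` {0..1} \<subseteq> {0..1}" using f by (simp add: piecewise_smooth_def)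
  have "eventually (\<lambda>x. x \<in> side_nbhd g \<eta>1 \<and> deriv f x \<noteq> 0 \<and> x \<in> {0..1}) (at_side g)"
    using eventually_side_nbhd[OF 1(1)] nz eventually_at_side_in_unit[OF g] by eventually_elim blast
  then obtain \<eta> where \<eta>: "0 < \<eta>" "\<And>x. x \<in> side_nbhd g \<eta> \<Longrightarrow> x \<in> side_nbhd g \<eta>1 \<and> deriv f x \<noteq> 0 \<and> x \<in> {0..1}"
    unfolding eventually_at_side by blast
  have d: "(f has_real_derivative deriv f x) (at x)" if "x \<in> side_nbhd g \<eta>" for x
    using C2_on_deriv[OF 1(2)] \<eta>(2)[OF that] by blast
  have inj: "inj_on f (side_nbhd g \<eta>)"
    by (rule inj_of_deriv_nonzero[OF side_nbhd_facts(2) d]) (use \<eta>(2) in blast)+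
  have "eventually (\<lambda>x. x \<in> side_nbhd g \<eta> \<and> f x \<noteq> l) (at_side g)"
  proof (cases "\<exists>x0\<in>side_nbhd g \<eta>. f x0 = l")
    case True
    then obtain x0 where x0: "x0 \<in> side_nbhd g \<eta>" "f x0 = l" by blast
    have "x0 \<noteq> pt g" using x0(1) by (cases g) auto
    then have "eventually (\<lambda>x. x \<noteq> x0) (at (pt g))" by (intro tendsto_imp_eventually_ne[OF tendsto_ident_at]) auto
    then have "eventually (\<lambda>x. x \<noteq> x0) (at_side g)" using at_side_le by (rule filter_leD[rotated])
    then show ?thesis using eventually_side_nbhd[OF \<eta>(1), of g]
    proof eventually_elim
      case (elim x) then show ?case using inj_onD[OF inj, of x x0] x0 by auto
    qed
  next
    case False
    show ?thesis using eventually_side_nbhd[OF \<eta>(1), of g] by eventually_elim (use False in blast)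
  qed
  then obtain \<zeta> where \<zeta>: "0 < \<zeta>" "\<And>x. x \<in> side_nbhd g \<zeta> \<Longrightarrow> x \<in> side_nbhd g \<eta> \<and> f x \<noteq> l"
    unfolding eventually_at_side by blast
  have "continuous_on (side_nbhd g \<zeta>) f" using d \<zeta>(2) by (meson DERIV_isCont continuous_at_imp_continuous_on)
  then have I: "is_interval (f ` side_nbhd g \<zeta>)"
    using side_nbhd_facts(2)[of g \<zeta>] by (simp add: connected_continuous_image is_interval_connected_1)
  have lI: "l \<notin> f ` side_nbhd g \<zeta>" using \<zeta>(2) by blast
  have ev\<zeta>: "eventually (\<lambda>x. x \<in> side_nbhd g \<zeta>) (at_side g)" using \<zeta>(1) by (rule eventually_side_nbhd)
  obtain x1 where x1: "x1 \<in> side_nbhd g \<zeta>" using eventually_happens'[OF at_side_neq_bot ev\<zeta>] by blast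
  have u: "f x \<in> {0..1}" if "x \<in> side_nbhd g \<zeta>" for x using \<zeta>(2)[OF that] \<eta>(2)[of x] im by blast
  have sep: "(\<forall>x\<in>side_nbhd g \<zeta>. l < f x) \<or> (\<forall>x\<in>side_nbhd g \<zeta>. f x < l)"
  proof (rule ccontr)
    assume "\<not> ?thesis"
    then obtain x y where xy: "x \<in> side_nbhd g \<zeta>" "y \<in> side_nbhd g \<zeta>" "f x \<le> l" "l \<le> f y" by (auto simp: not_less)
    then have "l \<in> {f x..f y}" by simp
    moreover have "{f x..f y} \<subseteq> f ` side_nbhd g \<zeta>" by (rule interval_Icc[OF I]) (use xy in blast)+
    ultimately show False using lI by blast
  qed
  then show ?thesis
  proof
    assume a: "\<forall>x\<in>side_nbhd g \<zeta>. l < f x"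
    then have "l < 1" using u[OF x1] x1 by force
    then have "RightOf l \<in> one_sided_points" using 1(3) by (auto simp: one_sided_points_def)
    moreover have "filterlim f (at_right l) (at_side g)"
      using 1(4) unfolding filterlim_at by (auto intro: eventually_mono[OF ev\<zeta>] simp: a less_imp_neq dest: a[rule_format])
    ultimately show ?thesis by (intro bexI[of _ "RightOf l"]) simp_all
  next
    assume a: "\<forall>x\<in>side_nbhd g \<zeta>. f x < l"
    then have "0 < l" using u[OF x1] x1 by force
    then have "LeftOf l \<in> one_sided_points" using 1(3) by (auto simp: one_sided_points_def)
    moreover have "filterlim f (at_left l) (at_side g)"
      using 1(4) unfolding filterlim_at by (auto intro: eventually_mono[OF ev\<zeta>] simp: a less_imp_neq dest: a[rule_format])
    ultimately show ?thesis by (intro bexI[of _ "LeftOf l"]) simp_all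
  qed
qed

lemma deriv_nonzero_near:
  assumes "A1 f ell" "g \<in> one_sided_points"
  shows "eventually (\<lambda>x. deriv f x \<noteq> 0) (at_side g)"
proof (cases "g \<in> crit_set f")
  case True
  then obtain \<eta> k where \<eta>: "0 < \<eta>" "0 < k" "\<And>x. x \<in> side_nbhd g \<eta> \<Longrightarrow> k \<le> \<bar>deriv f x\<bar> / \<bar>x - pt g\<bar> powr (ell g - 1)"
    using assms(1) unfolding A1_def comparable_on_def by meson
  show ?thesis using eventually_side_nbhd[OF \<eta>(1), of g]
  proof eventually_elim
    case (elim x) then show ?case using \<eta>(3)[OF elim] \<eta>(2) by auto
  qed
next
  case False
  then have "\<exists>L. (deriv f \<longlongrightarrow> L) (at_side g)" "\<not> (deriv f \<longlongrightarrow> 0) (at_side g)"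
    using assms(2) by (auto simp: crit_set_def one_sided_points_def)
  then obtain L where "(deriv f \<longlongrightarrow> L) (at_side g)" "L \<noteq> 0" by blast
  then show ?thesis by (rule tendsto_imp_eventually_ne)
qed

lemma funpow_deriv:
  fixes f :: "real \<Rightarrow> real"
  assumes "\<And>j. j < n \<Longrightarrow> (f has_real_derivative deriv f ((f ^^ j) x)) (at ((f ^^ j) x))"
  shows "((f ^^ n) has_real_derivative (\<Prod>j<n. deriv f ((f ^^ j) x))) (at x)"
  using assms
proof (induction n)
  case 0 show ?case using DERIV_ident by (simp add: id_def)
next
  case (Suc n)
  have "((\<lambda>x. f ((f ^^ n) x)) has_real_derivative deriv f ((f ^^ n) x) * (\<Prod>j<n. deriv f ((f ^^ j) x))) (at x)"
    by (rule DERIV_chain2) (use Suc in auto)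
  then show ?case by (simp add: comp_def mult.commute)
qed

lemma prod_lessThan_split: "prod (f :: nat \<Rightarrow> real) {..<N + M} = prod f {..<N} * (\<Prod>k<M. f (N + k))"
  by (induction M) (auto simp: mult.assoc)

text \<open>The orbit of a critical point as a sequence \<open>g\<close> of one-sided points, with the one-sided limits \<open>L\<close> of \<open>f'\<close> along it.  The
  derivatives in the definition of \<open>crit_deriv\<close> are products of these limits.\<close>

lemma critical_orbit:
  assumes f: "piecewise_smooth f" and A1: "A1 f ell" and c: "c \<in> crit_set f"
    and away: "\<And>n. 1 \<le> n \<Longrightarrow> 0 < crit_dist f n c"
  obtains g L where "\<And>n. g n \<in> one_sided_points"
    and "\<And>n. filterlim (f ^^ n) (at_side (g n)) (at_side c)"
    and "\<And>n. iter_at f n c = pt (g n)"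
    and "\<And>n. 1 \<le> n \<Longrightarrow> (deriv f \<longlongrightarrow> L n) (at_side (g n))"
    and "\<And>n. 1 \<le> n \<Longrightarrow> L n \<noteq> 0"
    and "\<And>n. 1 \<le> n \<Longrightarrow> eventually (\<lambda>x. (f has_real_derivative deriv f ((f ^^ n) x)) (at ((f ^^ n) x))) (at_side c)"
    and "\<And>n. crit_deriv f n c = (\<Prod>j<n. \<bar>L (Suc j)\<bar>)"
proof -
  have "\<exists>g. g 0 = c \<and> (\<forall>n. g n \<in> one_sided_points \<and> filterlim f (at_side (g (Suc n))) (at_side (g n)))"
  proof -
    have "\<exists>g. (g 0 \<in> one_sided_points \<and> g 0 = c) \<and> (\<forall>n. g n \<in> one_sided_points \<and> filterlim f (at_side (g (Suc n))) (at_side (g n)))"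
    proof -
      define nx where "nx g = (SOME g'. g' \<in> one_sided_points \<and> filterlim f (at_side g') (at_side g))" for g
      have nx: "nx g \<in> one_sided_points \<and> filterlim f (at_side (nx g)) (at_side g)" if "g \<in> one_sided_points" for g
        unfolding nx_def using one_sided_image[OF f that deriv_nonzero_near[OF A1 that]] by (rule_tac someI_ex) blast
      define g where "g n = (nx ^^ n) c" for n
      have gn: "g n \<in> one_sided_points" for n
        by (induction n) (use crit_set_sub c nx in \<open>auto simp: g_def\<close>)
      have "g 0 = c" "g (Suc n) = nx (g n)" for n by (simp_all add: g_def)
      moreover have "c \<in> one_sided_points" using crit_set_sub c by blast
      ultimately show ?thesis using nx gn by (intro exI[of _ g]) simp
    qed
    then show ?thesis by blast
  qed
  then obtain g where g: "g 0 = c" "\<And>n. g n \<in> one_sided_points" "\<And>n. filterlim f (at_side (g (Suc n))) (at_side (g n))"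
    by blast
  have fl: "filterlim (f ^^ n) (at_side (g n)) (at_side c)" for n
  proof (induction n)
    case 0 show ?case using g(1) by (simp add: filterlim_ident id_def)
  next
    case (Suc n)
    have "filterlim (\<lambda>x. f ((f ^^ n) x)) (at_side (g (Suc n))) (at_side c)"
      by (rule filterlim_compose[OF g(3) Suc])
    then show ?case by (simp add: comp_def)
  qed
  have it: "iter_at f n c = pt (g n)" for n
    unfolding iter_at_def by (rule tendsto_Lim[OF at_side_neq_bot filterlim_at_side_tendsto[OF fl]])
  have nc: "g n \<notin> crit_set f" if "1 \<le> n" for n
  proof
    assume "g n \<in> crit_set f"
    then have "pt (g n) \<in> pt ` crit_set f" by blast
    then have "crit_dist f n c = 0" unfolding crit_dist_def it by (rule infdist_zero)
    then show False using away[OF that] by simp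
  qed
  have "\<exists>l. (deriv f \<longlongrightarrow> l) (at_side (g n)) \<and> l \<noteq> 0" if "1 \<le> n" for n
    using nc[OF that] g(2)[of n] by (auto simp: crit_set_def one_sided_points_def)
  then obtain L where L: "\<And>n. 1 \<le> n \<Longrightarrow> (deriv f \<longlongrightarrow> L n) (at_side (g n)) \<and> L n \<noteq> 0" by metis
  have diff: "eventually (\<lambda>x. (f has_real_derivative deriv f ((f ^^ n) x)) (at ((f ^^ n) x))) (at_side c)" for n
  proof -
    obtain \<eta> where \<eta>: "0 < \<eta>" "C2_on (side_nbhd (g n) \<eta>) f" using one_sided_limit[OF f g(2)] by blast
    have "eventually (\<lambda>y. (f has_real_derivative deriv f y) (at y)) (at_side (g n))"
      using eventually_side_nbhd[OF \<eta>(1)] by eventually_elim (rule C2_on_deriv[OF \<eta>(2)])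
    then show ?thesis by (rule eventually_compose_filterlim[OF _ fl])
  qed
  have "crit_deriv f n c = (\<Prod>j<n. \<bar>L (Suc j)\<bar>)" for n
  proof -
    have "((\<lambda>x. \<Prod>j<n. \<bar>deriv f ((f ^^ Suc j) x)\<bar>) \<longlongrightarrow> (\<Prod>j<n. \<bar>L (Suc j)\<bar>)) (at_side c)"
    proof (intro tendsto_prod tendsto_rabs)
      fix j
      show "((\<lambda>x. deriv f ((f ^^ Suc j) x)) \<longlongrightarrow> L (Suc j)) (at_side c)"
        using filterlim_compose[OF conjunct1[OF L[of "Suc j"]] fl[of "Suc j"]] by simp
    qed
    moreover have "eventually (\<lambda>x. (\<Prod>j<n. \<bar>deriv f ((f ^^ Suc j) x)\<bar>) = \<bar>deriv (f ^^ n) (f x)\<bar>) (at_side c)"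
    proof -
      have "eventually (\<lambda>x. \<forall>j\<in>{..<n}. (f has_real_derivative deriv f ((f ^^ Suc j) x)) (at ((f ^^ Suc j) x))) (at_side c)"
        by (intro eventually_ball_finite ballI diff finite_lessThan)
      then show ?thesis
      proof eventually_elim
        case (elim x)
        have "((f ^^ n) has_real_derivative (\<Prod>j<n. deriv f ((f ^^ j) (f x)))) (at (f x))"
          by (rule funpow_deriv) (use elim in \<open>auto simp: funpow_swap1\<close>)
        then have "deriv (f ^^ n) (f x) = (\<Prod>j<n. deriv f ((f ^^ j) (f x)))" by (rule DERIV_imp_deriv)
        then show ?case by (simp add: abs_prod funpow_swap1)
      qed
    qed
    ultimately have "((\<lambda>x. \<bar>deriv (f ^^ n) (f x)\<bar>) \<longlongrightarrow> (\<Prod>j<n. \<bar>L (Suc j)\<bar>)) (at_side c)"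
      by (rule Lim_transform_eventually)
    then show ?thesis unfolding crit_deriv_def by (rule tendsto_Lim[OF at_side_neq_bot])
  qed
  with g(2) fl it L diff show ?thesis by (intro that[of g L]) blast+
qed

lemma summable_poly_geometric: "0 < x \<Longrightarrow> summable (\<lambda>r. (real r + 1) powr p * exp (- x * real r))"
proof -
  assume x: "0 < x"
  have "(\<lambda>r. (real r + 1) powr p * exp (- x * real r)) \<in> O(\<lambda>r. exp (- (x / 2) * real r))"
    using x by real_asymp
  moreover have "summable (\<lambda>r. norm (exp (- (x / 2) * real r)))"
  proof -
    have "summable (\<lambda>r. exp (- (x / 2)) ^ r)" using x by (intro summable_geometric) auto
    then show ?thesis by (simp add: exp_of_nat_mult[symmetric] mult.commute)
  qed
  ultimately show ?thesis by (rule summable_comparison_test_bigo[rotated])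
qed


lemma le_inverse_mult: "l * u \<le> v \<Longrightarrow> 0 < l \<Longrightarrow> u \<le> inverse l * (v :: real)"
  by (simp add: field_simps)

lemma summable_weighted_convolution:
  fixes A :: "nat \<Rightarrow> real"
  assumes A: "summable A" "\<And>n. 0 \<le> A n" and x: "0 < x"
  shows "summable (\<lambda>n. \<Sum>m\<le>n. A m * ((real (n - m) + 1) powr p * exp (- x * real (n - m))))"
proof (rule summable_Cauchy_product)
  show "summable (\<lambda>k. norm (A k))" using A by simp
  show "summable (\<lambda>k. norm ((real k + 1) powr p * exp (- x * real k)))"
    using summable_poly_geometric[OF x, of p] by (simp add: abs_mult)
qed

text \<open>If the \<open>d\<^sub>n\<close> stay away from \<open>1\<close>, the logarithm in \<open>A3\<close> is bounded below and there is nothing to do.  Otherwise \<open>c\<close> is at an end of the interval and is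
  the only critical or singular point.  Then let \<open>m\<close> be the last close visit before time \<open>n\<close>.  The derivative along the
  orbit from time \<open>m + 1\<close> to \<open>n\<close> grows exponentially, and the loss at the visit itself is \<open>d\<^sub>m\<close> to the power \<open>\<ell> - 1\<close>, which becomes at most one
  factor \<open>1 / d\<^sub>m\<close> in \<open>1 / E\<^sub>n\<close> because \<open>\<ell> - 1 \<le> 2 \<ell> - 1\<close>.  So the terms are dominated by the convolution of a part of the
  series in \<open>A3\<close> with a geometric sequence.\<close>

lemma critical_series_summable:
  assumes f: "piecewise_smooth f" and fin: "finite (crit_set f)" and A1: "A1 f ell" and A2: "A2 f" and A3: "A3 f ell p"
    and p: "0 \<le> p" and c: "c \<in> crit_set f" and ell: "1 < ell c"
  shows "summable (\<lambda>m. real (Suc m) powr p * inverse (crit_dist f (Suc m) c) * inverse (crit_E f ell (Suc m) c))"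
    and "\<And>n. 1 \<le> n \<Longrightarrow> 0 < crit_dist f n c \<and> crit_dist f n c \<le> 1"
proof -
  define d where "d n = crit_dist f n c" for n
  define E where "E n = inverse (crit_E f ell n c)" for n
  have E0: "0 \<le> E n" for n by (simp add: E_def crit_E_def)
  have d0: "0 < d n" if "1 \<le> n" for n using A3 c ell that unfolding A3_def d_def by blast
  have "summable (\<lambda>m. let n = Suc m; d = crit_dist f n c in real n powr p * inverse d * ln (inverse d) * inverse (crit_E f ell n c))"
    using A3 c ell unfolding A3_def by blast
  then have sA3: "summable (\<lambda>m. real (Suc m) powr p * inverse (d (Suc m)) * ln (inverse (d (Suc m))) * E (Suc m))"
    by (simp add: d_def E_def Let_def)
  obtain g L where g: "\<And>n. g n \<in> one_sided_points"
    and fl: "\<And>n. filterlim (f ^^ n) (at_side (g n)) (at_side c)"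
    and it: "\<And>n. iter_at f n c = pt (g n)"
    and L: "\<And>n. 1 \<le> n \<Longrightarrow> (deriv f \<longlongrightarrow> L n) (at_side (g n))" "\<And>n. 1 \<le> n \<Longrightarrow> L n \<noteq> 0"
    and diff: "\<And>n. 1 \<le> n \<Longrightarrow> eventually (\<lambda>x. (f has_real_derivative deriv f ((f ^^ n) x)) (at ((f ^^ n) x))) (at_side c)"
    and D: "\<And>n. crit_deriv f n c = (\<Prod>j<n. \<bar>L (Suc j)\<bar>)"
    using critical_orbit[OF f A1 c] d0[unfolded d_def] by blast
  have pr: "pt (g n) \<in> {0..1}" for n by (rule pt_range[OF g])
  have dle: "d n \<le> \<bar>pt (g n) - pt c'\<bar>" if "c' \<in> crit_set f" for n c'
    unfolding d_def crit_dist_def it using infdist_le[of "pt c'" "pt ` crit_set f" "pt (g n)"] that by (simp add: dist_real_def)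
  have prc: "pt c' \<in> {0..1}" if "c' \<in> crit_set f" for c' using pt_range crit_set_sub that by blast
  have d1: "d n \<le> 1" for n using dle[OF c, of n] pr[of n] prc[OF c] by auto
  show "\<And>n. 1 \<le> n \<Longrightarrow> 0 < crit_dist f n c \<and> crit_dist f n c \<le> 1" using d0 d1 by (simp add: d_def)
  let ?goal = "\<lambda>m. real (Suc m) powr p * inverse (d (Suc m)) * E (Suc m)"
  have lnle: "ln (inverse r) \<le> ln (inverse (d n))" if "1 \<le> n" "d n \<le> r" for n r
    using d0[OF that(1)] that(2) by (simp add: ln_inverse)
  have "summable ?goal"
  proof (cases "\<exists>r<1. \<forall>n\<ge>1. d n \<le> r")
    case True
    then obtain r where r: "r < 1" "\<And>n. 1 \<le> n \<Longrightarrow> d n \<le> r" by blast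
    have r0: "0 < r" using r(2)[of 1] d0[of 1] by simp
    have l0: "0 < ln (inverse r)" using r(1) r0 by (simp add: ln_inverse)
    show ?thesis
    proof (rule summable_comparison_test[OF _ summable_mult[OF sA3, of "inverse (ln (inverse r))"]], intro exI allI impI)
      fix m
      let ?u = "real (Suc m) powr p * inverse (d (Suc m)) * E (Suc m)"
      have u0: "0 \<le> ?u" using E0 d0[of "Suc m"] by (intro mult_nonneg_nonneg) (auto intro: less_imp_le)
      have "ln (inverse r) * ?u \<le> ln (inverse (d (Suc m))) * ?u"
        using lnle[of "Suc m" r] r(2)[of "Suc m"] u0 by (intro mult_right_mono) auto
      then have "?u \<le> inverse (ln (inverse r)) * (ln (inverse (d (Suc m))) * ?u)" using l0 by (rule le_inverse_mult)
      then show "norm ?u \<le> inverse (ln (inverse r)) * (real (Suc m) powr p * inverse (d (Suc m)) * ln (inverse (d (Suc m))) * E (Suc m))"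
        using u0 by (simp add: mult_ac)
    qed
  next
    case False
    have edge: "pt c' = 0 \<or> pt c' = 1" if c': "c' \<in> crit_set f" for c'
    proof (rule ccontr)
      assume "\<not> ?thesis"
      then have "max (pt c') (1 - pt c') < 1" using prc[OF c'] by auto
      moreover have "d n \<le> max (pt c') (1 - pt c')" for n using dle[OF c', of n] pr[of n] by auto
      ultimately show False using False by blast
    qed
    have same: "pt c' = pt c" if c': "c' \<in> crit_set f" for c'
    proof (rule ccontr)
      assume ne: "pt c' \<noteq> pt c"
      have "d n \<le> 1 / 2" for n
        using dle[OF c', of n] dle[OF c, of n] edge[OF c'] edge[OF c] ne pr[of n] by (auto simp: abs_if split: if_splits)
      moreover have "(1 / 2 :: real) < 1" by simp
      ultimately show False using False by blast
    qed
    have dn: "d n = \<bar>pt (g n) - pt c\<bar>" for n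
    proof -
      have "pt ` crit_set f = {pt c}"
      proof (rule equalityI)
        show "pt ` crit_set f \<subseteq> {pt c}" using same by (intro image_subsetI) simp
        show "{pt c} \<subseteq> pt ` crit_set f" using c by blast
      qed
      then show ?thesis by (simp add: d_def crit_dist_def it dist_real_def)
    qed
    obtain \<delta>1 k0 where \<delta>1: "0 < \<delta>1" "0 < k0" "\<And>x. x \<in> side_nbhd c \<delta>1 \<Longrightarrow> k0 \<le> \<bar>deriv f x\<bar> / \<bar>x - pt c\<bar> powr (ell c - 1)"
      using A1 c unfolding A1_def comparable_on_def by meson
    define \<delta> where "\<delta> = min (\<delta>1 / 2) (1 / 2)"
    have \<delta>: "0 < \<delta>" "\<delta> < \<delta>1" "\<delta> < 1" using \<delta>1(1) by (auto simp: \<delta>_def)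
    obtain k \<theta> where k: "0 < k" "0 < \<theta>" and A2a: "\<forall>x\<in>{0..1}. \<forall>n\<ge>1. \<forall>D'. ((f ^^ n) has_real_derivative D') (at x within {0..1}) \<longrightarrow>
        (\<forall>j<n. far_from_crit f \<delta> ((f ^^ j) x)) \<longrightarrow> k * exp (\<theta> * real n) \<le> \<bar>D'\<bar>"
      using A2[unfolded A2_def, THEN conjunct2, THEN spec, THEN mp, OF \<delta>(1)] by blast
    have A2': "k * exp (\<theta> * real n) \<le> \<bar>D'\<bar>" if "x \<in> {0..1}" "1 \<le> n" "((f ^^ n) has_real_derivative D') (at x within {0..1})"
      "\<forall>j<n. far_from_crit f \<delta> ((f ^^ j) x)" for x n D'
      using A2a that by blast
    define k1 where "k1 = min 1 k"
    have k1: "0 < k1" "k1 \<le> 1" "k1 \<le> k" using k by (auto simp: k1_def)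
    \<comment> \<open>Away from the critical point the assumption \<open>A2\<close> applies at nearby points of the orbit and passes to the limit.\<close>
    have far: "k1 * exp (\<theta> * real r) \<le> (\<Prod>j<r. \<bar>L (m + j)\<bar>)" if m: "1 \<le> m" and dm: "\<And>j. j < r \<Longrightarrow> \<delta> < d (m + j)" for m r
    proof (cases "r = 0")
      case True then show ?thesis using k1 by simp
    next
      case False
      have "((\<lambda>x. \<Prod>j<r. \<bar>deriv f ((f ^^ (m + j)) x)\<bar>) \<longlongrightarrow> (\<Prod>j<r. \<bar>L (m + j)\<bar>)) (at_side c)"
        using m by (intro tendsto_prod tendsto_rabs filterlim_compose[OF L(1) fl]) auto
      moreover have "eventually (\<lambda>x. k1 * exp (\<theta> * real r) \<le> (\<Prod>j<r. \<bar>deriv f ((f ^^ (m + j)) x)\<bar>)) (at_side c)"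
      proof -
        have "eventually (\<lambda>x. \<forall>j\<in>{..<r}. (f has_real_derivative deriv f ((f ^^ (m + j)) x)) (at ((f ^^ (m + j)) x))) (at_side c)"
          using diff m by (intro eventually_ball_finite) auto
        moreover have "eventually (\<lambda>x. \<forall>j\<in>{..<r}. far_from_crit f \<delta> ((f ^^ (m + j)) x)) (at_side c)"
        proof (intro eventually_ball_finite ballI)
          fix j assume j: "j \<in> {..<r}"
          have "((\<lambda>x. \<bar>(f ^^ (m + j)) x - pt c\<bar>) \<longlongrightarrow> \<bar>pt (g (m + j)) - pt c\<bar>) (at_side c)"
            by (intro tendsto_intros filterlim_at_side_tendsto fl)
          then have "eventually (\<lambda>x. \<delta> < \<bar>(f ^^ (m + j)) x - pt c\<bar>) (at_side c)"
            by (rule order_tendstoD) (use dm[of j] j dn in simp)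
          then show "eventually (\<lambda>x. far_from_crit f \<delta> ((f ^^ (m + j)) x)) (at_side c)"
            by eventually_elim (auto simp: far_from_crit_def same dist_real_def)
        qed simp
        moreover have "eventually (\<lambda>x. (f ^^ m) x \<in> {0..1}) (at_side c)"
          using eventually_compose_filterlim[OF eventually_at_side_in_unit[OF g] fl] .
        ultimately show ?thesis
        proof eventually_elim
          case (elim x)
          let ?y = "(f ^^ m) x"
          have s: "(f ^^ j) ?y = (f ^^ (m + j)) x" for j by (simp add: funpow_add add.commute[of m j])
          have "((f ^^ r) has_real_derivative (\<Prod>j<r. deriv f ((f ^^ j) ?y))) (at ?y)"
            by (rule funpow_deriv) (use elim(1) in \<open>simp add: s\<close>)
          then have "((f ^^ r) has_real_derivative (\<Prod>j<r. deriv f ((f ^^ j) ?y))) (at ?y within {0..1})"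
            by (rule has_field_derivative_at_within)
          then have "k * exp (\<theta> * real r) \<le> \<bar>\<Prod>j<r. deriv f ((f ^^ j) ?y)\<bar>"
            by (rule A2'[rotated 2]) (use elim False in \<open>auto simp: s\<close>)
          also have "\<dots> = (\<Prod>j<r. \<bar>deriv f ((f ^^ (m + j)) x)\<bar>)" by (simp add: abs_prod s)
          finally show ?case by (rule order_trans[OF mult_right_mono[OF k1(3) exp_ge_zero]])
        qed
      qed
      ultimately show ?thesis by (rule tendsto_lowerbound) (rule at_side_neq_bot)
    qed
    have close: "k0 * d m powr (ell c - 1) \<le> \<bar>L m\<bar>" if m: "1 \<le> m" and dm: "d m \<le> \<delta>" for m
    proof -
      have "pt (g m) \<in> side_nbhd c \<delta>1"
      proof -
        have "pt (g m) \<noteq> pt c" using d0[OF m] dn[of m] by auto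
        moreover have "\<bar>pt (g m) - pt c\<bar> < \<delta>1" using dm dn[of m] \<delta>(2) by simp
        moreover have "(\<exists>y. c = LeftOf y \<and> y = 1) \<or> (\<exists>y. c = RightOf y \<and> y = 0)"
          using edge[OF c] crit_set_sub[of f] c by (auto simp: one_sided_points_def)
        ultimately show ?thesis using pr[of m] by auto
      qed
      then have "eventually (\<lambda>x. x \<in> side_nbhd c \<delta>1) (nhds (pt (g m)))"
        using side_nbhd_facts(1) by (intro eventually_nhds_in_open)
      then have "eventually (\<lambda>x. (f ^^ m) x \<in> side_nbhd c \<delta>1) (at_side c)"
        by (rule eventually_compose_filterlim[OF _ filterlim_at_side_tendsto[OF fl]])
      then have ev: "eventually (\<lambda>x. k0 * \<bar>(f ^^ m) x - pt c\<bar> powr (ell c - 1) \<le> \<bar>deriv f ((f ^^ m) x)\<bar>) (at_side c)"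
      proof eventually_elim
        case (elim x)
        have "(f ^^ m) x \<noteq> pt c" using elim by (cases c) auto
        then have "0 < \<bar>(f ^^ m) x - pt c\<bar> powr (ell c - 1)" by simp
        then show ?case using \<delta>1(3)[OF elim] by (simp add: pos_le_divide_eq)
      qed
      have l1: "((\<lambda>x. \<bar>deriv f ((f ^^ m) x)\<bar>) \<longlongrightarrow> \<bar>L m\<bar>) (at_side c)"
        using m by (intro tendsto_rabs filterlim_compose[OF L(1) fl]) auto
      have l2: "((\<lambda>x. k0 * \<bar>(f ^^ m) x - pt c\<bar> powr (ell c - 1)) \<longlongrightarrow> k0 * \<bar>pt (g m) - pt c\<bar> powr (ell c - 1)) (at_side c)"
        by (intro tendsto_intros filterlim_at_side_tendsto fl) (use d0[OF m] dn[of m] in auto)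
      show ?thesis unfolding dn by (rule tendsto_le[OF at_side_neq_bot l1 l2 ev])
    qed
    define e where "e = 1 / (2 * ell c - 1)"
    have e: "0 < e" "(ell c - 1) * e \<le> 1" using ell by (auto simp: e_def field_simps)
    define Dn where "Dn n = (\<Prod>j<n. \<bar>L (Suc j)\<bar>)" for n
    have Dpos: "0 < Dn n" for n unfolding Dn_def using L(2) by (intro prod_pos) auto
    have EE: "E n = Dn (n - 1) powr (- e)" for n
      by (simp add: E_def crit_E_def D Dn_def e_def powr_minus)
    define x where "x = \<theta> * e"
    have x0: "0 < x" using k e by (simp add: x_def)
    \<comment> \<open>The value at \<open>m = 0\<close> covers orbits without a close visit.\<close>
    define B where "B m = (if m = 0 then 1 else if d m \<le> \<delta> then real m powr p * inverse (d m) * E m else 0)" for m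
    have B0: "0 \<le> B m" for m using E0[of m] d0[of m] by (cases "m = 0") (auto simp: B_def)
    have lnd: "0 < ln (inverse \<delta>)" using \<delta> by (simp add: ln_inverse)
    have sB: "summable B"
    proof -
      have "summable (\<lambda>m. B (Suc m))"
      proof (rule summable_comparison_test[OF _ summable_mult[OF sA3, of "inverse (ln (inverse \<delta>))"]], intro exI allI impI)
        fix m
        let ?u = "real (Suc m) powr p * inverse (d (Suc m)) * E (Suc m)"
        have u0: "0 \<le> ?u" using E0 d0[of "Suc m"] by (intro mult_nonneg_nonneg) (auto intro: less_imp_le)
        have lp: "0 \<le> ln (inverse (d (Suc m)))" using d0[of "Suc m"] d1[of "Suc m"] by (simp add: ln_inverse)
        show "norm (B (Suc m)) \<le> inverse (ln (inverse \<delta>)) * (real (Suc m) powr p * inverse (d (Suc m)) * ln (inverse (d (Suc m))) * E (Suc m))"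
        proof (cases "d (Suc m) \<le> \<delta>")
          case True
          have "ln (inverse \<delta>) * ?u \<le> ln (inverse (d (Suc m))) * ?u"
            using lnle[of "Suc m" \<delta>] True u0 by (intro mult_right_mono) auto
          then have "?u \<le> inverse (ln (inverse \<delta>)) * (ln (inverse (d (Suc m))) * ?u)" using lnd by (rule le_inverse_mult)
          moreover have "B (Suc m) = ?u" using True by (simp add: B_def)
          ultimately show ?thesis using u0 by (simp add: mult_ac)
        next
          case False
          then have "B (Suc m) = 0" by (simp add: B_def)
          moreover have "0 \<le> inverse (ln (inverse \<delta>)) * (ln (inverse (d (Suc m))) * ?u)" by (rule mult_nonneg_nonneg[OF _ mult_nonneg_nonneg[OF lp u0]]) (use lnd in simp)
          ultimately show ?thesis by (simp add: mult_ac)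
        qed
      qed
      then show ?thesis by (simp add: summable_Suc_iff)
    qed
    define T where "T r = (real r + 1) powr p * exp (- x * real r)" for r
    have T0: "0 \<le> T r" for r by (simp add: T_def)
    define Q where "Q = max (k1 powr (- e) * exp x) ((k0 * k1) powr (- e) * exp x)"
    have Q0: "0 \<le> Q" unfolding Q_def by (simp add: le_max_iff_disj)
    have key: "real n powr p * E n \<le> Q * (\<Sum>m\<le>n. B m * T (n - m))" if n: "1 \<le> n" and dnn: "\<delta> < d n" for n
    proof -
      have "\<exists>m\<le>n. real n powr p * E n \<le> Q * (B m * T (n - m))"
      proof (cases "\<exists>m. 1 \<le> m \<and> m < n \<and> d m \<le> \<delta>")
        case False
        have "\<delta> < d (1 + j)" if "j < n - 1" for j
        proof (rule ccontr)
          assume "\<not> \<delta> < d (1 + j)"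
          then have "1 \<le> 1 + j \<and> 1 + j < n \<and> d (1 + j) \<le> \<delta>" using that by auto
          then show False using False by blast
        qed
        then have "k1 * exp (\<theta> * real (n - 1)) \<le> (\<Prod>j<n - 1. \<bar>L (1 + j)\<bar>)"
          by (intro far) auto
        then have "k1 * exp (\<theta> * real (n - 1)) \<le> Dn (n - 1)" by (simp add: Dn_def)
        then have "E n \<le> (k1 * exp (\<theta> * real (n - 1))) powr (- e)"
          unfolding EE using k1 e by (intro powr_mono2') auto
        also have "\<dots> = k1 powr (- e) * exp (- x * real (n - 1))"
          using k1 by (simp add: powr_mult exp_powr_real x_def mult_ac)
        also have "\<dots> = k1 powr (- e) * exp x * exp (- x * real n)"
          using n by (simp add: of_nat_diff exp_add[symmetric] algebra_simps)
        also have "\<dots> \<le> Q * exp (- x * real n)" by (intro mult_right_mono) (auto simp: Q_def)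
        finally have "real n powr p * E n \<le> (real n + 1) powr p * (Q * exp (- x * real n))"
          using E0 p by (intro mult_mono powr_mono2) auto
        then have "real n powr p * E n \<le> Q * (B 0 * T (n - 0))" by (simp add: B_def T_def mult_ac)
        then show ?thesis by blast
      next
        case True
        define m where "m = Max {m. 1 \<le> m \<and> m < n \<and> d m \<le> \<delta>}"
        have "m \<in> {m. 1 \<le> m \<and> m < n \<and> d m \<le> \<delta>}" unfolding m_def using True by (intro Max_in) auto
        then have m: "1 \<le> m" "m < n" "d m \<le> \<delta>" by auto
        have after: "\<delta> < d j" if "m < j" "j < n" for j
        proof (rule ccontr)
          assume "\<not> \<delta> < d j"
          then have "j \<in> {m. 1 \<le> m \<and> m < n \<and> d m \<le> \<delta>}" using that by auto
          then have "j \<le> m" unfolding m_def by (intro Max_ge) auto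
          then show False using that by simp
        qed
        define r where "r = n - 1 - m"
        have n1: "n - 1 = (m - 1) + Suc r" using m by (simp add: r_def)
        have "k1 * exp (\<theta> * real r) \<le> (\<Prod>j<r. \<bar>L (Suc m + j)\<bar>)"
          by (rule far) (use after m in \<open>auto simp: r_def\<close>)
        moreover have DD: "Dn (n - 1) = Dn (m - 1) * (\<bar>L m\<bar> * (\<Prod>j<r. \<bar>L (Suc m + j)\<bar>))"
          unfolding Dn_def n1 prod_lessThan_split prod.lessThan_Suc_shift using m(1) by simp
        ultimately have "Dn (m - 1) * ((k0 * d m powr (ell c - 1)) * (k1 * exp (\<theta> * real r))) \<le> Dn (n - 1)"
          unfolding DD using close[OF m(1,3)] Dpos[of "m - 1"] k1 \<delta>1(2) by (intro mult_left_mono mult_mono) auto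
        then have "E n \<le> (Dn (m - 1) * ((k0 * d m powr (ell c - 1)) * (k1 * exp (\<theta> * real r)))) powr (- e)"
          unfolding EE using k1 e \<delta>1(2) Dpos d0[OF m(1)] by (intro powr_mono2') auto
        also have "\<dots> = E m * ((k0 * k1) powr (- e) * (d m powr (- ((ell c - 1) * e)) * exp (- x * real r)))"
          using k1 \<delta>1(2) Dpos[of "m - 1"] unfolding EE
          by (simp add: powr_mult exp_powr_real x_def powr_powr mult_ac)
        also have "\<dots> \<le> E m * ((k0 * k1) powr (- e) * (inverse (d m) * exp (- x * real r)))"
        proof -
          have "d m powr (- ((ell c - 1) * e)) \<le> d m powr (- 1)"
            using d0[OF m(1)] d1[of m] e by (intro powr_mono') auto
          also have "\<dots> = inverse (d m)" using d0[OF m(1)] by (simp add: powr_minus)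
          finally show ?thesis using E0 by (intro mult_left_mono mult_right_mono) auto
        qed
        also have "exp (- x * real r) = exp x * exp (- x * real (n - m))"
          using m by (simp add: r_def of_nat_diff exp_add[symmetric] algebra_simps)
        also have "E m * ((k0 * k1) powr (- e) * (inverse (d m) * (exp x * exp (- x * real (n - m)))))
           = ((k0 * k1) powr (- e) * exp x) * (inverse (d m) * E m * exp (- x * real (n - m)))" by (simp add: mult_ac)
        also have "\<dots> \<le> Q * (inverse (d m) * E m * exp (- x * real (n - m)))"
          using E0[of m] d0[OF m(1)] by (intro mult_right_mono) (auto simp: Q_def)
        finally have En: "E n \<le> Q * (inverse (d m) * E m * exp (- x * real (n - m)))" .
        have "real n \<le> real m * (real (n - m) + 1)"
        proof -
          have "1 * real (n - m) \<le> real m * real (n - m)" using m by (intro mult_right_mono) auto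
          then show ?thesis using m by (simp add: of_nat_diff algebra_simps)
        qed
        then have "real n powr p \<le> (real m * (real (n - m) + 1)) powr p" using p by (intro powr_mono2) auto
        also have "\<dots> = real m powr p * (real (n - m) + 1) powr p" by (simp add: powr_mult)
        finally have "real n powr p * E n \<le> (real m powr p * (real (n - m) + 1) powr p) * (Q * (inverse (d m) * E m * exp (- x * real (n - m))))"
          using En E0 by (intro mult_mono) auto
        also have "\<dots> = Q * (B m * T (n - m))" using m by (simp add: B_def T_def mult_ac)
        finally show ?thesis using m(2) by (intro exI[of _ m]) auto
      qed
      then obtain m where m: "m \<le> n" "real n powr p * E n \<le> Q * (B m * T (n - m))" by blast
      have "B m * T (n - m) \<le> (\<Sum>m\<le>n. B m * T (n - m))"
        using m(1) B0 T0 by (intro member_le_sum) auto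
      then show ?thesis using m(2) mult_left_mono[OF _ Q0] by (meson order_trans)
    qed
    have sC: "summable (\<lambda>n. \<Sum>m\<le>n. B m * T (n - m))"
      using summable_weighted_convolution[OF sB B0 x0, of p] by (simp add: T_def)
    have "summable (\<lambda>n. B n + inverse \<delta> * Q * (\<Sum>m\<le>n. B m * T (n - m)))"
      by (intro summable_add sB summable_mult sC)
    then have "summable (\<lambda>n. B (Suc n) + inverse \<delta> * Q * (\<Sum>m\<le>Suc n. B m * T (Suc n - m)))"
      by (subst summable_Suc_iff)
    then show ?thesis
    proof (rule summable_comparison_test[rotated], intro exI allI impI)
      fix m
      let ?n = "Suc m"
      let ?u = "real ?n powr p * inverse (d ?n) * E ?n"
      have u0: "0 \<le> ?u" using E0 d0[of ?n] by (intro mult_nonneg_nonneg) (auto intro: less_imp_le)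
      have c0: "0 \<le> inverse \<delta> * Q * (\<Sum>m\<le>?n. B m * T (?n - m))"
        using B0 T0 Q0 \<delta>(1) by (intro mult_nonneg_nonneg sum_nonneg) auto
      have "?u \<le> B ?n + inverse \<delta> * Q * (\<Sum>m\<le>?n. B m * T (?n - m))"
      proof (cases "d ?n \<le> \<delta>")
        case True
        then have "B ?n = ?u" by (simp add: B_def)
        then show ?thesis using c0 by linarith
      next
        case False
        then have "inverse (d ?n) \<le> inverse \<delta>" using \<delta>(1) by (intro le_imp_inverse_le) auto
        moreover have "real ?n powr p * E ?n \<le> Q * (\<Sum>m\<le>?n. B m * T (?n - m))" using False by (intro key) auto
        ultimately have "inverse (d ?n) * (real ?n powr p * E ?n) \<le> inverse \<delta> * (Q * (\<Sum>m\<le>?n. B m * T (?n - m)))"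
          by (rule mult_mono) (use E0 \<delta>(1) in auto)
        then have "?u \<le> inverse \<delta> * Q * (\<Sum>m\<le>?n. B m * T (?n - m))" by (simp only: mult_ac)
        then show ?thesis using B0[of ?n] by linarith
      qed
      then show "norm ?u \<le> B ?n + inverse \<delta> * Q * (\<Sum>m\<le>?n. B m * T (?n - m))" using u0 by simp
    qed
  qed
  then show "summable (\<lambda>m. real (Suc m) powr p * inverse (crit_dist f (Suc m) c) * inverse (crit_E f ell (Suc m) c))"
    by (simp add: d_def E_def)
qed


section \<open>The induced map as a system of expanding branches\<close>

context inducing_construction
begin

definition elems :: "real set set" where "elems = interior ` \<alpha>"

definition rtime :: "real set \<Rightarrow> nat" where "rtime A = \<tau> (SOME x. x \<in> A)"

definition bper :: "real set \<Rightarrow> nat" where "bper A = bp (SOME x. x \<in> A)"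

definition h0 :: "real \<Rightarrow> real" where "h0 x = (if x \<in> {0..1} then h x else 0)"

definition induced :: "(real \<Rightarrow> real) \<Rightarrow> real \<Rightarrow> real" where "induced v x = (\<Sum>j<\<tau> x. v ((f ^^ j) x))"

lemma elems_props:
  assumes "A \<in> elems"
  obtains a where "a \<in> \<alpha>" "A = interior a" "A \<subseteq> a" "is_interval A" "open A" "A \<noteq> {}" "A \<subseteq> {0..1}"
proof -
  from assms obtain a where a: "a \<in> \<alpha>" "A = interior a" by (auto simp: elems_def)
  have "is_interval A" using \<alpha>_interval[OF a(1)] a(2) by (simp add: is_interval_convex_1 convex_interior)
  with a \<alpha>_interval[OF a(1)] interior_subset[of a] show ?thesis by (intro that[of a]) auto
qed

lemma elems_unit: "A \<in> elems \<Longrightarrow> A \<noteq> {} \<and> A \<subseteq> {0..1}"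
  by (elim elems_props) blast

lemma elems_disjoint: "disjoint elems"
proof -
  have "interior a \<inter> interior b = {}" if "a \<in> \<alpha>" "b \<in> \<alpha>" "interior a \<noteq> interior b" for a b
  proof -
    have "a \<noteq> b" using that(3) by blast
    then have "a \<inter> b = {}" using \<alpha>_disjoint that(1,2) unfolding disjoint_def by blast
    then show ?thesis using interior_subset by blast
  qed
  then show ?thesis by (auto simp: disjoint_def elems_def)
qed

lemma elems_const:
  assumes "A \<in> elems" "x \<in> A" shows "rtime A = \<tau> x" "bper A = bp x"
proof -
  obtain a where a: "a \<in> \<alpha>" "A \<subseteq> a" using assms(1) by (rule elems_props)
  have "(SOME x. x \<in> A) \<in> A" using assms(2) by (rule someI)
  then show "rtime A = \<tau> x" "bper A = bp x"
    using constant_on_elements[OF a(1)] a(2) assms(2) unfolding constant_on_def rtime_def bper_def by (metis subsetD)+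
qed

lemma tau_bp: "bp x \<le> \<tau> x" "\<tau> x \<le> q\<^sub>0 + bp x"
proof -
  have "first_entry f \<delta> x < q\<^sub>0" if "\<exists>j<q\<^sub>0. (f ^^ j) x \<in> crit_nbhd f \<delta>"
    using that unfolding first_entry_def by (meson Least_le order.strict_trans1)
  then show "bp x \<le> \<tau> x" "\<tau> x \<le> q\<^sub>0 + bp x"
    by (auto simp: \<tau>_def bp_def return_time_def binding_period_def less_imp_le)
qed

lemma bper_le: "A \<in> elems \<Longrightarrow> bper A \<le> rtime A" "A \<in> elems \<Longrightarrow> rtime A \<le> q\<^sub>0 + bper A"
proof -
  assume A: "A \<in> elems"
  then obtain x where "x \<in> A" using elems_unit by blast
  then show "bper A \<le> rtime A" "rtime A \<le> q\<^sub>0 + bper A" using elems_const[OF A] tau_bp by simp_all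
qed

lemma elems_count: "\<exists>M. \<forall>k. finite {A \<in> elems. bper A = k} \<and> card {A \<in> elems. bper A = k} \<le> M"
proof -
  from F_bounds obtain C M where "\<forall>k. finite {a \<in> \<alpha>. \<exists>x\<in>a. bp x = k} \<and> card {a \<in> \<alpha>. \<exists>x\<in>a. bp x = k} \<le> M"
    unfolding Let_def by blast
  then have M: "finite {a \<in> \<alpha>. \<exists>x\<in>a. bp x = k}" "card {a \<in> \<alpha>. \<exists>x\<in>a. bp x = k} \<le> M" for k by blast+
  have sub: "{A \<in> elems. bper A = k} \<subseteq> interior ` {a \<in> \<alpha>. \<exists>x\<in>a. bp x = k}" for k
  proof
    fix A assume A: "A \<in> {A \<in> elems. bper A = k}"
    then have "A \<in> elems" by simp
    then obtain a where a: "a \<in> \<alpha>" "A = interior a" "A \<subseteq> a" "A \<noteq> {}" by (rule elems_props)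
    then obtain x where "x \<in> A" by blast
    then have "bp x = k" using A elems_const(2)[of A x] by simp
    then show "A \<in> interior ` {a \<in> \<alpha>. \<exists>x\<in>a. bp x = k}" using a \<open>x \<in> A\<close> by blast
  qed
  have "finite {A \<in> elems. bper A = k} \<and> card {A \<in> elems. bper A = k} \<le> M" for k
  proof
    show "finite {A \<in> elems. bper A = k}" using sub M(1) by (rule finite_subset[OF _ finite_imageI])
    have "card {A \<in> elems. bper A = k} \<le> card {a \<in> \<alpha>. \<exists>x\<in>a. bp x = k}"
      using card_mono[OF finite_imageI[OF M(1)] sub[of k]] card_image_le[OF M(1)[of k], of interior] by linarith
    then show "card {A \<in> elems. bper A = k} \<le> M" using M(2)[of k] by linarith
  qed
  then show ?thesis by blast
qed

lemma elems_summable: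
  fixes w :: "nat \<Rightarrow> real"
  assumes w: "summable w" "\<And>k. 0 \<le> w k" and g: "\<And>A. A \<in> elems \<Longrightarrow> 0 \<le> g A \<and> g A \<le> w (bper A)"
  shows "g summable_on elems"
proof (rule nonneg_bdd_above_summable_on)
  obtain M where M: "\<And>k. finite {A \<in> elems. bper A = k} \<and> card {A \<in> elems. bper A = k} \<le> M"
    using elems_count by blast
  show "bdd_above (sum g ` {B. B \<subseteq> elems \<and> finite B})"
  proof (rule bdd_aboveI2)
    fix B assume B: "B \<in> {B. B \<subseteq> elems \<and> finite B}"
    have "sum g B \<le> (\<Sum>A\<in>B. w (bper A))" using B g by (intro sum_mono) auto
    also have "\<dots> = (\<Sum>k\<in>bper ` B. \<Sum>A | A \<in> B \<and> bper A = k. w (bper A))"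
      using B by (intro sum.image_gen) auto
    also have "\<dots> \<le> (\<Sum>k\<in>bper ` B. real M * w k)"
    proof (rule sum_mono)
      fix k
      have "card {A. A \<in> B \<and> bper A = k} \<le> card {A \<in> elems. bper A = k}"
        using M B by (intro card_mono) auto
      then have "card {A. A \<in> B \<and> bper A = k} \<le> M" using M[of k] by linarith
      then show "(\<Sum>A | A \<in> B \<and> bper A = k. w (bper A)) \<le> real M * w k"
        using w(2)[of k] by (simp add: mult_right_mono)
    qed
    also have "\<dots> = real M * (\<Sum>k\<in>bper ` B. w k)" by (simp add: sum_distrib_left)
    also have "\<dots> \<le> real M * suminf w"
      using B w by (intro mult_left_mono sum_le_suminf) auto
    finally show "sum g B \<le> real M * suminf w" .
  qed
qed (use g in auto)

lemma f_unit: "piecewise_smooth f \<Longrightarrow> x \<in> {0..1} \<Longrightarrow> (f ^^ n) x \<in> {0..1}"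
proof (induction n)
  case (Suc n)
  have "f ` {0..1} \<subseteq> {0..1}" using Suc.prems(1) unfolding piecewise_smooth_def by blast
  then show ?case using Suc by (simp add: image_subset_iff)
qed simp

lemma tau_pos:
  assumes "piecewise_smooth f" "x \<in> {0..1}" shows "1 \<le> \<tau> x"
proof (cases "\<exists>j<q\<^sub>0. (f ^^ j) x \<in> crit_nbhd f \<delta>")
  case True
  then have "(f ^^ first_entry f \<delta> x) x \<in> crit_nbhd f \<delta>" unfolding first_entry_def by (auto intro: LeastI)
  then show ?thesis using b_pos f_unit[OF assms] True by (fastforce simp: \<tau>_def return_time_def)
next
  case False
  show ?thesis unfolding \<tau>_def return_time_def if_not_P[OF False] by (rule q0_pos)
qed

text \<open>At most \<open>M\<close> elements share a binding period \<open>k\<close>, and their return time is at most \<open>q\<^sub>0 + k\<close>.  So the sum over the elements is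
  dominated by the series of \<open>k\<^sup>p\<close> times the bounds of the construction, in the indices \<open>k\<close> and \<open>k - 1\<close>.\<close>

lemma branch_bounds:
  assumes f: "piecewise_smooth f" and fin: "finite (crit_set f)" and A1: "A1 f ell" and A2: "A2 f" and A3: "A3 f ell p" and p: "1 < p"
  shows "\<exists>\<kappa> s. 0 < s \<and> s \<le> 1 \<and> (\<lambda>A. real (rtime A) powr (1 + s) * \<kappa> A) summable_on elems \<and> \<kappa> summable_on elems \<and>
    (\<forall>A\<in>elems. (\<forall>x\<in>A. \<bar>1 / deriv F x\<bar> \<le> \<kappa> A) \<and> varbound (\<lambda>x. \<bar>1 / deriv F x\<bar>) A (\<kappa> A))"
proof -
  define cr where "cr = {c \<in> crit_set f. 1 < ell c}"
  have finc: "finite cr" using fin by (simp add: cr_def)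
  define d where "d c n = crit_dist f n c" for c n
  define E where "E c n = inverse (crit_E f ell n c)" for c n
  have E0: "0 \<le> E c n" for c n by (simp add: E_def crit_E_def)
  have cs: "summable (\<lambda>m. real (Suc m) powr p * inverse (d c (Suc m)) * E c (Suc m))"
    "1 \<le> n \<Longrightarrow> 0 < d c n \<and> d c n \<le> 1" if "c \<in> cr" for c n
    using critical_series_summable[OF f fin A1 A2 A3, of c] p that by (auto simp: cr_def d_def E_def)
  have sA3: "summable (\<lambda>m. real (Suc m) powr p * inverse (d c (Suc m)) * ln (inverse (d c (Suc m))) * E c (Suc m))" if "c \<in> cr" for c
    using A3 that unfolding A3_def cr_def d_def E_def Let_def by blast
  define V where "V c n = (1 + ln (inverse (d c n))) * inverse (d c n) * E c n" for c n
  have lnp: "0 \<le> ln (inverse (d c n))" if "c \<in> cr" "1 \<le> n" for c n using cs(2)[OF that] by (simp add: ln_inverse)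
  have V0: "0 \<le> V c n" and EV: "E c n \<le> V c n" if "c \<in> cr" "1 \<le> n" for c n
  proof -
    have i: "1 \<le> inverse (d c n)" using cs(2)[OF that] by (simp add: one_le_inverse)
    then have "1 * 1 \<le> (1 + ln (inverse (d c n))) * inverse (d c n)" using lnp[OF that] by (intro mult_mono) auto
    then have "1 * E c n \<le> (1 + ln (inverse (d c n))) * inverse (d c n) * E c n" using E0 by (intro mult_right_mono) auto
    then show "E c n \<le> V c n" by (simp add: V_def)
    then show "0 \<le> V c n" using E0[of c n] by linarith
  qed
  have sV: "summable (\<lambda>m. real (Suc m) powr p * V c (Suc m))" if "c \<in> cr" for c
    using summable_add[OF cs(1)[OF that] sA3[OF that]] by (simp add: V_def algebra_simps)
  from F_bounds obtain C where C: "0 < C" and FbA: "\<forall>a\<in>\<alpha>. \<forall>k. (\<exists>x\<in>a. bp x = k) \<longrightarrow>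
             (k \<le> 1 \<longrightarrow>
                (\<forall>x\<in>interior a. \<bar>1 / deriv F x\<bar> \<le> C) \<and>
                total_variation (\<lambda>x. \<bar>1 / deriv F x\<bar>) (interior a) \<le> ennreal C) \<and>
             (k \<ge> 2 \<longrightarrow> (\<exists>c\<in>crit_set f. ell c > 1 \<and>
                (\<forall>x\<in>interior a. \<bar>1 / deriv F x\<bar> \<le> C * inverse (crit_E f ell k c)) \<and>
                total_variation (\<lambda>x. \<bar>1 / deriv F x\<bar>) (interior a) \<le>
                  ennreal (C * (1 + ln (inverse (crit_dist f (k - 1) c))) *
                    inverse (crit_dist f (k - 1) c) * inverse (crit_E f ell (k - 1) c))))"
    unfolding Let_def by blast
  note Fb = FbA[THEN bspec, THEN spec, THEN mp]
  define e where "e k = (if k \<le> 1 then C else C * (\<Sum>c\<in>cr. V c k + V c (k - 1)))" for k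
  have e0: "0 \<le> e k" for k
    using C V0 by (auto simp: e_def intro!: mult_nonneg_nonneg sum_nonneg add_nonneg_nonneg)
  define \<kappa> where "\<kappa> A = e (bper A)" for A
  define s where "s = min (p - 1) 1"
  have s: "0 < s" "s \<le> 1" "1 + s \<le> p" using p by (auto simp: s_def)
  have bounds: "(\<forall>x\<in>A. \<bar>1 / deriv F x\<bar> \<le> \<kappa> A) \<and> varbound (\<lambda>x. \<bar>1 / deriv F x\<bar>) A (\<kappa> A)" if A: "A \<in> elems" for A
  proof -
    obtain a where a: "a \<in> \<alpha>" "A = interior a" "A \<subseteq> a" "A \<noteq> {}" using A by (rule elems_props)
    then obtain x where x: "x \<in> A" by blast
    define k where "k = bper A"
    have "\<exists>x\<in>a. bp x = k" using x a(3) elems_const(2)[OF A x] by (auto simp: k_def)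
    note fb = Fb[OF a(1) this]
    show ?thesis
    proof (cases "k \<le> 1")
      case True
      then have "\<kappa> A = C" by (simp add: \<kappa>_def e_def k_def)
      then show ?thesis using fb True C a(2) by (auto intro!: varbound_total_variation)
    next
      case False
      then obtain c where c: "c \<in> cr" "\<forall>x\<in>A. \<bar>1 / deriv F x\<bar> \<le> C * E c k"
        "total_variation (\<lambda>x. \<bar>1 / deriv F x\<bar>) A \<le> ennreal (C * V c (k - 1))"
        using fb a(2) unfolding cr_def E_def V_def d_def by (auto simp: mult.assoc)
      have k1: "1 \<le> k" "1 \<le> k - 1" using False by auto
      have "V c k + V c (k - 1) \<le> (\<Sum>c\<in>cr. V c k + V c (k - 1))"
        using c(1) finc V0 k1 by (intro member_le_sum[of c cr "\<lambda>c. V c k + V c (k - 1)"]) (auto intro: add_nonneg_nonneg)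
      then have "C * (V c k + V c (k - 1)) \<le> \<kappa> A" using C False by (simp add: \<kappa>_def e_def k_def)
      moreover have "C * E c k \<le> C * V c k" "0 \<le> C * V c k" "0 \<le> C * V c (k - 1)"
        using C EV[OF c(1) k1(1)] V0[OF c(1) k1(1)] V0[OF c(1) k1(2)] by auto
      ultimately have le: "C * E c k \<le> \<kappa> A" "C * V c (k - 1) \<le> \<kappa> A" by (auto simp: distrib_left)
      have "varbound (\<lambda>x. \<bar>1 / deriv F x\<bar>) A (C * V c (k - 1))"
        using c(3) \<open>0 \<le> C * V c (k - 1)\<close> by (rule varbound_total_variation)
      then show ?thesis using c(2) le by (auto intro: varbound_mono order_trans)
    qed
  qed
  define w where "w k = (real q\<^sub>0 + real k) powr p * e k" for k
  have w0: "0 \<le> w k" for k using e0 by (simp add: w_def)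
  have sw: "summable w"
  proof -
    define Q where "Q = (real q\<^sub>0 + 1) powr p * C"
    have shift: "summable (\<lambda>m. Q * (\<Sum>c\<in>cr. real (m + 2) powr p * V c (m + 2) + 2 powr p * (real (m + 1) powr p * V c (m + 1))))"
    proof (intro summable_mult summable_sum summable_add)
      fix c assume c: "c \<in> cr"
      show "summable (\<lambda>m. real (m + 1) powr p * V c (m + 1))" using sV[OF c] by simp
      show "summable (\<lambda>m. real (m + 2) powr p * V c (m + 2))"
        using sV[OF c] summable_Suc_iff[of "\<lambda>m. real (Suc m) powr p * V c (Suc m)"] by simp
    qed
    have "summable (\<lambda>m. w (m + 2))"
    proof (rule summable_comparison_test[OF _ shift], intro exI allI impI)
      fix m :: nat
      let ?k = "m + 2"
      have P: "(real q\<^sub>0 + real ?k) powr p \<le> (real q\<^sub>0 + 1) powr p * real ?k powr p"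
      proof -
        have "real q\<^sub>0 * 1 \<le> real q\<^sub>0 * real ?k" by (intro mult_left_mono) auto
        then have "(real q\<^sub>0 + real ?k) powr p \<le> ((real q\<^sub>0 + 1) * real ?k) powr p" using p by (intro powr_mono2) (auto simp: distrib_right)
        then show ?thesis by (simp add: powr_mult)
      qed
      have K: "real ?k powr p \<le> 2 powr p * real (m + 1) powr p"
      proof -
        have "real ?k powr p \<le> (2 * real (m + 1)) powr p" using p by (intro powr_mono2) auto
        also have "\<dots> = 2 powr p * real (m + 1) powr p" using powr_mult[of 2 "real (m + 1)" p] by simp
        finally show ?thesis .
      qed
      have "w ?k \<le> ((real q\<^sub>0 + 1) powr p * real ?k powr p) * e ?k"
        unfolding w_def using P e0 by (intro mult_right_mono) auto
      also have "\<dots> = Q * (\<Sum>c\<in>cr. real ?k powr p * V c ?k + real ?k powr p * V c (m + 1))"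
        by (simp add: e_def Q_def sum_distrib_left distrib_left mult_ac)
      also have "\<dots> \<le> Q * (\<Sum>c\<in>cr. real ?k powr p * V c ?k + 2 powr p * (real (m + 1) powr p * V c (m + 1)))"
      proof (intro mult_left_mono sum_mono add_left_mono)
        fix c assume c: "c \<in> cr"
        show "real ?k powr p * V c (m + 1) \<le> 2 powr p * (real (m + 1) powr p * V c (m + 1))"
          using mult_right_mono[OF K V0[OF c, of "m + 1"]] by (simp add: mult.assoc)
      qed (use C in \<open>simp add: Q_def\<close>)
      finally show "norm (w ?k) \<le> Q * (\<Sum>c\<in>cr. real ?k powr p * V c ?k + 2 powr p * (real (m + 1) powr p * V c (m + 1)))"
        using w0 by simp
    qed
    then show ?thesis by (simp only: summable_iff_shift)
  qed
  have S: "(\<lambda>A. real (rtime A) powr (1 + s) * \<kappa> A) summable_on elems"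
  proof (rule elems_summable[OF sw w0])
    fix A assume A: "A \<in> elems"
    obtain x where x: "x \<in> A" "x \<in> {0..1}" using elems_unit[OF A] by blast
    have t1: "1 \<le> rtime A" using tau_pos[OF f x(2)] elems_const(1)[OF A x(1)] by simp
    have "real (rtime A) powr (1 + s) \<le> real (rtime A) powr p" using t1 s by (intro powr_mono) auto
    also have "\<dots> \<le> (real q\<^sub>0 + real (bper A)) powr p" using bper_le(2)[OF A] p by (intro powr_mono2) auto
    finally show "0 \<le> real (rtime A) powr (1 + s) * \<kappa> A \<and> real (rtime A) powr (1 + s) * \<kappa> A \<le> w (bper A)"
      using e0 by (auto simp: \<kappa>_def w_def intro: mult_right_mono)
  qed
  have S': "\<kappa> summable_on elems"
  proof (rule elems_summable[OF sw w0])
    fix A assume A: "A \<in> elems"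
    have "1 \<le> (real q\<^sub>0 + real (bper A)) powr p" using q0_pos p by (intro ge_one_powr_ge_zero) auto
    then show "0 \<le> \<kappa> A \<and> \<kappa> A \<le> w (bper A)"
      using e0[of "bper A"] mult_right_mono[of 1 "(real q\<^sub>0 + real (bper A)) powr p" "e (bper A)"] by (simp add: \<kappa>_def w_def)
  qed
  show ?thesis using s(1,2) S S' bounds by blast
qed

lemma varbound_zero_extension:
  assumes "varbound g {0..1} B" "\<And>x. x \<in> {0..1} \<Longrightarrow> \<bar>g x\<bar> \<le> M"
  shows "bv0 (\<lambda>x. if x \<in> {0..1} then g x else 0) (B + 2 * M)"
proof -
  have "0 \<le> M" using assms(2)[of 0] by simp
  then have "varbound (\<lambda>x. if x \<in> {0..1} then g x else 0) UNIV (B + 2 * M)"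
    using varbound_indicator[OF assms(1) _ assms(2)] by (simp add: is_interval_1)
  then show ?thesis by (simp add: bv0_def)
qed

lemma varbound_bounded:
  assumes "varbound g {0..1} B" "x \<in> {0..1}" shows "\<bar>g x\<bar> \<le> \<bar>g 0\<bar> + B"
  using varbound_dist[OF assms(1), of 0 x] assms(2) by auto

lemma h0_bv: "\<exists>H. bv0 h0 H"
proof -
  obtain B where B: "varbound h {0..1} B" using h_BV by (rule BV_on_varbound)
  show ?thesis
    using varbound_zero_extension[OF B varbound_bounded[OF B]] by (auto simp: h0_def[abs_def])
qed

lemma muF_h0: "\<mu>\<^sub>F = density leb (\<lambda>x. ennreal (h0 x))"
proof -
  obtain H where "bv0 h0 H" using h0_bv by blast
  then have [measurable]: "h0 \<in> borel_measurable leb" by (rule bv0_leb)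
  have "h \<in> borel_measurable leb \<longleftrightarrow> h0 \<in> borel_measurable leb" by (rule measurable_cong) (simp add: h0_def)
  then have [measurable]: "h \<in> borel_measurable leb" by simp
  show ?thesis unfolding muF_density
  proof (rule density_cong)
    show "AE x in leb. ennreal (h x) = ennreal (h0 x)" by (rule AE_I2) (simp add: h0_def)
  qed measurable
qed

lemma ergodic_system:
  assumes f: "piecewise_smooth f"
    and \<kappa>: "\<And>A. A \<in> elems \<Longrightarrow> (\<forall>x\<in>A. \<bar>1 / deriv F x\<bar> \<le> \<kappa> A) \<and> varbound (\<lambda>x. \<bar>1 / deriv F x\<bar>) A (\<kappa> A)" "\<kappa> summable_on elems"
  shows "\<exists>\<sigma> H. ergodic_branches F (deriv F) elems \<kappa> \<sigma> h0 H"
proof -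
  obtain \<sigma> where \<sigma>: "1 < \<sigma>" "\<And>a x. a \<in> \<alpha> \<Longrightarrow> x \<in> interior a \<Longrightarrow> \<sigma> \<le> \<bar>deriv F x\<bar>" using F_expanding by blast
  obtain H where h: "bv0 h0 H" using h0_bv by blast
  have hm: "h0 \<in> borel_measurable leb" using h by (rule bv0_leb)
  have hn: "0 \<le> h0 x" for x using h_nonneg by (simp add: h0_def)
  have "(\<integral>x. h0 x \<partial>leb) = 1"
  proof -
    interpret prob_space \<mu>\<^sub>F by (rule muF_prob)
    have "(\<integral>x. 1 \<partial>\<mu>\<^sub>F) = (\<integral>x. h0 x * 1 \<partial>leb)"
      unfolding muF_h0 using hm hn by (subst integral_density) auto
    then show ?thesis using prob_space by simp
  qed
  have "ergodic_branches F (deriv F) elems \<kappa> \<sigma> h0 H"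
  proof unfold_locales
    show "is_interval a \<and> open a \<and> a \<noteq> {} \<and> a \<subseteq> {0..1}" if "a \<in> elems" for a using that by (rule elems_props) auto
    show "disjoint elems" by (rule elems_disjoint)
    show "F x \<in> {0..1}" if "x \<in> {0..1}" for x using f_unit[OF f that] by (simp add: F_def induced_map_def)
    show "(F has_real_derivative deriv F x) (at x)" if A: "a \<in> elems" and x: "x \<in> a" for a x
    proof -
      obtain a' where "a' \<in> \<alpha>" "a = interior a'" using A by (rule elems_props)
      then show ?thesis using C2_on_deriv[OF F_smooth] x by blast
    qed
    show "continuous_on a (deriv F)" if A: "a \<in> elems" for a
    proof -
      obtain a' where a': "a' \<in> \<alpha>" "a = interior a'" using A by (rule elems_props)
      obtain F1 F2 where F1: "\<And>x. x \<in> a \<Longrightarrow> (F has_real_derivative F1 x) (at x) \<and> (F1 has_real_derivative F2 x) (at x)"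
        using F_smooth[OF a'(1)] a'(2) unfolding C2_on_def by blast
      have "continuous_on a F1" using F1 by (meson DERIV_isCont continuous_at_imp_continuous_on)
      then show ?thesis by (rule continuous_on_eq) (use F1 DERIV_imp_deriv in metis)
    qed
    show "1 < \<sigma>" by (rule \<sigma>(1))
    show "\<sigma> \<le> \<bar>deriv F x\<bar>" if A: "a \<in> elems" and x: "x \<in> a" for a x
    proof -
      obtain a' where "a' \<in> \<alpha>" "a = interior a'" using A by (rule elems_props)
      then show ?thesis using \<sigma>(2) x by blast
    qed
    show "ergodic_map (density leb (\<lambda>x. ennreal (h0 x))) F" using muF_ergodic unfolding muF_h0 .
  qed (use \<kappa> h hn \<open>(\<integral>x. h0 x \<partial>leb) = 1\<close> in auto)
  then show ?thesis by blast
qed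

lemma f_meas: "f \<in> measurable leb leb"
  using mu_ergodic measurable_cong_sets[OF mu_sets mu_sets] by (auto simp: ergodic_map_def measure_preserving_map_def)

lemma fn_meas [measurable]: "(f ^^ n) \<in> measurable leb leb"
proof (induction n)
  case (Suc n)
  have "f \<circ> (f ^^ n) \<in> measurable leb leb" by (rule measurable_comp[OF Suc f_meas])
  then show ?case by (simp only: funpow.simps)
qed simp

lemma tau_meas [measurable]: "\<tau> \<in> measurable leb (count_space UNIV)"
proof -
  have [measurable]: "(\<lambda>x. real (\<tau> x)) \<in> borel_measurable leb" using \<tau>_integrable by auto
  have "(\<lambda>x. nat \<lfloor>real (\<tau> x)\<rfloor>) \<in> measurable leb (count_space UNIV)" by measurable
  then show ?thesis by simp
qed

lemma induced_meas:
  assumes [measurable]: "v \<in> borel_measurable leb" shows "induced v \<in> borel_measurable leb"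
  unfolding induced_def[abs_def]
  by (rule measurable_compose_countable[where f="\<lambda>n x. \<Sum>j<n. v ((f ^^ j) x)", OF _ tau_meas]) measurable

lemma cover: "AE x in leb. x \<in> \<Union>elems"
proof -
  have count: "countable \<alpha>" by (rule \<alpha>_countable)
  have "(\<Union>a\<in>\<alpha>. a - interior a) \<in> null_sets lebesgue"
  proof (rule null_sets_UN'[OF count])
    fix a assume a: "a \<in> \<alpha>"
    have "negligible (frontier a)" using \<alpha>_interval[OF a] by (intro negligible_convex_frontier is_interval_convex) auto
    moreover have "a - interior a \<subseteq> frontier a" using closure_subset by (auto simp: frontier_def)
    ultimately show "a - interior a \<in> null_sets lebesgue" by (meson negligible_iff_null_sets negligible_subset)
  qed
  then have "({0..1} - \<Union>\<alpha>) \<union> (\<Union>a\<in>\<alpha>. a - interior a) \<in> null_sets lebesgue" using \<alpha>_cover by (rule null_sets.Un[rotated])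
  then have "AE x in lebesgue. x \<notin> ({0..1} - \<Union>\<alpha>) \<union> (\<Union>a\<in>\<alpha>. a - interior a)" by (rule AE_not_in)
  then have "AE x in lebesgue. x \<in> {0..1} \<longrightarrow> x \<in> \<Union>elems"
    by eventually_elim (auto simp: elems_def)
  then show ?thesis by (subst AE_restrict_space_iff) auto
qed

text \<open>Composition with the monotone branches of \<open>f\<^sup>j\<close> does not increase the variation of \<open>v\<close>.\<close>

lemma induced_regular:
  assumes f: "piecewise_smooth f" and v: "varbound v {0..1} B" "\<And>x. x \<in> {0..1} \<Longrightarrow> \<bar>v x\<bar> \<le> M"
  shows "x \<in> {0..1} \<Longrightarrow> \<bar>induced v x\<bar> \<le> M * real (\<tau> x)"
    and "A \<in> elems \<Longrightarrow> varbound (induced v) A (B * real (rtime A))"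
proof -
  show "\<bar>induced v x\<bar> \<le> M * real (\<tau> x)" if x: "x \<in> {0..1}" for x
  proof -
    have "\<bar>induced v x\<bar> \<le> (\<Sum>j<\<tau> x. \<bar>v ((f ^^ j) x)\<bar>)" unfolding induced_def by (rule sum_abs)
    also have "\<dots> \<le> (\<Sum>j<\<tau> x. M)" using v(2) f_unit[OF f x] by (intro sum_mono) auto
    finally show ?thesis by (simp add: mult.commute)
  qed
  assume A: "A \<in> elems"
  obtain a where a: "a \<in> \<alpha>" "A \<subseteq> a" "A \<subseteq> {0..1}" "A \<noteq> {}" using A by (rule elems_props)
  obtain x where x: "x \<in> A" using a(4) by blast
  have "varbound (\<lambda>x. v ((f ^^ j) x)) A B" if "j < rtime A" for j
  proof (rule varbound_comp_mono[OF v(1), where \<psi>="f ^^ j"])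
    show "(f ^^ j) ` A \<subseteq> {0..1}" using f_unit[OF f] a(3) by blast
    have "j \<le> \<tau> x" using that elems_const(1)[OF A x] by simp
    then have "mono_on a (f ^^ j) \<or> antimono_on a (f ^^ j)" using iterates_on_elements[OF a(1), of x j] x a(2) by blast
    then show "mono_on A (f ^^ j) \<or> antimono_on A (f ^^ j)" using a(2) by (meson monotone_on_subset)
  qed
  then have "varbound (\<lambda>x. \<Sum>j<rtime A. v ((f ^^ j) x)) A (\<Sum>j<rtime A. B)" by (intro varbound_sum) auto
  then show "varbound (induced v) A (B * real (rtime A))"
    by (rule varbound_cong[OF varbound_mono]) (use elems_const(1)[OF A] in \<open>auto simp: induced_def\<close>)
qed

end


section \<open>From the induced map to the original map\<close>

lemma powr_tail_sum:
  assumes \<beta>: "0 < \<beta>" and k: "1 \<le> k"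
  shows "(\<Sum>j<N. real (max j k) powr (- (\<beta> + 1))) \<le> (2 + 1 / \<beta>) * real k powr (- \<beta>)"
proof -
  let ?g = "\<lambda>j. real (max j k) powr (- (\<beta> + 1))"
  have mono: "(\<Sum>j<N. ?g j) \<le> (\<Sum>j<N + (k + 1). ?g j)" by (intro sum_mono2) auto
  have "(\<Sum>j<M. ?g j) \<le> real (k + 1) * real k powr (- (\<beta> + 1)) + (real k powr (- \<beta>) - real (M - 1) powr (- \<beta>)) / \<beta>" if "k + 1 \<le> M" for M
    using that
  proof (induction M rule: nat_induct_at_least)
    case base
    have "(\<Sum>j<k + 1. ?g j) = (\<Sum>j<k + 1. real k powr (- (\<beta> + 1)))" by (intro sum.cong refl) (auto simp: max_def)
    then show ?case by simp
  next
    case (Suc M)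
    have M: "0 < real (M - 1)" "real (M - 1) < real M" "k \<le> M" using Suc.hyps k by auto
    have d: "((\<lambda>x. x powr (- \<beta>)) has_real_derivative - \<beta> * x powr (- \<beta> - 1)) (at x)" if "real (M - 1) \<le> x" for x
      using that M by (auto intro!: derivative_eq_intros)
    obtain z where z: "real (M - 1) < z" "z < real M" "real M powr (- \<beta>) - real (M - 1) powr (- \<beta>) = (real M - real (M - 1)) * (- \<beta> * z powr (- \<beta> - 1))"
      using MVT2[OF M(2) d] by blast
    have "real M powr (- (\<beta> + 1)) \<le> z powr (- \<beta> - 1)" proof -
      have "real M powr (- (\<beta> + 1)) \<le> z powr (- (\<beta> + 1))" using z M \<beta> by (intro powr_mono2') auto
      moreover have "- (\<beta> + 1) = - \<beta> - 1" by simp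
      ultimately show ?thesis by (simp only:)
    qed
    then have "\<beta> * real M powr (- (\<beta> + 1)) \<le> \<beta> * z powr (- \<beta> - 1)" using \<beta> by simp
    also have "\<dots> = real (M - 1) powr (- \<beta>) - real M powr (- \<beta>)" using z(3) M k by (simp add: of_nat_diff)
    finally have "real M powr (- (\<beta> + 1)) \<le> (real (M - 1) powr (- \<beta>) - real M powr (- \<beta>)) / \<beta>"
      using \<beta> by (simp add: pos_le_divide_eq mult.commute)
    moreover have "?g M = real M powr (- (\<beta> + 1))" using M(3) by (simp add: max_def)
    ultimately show ?case using Suc.IH by (simp add: diff_divide_distrib)
  qed
  from this[of "N + (k + 1)"] have "(\<Sum>j<N + (k + 1). ?g j) \<le> real (k + 1) * real k powr (- (\<beta> + 1)) + (real k powr (- \<beta>) - real (N + (k + 1) - 1) powr (- \<beta>)) / \<beta>" by simp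
  also have "\<dots> \<le> 2 * real k powr (- \<beta>) + real k powr (- \<beta>) / \<beta>"
  proof (intro add_mono divide_right_mono)
    have "real (k + 1) * real k powr (- (\<beta> + 1)) \<le> (2 * real k) * real k powr (- (\<beta> + 1))" using k by (intro mult_right_mono) auto
    also have "\<dots> = 2 * (real k powr 1 * real k powr (- (\<beta> + 1)))" by simp
    also have "\<dots> = 2 * real k powr (- \<beta>)" unfolding powr_add[symmetric] by simp
    finally show "real (k + 1) * real k powr (- (\<beta> + 1)) \<le> 2 * real k powr (- \<beta>)" .
  qed (use \<beta> in auto)
  finally show ?thesis using mono by (simp add: algebra_simps)
qed

context inducing_construction
begin

lemma space_muF [simp]: "space \<mu>\<^sub>F = {0..1}" and sets_muF [measurable_cong]: "sets \<mu>\<^sub>F = sets leb"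
  by (simp_all add: muF_density)

lemma space_mu [simp]: "space \<mu> = {0..1}"
  using sets_eq_imp_space_eq[OF mu_sets] by simp

lemma F_measurable [measurable]: "F \<in> measurable leb leb"
  using muF_ergodic measurable_cong_sets[OF sets_muF sets_muF] by (auto simp: ergodic_map_def measure_preserving_map_def)

definition mean_time :: real where "mean_time = (\<integral>x. real (\<tau> x) \<partial>\<mu>\<^sub>F)"

lemma tau_muF_integrable: "integrable \<mu>\<^sub>F (\<lambda>x. real (\<tau> x))"
proof -
  obtain H where H: "bv0 h0 H" using h0_bv by blast
  have hm[measurable]: "h0 \<in> borel_measurable leb" using H by (rule bv0_leb)
  have "integrable leb (\<lambda>x. h0 x * real (\<tau> x))"
    by (rule Bochner_Integration.integrable_bound[OF integrable_mult_right[OF \<tau>_integrable, of H]])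
      (use bv0_bound[OF H] bv0_nonneg[OF H] in \<open>auto simp: abs_mult intro!: AE_I2 mult_right_mono\<close>)
  moreover have "0 \<le> h0 x" for x using h_nonneg by (simp add: h0_def)
  ultimately show ?thesis unfolding muF_h0 by (subst integrable_density) auto
qed

lemma mean_time_ge1: assumes f: "piecewise_smooth f" shows "1 \<le> mean_time"
proof -
  interpret prob_space \<mu>\<^sub>F by (rule muF_prob)
  have "(\<integral>x. 1 \<partial>\<mu>\<^sub>F) \<le> mean_time"
    unfolding mean_time_def by (rule integral_mono[OF _ tau_muF_integrable]) (use tau_pos[OF f] in fastforce)+
  then show ?thesis using prob_space by simp
qed

text \<open>The part of the preimage of \<open>A\<close> that lies in level \<open>j\<close> of the tower over the induced map.\<close>

definition column :: "real set \<Rightarrow> nat \<Rightarrow> real set" where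
  "column A j = {x \<in> {0..1}. \<tau> x > j \<and> (f ^^ j) x \<in> A}"

lemma column_sets [measurable]: assumes [measurable]: "A \<in> sets leb" shows "column A j \<in> sets leb"
proof -
  have "column A j = {x \<in> space leb. \<tau> x > j \<and> (f ^^ j) x \<in> A}" by (simp add: column_def)
  also have "\<dots> \<in> sets leb" by measurable
  finally show ?thesis .
qed

lemma tower_nn:
  assumes A[measurable]: "A \<in> sets leb"
  shows "(\<integral>\<^sup>+x. (\<Sum>j<\<tau> x. indicator A ((f ^^ j) x)) \<partial>\<mu>\<^sub>F) = (\<Sum>j. emeasure \<mu>\<^sub>F (column A j))"
proof -
  have "(\<integral>\<^sup>+x. (\<Sum>j<\<tau> x. indicator A ((f ^^ j) x)) \<partial>\<mu>\<^sub>F) = (\<integral>\<^sup>+x. (\<Sum>j. indicator (column A j) x) \<partial>\<mu>\<^sub>F)"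
  proof (rule nn_integral_cong)
    fix x assume x: "x \<in> space \<mu>\<^sub>F"
    have "(\<Sum>j. indicator (column A j) x :: ennreal) = (\<Sum>j<\<tau> x. indicator (column A j) x)"
      by (rule suminf_finite) (auto simp: column_def)
    also have "\<dots> = (\<Sum>j<\<tau> x. indicator A ((f ^^ j) x))"
      by (rule sum.cong) (use x in \<open>auto simp: column_def indicator_def\<close>)
    finally show "(\<Sum>j<\<tau> x. indicator A ((f ^^ j) x)) = (\<Sum>j. indicator (column A j) x :: ennreal)" by simp
  qed
  also have "\<dots> = (\<Sum>j. \<integral>\<^sup>+x. indicator (column A j) x \<partial>\<mu>\<^sub>F)" by (rule nn_integral_suminf) measurable
  also have "\<dots> = (\<Sum>j. emeasure \<mu>\<^sub>F (column A j))" by (simp add: sets_muF)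
  finally show ?thesis .
qed

lemma column_summable: assumes A: "A \<in> sets leb" shows "summable (\<lambda>j. measure \<mu>\<^sub>F (column A j))"
proof -
  interpret prob_space \<mu>\<^sub>F by (rule muF_prob)
  have U: "{0..1} \<in> sets leb" by (simp add: sets_restrict_space_iff)
  have "(\<Sum>j. emeasure \<mu>\<^sub>F (column A j)) = (\<integral>\<^sup>+x. (\<Sum>j<\<tau> x. indicator A ((f ^^ j) x)) \<partial>\<mu>\<^sub>F)" by (rule tower_nn[OF A, symmetric])
  also have "\<dots> \<le> (\<integral>\<^sup>+x. ennreal (real (\<tau> x)) \<partial>\<mu>\<^sub>F)"
  proof (rule nn_integral_mono)
    fix x
    have "(\<Sum>j<\<tau> x. indicator A ((f ^^ j) x) :: ennreal) \<le> (\<Sum>j<\<tau> x. 1)" by (intro sum_mono) (auto simp: indicator_def)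
    then show "(\<Sum>j<\<tau> x. indicator A ((f ^^ j) x)) \<le> ennreal (real (\<tau> x))" by (simp add: ennreal_of_nat_eq_real_of_nat)
  qed
  also have "\<dots> < top" using tau_muF_integrable by (simp add: nn_integral_eq_integral less_top[symmetric])
  finally have "(\<Sum>j. ennreal (measure \<mu>\<^sub>F (column A j))) \<noteq> top" by (simp add: emeasure_eq_measure)
  then show ?thesis by (rule summable_suminf_not_top[rotated]) simp
qed

lemma mu_column:
  assumes A: "A \<in> sets leb"
  shows "measure \<mu> A = inverse mean_time * (\<Sum>j. measure \<mu>\<^sub>F (column A j))"
  using mu_eq[of A] A mu_sets by (simp add: mean_time_def column_def)

text \<open>The description of \<open>\<mu>\<close> on sets extends to functions by monotone approximation.\<close>

lemma mu_nn_integral: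
  assumes f: "piecewise_smooth f" and u: "u \<in> borel_measurable leb"
  shows "(\<integral>\<^sup>+x. u x \<partial>\<mu>) = ennreal (inverse mean_time) * (\<integral>\<^sup>+x. (\<Sum>j<\<tau> x. u ((f ^^ j) x)) \<partial>\<mu>\<^sub>F)"
proof -
  interpret M: prob_space \<mu> by (rule mu_prob)
  interpret MF: prob_space \<mu>\<^sub>F by (rule muF_prob)
  have mt: "0 \<le> inverse mean_time" using mean_time_ge1[OF f] by simp
  have me: "(\<lambda>x. \<Sum>j<\<tau> x. w ((f ^^ j) x)) \<in> borel_measurable \<mu>\<^sub>F" if [measurable]: "w \<in> borel_measurable leb" for w :: "real \<Rightarrow> ennreal"
  proof -
    have "(\<lambda>x. \<Sum>j<\<tau> x. w ((f ^^ j) x)) \<in> borel_measurable leb"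
      by (rule measurable_compose_countable[where f="\<lambda>n x. \<Sum>j<n. w ((f ^^ j) x)", OF _ tau_meas]) measurable
    then show ?thesis by (simp add: measurable_cong_sets[OF sets_muF refl])
  qed
  have bm: "borel_measurable leb = borel_measurable \<mu>" by (rule measurable_cong_sets[OF mu_sets[symmetric] refl])
  from u show ?thesis
  proof (induction u rule: borel_measurable_induct)
    case (cong w u)
    have "(\<integral>\<^sup>+x. w x \<partial>\<mu>) = (\<integral>\<^sup>+x. u x \<partial>\<mu>)" using cong(3) by (intro nn_integral_cong) simp
    moreover have "(\<integral>\<^sup>+x. (\<Sum>j<\<tau> x. w ((f ^^ j) x)) \<partial>\<mu>\<^sub>F) = (\<integral>\<^sup>+x. (\<Sum>j<\<tau> x. u ((f ^^ j) x)) \<partial>\<mu>\<^sub>F)"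
      using cong(3) f_unit[OF f] by (intro nn_integral_cong sum.cong refl) simp
    ultimately show ?case using cong by simp
  next
    case (set A)
    have "(\<integral>\<^sup>+x. indicator A x \<partial>\<mu>) = ennreal (measure \<mu> A)" using set mu_sets by (simp add: M.emeasure_eq_measure)
    also have "\<dots> = ennreal (inverse mean_time) * ennreal (\<Sum>j. measure \<mu>\<^sub>F (column A j))"
      unfolding mu_column[OF set] using mt by (intro ennreal_mult suminf_nonneg column_summable set) auto
    also have "ennreal (\<Sum>j. measure \<mu>\<^sub>F (column A j)) = (\<Sum>j. emeasure \<mu>\<^sub>F (column A j))"
      unfolding MF.emeasure_eq_measure by (intro suminf_ennreal2[symmetric] column_summable set) auto
    finally show ?case using tower_nn[OF set] by simp
  next
    case (mult w c)
    have "(\<integral>\<^sup>+x. (\<Sum>j<\<tau> x. c * w ((f ^^ j) x)) \<partial>\<mu>\<^sub>F) = c * (\<integral>\<^sup>+x. (\<Sum>j<\<tau> x. w ((f ^^ j) x)) \<partial>\<mu>\<^sub>F)"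
      unfolding sum_distrib_left[symmetric] by (rule nn_integral_cmult[OF me[OF mult(2)]])
    moreover have "(\<integral>\<^sup>+x. c * w x \<partial>\<mu>) = c * (\<integral>\<^sup>+x. w x \<partial>\<mu>)" using mult(2) unfolding bm by (rule nn_integral_cmult)
    ultimately show ?case using mult by (simp add: mult.left_commute)
  next
    case (add w z)
    have "(\<integral>\<^sup>+x. (\<Sum>j<\<tau> x. z ((f ^^ j) x) + w ((f ^^ j) x)) \<partial>\<mu>\<^sub>F) = (\<integral>\<^sup>+x. (\<Sum>j<\<tau> x. z ((f ^^ j) x)) \<partial>\<mu>\<^sub>F) + (\<integral>\<^sup>+x. (\<Sum>j<\<tau> x. w ((f ^^ j) x)) \<partial>\<mu>\<^sub>F)"
      unfolding sum.distrib using add by (intro nn_integral_add me) auto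
    moreover have "(\<integral>\<^sup>+x. z x + w x \<partial>\<mu>) = (\<integral>\<^sup>+x. z x \<partial>\<mu>) + (\<integral>\<^sup>+x. w x \<partial>\<mu>)"
      using add unfolding bm by (intro nn_integral_add) auto
    ultimately show ?case using add by (simp add: distrib_left add.commute)
  next
    case (seq U)
    have Ui: "incseq (\<lambda>i. U i x)" for x using seq(3) by (auto simp: incseq_def le_fun_def)
    have "(\<integral>\<^sup>+x. (SUP i. U i) x \<partial>\<mu>) = (\<integral>\<^sup>+x. (SUP i. U i x) \<partial>\<mu>)" by (simp add: SUP_apply image_image)
    also have "\<dots> = (SUP i. \<integral>\<^sup>+x. U i x \<partial>\<mu>)"
      using seq(1,3) unfolding bm by (intro nn_integral_monotone_convergence_SUP) auto
    finally have 1: "(\<integral>\<^sup>+x. (SUP i. U i) x \<partial>\<mu>) = (SUP i. \<integral>\<^sup>+x. U i x \<partial>\<mu>)" .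
    have "(\<integral>\<^sup>+x. (\<Sum>j<\<tau> x. (SUP i. U i) ((f ^^ j) x)) \<partial>\<mu>\<^sub>F) = (\<integral>\<^sup>+x. (SUP i. \<Sum>j<\<tau> x. U i ((f ^^ j) x)) \<partial>\<mu>\<^sub>F)"
      using Ui by (intro nn_integral_cong) (simp add: SUP_apply image_image ennreal_SUP_sum)
    also have "\<dots> = (SUP i. \<integral>\<^sup>+x. (\<Sum>j<\<tau> x. U i ((f ^^ j) x)) \<partial>\<mu>\<^sub>F)"
    proof (rule nn_integral_monotone_convergence_SUP)
      show "incseq (\<lambda>i x. \<Sum>j<\<tau> x. U i ((f ^^ j) x))"
        using Ui by (auto simp: incseq_def le_fun_def intro!: sum_mono)
      show "(\<lambda>x. \<Sum>j<\<tau> x. U i ((f ^^ j) x)) \<in> borel_measurable \<mu>\<^sub>F" for i by (rule me[OF seq(1)])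
    qed
    finally show ?case using 1 seq by (simp add: SUP_mult_left_ennreal)
  qed
qed

text \<open>Kac's formula, applied to the nonnegative function \<open>v + M\<close>.\<close>

lemma induced_mean:
  assumes f: "piecewise_smooth f" and v[measurable]: "v \<in> borel_measurable leb" and vM: "\<And>x. x \<in> {0..1} \<Longrightarrow> \<bar>v x\<bar> \<le> M"
    and v0: "(\<integral>x. v x \<partial>\<mu>) = 0"
  shows "(\<integral>x. induced v x * h0 x \<partial>leb) = 0"
proof -
  interpret P: prob_space \<mu> by (rule mu_prob)
  have vmu: "v \<in> borel_measurable \<mu>" using v by (simp add: measurable_cong_sets[OF mu_sets refl])
  have M0: "0 \<le> M" using vM[of 0] by simp
  have iv: "integrable \<mu> v" by (rule P.integrable_const_bound[where B=M]) (use vM vmu in \<open>auto intro!: AE_I2\<close>)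
  have mt: "1 \<le> mean_time" by (rule mean_time_ge1[OF f])
  have im[measurable]: "induced v \<in> borel_measurable leb" by (rule induced_meas[OF v])
  have im': "induced v \<in> borel_measurable \<mu>\<^sub>F" using im by (simp add: measurable_cong_sets[OF sets_muF refl])
  have ib: "\<bar>induced v x\<bar> \<le> M * real (\<tau> x)" if x: "x \<in> {0..1}" for x
  proof -
    have "\<bar>induced v x\<bar> \<le> (\<Sum>j<\<tau> x. \<bar>v ((f ^^ j) x)\<bar>)" unfolding induced_def by (rule sum_abs)
    also have "\<dots> \<le> (\<Sum>j<\<tau> x. M)" using vM f_unit[OF f x] by (intro sum_mono) auto
    finally show ?thesis by (simp add: mult.commute)
  qed
  have ii: "integrable \<mu>\<^sub>F (induced v)"
    by (rule Bochner_Integration.integrable_bound[OF integrable_mult_right[OF tau_muF_integrable, of M] im'])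
      (use ib M0 in \<open>auto intro!: AE_I2\<close>)
  have "ennreal M = (\<integral>\<^sup>+x. ennreal (v x + M) \<partial>\<mu>)"
  proof -
    have "(\<integral>\<^sup>+x. ennreal (v x + M) \<partial>\<mu>) = ennreal (\<integral>x. v x + M \<partial>\<mu>)"
    proof (intro nn_integral_eq_integral AE_I2)
      show "integrable \<mu> (\<lambda>x. v x + M)" using iv by auto
      show "0 \<le> v x + M" if "x \<in> space \<mu>" for x using vM[of x] that by (simp add: abs_le_iff)
    qed
    also have "(\<integral>x. v x + M \<partial>\<mu>) = M" using iv v0 P.prob_space by simp
    finally show ?thesis by simp
  qed
  also have "\<dots> = ennreal (inverse mean_time) * (\<integral>\<^sup>+x. (\<Sum>j<\<tau> x. ennreal (v ((f ^^ j) x) + M)) \<partial>\<mu>\<^sub>F)"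
    by (rule mu_nn_integral[OF f]) measurable
  also have "(\<integral>\<^sup>+x. (\<Sum>j<\<tau> x. ennreal (v ((f ^^ j) x) + M)) \<partial>\<mu>\<^sub>F) = (\<integral>\<^sup>+x. ennreal (induced v x + M * real (\<tau> x)) \<partial>\<mu>\<^sub>F)"
  proof (rule nn_integral_cong)
    fix x assume "x \<in> space \<mu>\<^sub>F"
    then have "0 \<le> v ((f ^^ j) x) + M" for j using vM[OF f_unit[OF f, of x j]] by (simp add: abs_le_iff)
    then show "(\<Sum>j<\<tau> x. ennreal (v ((f ^^ j) x) + M)) = ennreal (induced v x + M * real (\<tau> x))"
      by (simp add: induced_def sum.distrib mult.commute)
  qed
  also have "\<dots> = ennreal (\<integral>x. induced v x + M * real (\<tau> x) \<partial>\<mu>\<^sub>F)"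
  proof (intro nn_integral_eq_integral AE_I2)
    show "integrable \<mu>\<^sub>F (\<lambda>x. induced v x + M * real (\<tau> x))" using ii tau_muF_integrable by auto
    fix x assume "x \<in> space \<mu>\<^sub>F"
    then have "\<bar>induced v x\<bar> \<le> M * real (\<tau> x)" using ib by simp
    then show "0 \<le> induced v x + M * real (\<tau> x)" by linarith
  qed
  also have "(\<integral>x. induced v x + M * real (\<tau> x) \<partial>\<mu>\<^sub>F) = (\<integral>x. induced v x \<partial>\<mu>\<^sub>F) + M * mean_time"
    using ii tau_muF_integrable by (simp add: mean_time_def)
  finally have e: "ennreal M = ennreal (inverse mean_time) * ennreal ((\<integral>x. induced v x \<partial>\<mu>\<^sub>F) + M * mean_time)" .
  have nn: "0 \<le> (\<integral>x. induced v x \<partial>\<mu>\<^sub>F) + M * mean_time"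
  proof -
    have "\<bar>\<integral>x. induced v x \<partial>\<mu>\<^sub>F\<bar> \<le> (\<integral>x. \<bar>induced v x\<bar> \<partial>\<mu>\<^sub>F)" by (rule integral_abs_bound)
    also have "\<dots> \<le> (\<integral>x. M * real (\<tau> x) \<partial>\<mu>\<^sub>F)"
      using ii tau_muF_integrable ib by (intro integral_mono) auto
    finally show ?thesis by (simp add: mean_time_def)
  qed
  have "ennreal M = ennreal (inverse mean_time * ((\<integral>x. induced v x \<partial>\<mu>\<^sub>F) + M * mean_time))"
    using e nn mt by (simp add: ennreal_mult)
  then have "M = inverse mean_time * ((\<integral>x. induced v x \<partial>\<mu>\<^sub>F) + M * mean_time)"
    using nn mt M0 by (subst (asm) ennreal_inj) auto
  then have "(\<integral>x. induced v x \<partial>\<mu>\<^sub>F) = 0" using mt by (simp add: field_simps)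
  moreover obtain H where "bv0 h0 H" using h0_bv by blast
  then have [measurable]: "h0 \<in> borel_measurable leb" by (rule bv0_leb)
  have "(\<integral>x. induced v x \<partial>\<mu>\<^sub>F) = (\<integral>x. h0 x * induced v x \<partial>leb)"
    unfolding muF_h0 using h_nonneg by (subst integral_density) (auto simp: h0_def)
  ultimately show ?thesis by (simp add: mult.commute)
qed

text \<open>The time of the \<open>i\<close>-th return, in steps of \<open>f\<close>.\<close>

definition time :: "real \<Rightarrow> nat \<Rightarrow> nat" where "time x i = (\<Sum>l<i. \<tau> ((F ^^ l) x))"

lemma F_time: "(F ^^ i) x = (f ^^ time x i) x"
proof (induction i)
  case (Suc i)
  have "(F ^^ Suc i) x = (f ^^ \<tau> ((F ^^ i) x)) ((F ^^ i) x)" by (simp add: F_def induced_map_def \<tau>_def)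
  also have "\<dots> = (f ^^ (\<tau> ((F ^^ i) x) + time x i)) x" by (simp add: funpow_add Suc[symmetric])
  also have "\<tau> ((F ^^ i) x) + time x i = time x (Suc i)" by (simp add: time_def)
  finally show ?case .
qed (simp add: time_def)

lemma sum_induced: "(\<Sum>l<time x i. v ((f ^^ l) x)) = (\<Sum>l<i. induced v ((F ^^ l) x))"
proof (induction i)
  case (Suc i)
  have t: "time x (Suc i) = time x i + \<tau> ((F ^^ i) x)" by (simp add: time_def)
  have "(\<Sum>l<\<tau> ((F ^^ i) x). v ((f ^^ (time x i + l)) x)) = induced v ((F ^^ i) x)"
    unfolding induced_def F_time[of i x] by (intro sum.cong refl) (simp add: funpow_add add.commute[of "time x i"])
  then show ?case unfolding t sum_lessThan_split using Suc by simp
qed (simp add: time_def)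

text \<open>Take for \<open>N\<close> the number of returns up to time \<open>j + n\<close>.  The excursions that start at or before this time are short: the first one by
  assumption, the others because they start at \<open>f\<^sup>l (f\<^sup>j x)\<close> for some \<open>1 \<le> l \<le> n\<close>.  The two incomplete excursions at
  the ends have fewer than \<open>k\<close> steps each.\<close>

lemma deviation_dichotomy:
  assumes f: "piecewise_smooth f" and vM: "\<And>x. x \<in> {0..1} \<Longrightarrow> \<bar>v x\<bar> \<le> M" and x: "x \<in> {0..1}"
    and reg: "\<And>i. (F ^^ i) x \<in> \<Union>elems" and j: "j < \<tau> x" "\<tau> x \<le> k" and kn: "k \<le> n"
    and short: "\<And>l. 1 \<le> l \<Longrightarrow> l \<le> n \<Longrightarrow> \<tau> ((f ^^ l) ((f ^^ j) x)) \<le> k"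
  shows "\<exists>N\<le>2 * n. (\<forall>i<N. (F ^^ i) x \<in> \<Union>{A \<in> elems. rtime A \<le> k}) \<and>
     \<bar>\<Sum>i<n. v ((f ^^ i) ((f ^^ j) x))\<bar> \<le> \<bar>\<Sum>i<N. induced v ((F ^^ i) x)\<bar> + 2 * real k * M"
proof -
  have M0: "0 \<le> M" using vM[OF x] by simp
  have Fu: "(F ^^ i) x \<in> {0..1}" for i unfolding F_time by (rule f_unit[OF f x])
  have tS: "time x (Suc i) = time x i + \<tau> ((F ^^ i) x)" for i by (simp add: time_def)
  have ti: "i \<le> time x i" for i
  proof (induction i)
    case (Suc i) then show ?case using tau_pos[OF f Fu[of i]] by (simp add: tS)
  qed simp
  have tmono: "i \<le> i' \<Longrightarrow> time x i \<le> time x i'" for i i' unfolding time_def by (intro sum_mono2) auto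
  define S where "S = {i. time x i \<le> j + n}"
  have Sfin: "finite S" by (rule finite_subset[of _ "{..j + n}"]) (use ti in \<open>auto simp: S_def intro: order_trans\<close>)
  have "0 \<in> S" by (simp add: S_def time_def)
  define N where "N = Max S"
  have NS: "time x N \<le> j + n" using Max_in[OF Sfin] \<open>0 \<in> S\<close> by (auto simp: N_def S_def)
  have Nmax: "j + n < time x (Suc N)"
  proof (rule ccontr)
    assume "\<not> ?thesis"
    then have "Suc N \<in> S" by (simp add: S_def)
    then show False using Max_ge[OF Sfin, of "Suc N"] by (simp add: N_def)
  qed
  have N2: "N \<le> 2 * n" using ti[of N] NS j kn by linarith
  have short': "\<tau> ((F ^^ i) x) \<le> k" if "i \<le> N" for i
  proof (cases i)
    case 0 then show ?thesis using j by simp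
  next
    case (Suc i')
    have "j < time x i" using tmono[of 1 i] Suc j by (simp add: time_def)
    moreover have "time x i \<le> j + n" using tmono[OF that] NS by linarith
    ultimately have l: "1 \<le> time x i - j" "time x i - j \<le> n" "(time x i - j) + j = time x i" by auto
    have "(f ^^ (time x i - j)) ((f ^^ j) x) = (f ^^ ((time x i - j) + j)) x" by (simp add: funpow_add)
    then show ?thesis using short[OF l(1,2)] unfolding F_time l(3) by simp
  qed
  have "(F ^^ i) x \<in> \<Union>{A \<in> elems. rtime A \<le> k}" if "i < N" for i
  proof -
    obtain A where A: "A \<in> elems" "(F ^^ i) x \<in> A" using reg by blast
    then show ?thesis using elems_const(1)[OF A] short'[of i] that by auto
  qed
  moreover have "\<bar>\<Sum>i<n. v ((f ^^ i) ((f ^^ j) x))\<bar> \<le> \<bar>\<Sum>i<N. induced v ((F ^^ i) x)\<bar> + 2 * real k * M"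
  proof -
    define r where "r = j + n - time x N"
    have r: "j + n = time x N + r" "r \<le> k" using NS Nmax short'[of N] by (simp_all add: r_def tS)
    have part: "\<bar>\<Sum>l<m. v ((f ^^ (a + l)) x)\<bar> \<le> real k * M" if "m \<le> k" for m a
    proof -
      have "\<bar>\<Sum>l<m. v ((f ^^ (a + l)) x)\<bar> \<le> (\<Sum>l<m. \<bar>v ((f ^^ (a + l)) x)\<bar>)" by (rule sum_abs)
      also have "\<dots> \<le> (\<Sum>l<m. M)" using vM f_unit[OF f x] by (intro sum_mono) auto
      also have "\<dots> \<le> real k * M" using that M0 by (simp add: mult_right_mono)
      finally show ?thesis .
    qed
    have "(\<Sum>l<j + n. v ((f ^^ l) x)) = (\<Sum>l<j. v ((f ^^ l) x)) + (\<Sum>l<n. v ((f ^^ (j + l)) x))" by (rule sum_lessThan_split)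
    moreover have "(\<Sum>l<n. v ((f ^^ (j + l)) x)) = (\<Sum>i<n. v ((f ^^ i) ((f ^^ j) x)))"
      by (intro sum.cong refl) (simp add: funpow_add add.commute[of j])
    moreover have "(\<Sum>l<j + n. v ((f ^^ l) x)) = (\<Sum>i<N. induced v ((F ^^ i) x)) + (\<Sum>l<r. v ((f ^^ (time x N + l)) x))"
      unfolding r(1) sum_lessThan_split sum_induced ..
    moreover have "\<bar>\<Sum>l<j. v ((f ^^ l) x)\<bar> \<le> real k * M" using part[of j 0] j by simp
    moreover have "\<bar>\<Sum>l<r. v ((f ^^ (time x N + l)) x)\<bar> \<le> real k * M" by (rule part[OF r(2)])
    ultimately show ?thesis by linarith
  qed
  ultimately show ?thesis using N2 by blast
qed


lemma muF_return_tail: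
  assumes f: "piecewise_smooth f"
  shows "measure \<mu>\<^sub>F {x \<in> {0..1}. \<tau> x > j} \<le> mean_time * measure \<mu> {x \<in> {0..1}. \<tau> x > j}"
proof -
  define A where "A = {x \<in> {0..1}. \<tau> x > j}"
  have A: "A \<in> sets leb"
  proof -
    have "A = {x \<in> space leb. \<tau> x > j}" by (simp add: A_def)
    also have "\<dots> \<in> sets leb" by measurable
    finally show ?thesis .
  qed
  have "column A 0 = A" using tau_pos[OF f] by (force simp: column_def A_def)
  then have "measure \<mu>\<^sub>F A = (\<Sum>i<1. measure \<mu>\<^sub>F (column A i))" by simp
  also have "\<dots> \<le> (\<Sum>i. measure \<mu>\<^sub>F (column A i))" by (intro sum_le_suminf column_summable A) auto
  also have "\<dots> = mean_time * measure \<mu> A" unfolding mu_column[OF A] using mean_time_ge1[OF f] by simp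
  finally show ?thesis unfolding A_def .
qed

text \<open>Apply the one-sided estimate to \<open>v\<close> and to \<open>- v\<close>.\<close>

lemma level_deviation:
  assumes f: "piecewise_smooth f" and fin: "finite (crit_set f)" and A1: "A1 f ell" and A2: "A2 f" and A3: "A3 f ell p" and p: "1 < p"
    and v: "varbound v {0..1} B" and vm[measurable]: "v \<in> borel_measurable leb" and v0: "(\<integral>x. v x \<partial>\<mu>) = 0"
  shows "\<exists>s w. 0 < s \<and> 0 < w \<and> (\<forall>\<epsilon>>0. \<exists>\<omega> k0. 0 < \<omega> \<and> (\<forall>t k K y. 0 < t \<and> t \<le> \<omega> \<and> k0 \<le> k \<and> t powr s * exp (t * w * real k) \<le> \<omega> \<longrightarrow>
     measure \<mu>\<^sub>F {x \<in> {0..1}. (\<forall>i<K. (F ^^ i) x \<in> \<Union>{A \<in> elems. rtime A \<le> k}) \<and> y \<le> \<bar>\<Sum>i<K. induced v ((F ^^ i) x)\<bar>}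
       \<le> 8 * exp (\<epsilon> * t * real K - t * y)))"
proof -
  interpret P: prob_space \<mu>\<^sub>F by (rule muF_prob)
  obtain \<kappa> s where \<kappa>s: "0 < s \<and> s \<le> 1 \<and> (\<lambda>A. real (rtime A) powr (1 + s) * \<kappa> A) summable_on elems \<and> \<kappa> summable_on elems \<and>
    (\<forall>A\<in>elems. (\<forall>x\<in>A. \<bar>1 / deriv F x\<bar> \<le> \<kappa> A) \<and> varbound (\<lambda>x. \<bar>1 / deriv F x\<bar>) A (\<kappa> A))"
    using branch_bounds[OF f fin A1 A2 A3 p] by (elim exE)
  obtain \<sigma> H where erg: "ergodic_branches F (deriv F) elems \<kappa> \<sigma> h0 H"
    using ergodic_system[OF f, of \<kappa>] \<kappa>s by blast
  define M where "M = \<bar>v 0\<bar> + B"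
  have vM: "\<bar>v x\<bar> \<le> M" if "x \<in> {0..1}" for x unfolding M_def using varbound_bounded[OF v that] .
  have B0: "0 \<le> B" using v by (rule varbound_nonneg)
  define w where "w = M + B + 1"
  have w: "0 < w" "M \<le> w" "B \<le> w" using B0 by (auto simp: w_def M_def)
  have obs: "observable_branches F (deriv F) elems \<kappa> \<sigma> h0 H rtime (induced u) w s"
    if u: "varbound u {0..1} B" "\<And>x. x \<in> {0..1} \<Longrightarrow> \<bar>u x\<bar> \<le> M" "u \<in> borel_measurable leb" "(\<integral>x. u x \<partial>\<mu>) = 0" for u
  proof -
    interpret E: ergodic_branches F "deriv F" elems \<kappa> \<sigma> h0 H by (rule erg)
    have im: "induced u \<in> borel_measurable leb" by (rule induced_meas[OF u(3)])
    show ?thesis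
    proof unfold_locales
      show "1 \<le> rtime A" if A: "A \<in> elems" for A
      proof -
        obtain x where x: "x \<in> A" "x \<in> {0..1}" using elems_unit[OF A] by blast
        then show ?thesis using tau_pos[OF f x(2)] elems_const(1)[OF A x(1)] by simp
      qed
      show "finite {A \<in> elems. rtime A \<le> k}" for k
      proof (rule finite_subset)
        obtain M' where "\<forall>k. finite {A \<in> elems. bper A = k} \<and> card {A \<in> elems. bper A = k} \<le> M'" using elems_count by blast
        then show "finite (\<Union>i\<le>k. {A \<in> elems. bper A = i})" by auto
        show "{A \<in> elems. rtime A \<le> k} \<subseteq> (\<Union>i\<le>k. {A \<in> elems. bper A = i})" using bper_le(1) by fastforce
      qed
      show "\<bar>induced u x\<bar> \<le> w * real (rtime A)" if A: "A \<in> elems" and x: "x \<in> A" for A x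
      proof -
        have "x \<in> {0..1}" using elems_unit[OF A] x by blast
        then have "\<bar>induced u x\<bar> \<le> M * real (\<tau> x)" using induced_regular(1)[OF f u(1,2)] by blast
        also have "\<dots> \<le> w * real (\<tau> x)" using w by (intro mult_right_mono) auto
        finally show ?thesis using elems_const(1)[OF A x] by simp
      qed
      show "varbound (induced u) A (w * real (rtime A))" if A: "A \<in> elems" for A
        by (rule varbound_mono[OF induced_regular(2)[OF f u(1,2) A]]) (use w in \<open>auto intro: mult_right_mono\<close>)
      show "integrable leb (induced u)"
      proof (rule Bochner_Integration.integrable_bound[OF integrable_mult_right[OF \<tau>_integrable, of M] im], rule AE_I2)
        fix x assume "x \<in> space leb"
        then have "\<bar>induced u x\<bar> \<le> M * real (\<tau> x)" using induced_regular(1)[OF f u(1,2)] by simp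
        then show "norm (induced u x) \<le> norm (M * real (\<tau> x))" by simp
      qed
      show "(\<integral>x. induced u x * h0 x \<partial>leb) = 0" by (rule induced_mean[OF f u(3,2,4)])
    qed (use \<kappa>s cover im w in auto)
  qed
  have obs1: "observable_branches F (deriv F) elems \<kappa> \<sigma> h0 H rtime (induced v) w s"
    by (rule obs[OF v vM vm v0])
  have neg: "induced (\<lambda>x. - v x) = (\<lambda>x. - induced v x)" by (simp add: induced_def[abs_def] sum_negf)
  have obs2: "observable_branches F (deriv F) elems \<kappa> \<sigma> h0 H rtime (\<lambda>x. - induced v x) w s"
    unfolding neg[symmetric]
  proof (rule obs)
    show "varbound (\<lambda>x. - v x) {0..1} B" using varbound_cmult[OF v, of "-1"] by simp
  qed (use vM v0 in auto)
  note reg = observable_branches.region_def[OF obs1] observable_branches.region_def[OF obs2]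
    observable_branches.lev_def[OF obs1] observable_branches.lev_def[OF obs2]
  have "\<exists>\<omega> k0. 0 < \<omega> \<and> (\<forall>t k K y. 0 < t \<and> t \<le> \<omega> \<and> k0 \<le> k \<and> t powr s * exp (t * w * real k) \<le> \<omega> \<longrightarrow>
     measure \<mu>\<^sub>F {x \<in> {0..1}. (\<forall>i<K. (F ^^ i) x \<in> \<Union>{A \<in> elems. rtime A \<le> k}) \<and> y \<le> \<bar>\<Sum>i<K. induced v ((F ^^ i) x)\<bar>}
       \<le> 8 * exp (\<epsilon> * t * real K - t * y))" if \<epsilon>: "0 < \<epsilon>" for \<epsilon>
  proof -
    let ?R = "\<lambda>k. \<Union>{A \<in> elems. rtime A \<le> k}"
    obtain \<omega>1 k1 where 1: "0 < \<omega>1 \<and> (\<forall>t k K y. 0 < t \<and> t \<le> \<omega>1 \<and> k1 \<le> k \<and> t powr s * exp (t * w * real k) \<le> \<omega>1 \<longrightarrow>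
       measure \<mu>\<^sub>F {x \<in> {0..1}. (\<forall>i<K. (F ^^ i) x \<in> ?R k) \<and> y \<le> (\<Sum>i<K. induced v ((F ^^ i) x))} \<le> 4 * exp (\<epsilon> * t * real K - t * y))"
      using observable_branches.upper_deviation[OF obs1 \<epsilon>] unfolding reg muF_h0[symmetric] by (elim exE)
    obtain \<omega>2 k2 where 2: "0 < \<omega>2 \<and> (\<forall>t k K y. 0 < t \<and> t \<le> \<omega>2 \<and> k2 \<le> k \<and> t powr s * exp (t * w * real k) \<le> \<omega>2 \<longrightarrow>
       measure \<mu>\<^sub>F {x \<in> {0..1}. (\<forall>i<K. (F ^^ i) x \<in> ?R k) \<and> y \<le> (\<Sum>i<K. - induced v ((F ^^ i) x))} \<le> 4 * exp (\<epsilon> * t * real K - t * y))"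
      using observable_branches.upper_deviation[OF obs2 \<epsilon>] unfolding reg muF_h0[symmetric] by (elim exE)
    have "measure \<mu>\<^sub>F {x \<in> {0..1}. (\<forall>i<K. (F ^^ i) x \<in> ?R k) \<and> y \<le> \<bar>\<Sum>i<K. induced v ((F ^^ i) x)\<bar>} \<le> 8 * exp (\<epsilon> * t * real K - t * y)"
      if t: "0 < t \<and> t \<le> min \<omega>1 \<omega>2 \<and> max k1 k2 \<le> k \<and> t powr s * exp (t * w * real k) \<le> min \<omega>1 \<omega>2" for t k K y
    proof -
      let ?X = "{x \<in> {0..1}. (\<forall>i<K. (F ^^ i) x \<in> ?R k) \<and> y \<le> (\<Sum>i<K. induced v ((F ^^ i) x))}"
      let ?Y = "{x \<in> {0..1}. (\<forall>i<K. (F ^^ i) x \<in> ?R k) \<and> y \<le> (\<Sum>i<K. - induced v ((F ^^ i) x))}"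
      have [measurable]: "?R k \<in> sets leb" using observable_branches.region_sets[OF obs1, of k] unfolding reg .
      have [measurable]: "induced v \<in> borel_measurable leb" by (rule induced_meas[OF vm])
      have "?X = {x \<in> space leb. (\<forall>i\<in>{..<K}. (F ^^ i) x \<in> ?R k) \<and> y \<le> (\<Sum>i<K. induced v ((F ^^ i) x))}" by auto
      also have "\<dots> \<in> sets leb" by measurable
      finally have X: "?X \<in> sets \<mu>\<^sub>F" by (simp add: sets_muF)
      have "?Y = {x \<in> space leb. (\<forall>i\<in>{..<K}. (F ^^ i) x \<in> ?R k) \<and> y \<le> (\<Sum>i<K. - induced v ((F ^^ i) x))}" by auto
      also have "\<dots> \<in> sets leb" by measurable
      finally have Y: "?Y \<in> sets \<mu>\<^sub>F" by (simp add: sets_muF)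
      have "measure \<mu>\<^sub>F {x \<in> {0..1}. (\<forall>i<K. (F ^^ i) x \<in> ?R k) \<and> y \<le> \<bar>\<Sum>i<K. induced v ((F ^^ i) x)\<bar>} \<le> measure \<mu>\<^sub>F (?X \<union> ?Y)"
        by (rule P.finite_measure_mono) (use X Y in \<open>auto simp: sum_negf abs_if split: if_splits\<close>)
      also have "\<dots> \<le> measure \<mu>\<^sub>F ?X + measure \<mu>\<^sub>F ?Y" by (rule measure_Un_le[OF X Y])
      also have "\<dots> \<le> 4 * exp (\<epsilon> * t * real K - t * y) + 4 * exp (\<epsilon> * t * real K - t * y)"
      proof (rule add_mono)
        show "measure \<mu>\<^sub>F ?X \<le> 4 * exp (\<epsilon> * t * real K - t * y)" by (rule 1[THEN conjunct2, THEN spec, THEN spec, THEN spec, THEN spec, THEN mp]) (use t in auto)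
        show "measure \<mu>\<^sub>F ?Y \<le> 4 * exp (\<epsilon> * t * real K - t * y)" by (rule 2[THEN conjunct2, THEN spec, THEN spec, THEN spec, THEN spec, THEN mp]) (use t in auto)
      qed
      finally show ?thesis by simp
    qed
    moreover have "0 < min \<omega>1 \<omega>2" using 1 2 by simp
    ultimately show ?thesis by blast
  qed
  then show ?thesis using \<kappa>s w(1) by blast
qed

text \<open>Sum over the levels \<open>j\<close> of the tower.  The three terms are: a long first excursion; a long excursion that starts at one of the
  times \<open>1, \<dots>, n\<close>, where the sum over the levels turns back into \<open>\<mu>\<close>; and a deviation along short excursions, which
  can occur only in the levels \<open>j < k\<close>.\<close>

lemma deviation_split:
  assumes f: "piecewise_smooth f" and vm[measurable]: "v \<in> borel_measurable leb" and vM: "\<And>x. x \<in> {0..1} \<Longrightarrow> \<bar>v x\<bar> \<le> M"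
    and kn: "k \<le> n" and z: "2 * real k * M + y \<le> z"
    and R: "\<Union>{A \<in> elems. rtime A \<le> k} \<in> sets leb"
  shows "measure \<mu> {x \<in> {0..1}. z \<le> \<bar>\<Sum>i<n. v ((f ^^ i) x)\<bar>} \<le>
     inverse mean_time * (\<Sum>j. measure \<mu>\<^sub>F {x \<in> {0..1}. \<tau> x > max j k}) + real n * measure \<mu> {x \<in> {0..1}. \<tau> x > k} +
     inverse mean_time * (real k * (\<Sum>N\<le>2 * n. measure \<mu>\<^sub>F {x \<in> {0..1}. (\<forall>i<N. (F ^^ i) x \<in> \<Union>{A \<in> elems. rtime A \<le> k}) \<and> y \<le> \<bar>\<Sum>i<N. induced v ((F ^^ i) x)\<bar>}))"
proof -
  interpret P: prob_space \<mu>\<^sub>F by (rule muF_prob)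
  interpret Q: prob_space \<mu> by (rule mu_prob)
  note [measurable] = R
  let ?R = "\<Union>{A \<in> elems. rtime A \<le> k}"
  have mt: "0 \<le> inverse mean_time" using mean_time_ge1[OF f] by simp
  have iv[measurable]: "induced v \<in> borel_measurable leb" by (rule induced_meas[OF vm])
  define Bad where "Bad = {x \<in> {0..1}. z \<le> \<bar>\<Sum>i<n. v ((f ^^ i) x)\<bar>}"
  define L where "L = {x \<in> {0..1}. \<tau> x > k}"
  define Bl where "Bl l = {x \<in> {0..1}. (f ^^ l) x \<in> L}" for l
  define G where "G N = {x \<in> {0..1}. (\<forall>i<N. (F ^^ i) x \<in> ?R) \<and> y \<le> \<bar>\<Sum>i<N. induced v ((F ^^ i) x)\<bar>}" for N
  define T where "T j = {x \<in> {0..1}. \<tau> x > max j k}" for j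
  have Bad: "Bad \<in> sets leb"
  proof -
    have "Bad = {x \<in> space leb. z \<le> \<bar>\<Sum>i<n. v ((f ^^ i) x)\<bar>}" by (simp add: Bad_def)
    also have "\<dots> \<in> sets leb" by measurable
    finally show ?thesis .
  qed
  have L[measurable]: "L \<in> sets leb"
  proof -
    have "L = {x \<in> space leb. \<tau> x > k}" by (simp add: L_def)
    also have "\<dots> \<in> sets leb" by measurable
    finally show ?thesis .
  qed
  have Bl: "Bl l \<in> sets leb" for l
  proof -
    have "Bl l = {x \<in> space leb. (f ^^ l) x \<in> L}" by (simp add: Bl_def)
    also have "\<dots> \<in> sets leb" by measurable
    finally show ?thesis .
  qed
  have T: "T j \<in> sets leb" for j
  proof -
    have "T j = {x \<in> space leb. \<tau> x > max j k}" by (simp add: T_def)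
    also have "\<dots> \<in> sets leb" by measurable
    finally show ?thesis .
  qed
  have G: "G N \<in> sets leb" for N
  proof -
    have "G N = {x \<in> space leb. (\<forall>i\<in>{..<N}. (F ^^ i) x \<in> ?R) \<and> y \<le> \<bar>\<Sum>i<N. induced v ((F ^^ i) x)\<bar>}" by (auto simp: G_def)
    also have "\<dots> \<in> sets leb" by measurable
    finally show ?thesis .
  qed
  have reg: "AE x in \<mu>\<^sub>F. \<forall>i. (F ^^ i) x \<in> \<Union>elems"
  proof -
    have mp: "F \<in> measurable \<mu>\<^sub>F \<mu>\<^sub>F" "distr \<mu>\<^sub>F \<mu>\<^sub>F F = \<mu>\<^sub>F" using muF_ergodic by (auto simp: ergodic_map_def measure_preserving_map_def)
    obtain H where "bv0 h0 H" using h0_bv by blast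
    then have [measurable]: "h0 \<in> borel_measurable leb" by (rule bv0_leb)
    have "AE x in \<mu>\<^sub>F. (F ^^ i) x \<in> \<Union>elems" for i
    proof (induction i)
      case 0
      have "AE x in density leb (\<lambda>x. ennreal (h0 x)). x \<in> \<Union>elems" using cover by (subst AE_density) auto
      then show ?case unfolding muF_h0[symmetric] by simp
    next
      case (Suc i)
      then have "AE x in distr \<mu>\<^sub>F \<mu>\<^sub>F F. (F ^^ i) x \<in> \<Union>elems" unfolding mp(2) .
      then have "AE x in \<mu>\<^sub>F. (F ^^ i) (F x) \<in> \<Union>elems" by (rule AE_distrD[OF mp(1)])
      then show ?case by (simp add: funpow_swap1)
    qed
    then show ?thesis unfolding AE_all_countable by blast
  qed
  have step: "measure \<mu>\<^sub>F (column Bad j) \<le> measure \<mu>\<^sub>F (T j) + (\<Sum>l=1..n. measure \<mu>\<^sub>F (column (Bl l) j)) + (if j < k then (\<Sum>N\<le>2 * n. measure \<mu>\<^sub>F (G N)) else 0)" for j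
  proof -
    define U where "U = T j \<union> (\<Union>l\<in>{1..n}. column (Bl l) j) \<union> (\<Union>N\<in>(if j < k then {..2 * n} else {}). G N)"
    have Us: "U \<in> sets \<mu>\<^sub>F" unfolding U_def sets_muF using T G column_sets[OF Bl] by (intro sets.Un sets.finite_UN) auto
    have "measure \<mu>\<^sub>F (column Bad j) \<le> measure \<mu>\<^sub>F U"
    proof (rule P.finite_measure_mono_AE[OF _ Us])
      show "AE x in \<mu>\<^sub>F. x \<in> column Bad j \<longrightarrow> x \<in> U"
        using reg
      proof eventually_elim
        case (elim x)
        show ?case
        proof
          assume xc: "x \<in> column Bad j"
          then have x: "x \<in> {0..1}" "j < \<tau> x" "z \<le> \<bar>\<Sum>i<n. v ((f ^^ i) ((f ^^ j) x))\<bar>" by (auto simp: column_def Bad_def)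
          show "x \<in> U"
          proof (cases "x \<in> U")
            case False
            have tk: "\<tau> x \<le> k"
            proof (rule ccontr)
              assume "\<not> \<tau> x \<le> k" then have "x \<in> T j" using x by (simp add: T_def)
              then show False using False by (simp add: U_def)
            qed
            have sh: "\<tau> ((f ^^ l) ((f ^^ j) x)) \<le> k" if l: "1 \<le> l" "l \<le> n" for l
            proof (rule ccontr)
              assume "\<not> ?thesis"
              then have "x \<in> column (Bl l) j" using x f_unit[OF f] by (simp add: column_def Bl_def L_def)
              then show False using False l by (auto simp: U_def)
            qed
            have "\<exists>N\<le>2 * n. (\<forall>i<N. (F ^^ i) x \<in> ?R) \<and>
              \<bar>\<Sum>i<n. v ((f ^^ i) ((f ^^ j) x))\<bar> \<le> \<bar>\<Sum>i<N. induced v ((F ^^ i) x)\<bar> + 2 * real k * M"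
              by (rule deviation_dichotomy[OF f _ x(1) _ x(2) tk kn]) (use vM elim sh in blast)+
            then obtain N where N: "N \<le> 2 * n" "\<forall>i<N. (F ^^ i) x \<in> ?R"
              "\<bar>\<Sum>i<n. v ((f ^^ i) ((f ^^ j) x))\<bar> \<le> \<bar>\<Sum>i<N. induced v ((F ^^ i) x)\<bar> + 2 * real k * M"
              by blast
            have "x \<in> G N" using N(2,3) x(1,3) z by (simp add: G_def)
            moreover have "j < k" using x(2) tk by simp
            ultimately show ?thesis using N(1) by (auto simp: U_def)
          qed
        qed
      qed
    qed
    also have "\<dots> \<le> measure \<mu>\<^sub>F (T j \<union> (\<Union>l\<in>{1..n}. column (Bl l) j)) + measure \<mu>\<^sub>F (\<Union>N\<in>(if j < k then {..2 * n} else {}). G N)"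
      unfolding U_def using T G column_sets[OF Bl] by (intro measure_Un_le) (auto simp: sets_muF)
    also have "\<dots> \<le> (measure \<mu>\<^sub>F (T j) + measure \<mu>\<^sub>F (\<Union>l\<in>{1..n}. column (Bl l) j)) + measure \<mu>\<^sub>F (\<Union>N\<in>(if j < k then {..2 * n} else {}). G N)"
      using T column_sets[OF Bl] by (intro add_right_mono measure_Un_le) (auto simp: sets_muF)
    also have "\<dots> \<le> (measure \<mu>\<^sub>F (T j) + (\<Sum>l\<in>{1..n}. measure \<mu>\<^sub>F (column (Bl l) j))) + (\<Sum>N\<in>(if j < k then {..2 * n} else {}). measure \<mu>\<^sub>F (G N))"
      using G column_sets[OF Bl] by (intro add_mono order_refl P.finite_measure_subadditive_finite) (auto simp: sets_muF)
    finally show ?thesis by (simp split: if_splits)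
  qed
  have sT: "summable (\<lambda>j. measure \<mu>\<^sub>F (T j))"
  proof (rule summable_comparison_test[OF _ column_summable[of "{0..1}"]], intro exI allI impI)
    fix j
    have "{0..1} \<in> sets leb" by (simp add: sets_restrict_space_iff)
    then have "column {0..1} j \<in> sets \<mu>\<^sub>F" unfolding sets_muF by (rule column_sets)
    moreover have "T j \<subseteq> column {0..1} j" using f_unit[OF f] by (auto simp: T_def column_def)
    ultimately have "measure \<mu>\<^sub>F (T j) \<le> measure \<mu>\<^sub>F (column {0..1} j)" by (intro P.finite_measure_mono)
    then show "norm (measure \<mu>\<^sub>F (T j)) \<le> measure \<mu>\<^sub>F (column {0..1} j)" by simp
  qed (simp add: sets_restrict_space_iff)
  have sC: "summable (\<lambda>j. \<Sum>l=1..n. measure \<mu>\<^sub>F (column (Bl l) j))" by (intro summable_sum column_summable Bl)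
  let ?g = "\<Sum>N\<le>2 * n. measure \<mu>\<^sub>F (G N)"
  have sg: "(\<lambda>j. if j < k then ?g else 0) sums (real k * ?g)"
    using sums_finite[of "{..<k}" "\<lambda>j. if j < k then ?g else 0"] by simp
  have "(\<Sum>j. measure \<mu>\<^sub>F (column Bad j)) \<le> (\<Sum>j. measure \<mu>\<^sub>F (T j) + (\<Sum>l=1..n. measure \<mu>\<^sub>F (column (Bl l) j)) + (if j < k then ?g else 0))"
    by (intro suminf_le step column_summable Bad summable_add sT sC sums_summable[OF sg])
  also have "\<dots> = (\<Sum>j. measure \<mu>\<^sub>F (T j)) + (\<Sum>j. \<Sum>l=1..n. measure \<mu>\<^sub>F (column (Bl l) j)) + real k * ?g"
    using suminf_add[OF summable_add[OF sT sC] sums_summable[OF sg]] suminf_add[OF sT sC] sums_unique[OF sg] by simp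
  also have "(\<Sum>j. \<Sum>l=1..n. measure \<mu>\<^sub>F (column (Bl l) j)) = (\<Sum>l=1..n. \<Sum>j. measure \<mu>\<^sub>F (column (Bl l) j))"
    by (intro suminf_sum column_summable Bl)
  finally have "inverse mean_time * (\<Sum>j. measure \<mu>\<^sub>F (column Bad j)) \<le>
     inverse mean_time * ((\<Sum>j. measure \<mu>\<^sub>F (T j)) + (\<Sum>l=1..n. \<Sum>j. measure \<mu>\<^sub>F (column (Bl l) j)) + real k * ?g)"
    using mt by (rule mult_left_mono)
  then have "measure \<mu> Bad \<le> inverse mean_time * (\<Sum>j. measure \<mu>\<^sub>F (T j)) + (\<Sum>l=1..n. measure \<mu> (Bl l)) + inverse mean_time * (real k * ?g)"
    unfolding mu_column[OF Bad] mu_column[OF Bl] by (simp only: distrib_left sum_distrib_left)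
  moreover have "measure \<mu> (Bl l) = measure \<mu> L" for l
  proof -
    have fm: "f \<in> measurable \<mu> \<mu>" and fd: "distr \<mu> \<mu> f = \<mu>" using mu_ergodic by (auto simp: ergodic_map_def measure_preserving_map_def)
    have inv: "measure \<mu> {x \<in> {0..1}. f x \<in> A} = measure \<mu> A" if "A \<in> sets leb" for A
    proof -
      have "measure (distr \<mu> \<mu> f) A = measure \<mu> (f -` A \<inter> space \<mu>)" by (rule measure_distr[OF fm]) (use that mu_sets in simp)
      moreover have "f -` A \<inter> space \<mu> = {x \<in> {0..1}. f x \<in> A}" by auto
      ultimately show ?thesis unfolding fd by simp
    qed
    show ?thesis
    proof (induction l)
      case 0
      have "Bl 0 = L" by (auto simp: Bl_def L_def)
      then show ?case by simp
    next
      case (Suc l)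
      have "Bl (Suc l) = {x \<in> {0..1}. f x \<in> Bl l}" using f_unit[OF f, of _ 1] by (auto simp: Bl_def funpow_swap1)
      then show ?case using inv[OF Bl] Suc by simp
    qed
  qed
  ultimately show ?thesis by (simp add: Bad_def L_def T_def G_def)
qed


text \<open>Choose \<open>t = A ln n / n\<close> and \<open>k = \<eta> n\<close>.  The constant \<open>A\<close> makes the deviation along short excursions smaller than \<open>n\<^sup>-\<^sup>(\<^sup>\<beta>\<^sup>+\<^sup>2\<^sup>)\<close>, which
  pays for the factor \<open>k\<close> and for the sum over the number of returns.  Then \<open>\<eta>\<close> is chosen small, so that \<open>t k\<close> times the
  bound on \<open>\<bar>V\<bar> / \<tau>\<close> is at most \<open>s / 2\<close> times \<open>ln n\<close>, and the incomplete excursions contribute at most half of the deviation.\<close>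

lemma large_deviation:
  assumes f: "piecewise_smooth f" and fin: "finite (crit_set f)" and A1: "A1 f ell" and A2: "A2 f" and A3: "A3 f ell p" and p: "1 < p"
    and \<beta>: "0 < \<beta>" and tail: "(\<lambda>n. measure \<mu> {x \<in> {0..1}. \<tau> x > n}) \<in> O(\<lambda>n. real n powr (- (\<beta> + 1)))"
    and v: "BV_on {0..1} v" and v0: "(\<integral>x. v x \<partial>\<mu>) = 0" and \<epsilon>: "0 < \<epsilon>"
  shows "\<exists>C>0. \<forall>n\<ge>1. measure \<mu> {x \<in> {0..1}. \<epsilon> * real n \<le> \<bar>\<Sum>j<n. v ((f ^^ j) x)\<bar>} \<le> C * real n powr (- \<beta>)"
proof -
  interpret Q: prob_space \<mu> by (rule mu_prob)
  obtain B where B: "varbound v {0..1} B" using v by (rule BV_on_varbound)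
  define M where "M = \<bar>v 0\<bar> + B"
  have B0: "0 \<le> B" using B by (rule varbound_nonneg)
  have M0: "0 \<le> M" using B0 by (simp add: M_def)
  have vM: "\<bar>v x\<bar> \<le> M" if "x \<in> {0..1}" for x unfolding M_def using varbound_bounded[OF B that] .
  have vm: "v \<in> borel_measurable leb"
  proof -
    have "(\<lambda>x. if x \<in> {0..1} then v x else 0) \<in> borel_measurable leb"
      using varbound_zero_extension[OF B vM] by (rule bv0_leb)
    moreover have "v \<in> borel_measurable leb \<longleftrightarrow> (\<lambda>x. if x \<in> {0..1} then v x else 0) \<in> borel_measurable leb"
      by (rule measurable_cong) simp
    ultimately show ?thesis by simp
  qed
  have mt: "1 \<le> mean_time" by (rule mean_time_ge1[OF f])
  define \<nu> where "\<nu> m = measure \<mu> {x \<in> {0..1}. \<tau> x > m}" for m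
  obtain C' where C': "0 \<le> C'" "\<And>m. 1 \<le> m \<Longrightarrow> \<nu> m \<le> C' * real m powr (- (\<beta> + 1))"
  proof -
    obtain c where c: "0 < c" "\<forall>\<^sub>F m in sequentially. norm (\<nu> m) \<le> c * norm (real m powr (- (\<beta> + 1)))"
      using tail unfolding \<nu>_def[symmetric] by (rule landau_o.bigE)
    then obtain N0 where N0: "\<And>m. N0 \<le> m \<Longrightarrow> \<nu> m \<le> c * real m powr (- (\<beta> + 1))"
      unfolding eventually_sequentially by fastforce
    have "\<nu> m \<le> (c + real N0 powr (\<beta> + 1)) * real m powr (- (\<beta> + 1))" if m: "1 \<le> m" for m
    proof (cases "N0 \<le> m")
      case True
      then show ?thesis using N0[OF True] by (simp add: distrib_right add_increasing2)
    next
      case False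
      have "\<nu> m \<le> 1" unfolding \<nu>_def by (rule Q.prob_le_1)
      also have "1 = real m powr (\<beta> + 1) * real m powr (- (\<beta> + 1))" unfolding powr_add[symmetric] using m by simp
      also have "\<dots> \<le> (c + real N0 powr (\<beta> + 1)) * real m powr (- (\<beta> + 1))"
      proof (rule mult_right_mono)
        have "real m powr (\<beta> + 1) \<le> real N0 powr (\<beta> + 1)" using False \<beta> by (intro powr_mono2) auto
        then show "real m powr (\<beta> + 1) \<le> c + real N0 powr (\<beta> + 1)" using c(1) by linarith
      qed simp
      finally show ?thesis .
    qed
    then show ?thesis using c(1) by (intro that[of "c + real N0 powr (\<beta> + 1)"]) auto
  qed
  obtain s w where sw: "0 < s \<and> 0 < w \<and> (\<forall>\<epsilon>>0. \<exists>\<omega> k0. 0 < \<omega> \<and> (\<forall>t k K y. 0 < t \<and> t \<le> \<omega> \<and> k0 \<le> k \<and> t powr s * exp (t * w * real k) \<le> \<omega> \<longrightarrow>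
     measure \<mu>\<^sub>F {x \<in> {0..1}. (\<forall>i<K. (F ^^ i) x \<in> \<Union>{A \<in> elems. rtime A \<le> k}) \<and> y \<le> \<bar>\<Sum>i<K. induced v ((F ^^ i) x)\<bar>}
       \<le> 8 * exp (\<epsilon> * t * real K - t * y)))"
    using level_deviation[OF f fin A1 A2 A3 p B vm v0] by (elim exE)
  have s: "0 < s" and w: "0 < w" using sw by auto
  have "0 < \<epsilon> / 8" using \<epsilon> by simp
  from sw[THEN conjunct2, THEN conjunct2, THEN spec, THEN mp, OF this]
  obtain \<omega> k0 where ld: "0 < \<omega> \<and> (\<forall>t k K y. 0 < t \<and> t \<le> \<omega> \<and> k0 \<le> k \<and> t powr s * exp (t * w * real k) \<le> \<omega> \<longrightarrow>
     measure \<mu>\<^sub>F {x \<in> {0..1}. (\<forall>i<K. (F ^^ i) x \<in> \<Union>{A \<in> elems. rtime A \<le> k}) \<and> y \<le> \<bar>\<Sum>i<K. induced v ((F ^^ i) x)\<bar>}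
       \<le> 8 * exp (\<epsilon> / 8 * t * real K - t * y))" by (elim exE)
  have \<omega>: "0 < \<omega>" using ld by simp
  \<comment> \<open>Then \<open>exp (- (\<epsilon> / 4) * t * n)\<close> is \<open>n\<close> to the power \<open>- (\<beta> + 2)\<close>.\<close>
  define A where "A = 4 * (\<beta> + 2) / \<epsilon>"
  have A: "0 < A" using \<beta> \<epsilon> by (simp add: A_def)
  define \<eta> where "\<eta> = min 1 (min (s / (2 * A * w)) (\<epsilon> / (4 * (M + 1))))"
  have \<eta>: "0 < \<eta>" "\<eta> \<le> 1" using s A w \<epsilon> M0 by (auto simp: \<eta>_def)
  have \<eta>s: "A * w * \<eta> \<le> s / 2"
  proof -
    have "\<eta> \<le> s / (2 * A * w)" by (simp add: \<eta>_def)
    then have "A * w * \<eta> \<le> A * w * (s / (2 * A * w))" using A w by (intro mult_left_mono) auto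
    then show ?thesis using A w by simp
  qed
  have \<eta>M: "2 * \<eta> * M \<le> \<epsilon> / 2"
  proof -
    have "\<eta> \<le> \<epsilon> / (4 * (M + 1))" by (simp add: \<eta>_def)
    then have "\<eta> * (4 * (M + 1)) \<le> \<epsilon>" using M0 by (simp add: pos_le_divide_eq)
    then show ?thesis using \<eta>(1) by (simp add: algebra_simps)
  qed
  define t where "t n = A * ln (real n) / real n" for n
  define k where "k n = nat \<lfloor>\<eta> * real n\<rfloor>" for n
  have t_lim: "t \<longlonglongrightarrow> 0" unfolding t_def using A by real_asymp
  have e_lim: "(\<lambda>n. t n powr s * real n powr (s / 2)) \<longlonglongrightarrow> 0" unfolding t_def using A s by real_asymp
  have lin: "filterlim (\<lambda>n. \<eta> * real n) at_top sequentially" using \<eta>(1) by real_asymp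
  have "\<forall>\<^sub>F n in sequentially. t n < \<omega> \<and> t n powr s * real n powr (s / 2) < \<omega> \<and> real k0 + 2 \<le> \<eta> * real n \<and> 2 \<le> n"
    using order_tendstoD(2)[OF t_lim \<omega>] order_tendstoD(2)[OF e_lim \<omega>]
      filterlim_at_top[THEN iffD1, OF lin, THEN spec, of "real k0 + 2"] eventually_ge_at_top[of "2 :: nat"]
    by eventually_elim blast
  then obtain n0 where n0: "\<And>n. n0 \<le> n \<Longrightarrow> t n < \<omega> \<and> t n powr s * real n powr (s / 2) < \<omega> \<and> real k0 + 2 \<le> \<eta> * real n \<and> 2 \<le> n"
    unfolding eventually_sequentially by blast
  define D where "D = C' * (2 + 1 / \<beta>) * (\<eta> / 2) powr (- \<beta>) + C' * (\<eta> / 2) powr (- (\<beta> + 1)) + 24"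
  have D0: "0 < D" unfolding D_def using C'(1) \<beta> by (intro add_nonneg_pos add_nonneg_nonneg mult_nonneg_nonneg) auto
  have large: "measure \<mu> {x \<in> {0..1}. \<epsilon> * real n \<le> \<bar>\<Sum>j<n. v ((f ^^ j) x)\<bar>} \<le> D * real n powr (- \<beta>)" if n: "n0 \<le> n" for n
  proof -
    have n2: "2 \<le> n" and tn: "t n < \<omega>" "t n powr s * real n powr (s / 2) < \<omega>" and \<eta>n: "real k0 + 2 \<le> \<eta> * real n" using n0[OF n] by auto
    have ln0: "0 < ln (real n)" using n2 by simp
    have t0: "0 < t n" using A ln0 n2 by (simp add: t_def)
    have tnn: "t n * real n = A * ln (real n)" using n2 by (simp add: t_def)
    have kle: "real (k n) \<le> \<eta> * real n" using \<eta>(1) by (simp add: k_def)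
    have kge: "\<eta> * real n / 2 \<le> real (k n)" "k0 \<le> k n" "1 \<le> k n"
    proof -
      have "\<eta> * real n - 1 \<le> real (k n)" unfolding k_def using \<eta>n by linarith
      then show "\<eta> * real n / 2 \<le> real (k n)" "k0 \<le> k n" "1 \<le> k n" using \<eta>n by linarith+
    qed
    have kn: "k n \<le> n" using kle \<eta>(2) mult_right_mono[of \<eta> 1 "real n"] by simp
    have cond: "t n powr s * exp (t n * w * real (k n)) \<le> \<omega>"
    proof -
      have "t n * w * real (k n) \<le> t n * w * (\<eta> * real n)" using kle t0 w by (intro mult_left_mono) auto
      also have "\<dots> = A * w * \<eta> * ln (real n)" using tnn by (simp add: mult_ac)
      also have "\<dots> \<le> s / 2 * ln (real n)" using \<eta>s ln0 by (intro mult_right_mono) auto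
      finally have "exp (t n * w * real (k n)) \<le> real n powr (s / 2)" using n2 by (simp add: powr_def)
      then have "t n powr s * exp (t n * w * real (k n)) \<le> t n powr s * real n powr (s / 2)" by (intro mult_left_mono) auto
      then show ?thesis using tn(2) by linarith
    qed
    let ?G = "\<lambda>N. {x \<in> {0..1}. (\<forall>i<N. (F ^^ i) x \<in> \<Union>{A \<in> elems. rtime A \<le> k n}) \<and> \<epsilon> / 2 * real n \<le> \<bar>\<Sum>i<N. induced v ((F ^^ i) x)\<bar>}"
    have G: "measure \<mu>\<^sub>F (?G N) \<le> 8 * real n powr (- (\<beta> + 2))" if N: "N \<le> 2 * n" for N
    proof -
      have "measure \<mu>\<^sub>F (?G N) \<le> 8 * exp (\<epsilon> / 8 * t n * real N - t n * (\<epsilon> / 2 * real n))"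
        by (rule ld[THEN conjunct2, THEN spec, THEN spec, THEN spec, THEN spec, THEN mp]) (use t0 tn cond kge(2) in auto)
      also have "\<epsilon> / 8 * t n * real N - t n * (\<epsilon> / 2 * real n) \<le> - (\<epsilon> / 4) * (t n * real n)"
      proof -
        have "real N \<le> 2 * real n" using N by linarith
        then have "\<epsilon> / 8 * t n * real N \<le> \<epsilon> / 8 * t n * (2 * real n)" using \<epsilon> t0 by (intro mult_left_mono) auto
        then show ?thesis by (simp add: algebra_simps)
      qed
      also have "- (\<epsilon> / 4) * (t n * real n) = - (\<beta> + 2) * ln (real n)" unfolding tnn A_def using \<epsilon> by (simp add: field_simps)
      also have "exp (- (\<beta> + 2) * ln (real n)) = real n powr (- (\<beta> + 2))" using n2 by (simp add: powr_def)
      finally show ?thesis by simp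
    qed
    have R: "\<Union>{A \<in> elems. rtime A \<le> k n} \<in> sets leb"
    proof -
      have "open (\<Union>{A \<in> elems. rtime A \<le> k n})" by (intro open_Union) (auto elim: elems_props)
      moreover have "\<Union>{A \<in> elems. rtime A \<le> k n} \<subseteq> {0..1}" using elems_unit by blast
      ultimately show ?thesis by (simp add: sets_restrict_space_iff)
    qed
    have zy: "2 * real (k n) * M + \<epsilon> / 2 * real n \<le> \<epsilon> * real n"
    proof -
      have "2 * real (k n) * M \<le> 2 * (\<eta> * real n) * M" using kle M0 by (intro mult_right_mono mult_left_mono) auto
      also have "\<dots> = (2 * \<eta> * M) * real n" by simp
      also have "\<dots> \<le> \<epsilon> / 2 * real n" using \<eta>M by (intro mult_right_mono) auto
      finally show ?thesis by simp
    qed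
    have "measure \<mu> {x \<in> {0..1}. \<epsilon> * real n \<le> \<bar>\<Sum>j<n. v ((f ^^ j) x)\<bar>} \<le>
       inverse mean_time * (\<Sum>j. measure \<mu>\<^sub>F {x \<in> {0..1}. \<tau> x > max j (k n)}) + real n * \<nu> (k n) +
       inverse mean_time * (real (k n) * (\<Sum>N\<le>2 * n. measure \<mu>\<^sub>F (?G N)))"
      unfolding \<nu>_def by (rule deviation_split[OF f vm vM kn zy R])
    also have "inverse mean_time * (\<Sum>j. measure \<mu>\<^sub>F {x \<in> {0..1}. \<tau> x > max j (k n)}) \<le> C' * (2 + 1 / \<beta>) * real (k n) powr (- \<beta>)"
    proof -
      have le: "measure \<mu>\<^sub>F {x \<in> {0..1}. \<tau> x > max j (k n)} \<le> mean_time * C' * real (max j (k n)) powr (- (\<beta> + 1))" for j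
      proof -
        have "measure \<mu>\<^sub>F {x \<in> {0..1}. \<tau> x > max j (k n)} \<le> mean_time * \<nu> (max j (k n))" unfolding \<nu>_def by (rule muF_return_tail[OF f])
        also have "\<dots> \<le> mean_time * (C' * real (max j (k n)) powr (- (\<beta> + 1)))"
          using mt C'(2)[of "max j (k n)"] kge(3) by (intro mult_left_mono) auto
        finally show ?thesis by (simp add: mult.assoc)
      qed
      have part: "(\<Sum>j<N. measure \<mu>\<^sub>F {x \<in> {0..1}. \<tau> x > max j (k n)}) \<le> mean_time * C' * ((2 + 1 / \<beta>) * real (k n) powr (- \<beta>))" for N
      proof -
        have "(\<Sum>j<N. measure \<mu>\<^sub>F {x \<in> {0..1}. \<tau> x > max j (k n)}) \<le> (\<Sum>j<N. mean_time * C' * real (max j (k n)) powr (- (\<beta> + 1)))"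
          by (intro sum_mono le)
        also have "\<dots> = mean_time * C' * (\<Sum>j<N. real (max j (k n)) powr (- (\<beta> + 1)))" by (simp only: sum_distrib_left)
        also have "\<dots> \<le> mean_time * C' * ((2 + 1 / \<beta>) * real (k n) powr (- \<beta>))"
          using powr_tail_sum[OF \<beta> kge(3), of N] mt C'(1) by (intro mult_left_mono) auto
        finally show ?thesis .
      qed
      have "(\<Sum>j. measure \<mu>\<^sub>F {x \<in> {0..1}. \<tau> x > max j (k n)}) \<le> mean_time * C' * ((2 + 1 / \<beta>) * real (k n) powr (- \<beta>))"
        by (rule suminf_le_const[OF _ part], rule summableI_nonneg_bounded[OF _ part]) simp
      then have "inverse mean_time * (\<Sum>j. measure \<mu>\<^sub>F {x \<in> {0..1}. \<tau> x > max j (k n)}) \<le> inverse mean_time * (mean_time * C' * ((2 + 1 / \<beta>) * real (k n) powr (- \<beta>)))"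
        using mt by (intro mult_left_mono) auto
      also have "\<dots> = C' * (2 + 1 / \<beta>) * real (k n) powr (- \<beta>)" using mt by simp
      finally show ?thesis .
    qed
    also have "C' * (2 + 1 / \<beta>) * real (k n) powr (- \<beta>) \<le> C' * (2 + 1 / \<beta>) * ((\<eta> / 2) powr (- \<beta>) * real n powr (- \<beta>))"
    proof (rule mult_left_mono)
      have "real (k n) powr (- \<beta>) \<le> (\<eta> / 2 * real n) powr (- \<beta>)" using kge \<eta> n2 \<beta> by (intro powr_mono2') auto
      then show "real (k n) powr (- \<beta>) \<le> (\<eta> / 2) powr (- \<beta>) * real n powr (- \<beta>)" using \<eta> powr_mult[of "\<eta> / 2" "real n"] by simp
    qed (use C' \<beta> in auto)
    also have "real n * \<nu> (k n) \<le> C' * ((\<eta> / 2) powr (- (\<beta> + 1)) * real n powr (- \<beta>))"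
    proof -
      have "real (k n) powr (- (\<beta> + 1)) \<le> (\<eta> / 2 * real n) powr (- (\<beta> + 1))" using kge \<eta> n2 \<beta> by (intro powr_mono2') auto
      also have "\<dots> = (\<eta> / 2) powr (- (\<beta> + 1)) * real n powr (- (\<beta> + 1))" using \<eta> powr_mult[of "\<eta> / 2" "real n" "- (\<beta> + 1)"] by simp
      finally have "\<nu> (k n) \<le> C' * ((\<eta> / 2) powr (- (\<beta> + 1)) * real n powr (- (\<beta> + 1)))"
        using C'(2)[OF kge(3)] C'(1) by (meson mult_left_mono order_trans)
      then have "real n * \<nu> (k n) \<le> real n * (C' * ((\<eta> / 2) powr (- (\<beta> + 1)) * real n powr (- (\<beta> + 1))))" by (rule mult_left_mono) simp
      also have "\<dots> = C' * ((\<eta> / 2) powr (- (\<beta> + 1)) * (real n powr 1 * real n powr (- (\<beta> + 1))))" by simp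
      also have "\<dots> = C' * ((\<eta> / 2) powr (- (\<beta> + 1)) * real n powr (- \<beta>))" unfolding powr_add[symmetric] by simp
      finally show ?thesis .
    qed
    also have "inverse mean_time * (real (k n) * (\<Sum>N\<le>2 * n. measure \<mu>\<^sub>F (?G N))) \<le> 24 * real n powr (- \<beta>)"
    proof -
      have "(\<Sum>N\<le>2 * n. measure \<mu>\<^sub>F (?G N)) \<le> (\<Sum>N\<le>2 * n. 8 * real n powr (- (\<beta> + 2)))" by (intro sum_mono G) auto
      also have "\<dots> = real (2 * n + 1) * (8 * real n powr (- (\<beta> + 2)))" by simp
      also have "\<dots> \<le> (3 * real n) * (8 * real n powr (- (\<beta> + 2)))" using n2 by (intro mult_right_mono) auto
      finally have "real (k n) * (\<Sum>N\<le>2 * n. measure \<mu>\<^sub>F (?G N)) \<le> real n * ((3 * real n) * (8 * real n powr (- (\<beta> + 2))))"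
        using kn by (intro mult_mono) (auto intro: sum_nonneg)
      also have "\<dots> = 24 * (real n powr 2 * real n powr (- (\<beta> + 2)))" using n2 by (simp add: power2_eq_square)
      also have "\<dots> = 24 * real n powr (- \<beta>)" unfolding powr_add[symmetric] by simp
      finally have *: "real (k n) * (\<Sum>N\<le>2 * n. measure \<mu>\<^sub>F (?G N)) \<le> 24 * real n powr (- \<beta>)" .
      have "inverse mean_time * (real (k n) * (\<Sum>N\<le>2 * n. measure \<mu>\<^sub>F (?G N))) \<le> 1 * (real (k n) * (\<Sum>N\<le>2 * n. measure \<mu>\<^sub>F (?G N)))"
        using mt by (intro mult_right_mono) (auto intro!: mult_nonneg_nonneg sum_nonneg simp: inverse_le_1_iff)
      then show ?thesis using * by simp
    qed
    finally show ?thesis by (simp add: D_def algebra_simps)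
  qed
  show ?thesis
  proof (intro exI[of _ "D + real n0 powr \<beta>"] conjI allI impI)
    show "0 < D + real n0 powr \<beta>" using D0 by (simp add: add_pos_nonneg)
    fix n :: nat assume n: "1 \<le> n"
    show "measure \<mu> {x \<in> {0..1}. \<epsilon> * real n \<le> \<bar>\<Sum>j<n. v ((f ^^ j) x)\<bar>} \<le> (D + real n0 powr \<beta>) * real n powr (- \<beta>)"
    proof (cases "n0 \<le> n")
      case True
      then show ?thesis using large[OF True] by (simp add: distrib_right add_increasing2)
    next
      case False
      have "measure \<mu> {x \<in> {0..1}. \<epsilon> * real n \<le> \<bar>\<Sum>j<n. v ((f ^^ j) x)\<bar>} \<le> 1" by (rule Q.prob_le_1)
      also have "1 = real n powr \<beta> * real n powr (- \<beta>)" unfolding powr_add[symmetric] using n by simp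
      also have "\<dots> \<le> (D + real n0 powr \<beta>) * real n powr (- \<beta>)"
      proof (rule mult_right_mono)
        have "real n powr \<beta> \<le> real n0 powr \<beta>" using False \<beta> by (intro powr_mono2) auto
        then show "real n powr \<beta> \<le> D + real n0 powr \<beta>" using D0 by linarith
      qed simp
      finally show ?thesis .
    qed
  qed
qed

end

theorem corollary1p9:
  fixes f v h :: "real \<Rightarrow> real" and ell :: "one_sided \<Rightarrow> real"
    and p \<delta> \<beta> \<epsilon> :: real and q\<^sub>0 :: nat and b :: "real \<Rightarrow> nat"
    and \<alpha> :: "real set set" and \<mu>\<^sub>F \<mu> :: "real measure"
  assumes "piecewise_smooth f" and "finite (crit_set f)"
    and "A1 f ell" and "A2 f" and "p > 1" and "A3 f ell p"
    and "inducing_construction f ell \<delta> q\<^sub>0 b \<alpha> \<mu>\<^sub>F h \<mu>"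
    and "mixing_map \<mu> f"
    and "\<beta> > 0"
    and "(\<lambda>n. measure \<mu> {x \<in> {0..1}. return_time f \<delta> q\<^sub>0 b x > n}) \<in> O(\<lambda>n. real n powr (-(\<beta> + 1)))"
    and "BV_on {0..1} v" and "(\<integral>x. v x \<partial>\<mu>) = 0"
    and "\<epsilon> > 0"
  shows "\<exists>C>0. \<forall>n\<ge>1.
    measure \<mu> {x \<in> {0..1}. \<bar>\<Sum>j<n. v ((f ^^ j) x)\<bar> \<ge> \<epsilon> * real n} \<le> C * real n powr (-\<beta>)"
  by (rule inducing_construction.large_deviation[OF assms(7,1-4,6,5,9-13)])

end
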